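(* Let $p\geq 5$ be a prime, $F$ an algebraically closed field of characteristic $p$, $b\geq 1$, $r\in[0,2p-3]$ and $h=\frac{p-1}{2}$. Consider $F\mathfrak{S}_p$-modules. (i) Let $h=2\ell$ be even, i.e. $p\equiv 1\pmod 4$, and let $x_1,x_2,\ldots,x_\ell,y_\ell,\ldots,y_2,y_1$ be the numbers from the peak to the trough in the $b$th period of the $h$-wave sequence $W_h$. Then \[(\Omega^r(D_2))^{\otimes 2b}\equiv x_1\Omega^{2br}(D_0)\oplus y_1\Omega^{2br}(D_2)\oplus\cdots\oplus x_\ell\Omega^{2br}(D_{4\ell-4})\oplus y_\ell\Omega^{2br}(D_{4\ell-2}),\] that is, the coefficient of $\Omega^{2br}(D_{4i-4})$ is $x_i$ and that of $\Omega^{2br}(D_{4i-2})$ is $y_i$, for $1\leq i\leq\ell$. (ii) Let $h=2\ell+1$ be odd, i.e. $p\equiv 3\pmod 4$, and let $x_1,x_2,\ldots,x_\ell,z,y_\ell,\ldots,y_2,y_1$ be the numbers from the peak to the trough in the $b$th period of the $h$-wave sequence $W_h$. Then \begin{align*}(\Omega^r(D_2))^{\otimes 2b}\equiv{}& x_1\Omega^{2br}(D_0)\oplus y_1\Omega^{2br}(D_2)\oplus z\,\Omega^{2br}(D_4)\oplus x_2\Omega^{2br}(D_6)\oplus y_2\Omega^{2br}(D_8)\\&\oplus\cdots\oplus x_\ell\Omega^{2br}(D_{4\ell-2})\oplus y_\ell\Omega^{2br}(D_{4\ell}),\end{align*} that is, the coefficients of $\Omega^{2br}(D_0),\Omega^{2br}(D_2),\Omega^{2br}(D_4)$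 are $x_1,y_1,z$, and for $2\leq i\leq\ell$ those of $\Omega^{2br}(D_{4i-2}),\Omega^{2br}(D_{4i})$ are $x_i,y_i$.
   Context: For integers $a\leq b$, $[a,b]$ denotes the set of integers $c$ with $a\leq c\leq b$. $\mathfrak{S}_p$ is the symmetric group on $p$ letters. Modules are finite-dimensional; $V\otimes W$ is the tensor product over $F$ with diagonal group action. For $i\in[0,p-2]$, $D_i=D^{(p-i,1^i)}$ is the simple $F\mathfrak{S}_p$-module labelled by the ($p$-regular) hook partition $(p-i,1^i)$, i.e. the unique simple quotient (James) of the Specht module of that partition. $\Omega^r(V)$ is the $r$th Heller translate of $V$. $V\equiv W$ means $V\oplus P\cong W\oplus Q$ for some projective modules $P,Q$. For a non-negative integer $a$, $aV$ means the direct sum of $a$ copies of $V$. Wave sequences. An $h$-wave sequence is an infinite sequence of numbers written as a wave on $h$ horizontal levels: it goes down from a peak (top level) to a trough (bottom level), then up to the next peak, and so on; each peak or trough is shared by the two strokes meeting there. The $t$th period is the part from the $t$th peak to the $(t+1)$st peak. The whole wave is determined by its first stroke (first peak to first trough) and the following rule giving each stroke from the previous one. Even case $h=2\ell$. If a stroke, in the order it is traversed, is $x_1,x_2,\ldots,x_\ell,y_\ell,\ldots,y_2,y_1$, then the next stroke, in the order it is traversed, is $x_1',x_2',\ldots,x_\ell',y_\ell',\ldots,y_2',y_1'$, where $x_1'=y_1$; $x_i'=y_{i-1}+x_i+y_i$ for $2\leq i\leq\ell$; $y_i'=x_i+y_i+x_{i+1}$ for $1\leq i\leq\ell-1$; $y_\ell'=x_\ell+y_\ell$.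 The same rule is used for passing from a downward to an upward stroke and from an upward to a downward stroke. The specific sequence $W_h$ has first stroke given by $(x_1,\ldots,x_\ell)=(1,1,0,\ldots,0)$ and $(y_1,\ldots,y_\ell)=(1,0,\ldots,0)$ (for $\ell=1$ this is read as $x_1=1$, $y_1=1$). Odd case $h=2\ell+1$. If a stroke, in the order it is traversed, is $x_1,\ldots,x_\ell,z,y_\ell,\ldots,y_1$, then the next stroke, in the order it is traversed, is $x_1',\ldots,x_\ell',z',y_\ell',\ldots,y_1'$, where $x_1'=y_1$; $y_1'=x_1+y_1+z$; $z'=y_1+z+x_2$ (with $x_2=0$ if $\ell=1$); and, if $\ell\geq 2$, $x_2'=z+x_2+y_2$; $x_i'=y_{i-1}+x_i+y_i$ for $3\leq i\leq\ell$; $y_i'=x_i+y_i+x_{i+1}$ for $2\leq i\leq\ell-1$; $y_\ell'=x_\ell+y_\ell$. Again the same rule is used for both kinds of passage. The specific sequence $W_h$ has first stroke given by $(x_1,\ldots,x_\ell)=(1,0,\ldots,0)$, $(y_1,\ldots,y_\ell)=(1,0,\ldots,0)$, $z=1$. Thus the numbers from the peak to the trough in the $b$th period of $W_h$ are obtained from the first stroke by applying the rule $2(b-1)$ times. (Example: $W_3$ is $1,1,1,2,3,5,6,11,14,25,31,\ldots$, with peaks $1,3,14,\ldots$ and troughs $1,6,31,\ldots$.) *)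

theory Defs
  imports
    "Jordan_Normal_Form.Matrix_Kernel"
    "HOL-Algebra.Sym_Groups"
    "HOL-Computational_Algebra.Computational_Algebra"
    "HOL-Library.FuncSet"
begin

section \<open>Finite-dimensional modules over a group algebra\<close>

text \<open>
  HOL-Algebra has modules over commutative rings only.  A finite-dimensional left \<open>FG\<close>-module is
  therefore given here by its dimension \<open>n\<close> and the matrices through which \<open>G\<close> acts on the space
  \<open>F\<^sup>n\<close> of column vectors.  Every finite-dimensional module is isomorphic to one of this form, so
  quantifying over them is quantifying over all finite-dimensional modules up to isomorphism.
\<close>

record ('g, 'a) rep =
  rdim :: nat
  ract :: "'g \<Rightarrow> 'a mat"

definition is_module :: "('g, 'm) monoid_scheme \<Rightarrow> ('g, 'a::field) rep \<Rightarrow> bool" where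
  "is_module G V \<longleftrightarrow>
     (\<forall>g\<in>carrier G. ract V g \<in> carrier_mat (rdim V) (rdim V)) \<and>
     ract V \<one>\<^bsub>G\<^esub> = 1\<^sub>m (rdim V) \<and>
     (\<forall>g\<in>carrier G. \<forall>h\<in>carrier G. ract V (g \<otimes>\<^bsub>G\<^esub> h) = ract V g * ract V h)"

definition is_hom ::
  "('g, 'm) monoid_scheme \<Rightarrow> ('g, 'a::field) rep \<Rightarrow> ('g, 'a) rep \<Rightarrow> 'a mat \<Rightarrow> bool" where
  "is_hom G V W A \<longleftrightarrow>
     A \<in> carrier_mat (rdim W) (rdim V) \<and> (\<forall>g\<in>carrier G. A * ract V g = ract W g * A)"

definition inj_mat :: "'a::field mat \<Rightarrow> bool" where
  "inj_mat A \<longleftrightarrow> inj_on ((*\<^sub>v) A) (carrier_vec (dim_col A))"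

definition mat_range :: "'a::field mat \<Rightarrow> 'a vec set" where
  "mat_range A = (*\<^sub>v) A ` carrier_vec (dim_col A)"

definition surj_mat :: "'a::field mat \<Rightarrow> bool" where
  "surj_mat A \<longleftrightarrow> mat_range A = carrier_vec (dim_row A)"

definition iso_modules ::
  "('g, 'm) monoid_scheme \<Rightarrow> ('g, 'a::field) rep \<Rightarrow> ('g, 'a) rep \<Rightarrow> bool" where
  "iso_modules G V W \<longleftrightarrow> (\<exists>A. is_hom G V W A \<and> inj_mat A \<and> surj_mat A)"

definition is_submodule ::
  "('g, 'm) monoid_scheme \<Rightarrow> ('g, 'a::field) rep \<Rightarrow> 'a vec set \<Rightarrow> bool" where
  "is_submodule G V U \<longleftrightarrow>
     U \<subseteq> carrier_vec (rdim V) \<and> 0\<^sub>v (rdim V) \<in> U \<and>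
     (\<forall>u\<in>U. \<forall>v\<in>U. u + v \<in> U) \<and>
     (\<forall>c. \<forall>u\<in>U. c \<cdot>\<^sub>v u \<in> U) \<and>
     (\<forall>g\<in>carrier G. \<forall>u\<in>U. ract V g *\<^sub>v u \<in> U)"

definition simple_module :: "('g, 'm) monoid_scheme \<Rightarrow> ('g, 'a::field) rep \<Rightarrow> bool" where
  "simple_module G V \<longleftrightarrow>
     is_module G V \<and> rdim V \<noteq> 0 \<and>
     (\<forall>U. is_submodule G V U \<longrightarrow> U = {0\<^sub>v (rdim V)} \<or> U = carrier_vec (rdim V))"


subsection \<open>Direct sums and tensor products\<close>

definition dsum :: "('g, 'a::field) rep list \<Rightarrow> ('g, 'a) rep" where
  "dsum Vs = \<lparr> rdim = (\<Sum>V\<leftarrow>Vs. rdim V),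
               ract = (\<lambda>g. diag_block_mat (map (\<lambda>V. ract V g) Vs)) \<rparr>"

definition copies :: "nat \<Rightarrow> ('g, 'a::field) rep \<Rightarrow> ('g, 'a) rep" where
  "copies a V = dsum (replicate a V)"

definition kronecker :: "'a::field mat \<Rightarrow> 'a mat \<Rightarrow> 'a mat" where
  "kronecker A B = mat (dim_row A * dim_row B) (dim_col A * dim_col B)
     (\<lambda>(i, j). A $$ (i div dim_row B, j div dim_col B) * B $$ (i mod dim_row B, j mod dim_col B))"

definition tensor :: "('g, 'a::field) rep \<Rightarrow> ('g, 'a) rep \<Rightarrow> ('g, 'a) rep" where
  "tensor V W = \<lparr> rdim = rdim V * rdim W, ract = (\<lambda>g. kronecker (ract V g) (ract W g)) \<rparr>"

definition trivial_module :: "('g, 'a::field) rep" where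
  "trivial_module = \<lparr> rdim = 1, ract = (\<lambda>g. 1\<^sub>m 1) \<rparr>"

primrec tensor_power :: "('g, 'a::field) rep \<Rightarrow> nat \<Rightarrow> ('g, 'a) rep" where
  "tensor_power V 0 = trivial_module"
| "tensor_power V (Suc n) = tensor V (tensor_power V n)"


subsection \<open>Projective modules, stable equivalence and Heller translates\<close>

definition projective :: "('g, 'm) monoid_scheme \<Rightarrow> ('g, 'a::field) rep \<Rightarrow> bool" where
  "projective G P \<longleftrightarrow>
     is_module G P \<and>
     (\<forall>V W f g. is_module G V \<and> is_module G W \<and> is_hom G V W f \<and> surj_mat f \<and> is_hom G P W g
        \<longrightarrow> (\<exists>h. is_hom G P V h \<and> f * h = g))"

definition stably_equiv ::
  "('g, 'm) monoid_scheme \<Rightarrow> ('g, 'a::field) rep \<Rightarrow> ('g, 'a) rep \<Rightarrow> bool" where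
  "stably_equiv G V W \<longleftrightarrow>
     (\<exists>P Q. projective G P \<and> projective G Q \<and> iso_modules G (dsum [V, P]) (dsum [W, Q]))"

definition projective_cover ::
  "('g, 'm) monoid_scheme \<Rightarrow> ('g, 'a::field) rep \<Rightarrow> ('g, 'a) rep \<Rightarrow> 'a mat \<Rightarrow> bool" where
  "projective_cover G V P f \<longleftrightarrow>
     projective G P \<and> is_hom G P V f \<and> surj_mat f \<and>
     (\<forall>U. is_submodule G P U \<and> (*\<^sub>v) f ` U = carrier_vec (rdim V) \<longrightarrow> U = carrier_vec (rdim P))"

text \<open>
  \<open>\<Omega>(V)\<close> is the kernel of a projective cover of \<open>V\<close>.  It is defined up to isomorphism only; since
  modules are given by matrices, \<open>heller\<close> picks some module with an embedding onto that kernel.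
\<close>

definition is_heller ::
  "('g, 'm) monoid_scheme \<Rightarrow> ('g, 'a::field) rep \<Rightarrow> ('g, 'a) rep \<Rightarrow> bool" where
  "is_heller G V W \<longleftrightarrow>
     is_module G W \<and>
     (\<exists>P f k. projective_cover G V P f \<and> is_hom G W P k \<and> inj_mat k \<and> mat_range k = mat_kernel f)"

definition heller ::
  "('g, 'm) monoid_scheme \<Rightarrow> ('g, 'a::field) rep \<Rightarrow> ('g, 'a) rep" where
  "heller G V = (SOME W. is_heller G V W)"

definition heller_power ::
  "('g, 'm) monoid_scheme \<Rightarrow> nat \<Rightarrow> ('g, 'a::field) rep \<Rightarrow> ('g, 'a) rep" where
  "heller_power G r = heller G ^^ r"


section \<open>Specht modules and their simple quotients\<close>

text \<open>
  Partitions are lists of parts, cells of diagrams are pairs (row, column) counted from 0.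
  A tabloid is represented by the list of its rows, each row being a set of entries.
\<close>

definition young :: "nat list \<Rightarrow> (nat \<times> nat) set" where
  "young lam = {(i, j). i < length lam \<and> j < lam ! i}"

definition tableaux :: "nat list \<Rightarrow> (nat \<times> nat \<Rightarrow> nat) set" where
  "tableaux lam = {t \<in> extensional (young lam). bij_betw t (young lam) {1..sum_list lam}}"

definition tabloid :: "nat list \<Rightarrow> (nat \<times> nat \<Rightarrow> nat) \<Rightarrow> nat set list" where
  "tabloid lam t = map (\<lambda>i. t ` ({i} \<times> {..<lam ! i})) [0..<length lam]"

definition column_stabilizer :: "nat list \<Rightarrow> (nat \<times> nat \<Rightarrow> nat) \<Rightarrow> (nat \<Rightarrow> nat) set" where
  "column_stabilizer lam t =
     {s. s permutes {1..sum_list lam} \<and>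
         (\<forall>i j. (i, j) \<in> young lam \<longrightarrow> (\<exists>i'. (i', j) \<in> young lam \<and> s (t (i, j)) = t (i', j)))}"

text \<open>
  Elements of the permutation module on tabloids are represented by their coefficient functions,
  so that the permutation \<open>s\<close> sends \<open>v\<close> to the function \<open>T \<mapsto> v (s\<^sup>-\<^sup>1 T)\<close>.
\<close>

definition perm_act :: "(nat \<Rightarrow> nat) \<Rightarrow> (nat set list \<Rightarrow> 'a) \<Rightarrow> (nat set list \<Rightarrow> 'a)" where
  "perm_act s v = (\<lambda>T. v (map ((`) (inv' s)) T))"

definition polytabloid ::
  "nat list \<Rightarrow> (nat \<times> nat \<Rightarrow> nat) \<Rightarrow> (nat set list \<Rightarrow> 'a::field)" where
  "polytabloid lam t =
     (\<lambda>T. \<Sum>s\<in>column_stabilizer lam t. of_int (sign s) * (if tabloid lam (s \<circ> t) = T then 1 else 0))"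

definition specht :: "nat list \<Rightarrow> (nat set list \<Rightarrow> 'a::field) set" where
  "specht lam = {v. \<exists>c. v = (\<lambda>T. \<Sum>t\<in>tableaux lam. c t * polytabloid lam t T)}"

definition specht_quotient :: "nat list \<Rightarrow> (nat \<Rightarrow> nat, 'a::field) rep \<Rightarrow> bool" where
  "specht_quotient lam V \<longleftrightarrow>
     is_module (sym_group (sum_list lam)) V \<and>
     (\<exists>f :: (nat set list \<Rightarrow> 'a) \<Rightarrow> 'a vec.
        (\<forall>u\<in>specht lam. \<forall>v\<in>specht lam. f (\<lambda>T. u T + v T) = f u + f v) \<and>
        (\<forall>c. \<forall>v\<in>specht lam. f (\<lambda>T. c * v T) = c \<cdot>\<^sub>v f v) \<and>
        (\<forall>s\<in>carrier (sym_group (sum_list lam)). \<forall>v\<in>specht lam. f (perm_act s v) = ract V s *\<^sub>v f v) \<and>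
        f ` specht lam = carrier_vec (rdim V))"

text \<open>\<open>D\<^sup>\<lambda>\<close>; by James's theorem it is well defined up to isomorphism for \<open>CHAR('a)\<close>-regular \<open>\<lambda>\<close>.\<close>

definition james_simple :: "nat list \<Rightarrow> (nat \<Rightarrow> nat, 'a::field) rep" where
  "james_simple lam =
     (SOME V. simple_module (sym_group (sum_list lam)) V \<and> specht_quotient lam V)"

definition hook_simple :: "nat \<Rightarrow> nat \<Rightarrow> (nat \<Rightarrow> nat, 'a::field) rep" where
  "hook_simple p i = james_simple ((p - i) # replicate i 1)"


section \<open>Wave sequences\<close>

text \<open>
  A stroke of a wave with \<open>2l\<close> levels, \<open>x\<^sub>1, \<dots>, x\<^sub>l, y\<^sub>l, \<dots>, y\<^sub>1\<close> in the order it is traversed, is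
  represented by the pair \<open>(x, y)\<close>; with \<open>2l + 1\<close> levels the triple \<open>(x, z, y)\<close> represents
  \<open>x\<^sub>1, \<dots>, x\<^sub>l, z, y\<^sub>l, \<dots>, y\<^sub>1\<close>.  Only the values at the indices \<open>1, \<dots>, l\<close> matter.  Strokes are
  numbered from 0, so the downward stroke of the \<open>t\<close>-th period is the one numbered \<open>2(t - 1)\<close>.
\<close>

fun even_step :: "nat \<Rightarrow> (nat \<Rightarrow> nat) \<times> (nat \<Rightarrow> nat) \<Rightarrow> (nat \<Rightarrow> nat) \<times> (nat \<Rightarrow> nat)" where
  "even_step l (x, y) =
     (\<lambda>i. if i = 1 then y 1 else y (i - 1) + x i + y i,
      \<lambda>i. if i = l then x l + y l else x i + y i + x (i + 1))"

definition even_stroke :: "nat \<Rightarrow> nat \<Rightarrow> (nat \<Rightarrow> nat) \<times> (nat \<Rightarrow> nat)" where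
  "even_stroke l k =
     (even_step l ^^ k) (\<lambda>i. if i = 1 \<or> i = 2 then 1 else 0, \<lambda>i. if i = 1 then 1 else 0)"

fun odd_step ::
  "nat \<Rightarrow> (nat \<Rightarrow> nat) \<times> nat \<times> (nat \<Rightarrow> nat) \<Rightarrow> (nat \<Rightarrow> nat) \<times> nat \<times> (nat \<Rightarrow> nat)" where
  "odd_step l (x, z, y) =
     (\<lambda>i. if i = 1 then y 1 else if i = 2 then z + x 2 + y 2 else y (i - 1) + x i + y i,
      y 1 + z + (if l = 1 then 0 else x 2),
      \<lambda>i. if i = 1 then x 1 + y 1 + z else if i = l then x l + y l else x i + y i + x (i + 1))"

definition odd_stroke :: "nat \<Rightarrow> nat \<Rightarrow> (nat \<Rightarrow> nat) \<times> nat \<times> (nat \<Rightarrow> nat)" where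
  "odd_stroke l k =
     (odd_step l ^^ k) (\<lambda>i. if i = 1 then 1 else 0, 1, \<lambda>i. if i = 1 then 1 else 0)"

definition even_wave_descent :: "nat \<Rightarrow> nat \<Rightarrow> (nat \<Rightarrow> nat) \<times> (nat \<Rightarrow> nat)" where
  "even_wave_descent l b = even_stroke l (2 * (b - 1))"

definition odd_wave_descent :: "nat \<Rightarrow> nat \<Rightarrow> (nat \<Rightarrow> nat) \<times> nat \<times> (nat \<Rightarrow> nat)" where
  "odd_wave_descent l b = odd_stroke l (2 * (b - 1))"

end

theory Submission
  imports Defs
begin

text \<open>
  Let \<open>m = p - 2\<close> and let \<open>D\<close> be the \<open>m\<close>-dimensional heart of the permutation module of degree \<open>p\<close>;
  it is \<open>D\<^sub>1\<close>.  Its exterior powers \<open>E\<^sub>n\<close> are the modules \<open>D\<^sub>n\<close> for \<open>n \<le> p - 2\<close>: the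
  coefficient functions of polytabloids of hook shape are alternating functions of the column
  entries, and summing \<open>v(c) d(c\<^sub>1) \<otimes> \<dots> \<otimes> d(c\<^sub>n)\<close> over them maps the Specht module onto
  \<open>E\<^sub>n\<close>, with kernel the radical of the form in James's submodule theorem.  Moreover
  \<open>E\<^sub>p\<^sub>-\<^sub>1 = 0\<close>.

  Modulo projectives, \<open>D \<otimes> D\<close> satisfies a relation of Temperley-Lieb type: the differences of the
  \<open>p\<close> vectors \<open>d(a)\<close> spanning \<open>D\<close> form a spherical 4-design, so a sum over the group shows that
  \<open>1 + swap + cup cap\<close> lies in the image of the transfer and hence factors through a projective
  module.  As the dimension of \<open>D\<close> is \<open>-2\<close> in the field, the two remaining eigenspaces split
  \<open>D \<otimes> E\<^sub>n\<close> stably as \<open>E\<^sub>n\<^sub>-\<^sub>1 \<oplus> E\<^sub>n\<^sub>+\<^sub>1\<close>.  Cancelling the simple summand \<open>E\<^sub>n\<close> from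
  \<open>D \<otimes> D \<otimes> E\<^sub>n\<close> leaves the stable fusion rule \<open>E\<^sub>2 \<otimes> E\<^sub>n = E\<^sub>n\<^sub>-\<^sub>2 \<oplus> E\<^sub>n \<oplus> E\<^sub>n\<^sub>+\<^sub>2\<close>, truncated at
  both ends, and one stroke of the wave is one tensor factor \<open>E\<^sub>2\<close>.  Heller translates pass
  through tensor products and direct sums in the stable category.
\<close>

text \<open>The antisymmetrisers come from Wenzl's recursion, which asks only for the swap of two
  strands, its braid relation and the invertibility of 1, ..., n in the field; hence everything
  takes place below n = p. On D \<otimes> E_n two endomorphisms exist exactly and not just stably:
  contract D against E_n and re-insert the Casimir tensor, or antisymmetrise all n + 1 strands.
  Suitably scaled they are orthogonal idempotents with images E_(n-1) and E_(n+1), and their sum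
  differs from the identity by a multiple of the compressed operator 1 + swap + cup cap. That
  operator is what remains of the sixteen terms in a fourth power of differences: the d(a) sum to
  zero and their number p is zero in the field, so only the pairings of the four slots survive.
  Stable statements are equations between maps modulo transfers, and decompositions are biproducts
  in this sense; this makes them stable under tensoring and syzygies. Cancelling E_n rests on its
  endomorphisms forming a division ring. At the top, p - 1 distinct points other than p leave no
  choice, and summing one slot over all points shows that E_(p-1) vanishes.\<close>

section \<open>Finitely supported matrices\<close>

text \<open>Matrices with finitely many nonzero entries form a ring without unit.  Maps between modules of
  any dimensions live in it, so that composing them needs no dimension conditions; \<open>block r c A\<close>
  below marks \<open>A\<close> as an \<open>r \<times> c\<close> matrix, and \<open>idm n\<close> is the \<open>n\<close>-dimensional identity.\<close>

typedef (overloaded) 'a fmat =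
  "{f :: nat \<Rightarrow> nat \<Rightarrow> 'a::zero. \<exists>N. \<forall>i j. f i j \<noteq> 0 \<longrightarrow> i < N \<and> j < N}"
  morphisms entry Abs_fmat
  by (intro exI[of _ "\<lambda>_ _. 0"]) simp

setup_lifting type_definition_fmat

lemma entry_bound: "\<exists>N. \<forall>i j. entry A i j \<noteq> 0 \<longrightarrow> i < N \<and> j < N"
  using entry[of A] by simp

lemma fmat_eqI: "(\<And>i j. entry A i j = entry B i j) \<Longrightarrow> A = B"
  by (simp add: entry_inject[symmetric] ext)

instantiation fmat :: (comm_ring_1) ring
begin

lift_definition zero_fmat :: "'a fmat" is "\<lambda>i j. 0" by simp

lift_definition plus_fmat :: "'a fmat \<Rightarrow> 'a fmat \<Rightarrow> 'a fmat" is "\<lambda>A B i j. A i j + B i j"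
proof -
  fix A B :: "nat \<Rightarrow> nat \<Rightarrow> 'a"
  assume "\<exists>N. \<forall>i j. A i j \<noteq> 0 \<longrightarrow> i < N \<and> j < N" "\<exists>N. \<forall>i j. B i j \<noteq> 0 \<longrightarrow> i < N \<and> j < N"
  then obtain M N where "\<forall>i j. A i j \<noteq> 0 \<longrightarrow> i < M \<and> j < M" "\<forall>i j. B i j \<noteq> 0 \<longrightarrow> i < N \<and> j < N"
    by blast
  then show "\<exists>N. \<forall>i j. A i j + B i j \<noteq> 0 \<longrightarrow> i < N \<and> j < N"
    by (intro exI[of _ "max M N"]) (metis add.right_neutral less_max_iff_disj)
qed

lift_definition uminus_fmat :: "'a fmat \<Rightarrow> 'a fmat" is "\<lambda>A i j. - A i j" by simp

definition minus_fmat :: "'a fmat \<Rightarrow> 'a fmat \<Rightarrow> 'a fmat" where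
  "minus_fmat A B = A + (- B)"

text \<open>Summing over the support of a row keeps the sum finite without a choice of
  bound.\<close>

lift_definition times_fmat :: "'a fmat \<Rightarrow> 'a fmat \<Rightarrow> 'a fmat"
  is "\<lambda>A B i j. \<Sum>k | A i k \<noteq> 0. A i k * B k j"
proof -
  fix A B :: "nat \<Rightarrow> nat \<Rightarrow> 'a"
  assume "\<exists>N. \<forall>i j. A i j \<noteq> 0 \<longrightarrow> i < N \<and> j < N" "\<exists>N. \<forall>i j. B i j \<noteq> 0 \<longrightarrow> i < N \<and> j < N"
  then obtain M N where M: "\<forall>i j. A i j \<noteq> 0 \<longrightarrow> i < M \<and> j < M"
    and N: "\<forall>i j. B i j \<noteq> 0 \<longrightarrow> i < N \<and> j < N"
    by blast
  show "\<exists>N. \<forall>i j. (\<Sum>k | A i k \<noteq> 0. A i k * B k j) \<noteq> 0 \<longrightarrow> i < N \<and> j < N"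
  proof (intro exI allI impI)
    fix i j
    assume "(\<Sum>k | A i k \<noteq> 0. A i k * B k j) \<noteq> 0"
    then obtain k where "A i k * B k j \<noteq> 0"
      by (meson sum.neutral)
    then have "A i k \<noteq> 0" "B k j \<noteq> 0"
      by auto
    then show "i < max M N \<and> j < max M N"
      using M N by (meson less_max_iff_disj)
  qed
qed

lemma entry_times_bound:
  assumes "\<And>k. k \<ge> N \<Longrightarrow> entry A i k * entry B k j = 0"
  shows "entry (A * B) i j = (\<Sum>k<N. entry A i k * entry B k j)"
proof -
  obtain M where M: "\<forall>i j. entry A i j \<noteq> 0 \<longrightarrow> i < M \<and> j < M"
    using entry_bound by blast
  have "entry (A * B) i j = (\<Sum>k | entry A i k \<noteq> 0. entry A i k * entry B k j)"
    by transfer simp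
  also have "\<dots> = (\<Sum>k<max M N. entry A i k * entry B k j)"
    by (rule sum.mono_neutral_left) (use M in \<open>auto simp: less_max_iff_disj\<close>)
  also have "\<dots> = (\<Sum>k<N. entry A i k * entry B k j)"
    by (rule sum.mono_neutral_right) (use assms in \<open>auto simp: not_less\<close>)
  finally show ?thesis .
qed

text \<open>One cutoff serves all entries, and so does every larger one; several products can
  therefore be expanded over a common range when the ring axioms are checked.\<close>

lemma entry_times_ex:
  "\<exists>N. \<forall>M\<ge>N. \<forall>i j. entry (A * B) i j = (\<Sum>k<M. entry A i k * entry B k j)"
proof -
  obtain N where N: "\<forall>i j. entry A i j \<noteq> 0 \<longrightarrow> i < N \<and> j < N"
    using entry_bound by blast
  show ?thesis
    by (intro exI[of _ N] allI impI entry_times_bound) (metis N leD le_trans mult_zero_left)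
qed

instance
proof
  fix A B C :: "'a fmat"
  show "A + B + C = A + (B + C)" by transfer (simp add: add.assoc)
  show "A + B = B + A" by transfer (simp add: add.commute)
  show "0 + A = A" by transfer simp
  show "- A + A = 0" by transfer simp
  show "A - B = A + - B" by (rule minus_fmat_def)
  obtain N1 where N1: "\<forall>M\<ge>N1. \<forall>i j. entry (A * B) i j = (\<Sum>k<M. entry A i k * entry B k j)"
    using entry_times_ex by blast
  obtain N2 where N2: "\<forall>M\<ge>N2. \<forall>i j. entry ((A * B) * C) i j = (\<Sum>k<M. entry (A * B) i k * entry C k j)"
    using entry_times_ex by blast
  obtain N3 where N3: "\<forall>M\<ge>N3. \<forall>i j. entry (B * C) i j = (\<Sum>k<M. entry B i k * entry C k j)"
    using entry_times_ex by blast
  obtain N4 where N4: "\<forall>M\<ge>N4. \<forall>i j. entry (A * (B * C)) i j = (\<Sum>k<M. entry A i k * entry (B * C) k j)"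
    using entry_times_ex by blast
  define M where "M = Max {N1, N2, N3, N4}"
  have M: "M \<ge> N1" "M \<ge> N2" "M \<ge> N3" "M \<ge> N4"
    by (simp_all add: M_def)
  note N = N1[rule_format, OF M(1)] N2[rule_format, OF M(2)] N3[rule_format, OF M(3)] N4[rule_format, OF M(4)]
  show "A * B * C = A * (B * C)"
  proof (rule fmat_eqI)
    fix i j
    have "entry (A * B * C) i j
        = (\<Sum>k<M. (\<Sum>l<M. entry A i l * entry B l k) * entry C k j)"
      by (simp only: N)
    also have "\<dots> = (\<Sum>k<M. \<Sum>l<M. entry A i l * (entry B l k * entry C k j))"
      by (simp add: sum_distrib_right mult.assoc)
    also have "\<dots> = (\<Sum>l<M. entry A i l * (\<Sum>k<M. entry B l k * entry C k j))"
      unfolding sum_distrib_left by (rule sum.swap)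
    also have "\<dots> = entry (A * (B * C)) i j"
      by (simp only: N)
    finally show "entry (A * B * C) i j = entry (A * (B * C)) i j" .
  qed
next
  fix A B C :: "'a fmat"
  have plus: "entry (X + Y) i j = entry X i j + entry Y i j" for X Y :: "'a fmat" and i j
    by transfer simp
  obtain N1 where N1: "\<forall>M\<ge>N1. \<forall>i j. entry (A * C) i j = (\<Sum>k<M. entry A i k * entry C k j)"
    using entry_times_ex by blast
  obtain N2 where N2: "\<forall>M\<ge>N2. \<forall>i j. entry (B * C) i j = (\<Sum>k<M. entry B i k * entry C k j)"
    using entry_times_ex by blast
  obtain N3 where N3: "\<forall>M\<ge>N3. \<forall>i j. entry ((A + B) * C) i j = (\<Sum>k<M. entry (A + B) i k * entry C k j)"
    using entry_times_ex by blast
  obtain N4 where N4: "\<forall>M\<ge>N4. \<forall>i j. entry (A * (B + C)) i j = (\<Sum>k<M. entry A i k * entry (B + C) k j)"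
    using entry_times_ex by blast
  obtain N5 where N5: "\<forall>M\<ge>N5. \<forall>i j. entry (A * B) i j = (\<Sum>k<M. entry A i k * entry B k j)"
    using entry_times_ex by blast
  define M where "M = Max {N1, N2, N3, N4, N5}"
  have M: "M \<ge> N1" "M \<ge> N2" "M \<ge> N3" "M \<ge> N4" "M \<ge> N5"
    by (simp_all add: M_def)
  note N = N1[rule_format, OF M(1)] N2[rule_format, OF M(2)] N3[rule_format, OF M(3)] N4[rule_format, OF M(4)]
    N5[rule_format, OF M(5)]
  show "(A + B) * C = A * C + B * C"
  proof (rule fmat_eqI)
    show "entry ((A + B) * C) i j = entry (A * C + B * C) i j" for i j
      unfolding plus N by (simp add: plus algebra_simps sum.distrib)
  qed
  show "A * (B + C) = A * B + A * C"
  proof (rule fmat_eqI)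
    show "entry (A * (B + C)) i j = entry (A * B + A * C) i j" for i j
      unfolding plus N by (simp add: plus algebra_simps sum.distrib)
  qed
qed

end

lemma entry_zero [simp]: "entry 0 i j = 0"
  by transfer simp

lemma entry_plus [simp]: "entry (A + B) i j = entry A i j + entry B i j"
  by transfer simp

lemma entry_uminus [simp]: "entry (- A) i j = - entry A i j"
  by transfer simp

lemma entry_minus [simp]: "entry (A - B) i j = entry A i j - entry B i j"
  unfolding minus_fmat_def by (simp only: entry_plus entry_uminus diff_conv_add_uminus)

lemma entry_sum [simp]: "entry (sum f S) i j = (\<Sum>s\<in>S. entry (f s) i j)"
  by (induction S rule: infinite_finite_induct) auto

lift_definition scale :: "'a::comm_ring_1 \<Rightarrow> 'a fmat \<Rightarrow> 'a fmat" (infixr "\<cdot>" 75)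
  is "\<lambda>c A i j. c * A i j"
  by (metis mult_zero_right)

lemma entry_scale [simp]: "entry (c \<cdot> A) i j = c * entry A i j"
  by transfer simp

lemma scale_simps [simp]:
  "1 \<cdot> A = A" "0 \<cdot> A = 0" "c \<cdot> 0 = 0" "a \<cdot> b \<cdot> A = (a * b) \<cdot> A" "(- a) \<cdot> A = - (a \<cdot> A)"
  "c \<cdot> (- A) = - (c \<cdot> A)"
  by (auto intro!: fmat_eqI)

lemma scale_distribs:
  "c \<cdot> (A + B) = c \<cdot> A + c \<cdot> B" "c \<cdot> (A - B) = c \<cdot> A - c \<cdot> B"
  "(a + b) \<cdot> A = a \<cdot> A + b \<cdot> A" "(a - b) \<cdot> A = a \<cdot> A - b \<cdot> A"
  by (auto intro!: fmat_eqI simp: algebra_simps)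

lemma scale_sum: "c \<cdot> sum f S = (\<Sum>s\<in>S. c \<cdot> f s)"
  by (auto intro!: fmat_eqI simp: sum_distrib_left)

lemma scale_times [simp]: "(c \<cdot> A) * B = c \<cdot> (A * B)" "A * (c \<cdot> B) = c \<cdot> (A * B)"
proof -
  show "(c \<cdot> A) * B = c \<cdot> (A * B)"
  proof (rule fmat_eqI)
    fix i j
    obtain N where N: "\<forall>M\<ge>N. \<forall>i j. entry (A * B) i j = (\<Sum>k<M. entry A i k * entry B k j)"
      using entry_times_ex by blast
    obtain N' where N': "\<forall>M\<ge>N'. \<forall>i j. entry ((c \<cdot> A) * B) i j = (\<Sum>k<M. entry (c \<cdot> A) i k * entry B k j)"
      using entry_times_ex by blast
    show "entry ((c \<cdot> A) * B) i j = entry (c \<cdot> (A * B)) i j"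
      using N[rule_format, of "max N N'"] N'[rule_format, of "max N N'"]
      by (simp add: sum_distrib_left mult.assoc)
  qed
  show "A * (c \<cdot> B) = c \<cdot> (A * B)"
  proof (rule fmat_eqI)
    fix i j
    obtain N where N: "\<forall>M\<ge>N. \<forall>i j. entry (A * B) i j = (\<Sum>k<M. entry A i k * entry B k j)"
      using entry_times_ex by blast
    obtain N' where N': "\<forall>M\<ge>N'. \<forall>i j. entry (A * (c \<cdot> B)) i j = (\<Sum>k<M. entry A i k * entry (c \<cdot> B) k j)"
      using entry_times_ex by blast
    show "entry (A * (c \<cdot> B)) i j = entry (c \<cdot> (A * B)) i j"
      using N[rule_format, of "max N N'"] N'[rule_format, of "max N N'"]
      by (simp add: sum_distrib_left mult.left_commute)
  qed
qed

section \<open>Sizes and identity matrices\<close>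

definition block :: "nat \<Rightarrow> nat \<Rightarrow> 'a::comm_ring_1 fmat \<Rightarrow> bool" where
  "block r c A \<longleftrightarrow> (\<forall>i j. entry A i j \<noteq> 0 \<longrightarrow> i < r \<and> j < c)"

lemma blockD: "block r c A \<Longrightarrow> r \<le> i \<or> c \<le> j \<Longrightarrow> entry A i j = 0"
  unfolding block_def by (meson leD)

lemma entry_times_left:
  assumes "block r c A" shows "entry (A * B) i j = (\<Sum>k<c. entry A i k * entry B k j)"
  by (rule entry_times_bound) (simp add: blockD[OF assms])

lemma entry_times_right:
  assumes "block r c B" shows "entry (A * B) i j = (\<Sum>k<r. entry A i k * entry B k j)"
  by (rule entry_times_bound) (simp add: blockD[OF assms])

lemma block_times: assumes "block r n A" "block m c B" shows "block r c (A * B)"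
  unfolding block_def
proof (intro allI impI)
  fix i j assume *: "entry (A * B) i j \<noteq> 0"
  have "i < r" using * unfolding entry_times_left[OF assms(1)]
    by (metis (no_types, lifting) assms(1) blockD linorder_not_le mult_zero_left sum.neutral)
  moreover have "j < c" using * unfolding entry_times_right[OF assms(2)]
    by (metis (no_types, lifting) assms(2) blockD linorder_not_le mult_zero_right sum.neutral)
  ultimately show "i < r \<and> j < c" by simp
qed

lemma block_intros [simp, intro]:
  "block r c 0"
  "block r c A \<Longrightarrow> block r c B \<Longrightarrow> block r c (A + B)"
  "block r c A \<Longrightarrow> block r c B \<Longrightarrow> block r c (A - B)"
  "block r c A \<Longrightarrow> block r c (- A)"
  "block r c A \<Longrightarrow> block r c (a \<cdot> A)"
proof -
  show "block r c (A + B)" if "block r c A" "block r c B"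
    unfolding block_def using blockD[OF that(1)] blockD[OF that(2)]
    by (metis add.right_neutral entry_plus leI)
  show "block r c (A - B)" if "block r c A" "block r c B"
    unfolding block_def using blockD[OF that(1)] blockD[OF that(2)]
    by (metis diff_zero entry_minus leI)
  show "block r c (a \<cdot> A)" if "block r c A"
    unfolding block_def using blockD[OF that]
    by (metis entry_scale leI mult_zero_right)
qed (auto simp: block_def)

lemma block_sum [intro]: "(\<And>s. s \<in> S \<Longrightarrow> block r c (f s)) \<Longrightarrow> block r c (sum f S)"
  by (induction S rule: infinite_finite_induct) auto

lift_definition fmat_of :: "nat \<Rightarrow> nat \<Rightarrow> (nat \<Rightarrow> nat \<Rightarrow> 'a::comm_ring_1) \<Rightarrow> 'a fmat"
  is "\<lambda>r c f i j. if i < r \<and> j < c then f i j else 0"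
  by (metis less_max_iff_disj)

lemma entry_fmat_of [simp]: "entry (fmat_of r c f) i j = (if i < r \<and> j < c then f i j else 0)"
  by transfer simp

lemma block_fmat_of [simp, intro]: "block r c (fmat_of r c f)"
  by (simp add: block_def)

definition idm :: "nat \<Rightarrow> 'a::comm_ring_1 fmat" where
  "idm n = fmat_of n n (\<lambda>i j. if i = j then 1 else 0)"

lemma entry_idm: "entry (idm n) i j = (if i = j \<and> i < n then 1 else 0)"
  by (simp add: idm_def)

lemma block_idm [simp, intro]: "block n n (idm n)"
  by (simp add: idm_def)

lemma entry_idm_times: "entry (idm n * A) i j = (if i < n then entry A i j else 0)"
proof -
  have "entry (idm n * A) i j = (\<Sum>k<n. if k = i then entry A i j else 0)"
    unfolding entry_times_left[OF block_idm] by (rule sum.cong) (auto simp: entry_idm)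
  then show ?thesis by simp
qed

lemma entry_times_idm: "entry (A * idm n) i j = (if j < n then entry A i j else 0)"
proof -
  have "entry (A * idm n) i j = (\<Sum>k<n. if k = j then entry A i j else 0)"
    unfolding entry_times_right[OF block_idm] by (rule sum.cong) (auto simp: entry_idm)
  then show ?thesis by simp
qed

text \<open>This turns a size condition into two equations of the ring, which can be used for
  rewriting.\<close>

lemma block_iff: "block r c A \<longleftrightarrow> idm r * A = A \<and> A * idm c = A"
proof
  assume "block r c A"
  then show "idm r * A = A \<and> A * idm c = A"
    by (auto intro!: fmat_eqI simp: entry_idm_times entry_times_idm blockD)
next
  assume *: "idm r * A = A \<and> A * idm c = A"
  show "block r c A"
    unfolding block_def using * by (metis entry_idm_times entry_times_idm)
qed

lemma idm_times: "block r c A \<Longrightarrow> idm r * A = A"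
  and times_idm: "block r c A \<Longrightarrow> A * idm c = A"
  by (simp_all add: block_iff)

lemma idm_idm [simp]: "idm n * idm n = idm n"
  by (rule idm_times) (rule block_idm)

text \<open>The Kronecker product, for \<open>B\<close> of size \<open>r \<times> c\<close>.\<close>

definition tens :: "nat \<Rightarrow> nat \<Rightarrow> 'a::comm_ring_1 fmat \<Rightarrow> 'a fmat \<Rightarrow> 'a fmat" where
  "tens r c A B = Abs_fmat (\<lambda>i j. if 0 < r \<and> 0 < c
     then entry A (i div r) (j div c) * entry B (i mod r) (j mod c) else 0)"

lemma entry_tens:
  "entry (tens r c A B) i j = (if 0 < r \<and> 0 < c
     then entry A (i div r) (j div c) * entry B (i mod r) (j mod c) else 0)"
proof -
  obtain N where N: "\<forall>i j. entry A i j \<noteq> 0 \<longrightarrow> i < N \<and> j < N"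
    using entry_bound by blast
  have "\<exists>N. \<forall>i j. (if 0 < r \<and> 0 < c
     then entry A (i div r) (j div c) * entry B (i mod r) (j mod c) else 0) \<noteq> 0 \<longrightarrow> i < N \<and> j < N"
  proof (intro exI allI impI)
    fix i j
    assume *: "(if 0 < r \<and> 0 < c
     then entry A (i div r) (j div c) * entry B (i mod r) (j mod c) else 0) \<noteq> 0"
    then have rc: "0 < r" "0 < c" and "entry A (i div r) (j div c) \<noteq> 0"
      by (auto split: if_splits)
    then have "i div r < N" "j div c < N"
      using N by auto
    then have "i < N * r" "j < N * c"
      using rc by (simp_all add: div_less_iff_less_mult)
    then show "i < N * r + N * c \<and> j < N * r + N * c"
      by simp
  qed
  then show ?thesis
    unfolding tens_def by (subst Abs_fmat_inverse) auto
qed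

lemma tens_add_left: "tens r c (A + A') B = tens r c A B + tens r c A' B"
  and tens_add_right: "tens r c A (B + B') = tens r c A B + tens r c A B'"
  and tens_diff_left: "tens r c (A - A') B = tens r c A B - tens r c A' B"
  and tens_diff_right: "tens r c A (B - B') = tens r c A B - tens r c A B'"
  and tens_scale_left [simp]: "tens r c (a \<cdot> A) B = a \<cdot> tens r c A B"
  and tens_scale_right [simp]: "tens r c A (a \<cdot> B) = a \<cdot> tens r c A B"
  and tens_uminus_left [simp]: "tens r c (- A) B = - tens r c A B"
  and tens_uminus_right [simp]: "tens r c A (- B) = - tens r c A B"
  and tens_zero_left [simp]: "tens r c 0 B = 0"
  and tens_zero_right [simp]: "tens r c A 0 = 0"
  by (auto intro!: fmat_eqI simp: entry_tens algebra_simps)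

lemma tens_sum_left: "tens r c (sum f S) B = (\<Sum>s\<in>S. tens r c (f s) B)"
  and tens_sum_right: "tens r c A (sum f S) = (\<Sum>s\<in>S. tens r c A (f s))"
  by (induction S rule: infinite_finite_induct) (auto simp: tens_add_left tens_add_right)

lemma block_tens:
  assumes "block r c A" "block s d B"
  shows "block (r * s) (c * d) (tens s d A B)"
  unfolding block_def
proof (intro allI impI)
  fix i j
  assume "entry (tens s d A B) i j \<noteq> 0"
  then have "0 < s" "0 < d" "entry A (i div s) (j div d) \<noteq> 0"
    by (auto simp: entry_tens split: if_splits)
  moreover from this have "i div s < r" "j div d < c"
    using assms(1) by (auto simp: block_def)
  ultimately show "i < r * s \<and> j < c * d"
    by (simp add: div_less_iff_less_mult)
qed

lemma mixed_radix_less: "i < m \<Longrightarrow> j < n \<Longrightarrow> i * n + j < m * (n::nat)"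
  using mult_le_mono1[of "Suc i" m n] by simp

lemma sum_div_mod:
  fixes f :: "nat \<Rightarrow> nat \<Rightarrow> 'a::comm_monoid_add"
  assumes "0 < n"
  shows "(\<Sum>k<m * n. f (k div n) (k mod n)) = (\<Sum>i<m. \<Sum>j<n. f i j)"
proof -
  have "(\<Sum>k<m * n. f (k div n) (k mod n)) = (\<Sum>(i, j)\<in>{..<m} \<times> {..<n}. f i j)"
    by (rule sum.reindex_bij_witness[of _ "\<lambda>(i, j). i * n + j" "\<lambda>k. (k div n, k mod n)"])
      (use assms in \<open>auto simp: div_less_iff_less_mult intro: mixed_radix_less\<close>)
  then show ?thesis
    by (simp add: sum.cartesian_product)
qed

text \<open>The summation index splits as k = k1 c + k2 with k2 < c. The size condition on
  \<open>B\<close> or \<open>B'\<close> makes this range of k2 exhaust the product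
  \<open>B * B'\<close>, while k1 is bounded by the finite support of \<open>A\<close>.\<close>

lemma tens_times:
  assumes "block r' c B \<or> block c d' B'"
  shows "tens r c A B * tens c d A' B' = tens r d (A * A') (B * B')"
proof (cases "0 < c")
  \<comment> \<open>For \<open>c = 0\<close> the Kronecker product is \<open>0\<close> by
    definition, and the size condition leaves no entry in \<open>B\<close> or none in
    \<open>B'\<close>.\<close>
  case False
  then have "B = 0 \<or> B' = 0"
    using assms by (auto simp: block_def intro: fmat_eqI)
  moreover have "tens r c A B = 0"
    using False by (auto intro!: fmat_eqI simp: entry_tens)
  ultimately show ?thesis by auto
next
  case c: True
  show ?thesis
  proof (rule fmat_eqI)
  fix i j
  obtain N where N: "\<forall>i j. entry A i j \<noteq> 0 \<longrightarrow> i < N \<and> j < N"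
    using entry_bound by blast
  have AA': "entry (A * A') i' j' = (\<Sum>k<N. entry A i' k * entry A' k j')" for i' j'
    by (rule entry_times_bound) (metis N leD mult_zero_left)
  have BB': "entry (B * B') i' j' = (\<Sum>k<c. entry B i' k * entry B' k j')" for i' j'
    by (rule entry_times_bound) (metis assms blockD mult_zero_left mult_zero_right)
  show "entry (tens r c A B * tens c d A' B') i j = entry (tens r d (A * A') (B * B')) i j"
  proof (cases "0 < r \<and> 0 < d")
    case True
    have "entry (tens r c A B * tens c d A' B') i j
        = (\<Sum>k<N * c. entry (tens r c A B) i k * entry (tens c d A' B') k j)"
    proof (rule entry_times_bound)
      fix k assume "N * c \<le> k"
      then have "N \<le> k div c" using c by (simp add: less_eq_div_iff_mult_less_eq)
      then have "entry A (i div r) (k div c) = 0" using N by (meson leD)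
      then show "entry (tens r c A B) i k * entry (tens c d A' B') k j = 0"
        by (simp add: entry_tens)
    qed
    also have "\<dots> = (\<Sum>k<N * c. (\<lambda>k1 k2. entry A (i div r) k1 * entry B (i mod r) k2 *
        (entry A' k1 (j div d) * entry B' k2 (j mod d))) (k div c) (k mod c))"
      using True c by (simp add: entry_tens)
    also have "\<dots> = (\<Sum>k1<N. \<Sum>k2<c. entry A (i div r) k1 * entry B (i mod r) k2 *
        (entry A' k1 (j div d) * entry B' k2 (j mod d)))"
      by (rule sum_div_mod[OF c])
    also have "\<dots> = entry (tens r d (A * A') (B * B')) i j"
      using True by (simp add: entry_tens AA' BB' sum_product ac_simps)
    finally show ?thesis .
  next
    case False
    obtain M where "\<forall>M'\<ge>M. \<forall>i j. entry (tens r c A B * tens c d A' B') i j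
        = (\<Sum>k<M'. entry (tens r c A B) i k * entry (tens c d A' B') k j)"
      using entry_times_ex by blast
    then show ?thesis using False by (auto simp: entry_tens)
  qed
qed
qed

text \<open>Both sides read the same three digits of the row index and of the column index in mixed
  radix.\<close>

lemma tens_assoc:
  "tens t f (tens s d A B) C = tens (s * t) (d * f) A (tens t f B C)"
proof (rule fmat_eqI)
  fix i j
  have 1: "i mod (s * t) div t = i div t mod s" for i s t :: nat
    using mod_mult2_eq[of i t s] by (cases "t = 0") (auto simp: mult.commute)
  have 2: "i mod (s * t) mod t = i mod t" for i s t :: nat
    by (simp add: mod_mod_cancel)
  have 3: "i div (s * t) = i div t div s" for i s t :: nat
    by (metis div_mult2_eq mult.commute)
  show "entry (tens t f (tens s d A B) C) i j = entry (tens (s * t) (d * f) A (tens t f B C)) i j"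
    unfolding entry_tens 1 2 3 by (simp add: mult.assoc)
qed

lemma tens_idm [simp]: "tens n n (idm m) (idm n) = idm (m * n)"
proof (rule fmat_eqI)
  fix i j
  show "entry (tens n n (idm m) (idm n)) i j = entry (idm (m * n)) i j"
    by (auto simp: entry_tens entry_idm div_less_iff_less_mult)
      (metis div_mult_mod_eq)
qed

lemma tens_one_right [simp]: "tens (Suc 0) (Suc 0) A (idm (Suc 0)) = A"
  by (rule fmat_eqI) (simp add: entry_tens entry_idm)

text \<open>Tensoring with a one-dimensional identity on the left cuts a matrix down to its first r
  rows and c columns, so it is harmless exactly on matrices of that size.\<close>

lemma tens_one_left: "block r c A \<Longrightarrow> 0 < r \<Longrightarrow> 0 < c \<Longrightarrow> tens r c (idm (Suc 0)) A = A"
proof (rule fmat_eqI)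
  fix i j assume *: "block r c A" "0 < r" "0 < c"
  show "entry (tens r c (idm (Suc 0)) A) i j = entry A i j"
  proof (cases "i < r \<and> j < c")
    case False
    then have "entry A i j = 0" "\<not> (i div r = 0 \<and> j div c = 0)"
      using blockD[OF *(1), of i j] * by (auto simp: not_less div_eq_0_iff)
    then show ?thesis by (auto simp: entry_tens entry_idm)
  qed (use * in \<open>auto simp: entry_tens entry_idm\<close>)
qed

section \<open>Passage between matrices with dimensions and finitely supported ones\<close>

definition fm :: "'a::comm_ring_1 mat \<Rightarrow> 'a fmat" where
  "fm A = fmat_of (dim_row A) (dim_col A) (\<lambda>i j. A $$ (i, j))"

definition mt :: "nat \<Rightarrow> nat \<Rightarrow> 'a::comm_ring_1 fmat \<Rightarrow> 'a mat" where
  "mt r c A = Matrix.mat r c (\<lambda>(i, j). entry A i j)"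

lemma mt_carrier [simp]: "mt r c A \<in> carrier_mat r c"
  by (simp add: mt_def)

lemma mt_fm: "A \<in> carrier_mat r c \<Longrightarrow> mt r c (fm A) = A"
  by (auto simp: mt_def fm_def)

lemma fm_mt: "block r c A \<Longrightarrow> fm (mt r c A) = A"
  by (rule fmat_eqI) (auto simp: mt_def fm_def blockD)

lemma block_fm [simp]: "A \<in> carrier_mat r c \<Longrightarrow> block r c (fm A)"
  by (auto simp: fm_def)

lemma fm_inj: "A \<in> carrier_mat r c \<Longrightarrow> B \<in> carrier_mat r c \<Longrightarrow> fm A = fm B \<Longrightarrow> A = B"
  by (metis mt_fm)

lemma fm_times: "A \<in> carrier_mat r n \<Longrightarrow> B \<in> carrier_mat n c \<Longrightarrow> fm (A * B) = fm A * fm B"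
proof (rule fmat_eqI)
  fix i j assume *: "A \<in> carrier_mat r n" "B \<in> carrier_mat n c"
  show "entry (fm (A * B)) i j = entry (fm A * fm B) i j"
    unfolding entry_times_left[OF block_fm[OF *(1)]]
    using * by (auto simp: fm_def scalar_prod_def lessThan_atLeast0 intro!: sum.cong)
qed

lemma fm_one [simp]: "fm (1\<^sub>m n) = idm n"
  by (rule fmat_eqI) (auto simp: fm_def entry_idm)

lemma fm_kronecker: "fm (kronecker A B) = tens (dim_row B) (dim_col B) (fm A) (fm B)"
proof (rule fmat_eqI)
  fix i j
  show "entry (fm (kronecker A B)) i j = entry (tens (dim_row B) (dim_col B) (fm A) (fm B)) i j"
    by (cases "dim_row B = 0"; cases "dim_col B = 0")
      (auto simp: fm_def kronecker_def entry_tens div_less_iff_less_mult)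
qed

section \<open>The stable module category\<close>

definition act :: "('g, 'a::field) rep \<Rightarrow> 'g \<Rightarrow> 'a fmat" where
  "act V g = fm (ract V g)"

definition mkrep :: "nat \<Rightarrow> ('g \<Rightarrow> 'a::field fmat) \<Rightarrow> ('g, 'a) rep" where
  "mkrep n \<rho> = \<lparr>rdim = n, ract = (\<lambda>g. mt n n (\<rho> g))\<rparr>"

lemma rdim_mkrep [simp]: "rdim (mkrep n \<rho>) = n"
  by (simp add: mkrep_def)

lemma act_mkrep: "block n n (\<rho> g) \<Longrightarrow> act (mkrep n \<rho>) g = \<rho> g"
  by (simp add: act_def mkrep_def fm_mt)

lemma rdim_tensor [simp]: "rdim (tensor V W) = rdim V * rdim W"
  by (simp add: tensor_def)

locale fin_group = group G for G (structure) +
  assumes fin: "finite (carrier G)"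
begin

abbreviation modl :: "('a, 'f::field) rep \<Rightarrow> bool" where "modl \<equiv> is_module G"

lemma act_block [simp]: "modl V \<Longrightarrow> g \<in> carrier G \<Longrightarrow> block (rdim V) (rdim V) (act V g)"
  unfolding is_module_def act_def by (intro block_fm) blast

lemma act_one [simp]: "modl V \<Longrightarrow> act V \<one> = idm (rdim V)"
  by (simp add: is_module_def act_def)

lemma act_mult: "modl V \<Longrightarrow> g \<in> carrier G \<Longrightarrow> h \<in> carrier G \<Longrightarrow> act V (g \<otimes> h) = act V g * act V h"
  unfolding is_module_def act_def
  using fm_times[of "ract V g" "rdim V" "rdim V" "ract V h" "rdim V"] by simp

lemma modl_mkrep:
  assumes "\<And>g. g \<in> carrier G \<Longrightarrow> block n n (\<rho> g)" "\<rho> \<one> = idm n"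
    and "\<And>g h. g \<in> carrier G \<Longrightarrow> h \<in> carrier G \<Longrightarrow> \<rho> (g \<otimes> h) = \<rho> g * \<rho> h"
  shows "modl (mkrep n \<rho>)"
  unfolding is_module_def
proof (intro conjI ballI)
  fix g h assume gh: "g \<in> carrier G" "h \<in> carrier G"
  show "ract (mkrep n \<rho>) (g \<otimes> h) = ract (mkrep n \<rho>) g * ract (mkrep n \<rho>) h"
  proof (rule fm_inj[of _ n n])
    show "fm (ract (mkrep n \<rho>) (g \<otimes> h)) = fm (ract (mkrep n \<rho>) g * ract (mkrep n \<rho>) h)"
      unfolding mkrep_def rep.simps fm_times[OF mt_carrier mt_carrier] assms(3)[OF gh]
      using assms(1)[OF gh(1)] assms(1)[OF gh(2)] by (simp add: fm_mt block_times[of n n _ n n])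
  qed (auto simp: mkrep_def intro: mult_carrier_mat[OF mt_carrier mt_carrier])
next
  show "ract (mkrep n \<rho>) \<one> = 1\<^sub>m (rdim (mkrep n \<rho>))"
    using assms(2) mt_fm[OF one_carrier_mat, of n] by (simp add: mkrep_def)
qed (simp_all add: mkrep_def)

section \<open>Homomorphisms and the transfer\<close>

definition ghom :: "('a, 'f::field) rep \<Rightarrow> ('a, 'f) rep \<Rightarrow> 'f fmat \<Rightarrow> bool" where
  "ghom V W A \<longleftrightarrow> block (rdim W) (rdim V) A \<and> (\<forall>g\<in>carrier G. A * act V g = act W g * A)"

lemma ghom_block [simp]: "ghom V W A \<Longrightarrow> block (rdim W) (rdim V) A"
  by (simp add: ghom_def)

lemma ghom_act: "ghom V W A \<Longrightarrow> g \<in> carrier G \<Longrightarrow> A * act V g = act W g * A"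
  by (simp add: ghom_def)

lemma ghom_comp: "ghom W X B \<Longrightarrow> ghom V W A \<Longrightarrow> ghom V X (B * A)"
  unfolding ghom_def by (auto intro: block_times simp: mult.assoc) (simp add: mult.assoc[symmetric])

lemma ghom_id: "modl V \<Longrightarrow> ghom V V (idm (rdim V))"
  unfolding ghom_def by (metis act_block block_idm idm_times times_idm)

lemma ghom_idm_left: "ghom V W A \<Longrightarrow> idm (rdim W) * A = A"
  and ghom_idm_right: "ghom V W A \<Longrightarrow> A * idm (rdim V) = A"
  by (rule idm_times times_idm, erule ghom_block)+

lemma ghom_add: "ghom V W A \<Longrightarrow> ghom V W B \<Longrightarrow> ghom V W (A + B)"
  and ghom_diff: "ghom V W A \<Longrightarrow> ghom V W B \<Longrightarrow> ghom V W (A - B)"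
  and ghom_uminus: "ghom V W A \<Longrightarrow> ghom V W (- A)"
  and ghom_zero: "ghom V W 0"
  and ghom_scale: "ghom V W A \<Longrightarrow> ghom V W (c \<cdot> A)"
  unfolding ghom_def by (simp_all add: distrib_left distrib_right left_diff_distrib right_diff_distrib)

lemma sum_translate: 
  assumes "h \<in> carrier G"
  shows "(\<Sum>g\<in>carrier G. F (h \<otimes> g)) = (\<Sum>g\<in>carrier G. F g)"
  by (rule sum.reindex_bij_witness[of _ "\<lambda>g. inv h \<otimes> g" "\<lambda>g. h \<otimes> g"])
    (use assms in \<open>auto simp: m_assoc[symmetric]\<close>)

text \<open>The trace map from the trivial subgroup: the sum of all conjugates of a linear
  map.\<close>

definition transfer :: "('a, 'f::field) rep \<Rightarrow> ('a, 'f) rep \<Rightarrow> 'f fmat \<Rightarrow> 'f fmat" where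
  "transfer V W T = (\<Sum>g\<in>carrier G. act W g * T * act V (inv g))"

lemma act_inv [simp]: "modl V \<Longrightarrow> g \<in> carrier G \<Longrightarrow> act V g * act V (inv g) = idm (rdim V)"
  "modl V \<Longrightarrow> g \<in> carrier G \<Longrightarrow> act V (inv g) * act V g = idm (rdim V)"
  by (simp_all add: act_mult[symmetric])

lemma ghom_transfer:
  assumes V: "modl V" and W: "modl W" and T: "block (rdim W) (rdim V) T"
  shows "ghom V W (transfer V W T)"
  unfolding ghom_def
proof (intro conjI ballI)
  show "block (rdim W) (rdim V) (transfer V W T)"
    unfolding transfer_def
  proof (rule block_sum)
    fix g assume "g \<in> carrier G"
    then show "block (rdim W) (rdim V) (act W g * T * act V (inv g))"
      using assms by (intro block_times[of _ "rdim V" _ "rdim V"] block_times[of _ "rdim W" _ "rdim W"]) auto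
  qed
  fix h assume h: "h \<in> carrier G"
  have "act W h * transfer V W T = (\<Sum>g\<in>carrier G. act W (h \<otimes> g) * T * act V (inv g))"
    unfolding transfer_def sum_distrib_left
    by (rule sum.cong) (use h in \<open>auto simp: act_mult[OF W] mult.assoc\<close>)
  \<comment> \<open>Writing inv g as inv (h g) h turns the summand into a function of h g, ready for
    translation by h.\<close>
  also have "\<dots> = (\<Sum>g\<in>carrier G. act W (h \<otimes> g) * T * act V (inv (h \<otimes> g) \<otimes> h))"
    by (rule sum.cong) (use h in \<open>auto simp: inv_mult_group m_assoc\<close>)
  also have "\<dots> = (\<Sum>g\<in>carrier G. act W g * T * act V (inv g \<otimes> h))"
    by (rule sum_translate[OF h])
  also have "\<dots> = transfer V W T * act V h"
    unfolding transfer_def sum_distrib_right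
    by (rule sum.cong) (use h in \<open>auto simp: act_mult[OF V] mult.assoc\<close>)
  finally show "transfer V W T * act V h = act W h * transfer V W T" by simp
qed

text \<open>Homomorphisms slide past the group action, here from the left and below from the right;
  so transfers form a two-sided ideal of maps.\<close>

lemma ghom_times_transfer: "ghom W X B \<Longrightarrow> B * transfer V W T = transfer V X (B * T)"
  unfolding transfer_def sum_distrib_left
  by (rule sum.cong) (auto simp: mult.assoc[symmetric] ghom_act)

lemma transfer_times_ghom: "ghom V W A \<Longrightarrow> transfer W X T * A = transfer V X (T * A)"
  unfolding transfer_def sum_distrib_right
  by (rule sum.cong) (auto simp: mult.assoc ghom_act)

text \<open>By D. Higman's criterion these are the homomorphisms that factor through a projective module.\<close>

definition stably_zero :: "('a, 'f::field) rep \<Rightarrow> ('a, 'f) rep \<Rightarrow> 'f fmat \<Rightarrow> bool" where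
  "stably_zero V W A \<longleftrightarrow> (\<exists>T. block (rdim W) (rdim V) T \<and> A = transfer V W T)"

lemma stably_zero_left: "ghom W X B \<Longrightarrow> stably_zero V W A \<Longrightarrow> stably_zero V X (B * A)"
  unfolding stably_zero_def using block_times[OF ghom_block] ghom_times_transfer by metis

lemma stably_zero_right: "stably_zero W X B \<Longrightarrow> ghom V W A \<Longrightarrow> stably_zero V X (B * A)"
  unfolding stably_zero_def using block_times[OF _ ghom_block] transfer_times_ghom by metis

lemma transfer_add: "transfer V W (S + T) = transfer V W S + transfer V W T"
  and transfer_scale: "transfer V W (c \<cdot> T) = c \<cdot> transfer V W T"
  and transfer_zero [simp]: "transfer V W 0 = 0"
  by (simp_all add: transfer_def algebra_simps sum.distrib scale_sum)

lemma stably_zero_add: "stably_zero V W A \<Longrightarrow> stably_zero V W B \<Longrightarrow> stably_zero V W (A + B)"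
  unfolding stably_zero_def by (metis transfer_add block_intros(2))

lemma stably_zero_scale: "stably_zero V W A \<Longrightarrow> stably_zero V W (c \<cdot> A)"
  unfolding stably_zero_def by (metis transfer_scale block_intros(5))

lemma stably_zero_zero [simp]: "stably_zero V W 0"
  unfolding stably_zero_def by (intro exI[of _ 0]) auto

lemma stably_zero_uminus: "stably_zero V W A \<Longrightarrow> stably_zero V W (- A)"
  using stably_zero_scale[of V W A "-1"] by simp

lemma stably_zero_diff: "stably_zero V W A \<Longrightarrow> stably_zero V W B \<Longrightarrow> stably_zero V W (A - B)"
  using stably_zero_add[of V W A "- B"] stably_zero_uminus[of V W B] by simp

lemma stably_zero_minus_commute: "stably_zero V W (A - B) \<Longrightarrow> stably_zero V W (B - A)"
  using stably_zero_uminus[of V W "A - B"] by simp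

text \<open>Projectivity by Higman's criterion, the identity being a transfer;
  \<open>projective_iff_proj\<close> identifies it with the lifting property.\<close>

definition proj :: "('a, 'f::field) rep \<Rightarrow> bool" where
  "proj V \<longleftrightarrow> modl V \<and> stably_zero V V (idm (rdim V))"

lemma proj_stably_zero_from: "proj V \<Longrightarrow> ghom V W A \<Longrightarrow> stably_zero V W A"
  unfolding proj_def using stably_zero_left[of V W A V "idm (rdim V)"] by (auto simp: ghom_idm_right)

lemma proj_stably_zero_to: "proj W \<Longrightarrow> ghom V W A \<Longrightarrow> stably_zero V W A"
  unfolding proj_def using stably_zero_right[of W W "idm (rdim W)" V A] by (auto simp: ghom_idm_left)

section \<open>Isomorphisms and biproducts modulo stably zero maps\<close>

definition stab_iso :: "('a, 'f::field) rep \<Rightarrow> ('a, 'f) rep \<Rightarrow> bool" where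
  "stab_iso V W \<longleftrightarrow> modl V \<and> modl W \<and> (\<exists>f g. ghom V W f \<and> ghom W V g \<and>
     stably_zero V V (g * f - idm (rdim V)) \<and> stably_zero W W (f * g - idm (rdim W)))"

lemma stab_isoI:
  "modl V \<Longrightarrow> modl W \<Longrightarrow> ghom V W f \<Longrightarrow> ghom W V g \<Longrightarrow> stably_zero V V (g * f - idm (rdim V)) \<Longrightarrow>
   stably_zero W W (f * g - idm (rdim W)) \<Longrightarrow> stab_iso V W"
  unfolding stab_iso_def by blast

lemma stab_iso_modl: "stab_iso V W \<Longrightarrow> modl V" "stab_iso V W \<Longrightarrow> modl W"
  by (simp_all add: stab_iso_def)

lemma stab_iso_refl: "modl V \<Longrightarrow> stab_iso V V"
  by (rule stab_isoI[where f = "idm (rdim V)" and g = "idm (rdim V)"]) (simp_all add: ghom_id)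

lemma stab_iso_sym: "stab_iso V W \<Longrightarrow> stab_iso W V"
  unfolding stab_iso_def by blast

lemma stab_iso_trans [trans]:
  assumes "stab_iso U V" "stab_iso V W" shows "stab_iso U W"
proof -
  obtain f g where f: "ghom U V f" "ghom V U g" "stably_zero U U (g * f - idm (rdim U))"
      "stably_zero V V (f * g - idm (rdim V))"
    using assms(1) by (auto simp: stab_iso_def)
  obtain f' g' where f': "ghom V W f'" "ghom W V g'" "stably_zero V V (g' * f' - idm (rdim V))"
      "stably_zero W W (f' * g' - idm (rdim W))"
    using assms(2) by (auto simp: stab_iso_def)
  have id: "idm (rdim V) * f = f" "f' * idm (rdim V) = f'" "g * idm (rdim V) = g" "idm (rdim V) * g' = g'"
    using f f' by (blast intro: ghom_idm_left ghom_idm_right)+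
  show ?thesis
  proof (rule stab_isoI)
    have "stably_zero U U (g * (g' * f' - idm (rdim V)) * f + (g * f - idm (rdim U)))"
      by (intro stably_zero_add stably_zero_right[OF stably_zero_left[OF f(2) f'(3)] f(1)] f(3))
    then show "stably_zero U U ((g * g') * (f' * f) - idm (rdim U))"
      by (simp add: algebra_simps id)
    have "stably_zero W W (f' * (f * g - idm (rdim V)) * g' + (f' * g' - idm (rdim W)))"
      by (intro stably_zero_add stably_zero_right[OF stably_zero_left[OF f'(1) f(4)] f'(2)] f'(4))
    then show "stably_zero W W ((f' * f) * (g * g') - idm (rdim W))"
      by (simp add: algebra_simps id)
  qed (use assms f f' in \<open>auto simp: stab_iso_modl intro: ghom_comp\<close>)
qed

lemma stab_iso_proj: "proj V \<Longrightarrow> proj W \<Longrightarrow> stab_iso V W"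
  by (rule stab_isoI[of V W 0 0]) (auto simp: proj_def ghom_zero stably_zero_uminus)

text \<open>The biproduct equations of the stable category. Being equations between maps, they
  survive tensoring and the passage to syzygies.\<close>

definition stab_biprod_by where
  "stab_biprod_by X A B i p j q \<longleftrightarrow> modl X \<and> modl A \<and> modl B \<and>
     ghom A X i \<and> ghom X A p \<and> ghom B X j \<and> ghom X B q \<and>
     stably_zero A A (p * i - idm (rdim A)) \<and> stably_zero B B (q * j - idm (rdim B)) \<and>
     stably_zero A B (q * i) \<and> stably_zero B A (p * j) \<and> stably_zero X X (i * p + j * q - idm (rdim X))"

definition stab_biprod :: "('a, 'f::field) rep \<Rightarrow> ('a, 'f) rep \<Rightarrow> ('a, 'f) rep \<Rightarrow> bool" where
  "stab_biprod X A B \<longleftrightarrow> (\<exists>i p j q. stab_biprod_by X A B i p j q)"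

lemma stab_biprod_modl: "stab_biprod X A B \<Longrightarrow> modl X" "stab_biprod X A B \<Longrightarrow> modl A" "stab_biprod X A B \<Longrightarrow> modl B"
  by (auto simp: stab_biprod_def stab_biprod_by_def)

lemma stab_biprod_commute: "stab_biprod X A B \<Longrightarrow> stab_biprod X B A"
  unfolding stab_biprod_def stab_biprod_by_def by (metis add.commute)

text \<open>The comparison maps run through the common summands. In a composite the inner terms p'
  i' and q' j' become identities and the mixed ones vanish, which leaves i p + j q.\<close>

lemma stab_biprod_unique:
  assumes "stab_biprod X A B" "stab_biprod Y A B" shows "stab_iso X Y"
proof -
  obtain i p j q where 1: "stab_biprod_by X A B i p j q" using assms(1) by (auto simp: stab_biprod_def)
  obtain i' p' j' q' where 2: "stab_biprod_by Y A B i' p' j' q'" using assms(2) by (auto simp: stab_biprod_def)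
  have *: "stably_zero X X ((i * p' + j * q') * (i' * p + j' * q) - idm (rdim X))"
    if 1: "stab_biprod_by X A B i p j q" and 2: "stab_biprod_by Y A B i' p' j' q'" for X Y i p j q i' p' j' q'
  proof -
    note h = 1[unfolded stab_biprod_by_def] 2[unfolded stab_biprod_by_def]
    have id: "i * idm (rdim A) = i" "j * idm (rdim B) = j" "idm (rdim A) * p = p" "idm (rdim B) * q = q"
      using h by (blast intro: ghom_idm_left ghom_idm_right)+
    have "stably_zero X X (i * (p' * i' - idm (rdim A)) * p + j * (q' * j' - idm (rdim B)) * q
        + i * (p' * j') * q + j * (q' * i') * p + (i * p + j * q - idm (rdim X)))"
      using h by (intro stably_zero_add) (blast intro: stably_zero_left stably_zero_right ghom_comp)+
    then show ?thesis by (simp add: algebra_simps id)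
  qed
  show ?thesis
    by (rule stab_isoI[OF _ _ _ _ *[OF 1 2] *[OF 2 1]])
      (use 1 2 in \<open>auto simp: stab_biprod_by_def intro!: ghom_add intro: ghom_comp\<close>)
qed

lemma stab_biprod_cong1:
  assumes "stab_biprod X A B" "stab_iso A A'" shows "stab_biprod X A' B"
proof -
  obtain i p j q where 1: "stab_biprod_by X A B i p j q" using assms(1) by (auto simp: stab_biprod_def)
  note h = 1[unfolded stab_biprod_by_def]
  obtain f g where f: "ghom A A' f" "ghom A' A g" "stably_zero A A (g * f - idm (rdim A))"
      "stably_zero A' A' (f * g - idm (rdim A'))" "modl A'"
    using assms(2) by (auto simp: stab_iso_def)
  have id: "f * idm (rdim A) = f" "idm (rdim A) * g = g" "g * idm (rdim A') = g" "idm (rdim A) * p = p"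
    "i * idm (rdim A) = i"
    using f h by (blast intro: ghom_idm_left ghom_idm_right)+
  have "stably_zero A' A' (f * (p * i - idm (rdim A)) * g + (f * g - idm (rdim A')))"
    using h f by (intro stably_zero_add) (blast intro: stably_zero_left stably_zero_right ghom_comp)+
  then have 2: "stably_zero A' A' ((f * p) * (i * g) - idm (rdim A'))"
    by (simp add: algebra_simps id)
  have "stably_zero X X (i * (g * f - idm (rdim A)) * p + (i * p + j * q - idm (rdim X)))"
    using h f by (intro stably_zero_add) (blast intro: stably_zero_left stably_zero_right ghom_comp)+
  then have 3: "stably_zero X X ((i * g) * (f * p) + j * q - idm (rdim X))"
    by (simp add: algebra_simps id)
  have "stably_zero A' B (q * (i * g))" "stably_zero B A' (f * p * j)"
    using h f stably_zero_right[of A B "q * i" A' g] stably_zero_left[of A A' f B "p * j"] by (simp_all add: mult.assoc)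
  then have "stab_biprod_by X A' B (i * g) (f * p) j q"
    unfolding stab_biprod_by_def using 2 3 h f by (auto intro: ghom_comp)
  then show ?thesis by (auto simp: stab_biprod_def)
qed

lemma stab_biprod_cong: "stab_biprod X A B \<Longrightarrow> stab_iso A A' \<Longrightarrow> stab_iso B B' \<Longrightarrow> stab_biprod X A' B'"
  using stab_biprod_cong1 stab_biprod_commute by metis

lemma stab_biprod_stab_iso:
  assumes "stab_biprod X A B" "stab_iso X Y" shows "stab_biprod Y A B"
proof -
  obtain i p j q where 1: "stab_biprod_by X A B i p j q" using assms(1) by (auto simp: stab_biprod_def)
  note h = 1[unfolded stab_biprod_by_def]
  obtain f g where f: "ghom X Y f" "ghom Y X g" "stably_zero X X (g * f - idm (rdim X))"
      "stably_zero Y Y (f * g - idm (rdim Y))" "modl Y"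
    using assms(2) by (auto simp: stab_iso_def)
  have id: "p * idm (rdim X) = p" "q * idm (rdim X) = q" "idm (rdim X) * i = i" "idm (rdim X) * j = j"
    "f * idm (rdim X) = f" "idm (rdim X) * g = g"
    using f h by (blast intro: ghom_idm_left ghom_idm_right)+
  have "stably_zero A A (p * (g * f - idm (rdim X)) * i + (p * i - idm (rdim A)))"
    "stably_zero B B (q * (g * f - idm (rdim X)) * j + (q * j - idm (rdim B)))"
    "stably_zero A B (q * (g * f - idm (rdim X)) * i + q * i)"
    "stably_zero B A (p * (g * f - idm (rdim X)) * j + p * j)"
    "stably_zero Y Y (f * (i * p + j * q - idm (rdim X)) * g + (f * g - idm (rdim Y)))"
    using h f by (intro stably_zero_add; blast intro: stably_zero_left stably_zero_right ghom_comp)+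
  then have "stab_biprod_by Y A B (f * i) (p * g) (f * j) (q * g)"
    unfolding stab_biprod_by_def using h f by (auto intro: ghom_comp simp: algebra_simps id)
  then show ?thesis by (auto simp: stab_biprod_def)
qed

lemma stab_biprod_stab_isoI: "stab_biprod X A B \<Longrightarrow> stab_biprod Y A' B' \<Longrightarrow> stab_iso A A' \<Longrightarrow> stab_iso B B' \<Longrightarrow> stab_iso X Y"
  using stab_biprod_unique stab_biprod_cong by metis

lemma stab_biprod_proj: "stab_biprod X A B \<Longrightarrow> proj B \<Longrightarrow> stab_iso X A"
proof -
  assume *: "stab_biprod X A B" "proj B"
  obtain i p j q where "stab_biprod_by X A B i p j q" using *(1) by (auto simp: stab_biprod_def)
  note h = this[unfolded stab_biprod_by_def]
  have "stably_zero X X (j * q)" using h * by (metis stably_zero_left proj_stably_zero_to)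
  then have "stably_zero X X (i * p + j * q - idm (rdim X) - j * q)" using h stably_zero_diff by blast
  then show "stab_iso X A"
    using h by (intro stab_isoI[of X A p i]) auto
qed

lemma stab_biprod_projs: "stab_biprod X A B \<Longrightarrow> proj A \<Longrightarrow> proj B \<Longrightarrow> proj X"
proof -
  assume *: "stab_biprod X A B" "proj A" "proj B"
  obtain i p j q where "stab_biprod_by X A B i p j q" using *(1) by (auto simp: stab_biprod_def)
  note h = this[unfolded stab_biprod_by_def]
  have "stably_zero X X (j * q)" "stably_zero X X (i * p)" using h * by (metis stably_zero_left proj_stably_zero_to)+
  then have "stably_zero X X (i * p + j * q - (i * p + j * q - idm (rdim X)))" using h stably_zero_diff stably_zero_add by blast
  then show "proj X" using h by (simp add: proj_def)
qed

lemma stab_iso_stab_biprod: "stab_iso X A \<Longrightarrow> proj B \<Longrightarrow> stab_biprod X A B"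
proof -
  assume *: "stab_iso X A" "proj B"
  then obtain f g where f: "ghom X A f" "ghom A X g" "stably_zero X X (g * f - idm (rdim X))"
      "stably_zero A A (f * g - idm (rdim A))"
    by (auto simp: stab_iso_def)
  have "stab_biprod_by X A B g f 0 0"
    unfolding stab_biprod_by_def using * f by (auto simp: proj_def stab_iso_modl ghom_zero stably_zero_uminus)
  then show ?thesis by (auto simp: stab_biprod_def)
qed

text \<open>Regroups A + (B + C) as (A + B) + C, where \<open>Z\<close> is any model of A + B:
  inside \<open>X\<close> the summand A is reached directly and B by way of
  \<open>Y\<close>.\<close>

lemma stab_biprod_assoc:
  assumes "stab_biprod X A Y" "stab_biprod Y B C" "stab_biprod Z A B" shows "stab_biprod X Z C"
proof -
  obtain i p j q where "stab_biprod_by X A Y i p j q" using assms(1) by (auto simp: stab_biprod_def)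
  note 1 = this[unfolded stab_biprod_by_def]
  obtain i' p' j' q' where "stab_biprod_by Y B C i' p' j' q'" using assms(2) by (auto simp: stab_biprod_def)
  note 2 = this[unfolded stab_biprod_by_def]
  obtain i'' p'' j'' q'' where "stab_biprod_by Z A B i'' p'' j'' q''" using assms(3) by (auto simp: stab_biprod_def)
  note 3 = this[unfolded stab_biprod_by_def]
  have id: "i'' * idm (rdim A) = i''" "idm (rdim A) * p'' = p''" "idm (rdim Y) * i' = i'"
    "p' * idm (rdim Y) = p'" "idm (rdim Y) * j' = j'" "q' * idm (rdim Y) = q'" "j'' * idm (rdim B) = j''"
    "idm (rdim B) * q'' = q''" "j * idm (rdim Y) = j" "idm (rdim Y) * q = q"
    "i * idm (rdim A) = i" "idm (rdim A) * p = p" "idm (rdim B) * p' = p'" "i' * idm (rdim B) = i'"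
    using 1 2 3 by (blast intro: ghom_idm_left ghom_idm_right)+
  define I where "I = i * p'' + j * i' * q''"
  define P where "P = i'' * p + j'' * p' * q"
  define J where "J = j * j'"
  define Q where "Q = q' * q"
  have h: "ghom Z X I" "ghom X Z P" "ghom C X J" "ghom X C Q"
    unfolding I_def P_def J_def Q_def using 1 2 3 by (auto intro!: ghom_add intro: ghom_comp)
  have "stably_zero Z Z (i'' * (p * i - idm (rdim A)) * p'' + i'' * (p * j) * (i' * q'')
     + (j'' * p') * (q * i) * p'' + (j'' * p') * (q * j - idm (rdim Y)) * (i' * q'')
     + j'' * (p' * i' - idm (rdim B)) * q'' + (i'' * p'' + j'' * q'' - idm (rdim Z)))"
    using 1 2 3 by (intro stably_zero_add; blast intro: stably_zero_left stably_zero_right ghom_comp)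
  then have a: "stably_zero Z Z (P * I - idm (rdim Z))"
    unfolding P_def I_def by (simp add: algebra_simps id)
  have "stably_zero C C (q' * (q * j - idm (rdim Y)) * j' + (q' * j' - idm (rdim C)))"
    using 1 2 3 by (intro stably_zero_add; blast intro: stably_zero_left stably_zero_right ghom_comp)
  then have b: "stably_zero C C (Q * J - idm (rdim C))"
    unfolding Q_def J_def by (simp add: algebra_simps id)
  have "stably_zero Z C (q' * (q * i) * p'' + q' * (q * j - idm (rdim Y)) * (i' * q'') + (q' * i') * q'')"
    using 1 2 3 by (intro stably_zero_add; blast intro: stably_zero_left stably_zero_right ghom_comp)
  then have c: "stably_zero Z C (Q * I)"
    unfolding Q_def I_def by (simp add: algebra_simps id)
  have "stably_zero C Z (i'' * (p * j) * j' + (j'' * p') * (q * j - idm (rdim Y)) * j' + j'' * (p' * j'))"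
    using 1 2 3 by (intro stably_zero_add; blast intro: stably_zero_left stably_zero_right ghom_comp)
  then have d: "stably_zero C Z (P * J)"
    unfolding P_def J_def by (simp add: algebra_simps id)
  have "stably_zero X X (i * (p'' * i'' - idm (rdim A)) * p + i * (p'' * j'') * (p' * q)
     + (j * i') * (q'' * i'') * p + (j * i') * (q'' * j'' - idm (rdim B)) * (p' * q)
     + j * (i' * p' + j' * q' - idm (rdim Y)) * q + (i * p + j * q - idm (rdim X)))"
    using 1 2 3 by (intro stably_zero_add; blast intro: stably_zero_left stably_zero_right ghom_comp)
  then have e: "stably_zero X X (I * P + J * Q - idm (rdim X))"
    unfolding P_def I_def Q_def J_def by (simp add: algebra_simps id)
  have "stab_biprod_by X Z C I P J Q"
    unfolding stab_biprod_by_def using a b c d e h 1 2 3 by blast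
  then show ?thesis by (auto simp: stab_biprod_def)
qed

end

context fin_group begin

section \<open>Tensor products modulo projectives\<close>

lemma act_tensor:
  assumes "modl V" "modl W" "g \<in> carrier G"
  shows "act (tensor V W) g = tens (rdim W) (rdim W) (act V g) (act W g)"
proof -
  have "ract W g \<in> carrier_mat (rdim W) (rdim W)"
    using assms by (auto simp: is_module_def)
  then show ?thesis
    by (simp add: act_def tensor_def fm_kronecker)
qed

lemma modl_tensor:
  assumes V: "modl V" and W: "modl W" shows "modl (tensor V W)"
  unfolding is_module_def
proof (intro conjI ballI)
  have c: "ract V g \<in> carrier_mat (rdim V) (rdim V)" "ract W g \<in> carrier_mat (rdim W) (rdim W)"
    if "g \<in> carrier G" for g
    using assms that by (auto simp: is_module_def)
  have c': "kronecker (ract V g) (ract W g) \<in> carrier_mat (rdim V * rdim W) (rdim V * rdim W)"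
    if "g \<in> carrier G" for g
    using c[OF that] by (auto simp: kronecker_def)
  fix g assume g: "g \<in> carrier G"
  show "ract (tensor V W) g \<in> carrier_mat (rdim (tensor V W)) (rdim (tensor V W))"
    using c'[OF g] by (simp add: tensor_def)
  fix h assume h: "h \<in> carrier G"
  show "ract (tensor V W) (g \<otimes> h) = ract (tensor V W) g * ract (tensor V W) h"
  proof (rule fm_inj)
    show "ract (tensor V W) (g \<otimes> h) \<in> carrier_mat (rdim V * rdim W) (rdim V * rdim W)"
      "ract (tensor V W) g * ract (tensor V W) h \<in> carrier_mat (rdim V * rdim W) (rdim V * rdim W)"
      using c' g h by (auto simp: tensor_def intro!: mult_carrier_mat)
    have "fm (ract (tensor V W) (g \<otimes> h)) = act (tensor V W) (g \<otimes> h)"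
      by (simp add: act_def)
    also have "\<dots> = act (tensor V W) g * act (tensor V W) h"
      using g h assms by (simp add: act_tensor act_mult tens_times[where c = "rdim W" and d' = "rdim W"])
    also have "\<dots> = fm (ract (tensor V W) g * ract (tensor V W) h)"
      using c'[OF g] c'[OF h] by (simp add: act_def tensor_def fm_times)
    finally show "fm (ract (tensor V W) (g \<otimes> h)) = fm (ract (tensor V W) g * ract (tensor V W) h)" .
  qed
next
  have "fm (ract (tensor V W) \<one>) = idm (rdim V * rdim W)"
    using act_tensor[OF assms one_closed] assms by (simp add: act_def[of "tensor V W"])
  moreover have "ract (tensor V W) \<one> \<in> carrier_mat (rdim V * rdim W) (rdim V * rdim W)"
    using assms one_closed unfolding is_module_def tensor_def kronecker_def by auto
  ultimately show "ract (tensor V W) \<one> = 1\<^sub>m (rdim (tensor V W))"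
    by (metis fm_inj fm_one one_carrier_mat rdim_tensor)
qed

lemma ghom_tensor:
  assumes "modl V" "modl V'" "modl W" "modl W'" "ghom V V' A" "ghom W W' B"
  shows "ghom (tensor V W) (tensor V' W') (tens (rdim W') (rdim W) A B)"
  unfolding ghom_def
proof (intro conjI ballI)
  show "block (rdim (tensor V' W')) (rdim (tensor V W)) (tens (rdim W') (rdim W) A B)"
    using assms by (simp add: block_tens)
  fix g assume g: "g \<in> carrier G"
  show "tens (rdim W') (rdim W) A B * act (tensor V W) g = act (tensor V' W') g * tens (rdim W') (rdim W) A B"
    using assms g ghom_block[OF assms(6)] act_block[OF assms(4) g]
    by (simp add: act_tensor tens_times[where r' = "rdim W'" and c = "rdim W"]
        tens_times[where r' = "rdim W'" and c = "rdim W'"] ghom_act)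
qed

lemma tens_comp:
  assumes "ghom W W' B" "ghom W' W'' B'"
  shows "tens (rdim W'') (rdim W') A' B' * tens (rdim W') (rdim W) A B = tens (rdim W'') (rdim W) (A' * A) (B' * B)"
  by (rule tens_times[of "rdim W''"]) (use assms in auto)

text \<open>A homomorphism B equals g B g^-1, so it can be conjugated together with T in every
  summand of a transfer; the tensor product of the two maps is the transfer of T \<otimes>
  B.\<close>

lemma stably_zero_tensor_left:
  assumes "modl V" "modl V'" "modl W" "modl W'" "stably_zero V V' A" "ghom W W' B"
  shows "stably_zero (tensor V W) (tensor V' W') (tens (rdim W') (rdim W) A B)"
proof -
  obtain T where T: "block (rdim V') (rdim V) T" "A = transfer V V' T"
    using assms by (auto simp: stably_zero_def)
  have "tens (rdim W') (rdim W) A B = (\<Sum>g\<in>carrier G. tens (rdim W') (rdim W) (act V' g * T * act V (inv g)) B)"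
    by (simp add: T transfer_def tens_sum_left)
  also have "\<dots> = (\<Sum>g\<in>carrier G. act (tensor V' W') g * tens (rdim W') (rdim W) T B * act (tensor V W) (inv g))"
  proof (rule sum.cong[OF refl])
    fix g assume g: "g \<in> carrier G"
    have B: "B = act W' g * B * act W (inv g)"
      using assms(3,6) g by (metis act_inv(1) ghom_act ghom_idm_right mult.assoc)
    have b: "block (rdim W') (rdim W) (act W' g * B)"
      using assms g by (blast intro: block_times ghom_block act_block)
    have "tens (rdim W') (rdim W) (act V' g * T * act V (inv g)) B
        = tens (rdim W') (rdim W) (act V' g * T * act V (inv g)) (act W' g * B * act W (inv g))"
      using B by simp
    also have "\<dots> = tens (rdim W') (rdim W') (act V' g) (act W' g) * tens (rdim W') (rdim W) T B
        * tens (rdim W) (rdim W) (act V (inv g)) (act W (inv g))"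
      using assms g b
      by (simp add: tens_times[where r' = "rdim W'" and c = "rdim W'"] tens_times[where r' = "rdim W'" and c = "rdim W"])
    finally show "tens (rdim W') (rdim W) (act V' g * T * act V (inv g)) B
        = act (tensor V' W') g * tens (rdim W') (rdim W) T B * act (tensor V W) (inv g)"
      using assms g by (simp add: act_tensor)
  qed
  also have "\<dots> = transfer (tensor V W) (tensor V' W') (tens (rdim W') (rdim W) T B)"
    by (simp add: transfer_def)
  finally show ?thesis
    unfolding stably_zero_def using assms T(1)
    by (intro exI[of _ "tens (rdim W') (rdim W) T B"]) (auto simp: block_tens)
qed

lemma stably_zero_tensor_right:
  assumes "modl V" "modl V'" "modl W" "modl W'" "ghom V V' A" "stably_zero W W' B"
  shows "stably_zero (tensor V W) (tensor V' W') (tens (rdim W') (rdim W) A B)"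
proof -
  obtain T where T: "block (rdim W') (rdim W) T" "B = transfer W W' T"
    using assms by (auto simp: stably_zero_def)
  have "tens (rdim W') (rdim W) A B = (\<Sum>g\<in>carrier G. tens (rdim W') (rdim W) A (act W' g * T * act W (inv g)))"
    by (simp add: T transfer_def tens_sum_right)
  also have "\<dots> = (\<Sum>g\<in>carrier G. act (tensor V' W') g * tens (rdim W') (rdim W) A T * act (tensor V W) (inv g))"
  proof (rule sum.cong[OF refl])
    fix g assume g: "g \<in> carrier G"
    have A: "A = act V' g * A * act V (inv g)"
      using assms(1,5) g by (metis act_inv(1) ghom_act ghom_idm_right mult.assoc)
    have b: "block (rdim W') (rdim W) (act W' g * T)"
      using assms g T(1) by (blast intro: block_times ghom_block act_block)
    have "tens (rdim W') (rdim W) A (act W' g * T * act W (inv g))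
        = tens (rdim W') (rdim W) (act V' g * A * act V (inv g)) (act W' g * T * act W (inv g))"
      using A by simp
    also have "\<dots> = tens (rdim W') (rdim W') (act V' g) (act W' g) * tens (rdim W') (rdim W) A T
        * tens (rdim W) (rdim W) (act V (inv g)) (act W (inv g))"
      using assms g b T(1)
      by (simp add: tens_times[where r' = "rdim W'" and c = "rdim W'"] tens_times[where r' = "rdim W'" and c = "rdim W"])
    finally show "tens (rdim W') (rdim W) A (act W' g * T * act W (inv g))
        = act (tensor V' W') g * tens (rdim W') (rdim W) A T * act (tensor V W) (inv g)"
      using assms g by (simp add: act_tensor)
  qed
  also have "\<dots> = transfer (tensor V W) (tensor V' W') (tens (rdim W') (rdim W) A T)"
    by (simp add: transfer_def)
  finally show ?thesis
    unfolding stably_zero_def using assms T(1)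
    by (intro exI[of _ "tens (rdim W') (rdim W) A T"]) (auto simp: block_tens)
qed

lemma proj_tensor_left: "proj P \<Longrightarrow> modl W \<Longrightarrow> proj (tensor P W)"
  unfolding proj_def using stably_zero_tensor_left[of P P W W "idm (rdim P)" "idm (rdim W)"]
  by (auto simp: modl_tensor ghom_id)

lemma proj_tensor_right: "modl W \<Longrightarrow> proj P \<Longrightarrow> proj (tensor W P)"
  unfolding proj_def using stably_zero_tensor_right[of W W P P "idm (rdim W)" "idm (rdim P)"]
  by (auto simp: modl_tensor ghom_id)

lemma stab_iso_tensor_right: 
  assumes "stab_iso V V'" "modl W" shows "stab_iso (tensor W V) (tensor W V')"
proof -
  obtain f g where f: "ghom V V' f" "ghom V' V g" "stably_zero V V (g * f - idm (rdim V))"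
      "stably_zero V' V' (f * g - idm (rdim V'))" "modl V" "modl V'"
    using assms(1) by (auto simp: stab_iso_def)
  let ?t = "\<lambda>a b. tens (rdim a) (rdim b) (idm (rdim W))"
  note c = tens_comp[OF f(1) f(2), of "idm (rdim W)" "idm (rdim W)"] tens_comp[OF f(2) f(1), of "idm (rdim W)" "idm (rdim W)"]
  have "stably_zero (tensor W V) (tensor W V) (?t V V (g * f - idm (rdim V)))"
    "stably_zero (tensor W V') (tensor W V') (?t V' V' (f * g - idm (rdim V')))"
    using f assms by (auto intro!: stably_zero_tensor_right ghom_id)
  then show ?thesis
    using f assms c
    by (intro stab_isoI[of _ _ "?t V' V f" "?t V V' g"])
      (auto intro!: modl_tensor ghom_tensor ghom_id simp: tens_diff_right)
qed

lemma stab_iso_tensor_left: 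
  assumes "stab_iso V V'" "modl W" shows "stab_iso (tensor V W) (tensor V' W)"
proof -
  obtain f g where f: "ghom V V' f" "ghom V' V g" "stably_zero V V (g * f - idm (rdim V))"
      "stably_zero V' V' (f * g - idm (rdim V'))" "modl V" "modl V'"
    using assms(1) by (auto simp: stab_iso_def)
  let ?t = "\<lambda>a. tens (rdim W) (rdim W) a (idm (rdim W))"
  note c = tens_comp[OF ghom_id[OF assms(2)] ghom_id[OF assms(2)]]
  have "stably_zero (tensor V W) (tensor V W) (?t (g * f - idm (rdim V)))"
    "stably_zero (tensor V' W) (tensor V' W) (?t (f * g - idm (rdim V')))"
    using f assms by (auto intro!: stably_zero_tensor_left ghom_id)
  then show ?thesis
    using f assms c
    by (intro stab_isoI[of _ _ "?t f" "?t g"])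
      (auto intro!: modl_tensor ghom_tensor ghom_id simp: tens_diff_left)
qed

lemma stab_iso_tensor: "stab_iso V V' \<Longrightarrow> stab_iso W W' \<Longrightarrow> stab_iso (tensor V W) (tensor V' W')"
  using stab_iso_tensor_left stab_iso_tensor_right stab_iso_trans stab_iso_modl by metis

lemma stab_biprod_tensor_right:
  fixes X :: "('a, 'k::field) rep"
  assumes "stab_biprod X A B" "modl W" shows "stab_biprod (tensor W X) (tensor W A) (tensor W B)"
proof -
  obtain i p j q where "stab_biprod_by X A B i p j q" using assms(1) by (auto simp: stab_biprod_def)
  note h = this[unfolded stab_biprod_by_def]
  let ?t = "\<lambda>a b. tens (rdim a) (rdim b) (idm (rdim W))"
  have c: "?t Y Z u * ?t Z Z' v = ?t Y Z' (u * v)" if "ghom Z Y u" "ghom Z' Z v" for Y Z Z' and u v :: "'k fmat"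
    using tens_comp[OF that(2,1), of "idm (rdim W)" "idm (rdim W)"] by simp
  have "stably_zero (tensor W A) (tensor W A) (?t A A (p * i - idm (rdim A)))"
    "stably_zero (tensor W B) (tensor W B) (?t B B (q * j - idm (rdim B)))"
    "stably_zero (tensor W A) (tensor W B) (?t B A (q * i))"
    "stably_zero (tensor W B) (tensor W A) (?t A B (p * j))"
    "stably_zero (tensor W X) (tensor W X) (?t X X (i * p + j * q - idm (rdim X)))"
    using h assms by (auto intro!: stably_zero_tensor_right ghom_id)
  moreover have "?t A X p * ?t X A i = ?t A A (p * i)" "?t B X q * ?t X B j = ?t B B (q * j)"
    "?t B X q * ?t X A i = ?t B A (q * i)" "?t A X p * ?t X B j = ?t A B (p * j)"
    "?t X A i * ?t A X p = ?t X X (i * p)" "?t X B j * ?t B X q = ?t X X (j * q)"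
    by (rule c; use h in blast)+
  ultimately have "stab_biprod_by (tensor W X) (tensor W A) (tensor W B) (?t X A i) (?t A X p) (?t X B j) (?t B X q)"
    unfolding stab_biprod_by_def using h assms
    by (auto intro!: modl_tensor ghom_tensor ghom_id simp: tens_diff_right tens_add_right)
  then show ?thesis by (auto simp: stab_biprod_def)
qed

lemma stab_biprod_tensor_left:
  fixes X :: "('a, 'k::field) rep"
  assumes "stab_biprod X A B" "modl W" shows "stab_biprod (tensor X W) (tensor A W) (tensor B W)"
proof -
  obtain i p j q where "stab_biprod_by X A B i p j q" using assms(1) by (auto simp: stab_biprod_def)
  note h = this[unfolded stab_biprod_by_def]
  let ?t = "\<lambda>a. tens (rdim W) (rdim W) a (idm (rdim W))"
  have c: "?t u * ?t v = ?t (u * v)" for u v :: "'k fmat"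
    using tens_comp[OF ghom_id[OF assms(2)] ghom_id[OF assms(2)], of u v] by simp
  have "stably_zero (tensor A W) (tensor A W) (?t (p * i - idm (rdim A)))"
    "stably_zero (tensor B W) (tensor B W) (?t (q * j - idm (rdim B)))"
    "stably_zero (tensor A W) (tensor B W) (?t (q * i))"
    "stably_zero (tensor B W) (tensor A W) (?t (p * j))"
    "stably_zero (tensor X W) (tensor X W) (?t (i * p + j * q - idm (rdim X)))"
    using h assms by (auto intro!: stably_zero_tensor_left ghom_id)
  then have "stab_biprod_by (tensor X W) (tensor A W) (tensor B W) (?t i) (?t p) (?t j) (?t q)"
    unfolding stab_biprod_by_def using h assms
    by (auto intro!: modl_tensor ghom_tensor ghom_id simp: tens_diff_left tens_add_left c)
  then show ?thesis by (auto simp: stab_biprod_def)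
qed

section \<open>Syzygies\<close>

text \<open>Short exact sequences with projective middle term, given together with linear splittings
  \<open>s\<close> and \<open>t\<close>.\<close>

definition syzygy_by where
  "syzygy_by V K P f k s t \<longleftrightarrow> modl V \<and> modl K \<and> proj P \<and> ghom P V f \<and> ghom K P k \<and>
     block (rdim P) (rdim V) s \<and> block (rdim K) (rdim P) t \<and>
     f * s = idm (rdim V) \<and> t * k = idm (rdim K) \<and> k * t + s * f = idm (rdim P) \<and> f * k = 0 \<and> t * s = 0"

definition syzygy :: "('a, 'f::field) rep \<Rightarrow> ('a, 'f) rep \<Rightarrow> bool" where
  "syzygy V K \<longleftrightarrow> (\<exists>P f k s t. syzygy_by V K P f k s t)"

text \<open>The section s gives a linear lift s \<psi>. Composed with a T whose transfer is the
  identity and summed over its conjugates it becomes equivariant, and it remains a lift because f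
  and \<psi> slide through the transfer.\<close>

lemma proj_lift:
  assumes "proj P" "modl P'" "ghom P' V f" "block (rdim P') (rdim V) s" "f * s = idm (rdim V)" "ghom P V \<psi>"
  obtains \<Phi> where "ghom P P' \<Phi>" "f * \<Phi> = \<psi>"
proof -
  obtain T where T: "block (rdim P) (rdim P) T" "idm (rdim P) = transfer P P T"
    using assms(1) by (auto simp: proj_def stably_zero_def)
  have b: "block (rdim P') (rdim P) (s * \<psi> * T)"
    using assms T by (blast intro: block_times ghom_block)
  have "f * transfer P P' (s * \<psi> * T) = transfer P V (f * s * \<psi> * T)"
    by (simp add: ghom_times_transfer[OF assms(3)] mult.assoc)
  also have "\<dots> = transfer P V (\<psi> * T)"
    using ghom_idm_left[OF assms(6)] by (simp add: assms(5))
  also have "\<dots> = \<psi>"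
    using ghom_times_transfer[OF assms(6), of P T] T(2) ghom_idm_right[OF assms(6)] by simp
  finally have "f * transfer P P' (s * \<psi> * T) = \<psi>" .
  moreover have "ghom P P' (transfer P P' (s * \<psi> * T))"
    using assms b by (intro ghom_transfer) (auto simp: proj_def)
  ultimately show ?thesis using that by blast
qed

text \<open>In k x g = k g x the injection k can be cancelled, since t inverts it from the
  left.\<close>

lemma ghom_cancel:
  assumes "ghom K P k" "t * k = idm (rdim K)" "modl K" "modl Z"
    and "block (rdim K) (rdim Z) x" "ghom Z P (k * x)"
  shows "ghom Z K x"
  unfolding ghom_def
proof (intro conjI ballI assms)
  fix g assume g: "g \<in> carrier G"
  have "k * (x * act Z g) = k * (act K g * x)"
    using ghom_act[OF assms(6) g] ghom_act[OF assms(1) g] by (simp add: mult.assoc[symmetric])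
  then have "t * k * (x * act Z g) = t * k * (act K g * x)"
    by (simp add: mult.assoc)
  moreover have "block (rdim K) (rdim Z) (x * act Z g)" "block (rdim K) (rdim Z) (act K g * x)"
    using assms g by (blast intro: block_times act_block)+
  ultimately show "x * act Z g = act K g * x"
    by (simp add: assms(2) idm_times)
qed

text \<open>\<phi>' is the map induced on kernels by a lift \<Phi> of \<phi> to the projective
  terms. It depends on the choice of \<Phi>, but by \<open>lft_stably_zero\<close> only up to a
  stably zero map.\<close>

definition syzygy_map where
  "syzygy_map P f k P' f' k' \<phi> \<phi>' \<longleftrightarrow> (\<exists>\<Phi>. ghom P P' \<Phi> \<and> f' * \<Phi> = \<phi> * f \<and> k' * \<phi>' = \<Phi> * k)"

lemma lft_ex:
  assumes "syzygy_by V K P f k s t" "syzygy_by V' K' P' f' k' s' t'" "ghom V V' \<phi>"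
  shows "\<exists>\<phi>'. ghom K K' \<phi>' \<and> syzygy_map P f k P' f' k' \<phi> \<phi>'"
proof -
  note 1 = assms(1)[unfolded syzygy_by_def] and 2 = assms(2)[unfolded syzygy_by_def]
  have P': "modl P'" using 2 by (simp add: proj_def)
  have "ghom P V' (\<phi> * f)" using 1 2 assms(3) by (blast intro: ghom_comp)
  then obtain \<Phi> where F: "ghom P P' \<Phi>" "f' * \<Phi> = \<phi> * f"
    using proj_lift[of P P' V' f' s' "\<phi> * f"] 1 2 P' by blast
  have Fk: "ghom K P' (\<Phi> * k)" using F 1 ghom_comp by blast
  \<comment> \<open>k' t' = 1 - s' f' is the identity on the kernel of f', where \<Phi> k takes its
    values; so t' \<Phi> k is the induced map.\<close>
  have "k' * (t' * \<Phi> * k) = (k' * t') * (\<Phi> * k)" by (simp add: mult.assoc)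
  also have "k' * t' = idm (rdim P') - s' * f'" using 2 by (simp add: eq_diff_eq)
  also have "(idm (rdim P') - s' * f') * (\<Phi> * k) = \<Phi> * k - s' * (f' * \<Phi>) * k"
    using ghom_idm_left[OF Fk] by (simp add: left_diff_distrib mult.assoc)
  also have "\<dots> = \<Phi> * k" using 1 by (simp add: F mult.assoc)
  finally have k: "k' * (t' * \<Phi> * k) = \<Phi> * k" .
  have "ghom K K' (t' * \<Phi> * k)"
  proof (rule ghom_cancel)
    show "ghom K' P' k'" "t' * k' = idm (rdim K')" "modl K'" "modl K" using 1 2 by auto
    show "block (rdim K') (rdim K) (t' * \<Phi> * k)"
      using 1 2 F by (intro block_times[of _ "rdim P" _ "rdim P"] block_times[of _ "rdim P'" _ "rdim P'"]) auto
    show "ghom K P' (k' * (t' * \<Phi> * k))" using Fk k by simp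
  qed
  then show ?thesis unfolding syzygy_map_def using F k by blast
qed

text \<open>If \<phi> is a transfer, it lifts to a map \<sigma> from V to P'. Then \<Phi> - \<sigma>
  f takes values in the kernel of f' and agrees with \<Phi> on the kernel of f; so \<phi>' extends
  to P and factors through a projective module.\<close>

lemma lft_stably_zero:
  assumes "syzygy_by V K P f k s t" "syzygy_by V' K' P' f' k' s' t'" "stably_zero V V' \<phi>" "ghom K K' \<phi>'"
    and "syzygy_map P f k P' f' k' \<phi> \<phi>'"
  shows "stably_zero K K' \<phi>'"
proof -
  note 1 = assms(1)[unfolded syzygy_by_def] and 2 = assms(2)[unfolded syzygy_by_def]
  have P: "modl P" "modl P'" using 1 2 by (auto simp: proj_def)
  obtain \<Phi> where F: "ghom P P' \<Phi>" "f' * \<Phi> = \<phi> * f" "k' * \<phi>' = \<Phi> * k"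
    using assms(5) by (auto simp: syzygy_map_def)
  obtain T where T: "block (rdim V') (rdim V) T" "\<phi> = transfer V V' T"
    using assms(3) by (auto simp: stably_zero_def)
  define \<sigma> where "\<sigma> = transfer V P' (s' * T)"
  have sT: "block (rdim P') (rdim V) (s' * T)" using 2 T by (auto intro: block_times)
  have s: "ghom V P' \<sigma>" unfolding \<sigma>_def using sT 1 P by (intro ghom_transfer) auto
  have fs': "f' * (s' * T) = idm (rdim V') * T" using 2 by (simp add: mult.assoc[symmetric])
  have "f' * \<sigma> = transfer V V' (f' * (s' * T))"
    unfolding \<sigma>_def using 2 ghom_times_transfer[of P' V' f' V "s' * T"] by (simp add: mult.assoc)
  also have "\<dots> = \<phi>" using T(1) unfolding T(2) fs' by (simp add: idm_times)
  finally have fs: "f' * \<sigma> = \<phi>" .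
  define \<Delta> where "\<Delta> = \<Phi> - \<sigma> * f"
  have D: "ghom P P' \<Delta>" unfolding \<Delta>_def using F s 1 by (blast intro: ghom_diff ghom_comp)
  have fD: "f' * \<Delta> = 0" unfolding \<Delta>_def by (simp add: right_diff_distrib F mult.assoc[symmetric] fs)
  have kt': "k' * t' = idm (rdim P') - s' * f'" using 2 by (simp add: eq_diff_eq)
  have "k' * (t' * \<Delta>) = (idm (rdim P') - s' * f') * \<Delta>"
    by (simp only: mult.assoc[symmetric] kt')
  also have "\<dots> = \<Delta>" using ghom_idm_left[OF D] fD by (simp add: left_diff_distrib mult.assoc)
  finally have kt: "k' * (t' * \<Delta>) = \<Delta>" .
  have tau: "ghom P K' (t' * \<Delta>)"
  proof (rule ghom_cancel)
    show "ghom K' P' k'" "t' * k' = idm (rdim K')" "modl K'" "modl P" using 2 P by auto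
    show "block (rdim K') (rdim P) (t' * \<Delta>)" using 2 D by (blast intro: block_times ghom_block)
    show "ghom P P' (k' * (t' * \<Delta>))" using kt D by simp
  qed
  have "\<phi>' = t' * k' * \<phi>'" using 2 ghom_idm_left[OF assms(4)] by simp
  also have "\<dots> = t' * (\<Phi> * k)" by (simp add: mult.assoc F)
  also have "\<Phi> * k = \<Delta> * k" unfolding \<Delta>_def using 1 by (simp add: left_diff_distrib mult.assoc)
  finally have "\<phi>' = (t' * \<Delta>) * k" by (simp add: mult.assoc)
  then show ?thesis using stably_zero_right[OF proj_stably_zero_from[OF _ tau], of K k] 1 by simp
qed

lemma lftI: "ghom P P' \<Phi> \<Longrightarrow> f' * \<Phi> = \<phi> * f \<Longrightarrow> k' * \<phi>' = \<Phi> * k \<Longrightarrow> syzygy_map P f k P' f' k' \<phi> \<phi>'"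
  unfolding syzygy_map_def by blast

lemma lft_id:
  assumes "syzygy_by V K P f k s t" shows "syzygy_map P f k P f k (idm (rdim V)) (idm (rdim K))"
proof -
  have h: "modl P" "ghom P V f" "ghom K P k"
    using assms by (auto simp: syzygy_by_def proj_def)
  then show ?thesis
    using ghom_idm_left[OF h(2)] ghom_idm_right[OF h(2)] ghom_idm_left[OF h(3)] ghom_idm_right[OF h(3)]
    by (intro lftI[of _ _ "idm (rdim P)"]) (simp_all add: ghom_id)
qed

lemma lft_add:
  assumes "syzygy_map P f k P' f' k' \<phi> \<phi>'" "syzygy_map P f k P' f' k' \<psi> \<psi>'"
  shows "syzygy_map P f k P' f' k' (\<phi> + \<psi>) (\<phi>' + \<psi>')"
proof -
  obtain A B where "ghom P P' A" "f' * A = \<phi> * f" "k' * \<phi>' = A * k"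
    "ghom P P' B" "f' * B = \<psi> * f" "k' * \<psi>' = B * k"
    using assms by (auto simp: syzygy_map_def)
  then show ?thesis
    by (intro lftI[of _ _ "A + B"]) (simp_all add: ghom_add distrib_left distrib_right)
qed

lemma lft_diff:
  assumes "syzygy_map P f k P' f' k' \<phi> \<phi>'" "syzygy_map P f k P' f' k' \<psi> \<psi>'"
  shows "syzygy_map P f k P' f' k' (\<phi> - \<psi>) (\<phi>' - \<psi>')"
proof -
  obtain A B where "ghom P P' A" "f' * A = \<phi> * f" "k' * \<phi>' = A * k"
    "ghom P P' B" "f' * B = \<psi> * f" "k' * \<psi>' = B * k"
    using assms by (auto simp: syzygy_map_def)
  then show ?thesis
    by (intro lftI[of _ _ "A - B"]) (simp_all add: ghom_diff left_diff_distrib right_diff_distrib)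
qed

lemma lft_comp:
  assumes "syzygy_map P f k P' f' k' \<phi> \<phi>'" "syzygy_map P' f' k' P'' f'' k'' \<psi> \<psi>'"
  shows "syzygy_map P f k P'' f'' k'' (\<psi> * \<phi>) (\<psi>' * \<phi>')"
proof -
  obtain A B where *: "ghom P P' A" "f' * A = \<phi> * f" "k' * \<phi>' = A * k"
    "ghom P' P'' B" "f'' * B = \<psi> * f'" "k'' * \<psi>' = B * k'"
    using assms by (auto simp: syzygy_map_def)
  show ?thesis
  proof (rule lftI)
    show "ghom P P'' (B * A)" using * ghom_comp by blast
    have "f'' * (B * A) = \<psi> * (f' * A)" by (metis *(5) mult.assoc)
    then show "f'' * (B * A) = \<psi> * \<phi> * f" by (simp only: * mult.assoc)
    have "k'' * (\<psi>' * \<phi>') = B * (k' * \<phi>')" by (metis *(6) mult.assoc)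
    then show "k'' * (\<psi>' * \<phi>') = B * A * k" by (simp only: * mult.assoc)
  qed
qed

lemma syzygy_modl: "syzygy V K \<Longrightarrow> modl V" "syzygy V K \<Longrightarrow> modl K"
  by (auto simp: syzygy_def syzygy_by_def)

text \<open>Schanuel's lemma in stable form. The maps induced by a and b compose to the identity up
  to a map lying over b a - 1 or a b - 1, and these are stably zero.\<close>

lemma syzygy_stab_iso:
  assumes "syzygy V K" "syzygy V' K'" "stab_iso V V'" shows "stab_iso K K'"
proof -
  obtain P f k s t where 1: "syzygy_by V K P f k s t" using assms by (auto simp: syzygy_def)
  obtain P' f' k' s' t' where 2: "syzygy_by V' K' P' f' k' s' t'" using assms by (auto simp: syzygy_def)
  obtain a b where ab: "ghom V V' a" "ghom V' V b" "stably_zero V V (b * a - idm (rdim V))"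
      "stably_zero V' V' (a * b - idm (rdim V'))"
    using assms(3) by (auto simp: stab_iso_def)
  obtain a' where a: "ghom K K' a'" "syzygy_map P f k P' f' k' a a'" using lft_ex[OF 1 2 ab(1)] by blast
  obtain b' where b: "ghom K' K b'" "syzygy_map P' f' k' P f k b b'" using lft_ex[OF 2 1 ab(2)] by blast
  have m: "modl K" "modl K'" using assms syzygy_modl by auto
  show ?thesis
  proof (rule stab_isoI[OF m a(1) b(1)])
    show "stably_zero K K (b' * a' - idm (rdim K))"
      by (rule lft_stably_zero[OF 1 1 ab(3) _ lft_diff[OF lft_comp[OF a(2) b(2)] lft_id[OF 1]]])
        (use a b m in \<open>blast intro: ghom_diff ghom_comp ghom_id\<close>)
    show "stably_zero K' K' (a' * b' - idm (rdim K'))"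
      by (rule lft_stably_zero[OF 2 2 ab(4) _ lft_diff[OF lft_comp[OF b(2) a(2)] lft_id[OF 2]]])
        (use a b m in \<open>blast intro: ghom_diff ghom_comp ghom_id\<close>)
  qed
qed

lemma syzygy_stab_biprod:
  assumes "stab_biprod X A B" "syzygy X KX" "syzygy A KA" "syzygy B KB" shows "stab_biprod KX KA KB"
proof -
  obtain i p j q where "stab_biprod_by X A B i p j q" using assms(1) by (auto simp: stab_biprod_def)
  note h = this[unfolded stab_biprod_by_def]
  obtain P f k s t where x: "syzygy_by X KX P f k s t" using assms by (auto simp: syzygy_def)
  obtain P1 f1 k1 s1 t1 where a: "syzygy_by A KA P1 f1 k1 s1 t1" using assms by (auto simp: syzygy_def)
  obtain P2 f2 k2 s2 t2 where b: "syzygy_by B KB P2 f2 k2 s2 t2" using assms by (auto simp: syzygy_def)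
  obtain i' where i: "ghom KA KX i'" "syzygy_map P1 f1 k1 P f k i i'" using lft_ex[OF a x] h by blast
  obtain p' where p: "ghom KX KA p'" "syzygy_map P f k P1 f1 k1 p p'" using lft_ex[OF x a] h by blast
  obtain j' where j: "ghom KB KX j'" "syzygy_map P2 f2 k2 P f k j j'" using lft_ex[OF b x] h by blast
  obtain q' where q: "ghom KX KB q'" "syzygy_map P f k P2 f2 k2 q q'" using lft_ex[OF x b] h by blast
  have m: "modl KX" "modl KA" "modl KB" using assms syzygy_modl by auto
  note hs = ghom_id[OF m(1)] ghom_id[OF m(2)] ghom_id[OF m(3)] i(1) p(1) j(1) q(1)
  have "stably_zero KA KA (p' * i' - idm (rdim KA))"
    by (rule lft_stably_zero[OF a a _ _ lft_diff[OF lft_comp[OF i(2) p(2)] lft_id[OF a]]])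
      (use h hs in \<open>blast intro: ghom_diff ghom_comp\<close>)+
  moreover have "stably_zero KB KB (q' * j' - idm (rdim KB))"
    by (rule lft_stably_zero[OF b b _ _ lft_diff[OF lft_comp[OF j(2) q(2)] lft_id[OF b]]])
      (use h hs in \<open>blast intro: ghom_diff ghom_comp\<close>)+
  moreover have "stably_zero KA KB (q' * i')"
    by (rule lft_stably_zero[OF a b _ _ lft_comp[OF i(2) q(2)]])
      (use h hs in \<open>blast intro: ghom_diff ghom_comp\<close>)+
  moreover have "stably_zero KB KA (p' * j')"
    by (rule lft_stably_zero[OF b a _ _ lft_comp[OF j(2) p(2)]])
      (use h hs in \<open>blast intro: ghom_diff ghom_comp\<close>)+
  moreover have "stably_zero KX KX (i' * p' + j' * q' - idm (rdim KX))"
    by (rule lft_stably_zero[OF x x _ _ lft_diff[OF lft_add[OF lft_comp[OF p(2) i(2)] lft_comp[OF q(2) j(2)]] lft_id[OF x]]])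
      (use h hs in \<open>blast intro: ghom_diff ghom_add ghom_comp\<close>)+
  ultimately have "stab_biprod_by KX KA KB i' p' j' q'"
    unfolding stab_biprod_by_def using m hs by blast
  then show ?thesis by (auto simp: stab_biprod_def)
qed

lemma syzygy_proj: "syzygy V K \<Longrightarrow> proj V \<Longrightarrow> proj K"
  unfolding syzygy_def proj_def using lft_stably_zero lft_id ghom_id by (metis syzygy_by_def)

lemma syzygy_tensor_left:
  fixes V :: "('a, 'k::field) rep"
  assumes "syzygy V K" "modl W" shows "syzygy (tensor V W) (tensor K W)"
proof -
  obtain P f k s t where "syzygy_by V K P f k s t" using assms by (auto simp: syzygy_def)
  note h = this[unfolded syzygy_by_def]
  let ?t = "\<lambda>a. tens (rdim W) (rdim W) a (idm (rdim W))"
  have c: "?t u * ?t v = ?t (u * v)" for u v :: "'k fmat"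
    using tens_comp[OF ghom_id[OF assms(2)] ghom_id[OF assms(2)], of u v] by simp
  have P: "modl P" using h by (simp add: proj_def)
  have "syzygy_by (tensor V W) (tensor K W) (tensor P W) (?t f) (?t k) (?t s) (?t t)"
    unfolding syzygy_by_def using h assms P
    by (auto intro!: modl_tensor proj_tensor_left ghom_tensor ghom_id block_tens
        simp: c tens_add_left[symmetric])
  then show ?thesis unfolding syzygy_def by blast
qed

lemma syzygy_tensor_right:
  fixes V :: "('a, 'k::field) rep"
  assumes "syzygy V K" "modl W" shows "syzygy (tensor W V) (tensor W K)"
proof -
  obtain P f k s t where "syzygy_by V K P f k s t" using assms by (auto simp: syzygy_def)
  note h = this[unfolded syzygy_by_def]
  let ?t = "\<lambda>a b. tens a b (idm (rdim W))"
  have c: "?t a b u * ?t b c v = ?t a c (u * v)" if "block a b u" "block b c v" for a b c and u v :: "'k fmat"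
    using tens_times[of a b u c v a "idm (rdim W)" c "idm (rdim W)"] that by simp
  have P: "modl P" using h by (simp add: proj_def)
  have b: "block (rdim P) (rdim K) k" "block (rdim V) (rdim P) f" using h by auto
  have "syzygy_by (tensor W V) (tensor W K) (tensor W P) (?t (rdim V) (rdim P) f) (?t (rdim P) (rdim K) k)
     (?t (rdim P) (rdim V) s) (?t (rdim K) (rdim P) t)"
    unfolding syzygy_by_def using h assms P b c
    by (auto intro!: modl_tensor proj_tensor_right ghom_tensor ghom_id block_tens
        simp: tens_add_right[symmetric])
  then show ?thesis unfolding syzygy_def by blast
qed

end

section \<open>Modules given by matrices\<close>

lemma mat_factor:
  assumes K: "K \<in> carrier_mat n d" and B: "B \<in> carrier_mat n m"
    and r: "\<And>j. j < m \<Longrightarrow> col B j \<in> mat_range K"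
  shows "\<exists>X \<in> carrier_mat d m. K * X = B"
proof -
  have "\<forall>j<m. \<exists>x. x \<in> carrier_vec d \<and> K *\<^sub>v x = col B j"
    using r K unfolding mat_range_def by fastforce
  then obtain x where x: "\<And>j. j < m \<Longrightarrow> x j \<in> carrier_vec d \<and> K *\<^sub>v x j = col B j"
    by metis
  define X where "X = mat_of_cols d (map x [0..<m])"
  have X: "X \<in> carrier_mat d m" using mat_of_cols_carrier(1)[of d "map x [0..<m]"] by (simp add: X_def)
  have cX: "col X j = x j" if "j < m" for j
    using x[OF that] that unfolding X_def by (subst col_mat_of_cols) auto
  have "K * X = B"
  proof (rule mat_col_eqI)
    fix j assume "j < dim_col B"
    then show "col (K * X) j = col B j"
      using col_mult2[OF K X, of j] cX x B by simp
  qed (use K X B in auto)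
  then show ?thesis using X by blast
qed

lemma mult_unit_vec_col:
  fixes K :: "'a::field mat"
  shows "K \<in> carrier_mat n d \<Longrightarrow> j < d \<Longrightarrow> K *\<^sub>v unit_vec d j = col K j"
proof (rule eq_vecI)
  assume K: "K \<in> carrier_mat n d" and j: "j < d"
  fix i assume "i < dim_vec (col K j)"
  then have "row K i \<bullet> unit_vec d j = row K i $ j"
    using K j by (intro scalar_prod_right_unit) auto
  then show "(K *\<^sub>v unit_vec d j) $ i = col K j $ i"
    using K j \<open>i < dim_vec (col K j)\<close> by simp
qed auto

lemma surj_mat_right_inverse:
  assumes "K \<in> carrier_mat n d" "surj_mat K"
  shows "\<exists>X \<in> carrier_mat d n. K * X = 1\<^sub>m n"
  by (rule mat_factor[OF assms(1)]) (use assms in \<open>auto simp: surj_mat_def\<close>)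

lemma mat_range_carrier: "K \<in> carrier_mat n d \<Longrightarrow> mat_range K = (*\<^sub>v) K ` carrier_vec d"
  by (auto simp: mat_range_def)

lemma inj_mat_cancel:
  assumes K: "K \<in> carrier_mat n d" "inj_mat K" and X: "X \<in> carrier_mat d m" "Y \<in> carrier_mat d m"
    and eq: "K * X = K * Y"
  shows "X = Y"
proof (rule mat_col_eqI)
  fix j assume "j < dim_col Y"
  then have j: "j < m" using X by auto
  have "K *\<^sub>v col X j = K *\<^sub>v col Y j"
    using col_mult2[OF K(1) X(1) j] col_mult2[OF K(1) X(2) j] eq by simp
  moreover have "col X j \<in> carrier_vec d" "col Y j \<in> carrier_vec d"
    using X by (auto intro: carrier_vecI)
  ultimately show "col X j = col Y j"
    using K by (auto simp: inj_mat_def inj_on_def)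
qed (use X in auto)

lemma inj_matI_kernel:
  assumes K: "K \<in> carrier_mat n d"
    and k: "\<And>v. v \<in> carrier_vec d \<Longrightarrow> K *\<^sub>v v = 0\<^sub>v n \<Longrightarrow> v = 0\<^sub>v d"
  shows "inj_mat (K :: 'a::field mat)"
  unfolding inj_mat_def
proof (rule inj_onI)
  fix x y assume xy: "x \<in> carrier_vec (dim_col K)" "y \<in> carrier_vec (dim_col K)" "K *\<^sub>v x = K *\<^sub>v y"
  then have c: "x \<in> carrier_vec d" "y \<in> carrier_vec d" using K by auto
  have "K *\<^sub>v (x - y) = K *\<^sub>v x - K *\<^sub>v y"
    using K c by (simp add: mult_minus_distrib_mat_vec)
  also have "\<dots> = 0\<^sub>v n" using K xy by auto
  finally have "x - y = 0\<^sub>v d" using k[of "x - y"] c by auto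
  then show "x = y" using c by (auto intro!: eq_vecI simp: vec_eq_iff)
qed

lemma inj_mat_left_inverse:
  fixes K :: "'a::field mat"
  assumes "K \<in> carrier_mat n d" "T \<in> carrier_mat d n" "T * K = 1\<^sub>m d"
  shows "inj_mat K"
  unfolding inj_mat_def
proof (rule inj_onI)
  fix x y :: "'a vec" assume "x \<in> carrier_vec (dim_col K)" "y \<in> carrier_vec (dim_col K)" "K *\<^sub>v x = K *\<^sub>v y"
  then have xy: "K *\<^sub>v x = K *\<^sub>v y" "x \<in> carrier_vec d" "y \<in> carrier_vec d"
    using assms by auto
  have "T * K *\<^sub>v x = T * K *\<^sub>v y"
    unfolding assoc_mult_mat_vec[OF assms(2,1) xy(2)] assoc_mult_mat_vec[OF assms(2,1) xy(3)] xy(1) ..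
  then show "x = y" using assms xy by simp
qed

lemma right_inverse_surj_mat:
  fixes K :: "'a::field mat"
  assumes "K \<in> carrier_mat n d" "X \<in> carrier_mat d n" "K * X = 1\<^sub>m n"
  shows "surj_mat K"
  unfolding surj_mat_def mat_range_carrier[OF assms(1)]
proof (intro equalityI subsetI)
  fix y :: "'a vec" assume "y \<in> carrier_vec (dim_row K)"
  then have "y \<in> carrier_vec n" using assms by auto
  then have "y = K *\<^sub>v (X *\<^sub>v y)" "X *\<^sub>v y \<in> carrier_vec d"
    using assms by (auto simp: assoc_mult_mat_vec[of K n d X n, symmetric])
  then show "y \<in> (*\<^sub>v) K ` carrier_vec d" by blast
qed (use assms in auto)

lemma inj_mat_square:
  assumes K: "K \<in> carrier_mat n n" "inj_mat (K :: 'a::field mat)"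
  shows "surj_mat K"
proof -
  have "det K \<noteq> 0"
  proof
    assume "det K = 0"
    then obtain v where v: "v \<in> carrier_vec n" "v \<noteq> 0\<^sub>v n" "K *\<^sub>v v = 0\<^sub>v n"
      using det_0_iff_vec_prod_zero_field[OF K(1)] by blast
    have "K *\<^sub>v 0\<^sub>v n = 0\<^sub>v n" using K by auto
    then show False using v K by (auto simp: inj_mat_def inj_on_def)
  qed
  then have "K \<in> Units (ring_mat TYPE('a) n ())" by (rule det_non_zero_imp_unit[OF K(1)])
  then obtain X where "X \<in> carrier_mat n n" "K * X = 1\<^sub>m n"
    by (auto simp: Units_def ring_mat_def)
  then show ?thesis using right_inverse_surj_mat K by blast
qed

text \<open>An injective matrix with more columns than rows would stay injective when filled up with
  zero rows; being square it would then be onto, but it misses a unit vector.\<close>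

lemma inj_mat_le:
  assumes K: "K \<in> carrier_mat n d" "inj_mat (K :: 'a::field mat)"
  shows "d \<le> n"
proof (rule ccontr)
  assume "\<not> d \<le> n"
  then have nd: "n < d" by simp
  define K' where "K' = Matrix.mat d d (\<lambda>(i, j). if i < n then K $$ (i, j) else 0)"
  have K': "K' \<in> carrier_mat d d" by (simp add: K'_def)
  have "inj_mat K'"
  proof (rule inj_matI_kernel[OF K'])
    fix v assume v: "v \<in> carrier_vec d" "K' *\<^sub>v v = 0\<^sub>v d"
    have "K *\<^sub>v v = 0\<^sub>v n"
    proof (rule eq_vecI)
      fix i assume i: "i < dim_vec (0\<^sub>v n :: 'a vec)"
      have "(K *\<^sub>v v) $ i = (K' *\<^sub>v v) $ i"
        using i nd K v(1) by (auto simp: K'_def scalar_prod_def intro!: sum.cong)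
      then show "(K *\<^sub>v v) $ i = 0\<^sub>v n $ i" using v i nd by simp
    qed (use K in auto)
    moreover have "K *\<^sub>v 0\<^sub>v d = 0\<^sub>v n" using K by auto
    ultimately show "v = 0\<^sub>v d" using K v by (auto simp: inj_mat_def inj_on_def)
  qed
  then have "surj_mat K'" by (rule inj_mat_square[OF K'])
  then have "unit_vec d n \<in> (*\<^sub>v) K' ` carrier_vec d"
    using K' by (auto simp: surj_mat_def mat_range_carrier)
  then obtain v where v: "v \<in> carrier_vec d" "K' *\<^sub>v v = unit_vec d n" by (metis imageE)
  have "(K' *\<^sub>v v) $ n = 0"
    using nd v(1) by (auto simp: K'_def scalar_prod_def)
  then show False using v nd by simp
qed

text \<open>Among the injective matrices with range in U, one with the largest number of columns is
  onto U: any vector of U outside its range could be appended as a further column.\<close>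

lemma subspace_basis:
  fixes U :: "'a::field vec set"
  assumes U: "U \<subseteq> carrier_vec n" "0\<^sub>v n \<in> U" "\<And>u v. u \<in> U \<Longrightarrow> v \<in> U \<Longrightarrow> u + v \<in> U"
    "\<And>c u. u \<in> U \<Longrightarrow> c \<cdot>\<^sub>v u \<in> U"
  shows "\<exists>d K. K \<in> carrier_mat n d \<and> inj_mat K \<and> mat_range K = U"
proof -
  let ?Q = "\<lambda>d. \<exists>K \<in> carrier_mat n d. inj_mat K \<and> mat_range K \<subseteq> U"
  have "?Q 0"
  proof (rule bexI)
    show "0\<^sub>m n 0 \<in> carrier_mat n 0" by simp
    have "0\<^sub>m n 0 *\<^sub>v v = 0\<^sub>v n" if "v \<in> carrier_vec 0" for v :: "'a vec"
      using that by (auto intro!: eq_vecI simp: scalar_prod_def)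
    then show "inj_mat (0\<^sub>m n 0) \<and> mat_range (0\<^sub>m n 0) \<subseteq> U"
      using U(2) by (auto simp: inj_mat_def inj_on_def mat_range_def)
  qed
  moreover have "\<forall>d. ?Q d \<longrightarrow> d \<le> n" using inj_mat_le by blast
  ultimately obtain d where d: "?Q d" "\<And>d'. ?Q d' \<Longrightarrow> d' \<le> d"
    using GreatestI_nat[of ?Q 0 n] Greatest_le_nat[of ?Q _ n] by blast
  then obtain K where K: "K \<in> carrier_mat n d" "inj_mat K" "mat_range K \<subseteq> U" by blast
  have "U \<subseteq> mat_range K"
  proof (rule ccontr)
    assume "\<not> U \<subseteq> mat_range K"
    then obtain u where u: "u \<in> U" "u \<notin> mat_range K" by blast
    have un: "u \<in> carrier_vec n" using u U by blast
    define K' where "K' = Matrix.mat n (Suc d) (\<lambda>(i, j). if j < d then K $$ (i, j) else u $ i)"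
    have K': "K' \<in> carrier_mat n (Suc d)" by (simp add: K'_def)
    have mult: "K' *\<^sub>v w = K *\<^sub>v vec d (\<lambda>i. w $ i) + w $ d \<cdot>\<^sub>v u" if "w \<in> carrier_vec (Suc d)" for w
      by (rule eq_vecI) (use that K un in \<open>auto simp: K'_def scalar_prod_def mult.commute intro!: sum.cong\<close>)
    have "inj_mat K'"
    proof (rule inj_matI_kernel[OF K'])
      fix w assume w: "w \<in> carrier_vec (Suc d)" "K' *\<^sub>v w = 0\<^sub>v n"
      define v where "v = vec d (\<lambda>i. w $ i)"
      have v: "v \<in> carrier_vec d" by (simp add: v_def)
      have e: "K *\<^sub>v v + w $ d \<cdot>\<^sub>v u = 0\<^sub>v n" using mult[OF w(1)] w(2) by (simp add: v_def)
      have wd: "w $ d = 0"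
      proof (rule ccontr)
        assume nz: "w $ d \<noteq> 0"
        have "K *\<^sub>v ((- inverse (w $ d)) \<cdot>\<^sub>v v) = (- inverse (w $ d)) \<cdot>\<^sub>v (K *\<^sub>v v)"
          using K v by (simp add: mult_mat_vec)
        also have "\<dots> = u"
        proof (rule eq_vecI)
          fix i assume i: "i < dim_vec u"
          have "(K *\<^sub>v v + w $ d \<cdot>\<^sub>v u) $ i = 0" using e i un by simp
          then have "(K *\<^sub>v v) $ i = - (w $ d * u $ i)"
            using i un K by (simp add: eq_neg_iff_add_eq_0)
          then show "((- inverse (w $ d)) \<cdot>\<^sub>v (K *\<^sub>v v)) $ i = u $ i"
            using i un K nz by simp
        qed (use K un in auto)
        finally have "u \<in> mat_range K"
          unfolding mat_range_carrier[OF K(1)] using v by (metis image_eqI smult_carrier_vec)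
        then show False using u by blast
      qed
      have "K *\<^sub>v v = 0\<^sub>v n"
      proof (rule eq_vecI)
        fix i assume i: "i < dim_vec (0\<^sub>v n :: 'a vec)"
        have "(K *\<^sub>v v + w $ d \<cdot>\<^sub>v u) $ i = 0" using e i by simp
        then show "(K *\<^sub>v v) $ i = 0\<^sub>v n $ i" using i un K wd by simp
      qed (use K in auto)
      moreover have "K *\<^sub>v 0\<^sub>v d = 0\<^sub>v n" using K by auto
      ultimately have v0: "v = 0\<^sub>v d" using K v by (auto simp: inj_mat_def inj_on_def)
      show "w = 0\<^sub>v (Suc d)"
      proof (rule eq_vecI)
        fix i assume "i < dim_vec (0\<^sub>v (Suc d) :: 'a vec)"
        then have "i < d \<or> i = d" by auto
        moreover have "w $ i = 0" if "i < d"
        proof -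
          have "w $ i = v $ i" using that by (simp add: v_def)
          then show ?thesis using v0 that by simp
        qed
        ultimately show "w $ i = 0\<^sub>v (Suc d) $ i" using wd by auto
      qed (use w in auto)
    qed
    moreover have "mat_range K' \<subseteq> U"
    proof
      fix y assume "y \<in> mat_range K'"
      then obtain w where w: "w \<in> carrier_vec (Suc d)" "y = K' *\<^sub>v w"
        unfolding mat_range_carrier[OF K'] by blast
      have "K *\<^sub>v vec d (\<lambda>i. w $ i) \<in> U"
        using K(3) unfolding mat_range_carrier[OF K(1)] by (metis image_subset_iff vec_carrier)
      then show "y \<in> U" unfolding w mult[OF w(1)] using U u by blast
    qed
    ultimately have "?Q (Suc d)" using K' by blast
    then show False using d(2) by fastforce
  qed
  then show ?thesis using K by blast
qed

context fin_group begin

lemma is_hom_ghom: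
  assumes "modl V" "modl W" "is_hom G V W A" shows "ghom V W (fm A)"
  unfolding ghom_def
proof (intro conjI ballI)
  have A: "A \<in> carrier_mat (rdim W) (rdim V)" using assms by (simp add: is_hom_def)
  then show "block (rdim W) (rdim V) (fm A)" by simp
  fix g assume g: "g \<in> carrier G"
  have "ract V g \<in> carrier_mat (rdim V) (rdim V)" "ract W g \<in> carrier_mat (rdim W) (rdim W)"
    using assms g by (auto simp: is_module_def)
  then show "fm A * act V g = act W g * fm A"
    using A assms(3) g unfolding act_def is_hom_def by (metis fm_times)
qed

lemma ghom_is_hom:
  assumes "modl V" "modl W" "ghom V W A" shows "is_hom G V W (mt (rdim W) (rdim V) A)"
  unfolding is_hom_def
proof (intro conjI ballI)
  fix g assume g: "g \<in> carrier G"
  have c: "ract V g \<in> carrier_mat (rdim V) (rdim V)" "ract W g \<in> carrier_mat (rdim W) (rdim W)"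
    using assms g by (auto simp: is_module_def)
  show "mt (rdim W) (rdim V) A * ract V g = ract W g * mt (rdim W) (rdim V) A"
  proof (rule fm_inj[of _ "rdim W" "rdim V"])
    show "fm (mt (rdim W) (rdim V) A * ract V g) = fm (ract W g * mt (rdim W) (rdim V) A)"
      using ghom_act[OF assms(3) g] ghom_block[OF assms(3)]
      unfolding fm_times[OF mt_carrier c(1)] fm_times[OF c(2) mt_carrier]
      by (simp add: fm_mt act_def)
  qed (use c mult_carrier_mat[OF c(2) mt_carrier] mult_carrier_mat[OF mt_carrier c(1)] in auto)
qed simp

definition giso :: "('a, 'k::field) rep \<Rightarrow> ('a, 'k) rep \<Rightarrow> bool" where
  "giso V W \<longleftrightarrow> modl V \<and> modl W \<and> (\<exists>f g. ghom V W f \<and> ghom W V g \<and> g * f = idm (rdim V) \<and> f * g = idm (rdim W))"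

lemma giso_stab_iso: "giso V W \<Longrightarrow> stab_iso V W"
  unfolding giso_def by (metis stab_isoI diff_self stably_zero_zero)

lemma giso_iso_modules: assumes "giso V W" shows "iso_modules G V W"
proof -
  obtain f g where f: "ghom V W f" "ghom W V g" "g * f = idm (rdim V)" "f * g = idm (rdim W)"
    and m: "modl V" "modl W" using assms by (auto simp: giso_def)
  let ?f = "mt (rdim W) (rdim V) f" and ?g = "mt (rdim V) (rdim W) g"
  have "?g * ?f = 1\<^sub>m (rdim V)"
    by (rule fm_inj[of _ "rdim V" "rdim V"])
      (use f in \<open>auto simp: fm_times[OF mt_carrier mt_carrier] fm_mt intro: mult_carrier_mat[OF mt_carrier mt_carrier]\<close>)
  moreover have "?f * ?g = 1\<^sub>m (rdim W)"
    by (rule fm_inj[of _ "rdim W" "rdim W"])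
      (use f in \<open>auto simp: fm_times[OF mt_carrier mt_carrier] fm_mt intro: mult_carrier_mat[OF mt_carrier mt_carrier]\<close>)
  ultimately show ?thesis
    unfolding iso_modules_def
    using ghom_is_hom[OF m f(1)] inj_mat_left_inverse[OF mt_carrier mt_carrier] right_inverse_surj_mat[OF mt_carrier mt_carrier]
    by blast
qed

lemma bij_hom_inverse:
  assumes m: "modl V" "modl W" and A: "is_hom G V W A" "inj_mat A" "surj_mat A"
  shows "\<exists>g. ghom W V g \<and> g * fm A = idm (rdim V) \<and> fm A * g = idm (rdim W)"
proof -
  have c: "A \<in> carrier_mat (rdim W) (rdim V)" using A by (simp add: is_hom_def)
  obtain X where X: "X \<in> carrier_mat (rdim V) (rdim W)" "A * X = 1\<^sub>m (rdim W)"
    using surj_mat_right_inverse[OF c A(3)] by blast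
  have "A * (X * A) = A * 1\<^sub>m (rdim V)"
    using X c assoc_mult_mat[OF c X(1) c] by simp
  then have XA: "X * A = 1\<^sub>m (rdim V)"
    using inj_mat_cancel[OF c A(2), of "X * A" "rdim V" "1\<^sub>m (rdim V)"] X c by simp
  have f: "ghom V W (fm A)" using is_hom_ghom[OF m A(1)] .
  have e: "fm X * fm A = idm (rdim V)" "fm A * fm X = idm (rdim W)"
    using X XA fm_times[OF X(1) c] fm_times[OF c X(1)] by auto
  have "ghom W V (fm X)"
    by (rule ghom_cancel[OF f e(1) m]) (use X e ghom_id[OF m(2)] in simp_all)
  then show ?thesis using e by blast
qed

lemma bij_hom_giso:
  assumes m: "modl V" "modl W" and A: "is_hom G V W A" "inj_mat A" "surj_mat A"
  shows "giso V W"
  unfolding giso_def using bij_hom_inverse[OF assms] is_hom_ghom[OF m A(1)] m by blast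

text \<open>A basis matrix K of the submodule determines the action by K X(g) = g K, and cancelling
  K shows that X is multiplicative.\<close>

lemma sub_rep:
  fixes V :: "('a, 'k::field) rep"
  assumes V: "modl V" and U: "is_submodule G V U"
  shows "\<exists>W k. modl W \<and> is_hom G W V k \<and> inj_mat k \<and> mat_range k = U"
proof -
  obtain d K where K: "K \<in> carrier_mat (rdim V) d" "inj_mat K" "mat_range K = U"
    using subspace_basis[of U "rdim V"] U by (auto simp: is_submodule_def)
  have c: "ract V g \<in> carrier_mat (rdim V) (rdim V)" if "g \<in> carrier G" for g
    using V that by (auto simp: is_module_def)
  have "\<exists>X \<in> carrier_mat d d. K * X = ract V g * K" if g: "g \<in> carrier G" for g
  proof (rule mat_factor[OF K(1)])
    fix j assume j: "j < d"
    have "col K j \<in> U"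
      using K(3) mult_unit_vec_col[OF K(1) j] unfolding mat_range_carrier[OF K(1)]
      by (metis image_eqI unit_vec_carrier)
    then have "ract V g *\<^sub>v col K j \<in> U" using U g by (auto simp: is_submodule_def)
    then show "col (ract V g * K) j \<in> mat_range K"
      using col_mult2[OF c[OF g] K(1) j] K(3) by simp
  qed (use c[OF g] K in auto)
  then obtain X where X: "\<And>g. g \<in> carrier G \<Longrightarrow> X g \<in> carrier_mat d d \<and> K * X g = ract V g * K"
    by metis
  define W where "W = \<lparr>rdim = d, ract = X\<rparr>"
  have "modl W"
    unfolding is_module_def
  proof (intro conjI ballI)
    show "ract W g \<in> carrier_mat (rdim W) (rdim W)" if "g \<in> carrier G" for g
      using X[OF that] by (simp add: W_def)
    have "K * X \<one> = K * 1\<^sub>m d" using X[OF one_closed] V K by (simp add: is_module_def)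
    then show "ract W \<one> = 1\<^sub>m (rdim W)"
      using inj_mat_cancel[OF K(1,2), of "X \<one>" d "1\<^sub>m d"] X[OF one_closed] by (simp add: W_def)
    fix g h assume g: "g \<in> carrier G" and h: "h \<in> carrier G"
    note Xg = X[OF g, THEN conjunct1] X[OF g, THEN conjunct2] and Xh = X[OF h, THEN conjunct1] X[OF h, THEN conjunct2]
    have "K * X (g \<otimes> h) = ract V g * ract V h * K"
      using X[of "g \<otimes> h"] g h V by (auto simp: is_module_def)
    also have "\<dots> = ract V g * (K * X h)"
      using Xh(2) assoc_mult_mat[OF c[OF g] c[OF h] K(1)] by simp
    also have "\<dots> = K * X g * X h"
      using Xg(2) assoc_mult_mat[OF c[OF g] K(1) Xh(1)] by simp
    also have "\<dots> = K * (X g * X h)" using assoc_mult_mat[OF K(1) Xg(1) Xh(1)] .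
    finally have "X (g \<otimes> h) = X g * X h"
      using inj_mat_cancel[OF K(1,2), of "X (g \<otimes> h)" d "X g * X h"] Xg(1) Xh(1) X[of "g \<otimes> h"] g h by auto
    then show "ract W (g \<otimes> h) = ract W g * ract W h" by (simp add: W_def)
  qed
  moreover have "is_hom G W V K" using K X by (auto simp: is_hom_def W_def)
  ultimately show ?thesis using K by blast
qed

lemma fm_mat_factor:
  assumes k: "K \<in> carrier_mat n d" and b: "block n m B"
    and r: "\<And>j. j < m \<Longrightarrow> col (mt n m B) j \<in> mat_range K"
  obtains X where "block d m X" "fm K * X = B"
proof -
  have "\<exists>X\<in>carrier_mat d m. K * X = mt n m B"
    by (rule mat_factor[OF k mt_carrier r])
  then obtain X where X: "X \<in> carrier_mat d m" "K * X = mt n m B" ..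
  have "fm K * fm X = B" unfolding fm_times[OF k X(1), symmetric] X(2) by (rule fm_mt[OF b])
  then show ?thesis by (rule that[OF block_fm[OF X(1)]])
qed

lemma is_submoduleI:
  assumes "U \<subseteq> carrier_vec (rdim V)" "0\<^sub>v (rdim V) \<in> U"
    and "\<And>u v. u \<in> U \<Longrightarrow> v \<in> U \<Longrightarrow> u + v \<in> U" "\<And>c u. u \<in> U \<Longrightarrow> c \<cdot>\<^sub>v u \<in> U"
    and "\<And>g u. g \<in> carrier G \<Longrightarrow> u \<in> U \<Longrightarrow> ract V g *\<^sub>v u \<in> U"
  shows "is_submodule G V U"
  unfolding is_submodule_def using assms by blast

lemma hom_vec_act:
  assumes V: "modl V" and W: "modl W" and A: "is_hom G V W A"
    and g: "g \<in> carrier G" and x: "x \<in> carrier_vec (rdim V)"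
  shows "ract W g *\<^sub>v (A *\<^sub>v x) = A *\<^sub>v (ract V g *\<^sub>v x)"
proof -
  have A': "A \<in> carrier_mat (rdim W) (rdim V)" and comm: "A * ract V g = ract W g * A"
    using A g unfolding is_hom_def by blast+
  have c: "ract V g \<in> carrier_mat (rdim V) (rdim V)" "ract W g \<in> carrier_mat (rdim W) (rdim W)"
    using V W g unfolding is_module_def by blast+
  show ?thesis
    unfolding assoc_mult_mat_vec[OF c(2) A' x, symmetric] comm[symmetric]
    by (rule assoc_mult_mat_vec[OF A' c(1) x])
qed

lemma act_vec_carrier: "modl V \<Longrightarrow> g \<in> carrier G \<Longrightarrow> x \<in> carrier_vec (rdim V) \<Longrightarrow> ract V g *\<^sub>v x \<in> carrier_vec (rdim V)"
  unfolding is_module_def by (meson mult_mat_vec_carrier)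

lemma range_submodule:
  fixes A :: "'k::field mat"
  assumes m: "modl V" "modl W" and h: "is_hom G V W A"
  shows "is_submodule G W (mat_range A)"
proof -
  have A: "A \<in> carrier_mat (rdim W) (rdim V)" using h unfolding is_hom_def by blast
  note r = mat_range_carrier[OF A]
  show ?thesis
  proof (rule is_submoduleI)
    show "mat_range A \<subseteq> carrier_vec (rdim W)" unfolding r using mult_mat_vec_carrier[OF A] by blast
    have "A *\<^sub>v 0\<^sub>v (rdim V) = 0\<^sub>v (rdim W)" using A by auto
    then show "0\<^sub>v (rdim W) \<in> mat_range A"
      unfolding r by (intro image_eqI[of _ _ "0\<^sub>v (rdim V)"]) simp_all
  next
    fix u v assume "u \<in> mat_range A" "v \<in> mat_range A"
    then obtain x y where x: "u = A *\<^sub>v x" "x \<in> carrier_vec (rdim V)" "v = A *\<^sub>v y" "y \<in> carrier_vec (rdim V)"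
      unfolding r by blast
    show "u + v \<in> mat_range A"
      unfolding r x(1,3) mult_add_distrib_mat_vec[OF A x(2,4), symmetric] using x(2,4) by (intro imageI) simp
  next
    fix c u assume "u \<in> mat_range A"
    then obtain x where x: "u = A *\<^sub>v x" "x \<in> carrier_vec (rdim V)" unfolding r by blast
    show "c \<cdot>\<^sub>v u \<in> mat_range A"
      unfolding r x(1) mult_mat_vec[OF A x(2), symmetric] using x(2) by (intro imageI) simp
  next
    fix g u assume g: "g \<in> carrier G" and "u \<in> mat_range A"
    then obtain x where x: "u = A *\<^sub>v x" "x \<in> carrier_vec (rdim V)" unfolding r by blast
    show "ract W g *\<^sub>v u \<in> mat_range A"
      unfolding r x(1) hom_vec_act[OF m h g x(2)] by (rule imageI[OF act_vec_carrier[OF m(1) g x(2)]])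
  qed
qed

lemma kernel_submodule:
  fixes A :: "'k::field mat"
  assumes m: "modl V" "modl W" and h: "is_hom G V W A"
  shows "is_submodule G V (mat_kernel A)"
proof -
  have A: "A \<in> carrier_mat (rdim W) (rdim V)" using h unfolding is_hom_def by blast
  have r: "v \<in> mat_kernel A \<longleftrightarrow> v \<in> carrier_vec (rdim V) \<and> A *\<^sub>v v = 0\<^sub>v (rdim W)" for v
    using mat_kernel[OF A] by blast
  show ?thesis
  proof (rule is_submoduleI)
    show "mat_kernel A \<subseteq> carrier_vec (rdim V)" using r by blast
    show "0\<^sub>v (rdim V) \<in> mat_kernel A" unfolding r using A by auto
  next
    fix u v assume "u \<in> mat_kernel A" "v \<in> mat_kernel A"
    then have u: "u \<in> carrier_vec (rdim V)" "A *\<^sub>v u = 0\<^sub>v (rdim W)"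
      "v \<in> carrier_vec (rdim V)" "A *\<^sub>v v = 0\<^sub>v (rdim W)" unfolding r by blast+
    show "u + v \<in> mat_kernel A"
      unfolding r mult_add_distrib_mat_vec[OF A u(1,3)] u(2,4) using u by simp
  next
    fix c u assume "u \<in> mat_kernel A"
    then have u: "u \<in> carrier_vec (rdim V)" "A *\<^sub>v u = 0\<^sub>v (rdim W)" unfolding r by blast+
    show "c \<cdot>\<^sub>v u \<in> mat_kernel A"
      unfolding r mult_mat_vec[OF A u(1)] u(2) using u by (auto intro!: eq_vecI)
  next
    fix g u assume g: "g \<in> carrier G" and "u \<in> mat_kernel A"
    then have u: "u \<in> carrier_vec (rdim V)" "A *\<^sub>v u = 0\<^sub>v (rdim W)" unfolding r by blast+
    have "ract W g \<in> carrier_mat (rdim W) (rdim W)" using m g unfolding is_module_def by blast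
    then show "ract V g *\<^sub>v u \<in> mat_kernel A"
      unfolding r hom_vec_act[OF m h g u(1), symmetric] u(2) using act_vec_carrier[OF m(1) g u(1)] by auto
  qed
qed

text \<open>The image of e as a module of its own. The exterior powers and the projective complement
  in \<open>stab_iso_stably_equiv\<close> are obtained in this way.\<close>

lemma split_idempotent:
  fixes V :: "('a, 'k::field) rep"
  assumes V: "modl V" and e: "ghom V V e" "e * e = e"
  shows "\<exists>W i p. modl W \<and> ghom W V i \<and> ghom V W p \<and> i * p = e \<and> p * i = idm (rdim W)"
proof -
  let ?n = "rdim V"
  let ?e = "mt ?n ?n e"
  have he: "is_hom G V V ?e" by (rule ghom_is_hom[OF V V e(1)])
  have fe: "fm ?e = e" using e by (simp add: fm_mt)
  obtain W K where W: "modl W" "is_hom G W V K" "inj_mat K" "mat_range K = mat_range ?e"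
    using sub_rep[OF V range_submodule[OF V V he]] by blast
  have K: "K \<in> carrier_mat ?n (rdim W)" using W by (simp add: is_hom_def)
  have i: "ghom W V (fm K)" using is_hom_ghom[OF W(1) V W(2)] .
  obtain p where p: "block (rdim W) ?n p" "fm K * p = e"
  proof (rule fm_mat_factor[OF K ghom_block[OF e(1)]])
    fix j assume j: "j < ?n"
    show "col ?e j \<in> mat_range K"
      unfolding W(4) mat_range_carrier[OF mt_carrier]
      using mult_unit_vec_col[OF mt_carrier j, of ?n e] by (metis image_eqI unit_vec_carrier)
  qed blast
  obtain x where x: "block ?n (rdim W) x" "fm ?e * x = fm K"
  proof (rule fm_mat_factor[OF mt_carrier block_fm[OF K], of ?n e])
    fix j assume j: "j < rdim W"
    show "col (mt ?n (rdim W) (fm K)) j \<in> mat_range ?e"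
      unfolding W(4)[symmetric] mt_fm[OF K] mat_range_carrier[OF K]
      using mult_unit_vec_col[OF K j] by (metis image_eqI unit_vec_carrier)
  qed blast
  have eK: "e * fm K = fm K" using x(2) fe e(2) by (metis mult.assoc)
  define P where "P = mt (rdim W) ?n p"
  have P: "P \<in> carrier_mat (rdim W) ?n" "fm P = p" using p by (auto simp: P_def fm_mt)
  have "K * (P * K) = K * 1\<^sub>m (rdim W)"
  proof (rule fm_inj)
    show "fm (K * (P * K)) = fm (K * 1\<^sub>m (rdim W))"
      using K P p(2) eK by (simp add: fm_times[OF K mult_carrier_mat[OF P(1) K]] fm_times[OF P(1) K] mult.assoc[symmetric])
  qed (use K P in \<open>auto intro: mult_carrier_mat\<close>)
  then have "P * K = 1\<^sub>m (rdim W)"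
    using inj_mat_cancel[OF K W(3), of "P * K" "rdim W" "1\<^sub>m (rdim W)"] K P by auto
  then have pK: "p * fm K = idm (rdim W)" using fm_times[OF P(1) K] P(2) by simp
  have "ghom V W p"
    by (rule ghom_cancel[OF i pK W(1) V p(1)]) (use p e in simp)
  then show ?thesis using W(1) i p pK by blast
qed

end

section \<open>Projective modules and direct sums\<close>

definition emb :: "nat \<Rightarrow> nat \<Rightarrow> nat \<Rightarrow> 'a::comm_ring_1 fmat" where
  "emb n off m = fmat_of n m (\<lambda>i j. if i = j + off then 1 else 0)"

definition cut :: "nat \<Rightarrow> nat \<Rightarrow> nat \<Rightarrow> 'a::comm_ring_1 fmat" where
  "cut m off n = fmat_of m n (\<lambda>i j. if j = i + off then 1 else 0)"

lemma block_emb [simp]: "block n m (emb n off m)" and block_cut [simp]: "block m n (cut m off n)"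
  by (simp_all add: emb_def cut_def)

lemma entry_emb_times: "entry (emb n off m * X) i j = (if i < n \<and> off \<le> i \<and> i < off + m then entry X (i - off) j else 0)"
proof -
  have "entry (emb n off m * X) i j = (\<Sum>k<m. entry (emb n off m) i k * entry X k j)"
    by (rule entry_times_left[OF block_emb])
  also have "\<dots> = (\<Sum>k<m. if k = i - off then (if i < n \<and> off \<le> i then entry X (i - off) j else 0) else 0)"
    by (rule sum.cong) (auto simp: emb_def)
  finally show ?thesis by auto
qed

lemma entry_cut_times: "entry (cut m off n * X) i j = (if i < m \<and> i + off < n then entry X (i + off) j else 0)"
proof -
  have "entry (cut m off n * X) i j = (\<Sum>k<n. entry (cut m off n) i k * entry X k j)"
    by (rule entry_times_left[OF block_cut])
  also have "\<dots> = (\<Sum>k<n. if k = i + off then (if i < m then entry X (i + off) j else 0) else 0)"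
    by (rule sum.cong) (auto simp: cut_def)
  finally show ?thesis by auto
qed

lemma entry_times_cut: "entry (X * cut m off n) i j = (if j < n \<and> off \<le> j \<and> j < off + m then entry X i (j - off) else 0)"
proof -
  have "entry (X * cut m off n) i j = (\<Sum>k<m. entry X i k * entry (cut m off n) k j)"
    by (rule entry_times_right[OF block_cut])
  also have "\<dots> = (\<Sum>k<m. if k = j - off then (if j < n \<and> off \<le> j then entry X i (j - off) else 0) else 0)"
    by (rule sum.cong) (auto simp: cut_def)
  finally show ?thesis by auto
qed

lemma fm_diag_block_Cons:
  assumes A: "A \<in> carrier_mat n n" and D: "diag_block_mat As \<in> carrier_mat m m"
  shows "fm (diag_block_mat (A # As))
    = emb (n + m) 0 n * fm A * cut n 0 (n + m) + emb (n + m) n m * fm (diag_block_mat As) * cut m n (n + m)"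
proof (rule fmat_eqI)
  fix i j
  have d: "diag_block_mat (A # As) = four_block_mat A (0\<^sub>m n m) (0\<^sub>m m n) (diag_block_mat As)"
    using A D by (simp add: Let_def)
  show "entry (fm (diag_block_mat (A # As))) i j = entry (emb (n + m) 0 n * fm A * cut n 0 (n + m)
      + emb (n + m) n m * fm (diag_block_mat As) * cut m n (n + m)) i j"
    unfolding d entry_plus entry_times_cut entry_emb_times
    using A D by (auto simp: fm_def)
qed

lemma rdim_dsum [simp]: "rdim (dsum Vs) = (\<Sum>V\<leftarrow>Vs. rdim V)"
  by (simp add: dsum_def)

context fin_group begin

section \<open>The regular module and Higman's criterion\<close>

definition enum :: "nat \<Rightarrow> 'a" where
  "enum = (SOME e. bij_betw e {..<card (carrier G)} (carrier G))"

lemma enum_bij: "bij_betw enum {..<card (carrier G)} (carrier G)"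
proof -
  have "\<exists>e. bij_betw e {..<card (carrier G)} (carrier G)"
    using ex_bij_betw_nat_finite[OF fin] by (simp add: atLeast0LessThan)
  then show ?thesis unfolding enum_def by (rule someI_ex)
qed

lemma enum_in [simp]: "i < card (carrier G) \<Longrightarrow> enum i \<in> carrier G"
  using enum_bij bij_betwE by blast

lemma enum_eq: "i < card (carrier G) \<Longrightarrow> j < card (carrier G) \<Longrightarrow> enum i = enum j \<longleftrightarrow> i = j"
  using enum_bij by (auto simp: bij_betw_def inj_on_def)

lemma card_G [simp]: "0 < card (carrier G)"
  using fin one_closed card_gt_0_iff by blast

lemma sum_enum: "(\<Sum>i<card (carrier G). F (enum i)) = (\<Sum>x\<in>carrier G. F x)"
  by (rule sum.reindex_bij_betw[OF enum_bij])

definition regm :: "'a \<Rightarrow> 'f::field fmat" where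
  "regm g = fmat_of (card (carrier G)) (card (carrier G)) (\<lambda>i j. if enum i = g \<otimes> enum j then 1 else 0)"

definition reg :: "('a, 'f::field) rep" where
  "reg = mkrep (card (carrier G)) regm"

lemma block_regm: "block (card (carrier G)) (card (carrier G)) (regm g)"
  by (simp add: regm_def)

lemma rdim_reg [simp]: "rdim reg = card (carrier G)" by (simp add: reg_def)

lemma act_reg [simp]: "act reg g = regm g" by (simp add: reg_def act_mkrep block_regm)

lemma modl_reg: "modl (reg :: ('a, 'f::field) rep)"
  unfolding reg_def
proof (rule modl_mkrep[OF block_regm])
  show "regm \<one> = idm (card (carrier G))"
    by (rule fmat_eqI) (auto simp: regm_def entry_idm enum_eq)
  fix g h assume g: "g \<in> carrier G" and h: "h \<in> carrier G"
  show "regm (g \<otimes> h) = regm g * (regm h :: 'f fmat)"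
  proof (rule fmat_eqI)
    fix i j
    let ?N = "card (carrier G)"
    show "entry (regm (g \<otimes> h)) i j = entry (regm g * (regm h :: 'f fmat)) i j"
    proof (cases "i < ?N \<and> j < ?N")
      case True
      then have ij: "i < ?N" "j < ?N" by auto
      have "entry (regm g * (regm h :: 'f fmat)) i j = (\<Sum>k<?N. entry (regm g) i k * entry (regm h) k j)"
        by (rule entry_times_left[OF block_regm])
      also have "\<dots> = (\<Sum>k<?N. (\<lambda>x. (if enum i = g \<otimes> x then 1 else 0) * (if x = h \<otimes> enum j then 1 else 0)) (enum k))"
        by (rule sum.cong) (use ij in \<open>auto simp: regm_def\<close>)
      also have "\<dots> = (\<Sum>x\<in>carrier G. (if enum i = g \<otimes> x then 1 else 0) * (if x = h \<otimes> enum j then 1 else 0))"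
        by (rule sum_enum)
      also have "\<dots> = (\<Sum>x\<in>carrier G. if x = h \<otimes> enum j then (if enum i = g \<otimes> (h \<otimes> enum j) then 1 else 0) else 0)"
        by (rule sum.cong) auto
      also have "\<dots> = (if enum i = g \<otimes> (h \<otimes> enum j) then 1 else 0)"
        using fin ij h by simp
      also have "\<dots> = entry (regm (g \<otimes> h)) i j"
        using ij g h by (simp add: regm_def m_assoc)
      finally show ?thesis by simp
    qed (auto simp: blockD[OF block_regm] blockD[OF block_times[OF block_regm block_regm]] not_less)
  qed
qed

definition aug :: "'f::field fmat" where
  "aug = fmat_of (Suc 0) (card (carrier G)) (\<lambda>_ _. 1)"

text \<open>A linear section of the augmentation \<open>aug\<close>; it need not be
  equivariant.\<close>

definition point :: "'f::field fmat" where
  "point = fmat_of (card (carrier G)) (Suc 0) (\<lambda>i _. if i = 0 then 1 else 0)"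

lemma block_aug: "block (Suc 0) (card (carrier G)) aug" and block_point: "block (card (carrier G)) (Suc 0) point"
  by (simp_all add: aug_def point_def)

lemma aug_point: "aug * point = (idm (Suc 0) :: 'f::field fmat)"
proof (rule fmat_eqI)
  fix i j
  show "entry (aug * point) i j = entry (idm (Suc 0) :: 'f fmat) i j"
    unfolding entry_times_left[OF block_aug] by (auto simp: aug_def point_def entry_idm)
qed

lemma aug_regm:
  assumes g: "g \<in> carrier G" shows "aug * regm g = (aug :: 'f::field fmat)"
proof (rule fmat_eqI)
  fix i j
  let ?N = "card (carrier G)"
  show "entry (aug * regm g) i j = entry (aug :: 'f fmat) i j"
  proof (cases "i = 0 \<and> j < ?N")
    case True
    have "entry (aug * regm g) i j = (\<Sum>k<?N. (\<lambda>x. if x = g \<otimes> enum j then 1 else (0::'f)) (enum k))"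
      unfolding entry_times_left[OF block_aug]
      by (rule sum.cong) (use True in \<open>auto simp: regm_def aug_def\<close>)
    also have "\<dots> = (\<Sum>x\<in>carrier G. if x = g \<otimes> enum j then 1 else 0)" by (rule sum_enum)
    also have "\<dots> = 1" using True g fin by simp
    finally show ?thesis using True by (simp add: aug_def)
  qed (auto simp: blockD[OF block_aug] blockD[OF block_times[OF block_aug block_regm]] not_less)
qed

text \<open>The conjugates of the projection onto one basis vector are the projections onto all of
  them, each occurring once, so its transfer is the identity.\<close>

lemma proj_reg: "proj (reg :: ('a, 'f::field) rep)"
  unfolding proj_def stably_zero_def
proof (intro conjI exI)
  let ?N = "card (carrier G)"
  let ?E = "fmat_of ?N ?N (\<lambda>i j. if i = 0 \<and> j = 0 then 1 else 0) :: 'f fmat"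
  show "block (rdim reg) (rdim reg) ?E" by simp
  show "idm (rdim reg) = transfer reg reg ?E"
  proof (rule fmat_eqI)
    fix i j
    have b: "block ?N ?N (regm g * ?E)" "block ?N ?N (regm g * ?E * regm h)" for g h
      by (blast intro: block_times block_regm block_fmat_of)+
    show "entry (idm (rdim reg) :: 'f fmat) i j = entry (transfer reg reg ?E) i j"
    proof (cases "i < ?N \<and> j < ?N")
      case True
      then have ij: "i < ?N" "j < ?N" by auto
      have 1: "entry (regm g * ?E) i k = (if k = 0 \<and> enum i = g \<otimes> enum 0 then 1 else 0)" for g k
        unfolding entry_times_left[OF block_regm]
        by (subst sum.cong[OF refl, of _ _ "\<lambda>l. if l = 0 then (if k = 0 \<and> enum i = g \<otimes> enum 0 then 1 else 0) else 0"])
          (use ij in \<open>auto simp: regm_def\<close>)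
      have 2: "entry (regm g * ?E * regm h) i j
          = (if enum i = g \<otimes> enum 0 \<and> enum 0 = h \<otimes> enum j then 1 else 0)" for g h
        unfolding entry_times_left[OF b(1)] 1
        by (subst sum.cong[OF refl, of _ _ "\<lambda>l. if l = 0 then (if enum i = g \<otimes> enum 0 \<and> enum 0 = h \<otimes> enum j then 1 else 0) else 0"])
          (use ij in \<open>auto simp: regm_def\<close>)
      have "entry (transfer reg reg ?E) i j
          = (\<Sum>g\<in>carrier G. if g = enum i \<otimes> inv (enum 0) then (if i = j then 1 else 0) else 0)"
        unfolding transfer_def entry_sum act_reg 2
      proof (rule sum.cong[OF refl])
        fix g assume g: "g \<in> carrier G"
        have e: "enum i \<in> carrier G" "enum 0 \<in> carrier G" "enum j \<in> carrier G" using ij by auto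
        have A: "enum i = g \<otimes> enum 0 \<longleftrightarrow> g = enum i \<otimes> inv (enum 0)"
          using inv_solve_right[OF g e(1,2)] by simp
        have "enum 0 = inv g \<otimes> enum j \<longleftrightarrow> enum j = g \<otimes> enum 0"
          using inv_solve_left[OF e(2) g e(3)] by simp
        then have B: "enum 0 = inv g \<otimes> enum j \<longleftrightarrow> i = j" if "enum i = g \<otimes> enum 0"
          using enum_eq[OF ij] that by metis
        show "(if enum i = g \<otimes> enum 0 \<and> enum 0 = inv g \<otimes> enum j then 1 else 0)
          = (if g = enum i \<otimes> inv (enum 0) then if i = j then 1 else 0 else (0::'f))"
        proof (cases "enum i = g \<otimes> enum 0")
          case True
          then have C: "g = enum i \<otimes> inv (enum 0)" using A by blast
          show ?thesis unfolding if_P[OF C] B[OF True] using True by simp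
        next
          case False
          then have C: "g \<noteq> enum i \<otimes> inv (enum 0)" using A by blast
          show ?thesis unfolding if_not_P[OF C] using False by simp
        qed
      qed
      also have "\<dots> = (if i = j then 1 else 0)" using fin ij by simp
      finally show ?thesis using ij by (simp add: entry_idm)
    next
      case False
      have "block ?N ?N (transfer reg reg ?E)" unfolding transfer_def act_reg using b by blast
      then show ?thesis using False by (auto simp: blockD entry_idm not_less)
    qed
  qed
qed (rule modl_reg)

text \<open>V \<otimes> FG is projective because FG is, and the augmentation of FG maps it onto
  V.\<close>

lemma proj_onto:
  assumes V: "modl V"
  shows "\<exists>P f s. proj P \<and> ghom P V f \<and> block (rdim P) (rdim V) s \<and> f * s = idm (rdim V)"
proof (intro exI conjI)
  let ?N = "card (carrier G)"
  let ?P = "tensor V reg"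
  let ?f = "tens (Suc 0) ?N (idm (rdim V)) aug"
  let ?s = "tens ?N (Suc 0) (idm (rdim V)) point"
  show "proj ?P" by (rule proj_tensor_right[OF V proj_reg])
  show "ghom ?P V ?f"
    unfolding ghom_def
  proof (intro conjI ballI)
    show "block (rdim V) (rdim ?P) ?f"
      using block_tens[OF block_idm[of "rdim V"] block_aug] by simp
    fix g assume g: "g \<in> carrier G"
    have "?f * act ?P g = tens (Suc 0) ?N (act V g) aug"
      using g V by (simp add: act_tensor modl_reg tens_times[OF disjI1, OF block_aug] aug_regm idm_times[OF act_block])
    also have "\<dots> = tens (Suc 0) (Suc 0) (act V g) (idm (Suc 0)) * ?f"
      using g V by (simp only: tens_times[OF disjI1, OF block_idm] idm_times[OF block_aug] times_idm[OF act_block])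
    also have "\<dots> = act V g * ?f" by simp
    finally show "?f * act ?P g = act V g * ?f" .
  qed
  show "block (rdim ?P) (rdim V) ?s"
    using block_tens[OF block_idm[of "rdim V"] block_point] by simp
  have "?f * ?s = tens (Suc 0) (Suc 0) (idm (rdim V)) (idm (Suc 0))"
    by (simp only: tens_times[OF disjI1, OF block_aug] aug_point idm_idm)
  then show "?f * ?s = idm (rdim V)" by simp
qed

text \<open>A transfer of T into W factors through any projective module with a linearly split map
  onto W: the first factor is the transfer of the linear lift s T.\<close>

lemma stably_zero_factor:
  assumes "modl V" "modl W" "stably_zero V W A"
  shows "\<exists>Q a b. proj Q \<and> ghom V Q a \<and> ghom Q W b \<and> A = b * a"
proof -
  obtain Q f s where Q: "proj Q" "ghom Q W f" "block (rdim Q) (rdim W) s" "f * s = idm (rdim W)"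
    using proj_onto[OF assms(2)] by blast
  obtain T where T: "block (rdim W) (rdim V) T" "A = transfer V W T" using assms(3) by (auto simp: stably_zero_def)
  have "modl Q" using Q by (simp add: proj_def)
  then have "ghom V Q (transfer V Q (s * T))"
    using assms Q T by (intro ghom_transfer) (auto intro: block_times)
  moreover have "A = f * transfer V Q (s * T)"
    unfolding T(2) ghom_times_transfer[OF Q(2)] mult.assoc[symmetric] Q(4) idm_times[OF T(1)] ..
  ultimately show ?thesis using Q by blast
qed

text \<open>A module with the lifting property is a retract of the projective module from
  \<open>proj_onto\<close>, so its identity is a transfer; the converse is
  \<open>proj_lift\<close>.\<close>

lemma projective_iff_proj: "projective G P \<longleftrightarrow> proj P"
proof
  assume P: "projective G P"
  then have m: "modl P" by (simp add: projective_def)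
  obtain Q f s where Q: "proj Q" "ghom Q P f" "block (rdim Q) (rdim P) s" "f * s = idm (rdim P)"
    using proj_onto[OF m] by blast
  have mQ: "modl Q" using Q by (simp add: proj_def)
  let ?f = "mt (rdim P) (rdim Q) f" and ?s = "mt (rdim Q) (rdim P) s"
  have hf: "is_hom G Q P ?f" by (rule ghom_is_hom[OF mQ m Q(2)])
  have "?f * ?s = 1\<^sub>m (rdim P)"
    by (rule fm_inj[of _ "rdim P" "rdim P"])
      (use Q in \<open>auto simp: fm_times[OF mt_carrier mt_carrier] fm_mt intro: mult_carrier_mat[OF mt_carrier mt_carrier]\<close>)
  then have "surj_mat ?f" by (rule right_inverse_surj_mat[OF mt_carrier mt_carrier])
  moreover have "is_hom G P P (1\<^sub>m (rdim P))"
    using m by (auto simp: is_hom_def is_module_def)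
  ultimately obtain h where h: "is_hom G P Q h" "?f * h = 1\<^sub>m (rdim P)"
    using P m mQ hf unfolding projective_def by blast
  have hc: "h \<in> carrier_mat (rdim Q) (rdim P)" using h by (simp add: is_hom_def)
  have gh: "ghom P Q (fm h)" by (rule is_hom_ghom[OF m mQ h(1)])
  have "f * fm h = idm (rdim P)"
    using h(2) fm_times[OF mt_carrier hc, of "rdim P" f] fm_mt[OF ghom_block[OF Q(2)]] by simp
  then have "stably_zero P P (idm (rdim P))"
    using stably_zero_right[OF proj_stably_zero_from[OF Q(1,2)] gh] by simp
  then show "proj P" using m by (simp add: proj_def)
next
  assume P: "proj P"
  then have m: "modl P" by (simp add: proj_def)
  show "projective G P"
    unfolding projective_def
  proof (intro conjI allI impI m)
    fix V W f g assume *: "modl V \<and> modl W \<and> is_hom G V W f \<and> surj_mat f \<and> is_hom G P W g"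
    have c: "f \<in> carrier_mat (rdim W) (rdim V)" "g \<in> carrier_mat (rdim W) (rdim P)"
      using * by (auto simp: is_hom_def)
    obtain s where s: "s \<in> carrier_mat (rdim V) (rdim W)" "f * s = 1\<^sub>m (rdim W)"
      using surj_mat_right_inverse[OF c(1)] * by blast
    have gf: "ghom V W (fm f)" and gg: "ghom P W (fm g)" using * m is_hom_ghom by blast+
    have fs: "fm f * fm s = idm (rdim W)" using s fm_times[OF c(1) s(1)] by simp
    obtain H where H: "ghom P V H" "fm f * H = fm g"
      using proj_lift[OF P _ gf block_fm[OF s(1)] fs gg] * by blast
    have "f * mt (rdim V) (rdim P) H = g"
      by (rule fm_inj[OF mult_carrier_mat[OF c(1) mt_carrier] c(2)])
        (simp add: fm_times[OF c(1) mt_carrier] fm_mt[OF ghom_block[OF H(1)]] H(2))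
    then show "\<exists>h. is_hom G P V h \<and> f * h = g"
      using ghom_is_hom[OF m _ H(1)] * by blast
  qed
qed

text \<open>The strict counterpart of \<open>stab_biprod_by\<close>, which the block structure of
  \<open>dsum\<close> provides.\<close>

definition bip where
  "bip X A B i p j q \<longleftrightarrow> modl X \<and> modl A \<and> modl B \<and>
     ghom A X i \<and> ghom X A p \<and> ghom B X j \<and> ghom X B q \<and>
     p * i = idm (rdim A) \<and> q * j = idm (rdim B) \<and>
     q * i = 0 \<and> p * j = 0 \<and> i * p + j * q = idm (rdim X)"

lemma bip_stab_biprod: "bip X A B i p j q \<Longrightarrow> stab_biprod X A B"
  unfolding bip_def stab_biprod_def stab_biprod_by_def by (metis diff_self stably_zero_zero)

lemma dsum_bip:
  fixes Vs :: "('a, 'k::field) rep list"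
  assumes "modl V" "modl (dsum Vs)"
  shows "\<exists>i p j q. bip (dsum (V # Vs)) V (dsum Vs) i p j q"
proof -
  define n where "n = rdim V"
  define m where "m = rdim (dsum Vs)"
  let ?X = "dsum (V # Vs)"
  let ?i = "emb (n + m) 0 n :: 'k fmat" and ?p = "cut n 0 (n + m) :: 'k fmat"
  let ?j = "emb (n + m) n m :: 'k fmat" and ?q = "cut m n (n + m) :: 'k fmat"
  have dX: "rdim ?X = n + m" by (simp add: n_def m_def)
  have c: "ract V g \<in> carrier_mat n n" "ract (dsum Vs) g \<in> carrier_mat m m" if "g \<in> carrier G" for g
    using assms that unfolding is_module_def n_def m_def by blast+
  have rX: "ract ?X g = diag_block_mat (ract V g # map (\<lambda>V. ract V g) Vs)" for g by (simp add: dsum_def)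
  have rV: "ract (dsum Vs) g = diag_block_mat (map (\<lambda>V. ract V g) Vs)" for g by (simp add: dsum_def)
  have aX: "act ?X g = ?i * act V g * ?p + ?j * act (dsum Vs) g * ?q" if g: "g \<in> carrier G" for g
    unfolding act_def rX rV by (rule fm_diag_block_Cons) (use c[OF g] rV in auto)
  have cX: "ract ?X g \<in> carrier_mat (n + m) (n + m)" if g: "g \<in> carrier G" for g
    using c[OF g] unfolding rX rV by (auto simp: Let_def)
  have e: "?p * ?i = idm n" "?q * ?j = idm m" "?q * ?i = 0" "?p * ?j = 0" "?i * ?p + ?j * ?q = idm (n + m)"
    by (rule fmat_eqI, unfold entry_plus entry_cut_times entry_emb_times,
      (auto simp: emb_def cut_def entry_idm)[1])+
  have e': "?p * (?i * Y) = idm n * Y" "?q * (?j * Y) = idm m * Y" "?q * (?i * Y) = 0" "?p * (?j * Y) = 0" for Y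
    by (simp_all add: mult.assoc[symmetric] e)
  have id: "idm n * act V g = act V g" "act V g * idm n = act V g" 
    "idm m * act (dsum Vs) g = act (dsum Vs) g" "act (dsum Vs) g * idm m = act (dsum Vs) g" if "g \<in> carrier G" for g
    using that assms unfolding n_def m_def by (blast intro: idm_times times_idm act_block)+
  have id': "idm n * (act V g * Y) = act V g * Y" 
    "idm m * (act (dsum Vs) g * Y) = act (dsum Vs) g * Y" if "g \<in> carrier G" for g Y
    using id[OF that] by (simp_all add: mult.assoc[symmetric])
  have mX: "modl ?X"
    unfolding is_module_def dX
  proof (intro conjI ballI)
    show "ract ?X g \<in> carrier_mat (n + m) (n + m)" if "g \<in> carrier G" for g using cX[OF that] .
    have "fm (ract ?X \<one>) = ?i * idm n * ?p + ?j * idm m * ?q"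
      using aX[OF one_closed] act_one[OF assms(1)] act_one[OF assms(2)] by (simp add: act_def[of ?X] n_def m_def)
    also have "\<dots> = idm (n + m)"
      unfolding times_idm[OF block_emb] by (rule e(5))
    finally show "ract ?X \<one> = 1\<^sub>m (n + m)"
      by (intro fm_inj[OF cX[OF one_closed]]) simp_all
    fix g h assume g: "g \<in> carrier G" and h: "h \<in> carrier G"
    have "act ?X (g \<otimes> h) = act ?X g * act ?X h"
      unfolding aX[OF g] aX[OF h] aX[OF m_closed[OF g h]]
      by (simp add: distrib_left distrib_right mult.assoc e' id' g h act_mult assms)
    then have "fm (ract ?X (g \<otimes> h)) = fm (ract ?X g * ract ?X h)"
      unfolding act_def fm_times[OF cX[OF g] cX[OF h]] .
    then show "ract ?X (g \<otimes> h) = ract ?X g * ract ?X h"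
      by (intro fm_inj[OF cX[OF m_closed[OF g h]] mult_carrier_mat[OF cX[OF g] cX[OF h]]])
  qed
  have "ghom V ?X ?i" "ghom ?X V ?p" "ghom (dsum Vs) ?X ?j" "ghom ?X (dsum Vs) ?q"
    unfolding ghom_def dX n_def[symmetric] m_def[symmetric]
    by (auto simp: aX distrib_left distrib_right mult.assoc e e' id id')
  then show ?thesis unfolding bip_def dX n_def[symmetric] m_def[symmetric] using mX assms e by blast
qed

lemma modl_dsum_Nil: "modl (dsum [])"
  by (auto simp: dsum_def is_module_def)

lemma proj_dsum_Nil: "proj (dsum [])"
  unfolding proj_def stably_zero_def using modl_dsum_Nil
  by (auto intro!: exI[of _ 0] fmat_eqI simp: entry_idm)

lemma modl_dsum: "(\<And>V. V \<in> set Vs \<Longrightarrow> modl V) \<Longrightarrow> modl (dsum Vs)"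
proof (induction Vs)
  case (Cons V Vs)
  then show ?case using dsum_bip[of V Vs] by (auto simp: bip_def)
qed (rule modl_dsum_Nil)

lemma stab_biprod_dsum: "modl V \<Longrightarrow> modl (dsum Vs) \<Longrightarrow> stab_biprod (dsum (V # Vs)) V (dsum Vs)"
  using dsum_bip bip_stab_biprod by blast

text \<open>The list ends in the zero module \<open>dsum []\<close>. Its projection has no rows and
  vanishes, so the inner sum \<open>dsum [W]\<close> can be replaced by \<open>W\<close>.\<close>

lemma dsum_two:
  fixes V :: "('a, 'k::field) rep"
  assumes "modl V" "modl W"
  shows "\<exists>i p j q. bip (dsum [V, W]) V W i p j q"
proof -
  obtain i p j q where 1: "bip (dsum [W]) W (dsum []) i p j q"
    using dsum_bip[OF assms(2) modl_dsum_Nil] by blast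
  note h1 = this[unfolded bip_def]
  obtain i' p' j' q' where 2: "bip (dsum [V, W]) V (dsum [W]) i' p' j' q'"
    using dsum_bip[OF assms(1), of "[W]"] h1 by blast
  note h2 = this[unfolded bip_def]
  have "ghom (dsum [W]) (dsum []) q" using h1 by blast
  then have "block 0 (rdim (dsum [W])) q" using ghom_block by fastforce
  then have "q = 0" by (intro fmat_eqI) (auto simp: blockD)
  then have ip: "i * p = idm (rdim (dsum [W]))" using h1 by simp
  have j': "j' * idm (rdim (dsum [W])) = j'" using h2 ghom_idm_right by blast
  have p: "idm (rdim W) * p = p" using h1 ghom_idm_left by blast
  have "bip (dsum [V, W]) V W i' p' (j' * i) (p * q')"
    unfolding bip_def
  proof (intro conjI)
    have "p * q' * (j' * i) = p * (q' * j') * i" by (simp add: mult.assoc)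
    also have "\<dots> = idm (rdim W)"
      using h1 h2 ghom_idm_right[of "dsum [W]" W p] by (simp add: mult.assoc[symmetric])
    finally show "p * q' * (j' * i) = idm (rdim W)" .
    have "i' * p' + j' * i * (p * q') = i' * p' + j' * (i * p) * q'" by (simp add: mult.assoc)
    also have "\<dots> = idm (rdim (dsum [V, W]))" unfolding ip j' using h2 by simp
    finally show "i' * p' + j' * i * (p * q') = idm (rdim (dsum [V, W]))" .
    show "p * q' * i' = 0" using h2 by (simp add: mult.assoc)
    show "p' * (j' * i) = 0" using h2 by (simp add: mult.assoc[symmetric])
  qed (use h1 h2 in \<open>blast intro: ghom_comp\<close>)+
  then show ?thesis by blast
qed

text \<open>Let 1 - g f = b a with a, b through a projective Q. The pair (f, a) embeds V into W + Q,
  and (g, b) retracts it. The complement Z of V is cut out by a stably zero idempotent, so Z is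
  projective and V + Z is isomorphic to W + Q.\<close>

lemma stab_iso_stably_equiv:
  fixes V :: "('a, 'k::field) rep"
  assumes "stab_iso V W" shows "stably_equiv G V W"
proof -
  obtain f g where f: "ghom V W f" "ghom W V g" "stably_zero V V (g * f - idm (rdim V))"
      "stably_zero W W (f * g - idm (rdim W))" and m: "modl V" "modl W"
    using assms by (auto simp: stab_iso_def)
  obtain Q a b where Q: "proj Q" "ghom V Q a" "ghom Q V b" "idm (rdim V) - g * f = b * a"
    using stably_zero_factor[OF m(1) m(1) stably_zero_minus_commute[OF f(3)]] by blast
  have mQ: "modl Q" using Q by (simp add: proj_def)
  obtain jW qW jQ qQ where Y: "bip (dsum [W, Q]) W Q jW qW jQ qQ"
    using dsum_two[OF m(2) mQ] by blast
  note hY = this[unfolded bip_def]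
  let ?Y = "dsum [W, Q]"
  have mY: "modl ?Y" using hY by blast
  define \<phi> where "\<phi> = jW * f + jQ * a"
  define \<psi> where "\<psi> = g * qW + b * qQ"
  have h\<phi>: "ghom V ?Y \<phi>" unfolding \<phi>_def using hY f Q by (blast intro: ghom_add ghom_comp)
  have h\<psi>: "ghom ?Y V \<psi>" unfolding \<psi>_def using hY f Q by (blast intro: ghom_add ghom_comp)
  have 0: "qW * (jW * x) = idm (rdim W) * x" "qQ * (jW * x) = 0" "qW * (jQ * x) = 0" "qQ * (jQ * x) = idm (rdim Q) * x" for x
    using hY by (simp_all add: mult.assoc[symmetric])
  have "\<psi> * \<phi> = g * f + b * a"
    unfolding \<phi>_def \<psi>_def
    by (simp add: distrib_left distrib_right mult.assoc 0 ghom_idm_left[OF f(1)] ghom_idm_left[OF Q(2)])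
  then have \<psi>\<phi>: "\<psi> * \<phi> = idm (rdim V)" using Q(4) by (metis add.commute diff_add_cancel)
  define e where "e = idm (rdim ?Y) - \<phi> * \<psi>"
  have he: "ghom ?Y ?Y e" unfolding e_def by (intro ghom_diff ghom_id[OF mY] ghom_comp[OF h\<phi> h\<psi>])
  have \<psi>e: "\<psi> * e = 0"
    unfolding e_def right_diff_distrib mult.assoc[symmetric] \<psi>\<phi> ghom_idm_left[OF h\<psi>] ghom_idm_right[OF h\<psi>] by simp
  have e\<phi>: "e * \<phi> = 0"
    unfolding e_def left_diff_distrib mult.assoc \<psi>\<phi> ghom_idm_left[OF h\<phi>] ghom_idm_right[OF h\<phi>] by simp
  have ee: "e * e = e"
    by (subst (1) e_def, unfold left_diff_distrib ghom_idm_left[OF he] mult.assoc \<psi>e) simp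
  obtain Z \<iota> \<pi> where Z: "modl Z" "ghom Z ?Y \<iota>" "ghom ?Y Z \<pi>" "\<iota> * \<pi> = e" "\<pi> * \<iota> = idm (rdim Z)"
    using split_idempotent[OF mY he ee] by blast
  \<comment> \<open>Block by block: on W the idempotent is 1 - f g, stably zero by assumption, and
    the three other blocks factor through Q.\<close>
  have "stably_zero ?Y ?Y (- (jW * (f * g - idm (rdim W)) * qW) - (jW * f) * (b * qQ) - (jQ * a) * (g * qW)
      + (jQ * (idm (rdim Q) - a * b)) * qQ)"
  proof (intro stably_zero_add stably_zero_diff stably_zero_uminus)
    show "stably_zero ?Y ?Y (jW * (f * g - idm (rdim W)) * qW)" using hY f by (blast intro: stably_zero_right stably_zero_left)
    have "stably_zero ?Y ?Y x" if "ghom Q ?Y u" "ghom ?Y Q v" "x = u * v" for x u v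
      unfolding that(3) by (rule stably_zero_right[OF proj_stably_zero_from[OF Q(1) that(1)] that(2)])
    note qf = this
    have "ghom Q ?Y (jW * f * b)" using hY f Q by (blast intro: ghom_comp)
    from qf[OF this] show "stably_zero ?Y ?Y ((jW * f) * (b * qQ))" using hY by (simp add: mult.assoc)
    have "ghom ?Y Q (a * g * qW)" using hY f Q by (blast intro: ghom_comp)
    from qf[OF _ this] show "stably_zero ?Y ?Y ((jQ * a) * (g * qW))" using hY by (simp add: mult.assoc)
    have "ghom Q ?Y (jQ * (idm (rdim Q) - a * b))" using hY Q ghom_id[OF mQ] by (blast intro: ghom_comp ghom_diff)
    from qf[OF this _ refl] show "stably_zero ?Y ?Y ((jQ * (idm (rdim Q) - a * b)) * qQ)" using hY by blast
  qed
  also have "- (jW * (f * g - idm (rdim W)) * qW) - (jW * f) * (b * qQ) - (jQ * a) * (g * qW)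
      + (jQ * (idm (rdim Q) - a * b)) * qQ
     = (jW * idm (rdim W)) * qW + (jQ * idm (rdim Q)) * qQ - \<phi> * \<psi>"
    unfolding \<phi>_def \<psi>_def by (simp add: algebra_simps)
  also have "\<dots> = e"
    unfolding e_def using hY ghom_idm_right[of W ?Y jW] ghom_idm_right[of Q ?Y jQ] by simp
  finally have "stably_zero ?Y ?Y e" .
  \<comment> \<open>The identity of Z is \<pi> e \<iota>, so it inherits stable vanishing from
    e.\<close>
  then have "stably_zero Z Z (\<pi> * e * \<iota>)" using stably_zero_left[OF Z(3)] stably_zero_right[OF _ Z(2)] by blast
  also have "\<pi> * e * \<iota> = idm (rdim Z)"
    unfolding Z(4)[symmetric] mult.assoc[symmetric] Z(5) idm_times[OF ghom_block[OF Z(3)]]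
    by (simp add: Z(5))
  finally have pZ: "proj Z" using Z(1) by (simp add: proj_def)
  have \<psi>\<iota>: "\<psi> * \<iota> = 0"
  proof -
    have "\<psi> * \<iota> = \<psi> * (\<iota> * \<pi>) * \<iota>" unfolding mult.assoc Z(5) ghom_idm_right[OF Z(2)] ..
    then show ?thesis unfolding Z(4) \<psi>e by simp
  qed
  have \<pi>\<phi>: "\<pi> * \<phi> = 0"
  proof -
    have "\<pi> * \<phi> = \<pi> * (\<iota> * \<pi>) * \<phi>" unfolding mult.assoc[symmetric] Z(5) ghom_idm_left[OF Z(3)] ..
    then show ?thesis unfolding Z(4) mult.assoc e\<phi> by simp
  qed
  obtain iV pV iZ qZ where X: "bip (dsum [V, Z]) V Z iV pV iZ qZ"
    using dsum_two[OF m(1) Z(1)] by blast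
  note hX = this[unfolded bip_def]
  have 1: "pV * (iV * x) = idm (rdim V) * x" "qZ * (iV * x) = 0" "pV * (iZ * x) = 0" "qZ * (iZ * x) = idm (rdim Z) * x" for x
    using hX by (simp_all add: mult.assoc[symmetric])
  have 2: "\<psi> * (\<phi> * x) = idm (rdim V) * x" "\<psi> * (\<iota> * x) = 0" "\<pi> * (\<phi> * x) = 0" "\<pi> * (\<iota> * x) = idm (rdim Z) * x" for x
    using \<psi>\<phi> \<psi>\<iota> \<pi>\<phi> Z(5) by (simp_all add: mult.assoc[symmetric])
  have "giso (dsum [V, Z]) ?Y"
    unfolding giso_def
  proof (intro conjI exI)
    show "ghom (dsum [V, Z]) ?Y (\<phi> * pV + \<iota> * qZ)" using hX h\<phi> Z by (blast intro: ghom_add ghom_comp)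
    show "ghom ?Y (dsum [V, Z]) (iV * \<psi> + iZ * \<pi>)" using hX h\<psi> Z by (blast intro: ghom_add ghom_comp)
    have idx: "idm (rdim V) * pV = pV" "idm (rdim Z) * qZ = qZ" "idm (rdim V) * \<psi> = \<psi>" "idm (rdim Z) * \<pi> = \<pi>"
      using hX h\<psi> Z by (blast intro: ghom_idm_left)+
    show "(iV * \<psi> + iZ * \<pi>) * (\<phi> * pV + \<iota> * qZ) = idm (rdim (dsum [V, Z]))"
      using hX by (simp add: distrib_left distrib_right mult.assoc 2 idx)
    have "(\<phi> * pV + \<iota> * qZ) * (iV * \<psi> + iZ * \<pi>) = \<phi> * \<psi> + \<iota> * \<pi>"
      by (simp add: distrib_left distrib_right mult.assoc 1 idx)
    also have "\<dots> = idm (rdim ?Y)" by (simp add: Z(4) e_def)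
    finally show "(\<phi> * pV + \<iota> * qZ) * (iV * \<psi> + iZ * \<pi>) = idm (rdim ?Y)" .
  qed (use hX mY in auto)
  then show ?thesis
    unfolding stably_equiv_def using pZ Q(1) giso_iso_modules projective_iff_proj by blast
qed

end

context fin_group begin

section \<open>Projective covers and Heller translates\<close>

lemma surj_ghom_section:
  assumes m: "modl P" "modl V" and f: "is_hom G P V f" "surj_mat f"
  shows "\<exists>s. block (rdim P) (rdim V) s \<and> fm f * s = idm (rdim V)"
proof -
  have c: "f \<in> carrier_mat (rdim V) (rdim P)" using f by (simp add: is_hom_def)
  obtain X where X: "X \<in> carrier_mat (rdim P) (rdim V)" "f * X = 1\<^sub>m (rdim V)"
    using surj_mat_right_inverse[OF c f(2)] by blast
  then show ?thesis using fm_times[OF c X(1)] by (intro exI[of _ "fm X"]) auto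
qed

lemma section_surj:
  assumes m: "modl P" "modl V" and f: "ghom P V f" and s: "block (rdim P) (rdim V) s" "f * s = idm (rdim V)"
  shows "surj_mat (mt (rdim V) (rdim P) f)"
proof (rule right_inverse_surj_mat[OF mt_carrier mt_carrier])
  show "mt (rdim V) (rdim P) f * mt (rdim P) (rdim V) s = 1\<^sub>m (rdim V)"
    by (rule fm_inj[OF mult_carrier_mat[OF mt_carrier mt_carrier] one_carrier_mat])
      (simp add: fm_times[OF mt_carrier mt_carrier] fm_mt[OF ghom_block[OF f]] fm_mt[OF s(1)] s(2))
qed

text \<open>A surjection onto \<open>V\<close> from a submodule of a projective module that has minimal dimension among
  these is a projective cover: the submodule is a retract.\<close>

lemma ex_projective_cover:
  fixes V :: "('a, 'k::field) rep"
  assumes V: "modl V"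
  shows "\<exists>P f. projective_cover G V P f"
proof -
  obtain P0 f0 s0 where P0: "proj P0" "ghom P0 V f0" "block (rdim P0) (rdim V) s0" "f0 * s0 = idm (rdim V)"
    using proj_onto[OF V] by blast
  have m0: "modl P0" using P0 by (simp add: proj_def)
  define cand where "cand d \<longleftrightarrow> (\<exists>W k s. modl W \<and> rdim W = d \<and> ghom W P0 k \<and>
      block (rdim W) (rdim V) s \<and> f0 * k * s = idm (rdim V))" for d
  have "cand (rdim P0)"
    unfolding cand_def using P0 m0 ghom_id[OF m0] ghom_idm_right[OF P0(2)] by metis
  then have cL: "cand (LEAST d. cand d)" by (rule LeastI)
  obtain W k s where W: "modl W" "rdim W = (LEAST d. cand d)" "ghom W P0 k"
      "block (rdim W) (rdim V) s" "f0 * k * s = idm (rdim V)"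
    using cL unfolding cand_def by blast
  have least: "rdim W \<le> rdim W'" if "modl W'" "ghom W' P0 k'" "block (rdim W') (rdim V) s'"
      "f0 * k' * s' = idm (rdim V)" for W' k' s'
    unfolding W(2) by (rule Least_le) (use that in \<open>auto simp: cand_def\<close>)
  define f where "f = f0 * k"
  have f: "ghom W V f" unfolding f_def by (rule ghom_comp[OF P0(2) W(3)])
  let ?f = "mt (rdim V) (rdim W) f"
  have hf: "is_hom G W V ?f" by (rule ghom_is_hom[OF W(1) V f])
  have fmf: "fm ?f = f" by (rule fm_mt[OF ghom_block[OF f]])
  have fs: "f * s = idm (rdim V)" using W(5) by (simp add: f_def)
  have surjf: "surj_mat ?f" by (rule section_surj[OF W(1) V f W(4) fs])
  have minimal: "U = carrier_vec (rdim W)"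
    if U: "is_submodule G W U" "(*\<^sub>v) ?f ` U = carrier_vec (rdim V)" for U
  proof -
    \<comment> \<open>U, made into a module, maps onto V as well and is therefore a candidate;
      minimality gives it the full dimension of W.\<close>
    obtain W2 k2 where W2: "modl W2" "is_hom G W2 W k2" "inj_mat k2" "mat_range k2 = U"
      using sub_rep[OF W(1) U(1)] by blast
    have k2c: "k2 \<in> carrier_mat (rdim W) (rdim W2)" using W2 by (simp add: is_hom_def)
    have "surj_mat (?f * k2)"
      unfolding surj_mat_def
    proof -
      have "mat_range (?f * k2) = (*\<^sub>v) (?f * k2) ` carrier_vec (rdim W2)"
        by (rule mat_range_carrier[OF mult_carrier_mat[OF mt_carrier k2c]])
      also have "\<dots> = (*\<^sub>v) ?f ` ((*\<^sub>v) k2 ` carrier_vec (rdim W2))"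
        unfolding image_image
        by (rule image_cong[OF refl]) (rule assoc_mult_mat_vec[OF mt_carrier k2c])
      also have "\<dots> = carrier_vec (rdim V)"
        using U(2) W2(4) unfolding mat_range_carrier[OF k2c] by simp
      finally show "mat_range (?f * k2) = carrier_vec (dim_row (?f * k2))" by (simp add: mt_def)
    qed
    then obtain X where X: "X \<in> carrier_mat (rdim W2) (rdim V)" "?f * k2 * X = 1\<^sub>m (rdim V)"
      using surj_mat_right_inverse[OF mult_carrier_mat[OF mt_carrier k2c]] by blast
    have "fm (?f * k2 * X) = f * fm k2 * fm X"
      unfolding fm_times[OF mult_carrier_mat[OF mt_carrier k2c] X(1)] fm_times[OF mt_carrier k2c] fmf ..
    then have "f0 * (k * fm k2) * fm X = idm (rdim V)" using X(2) by (simp add: f_def mult.assoc)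
    moreover have "ghom W2 P0 (k * fm k2)"
      by (rule ghom_comp[OF W(3) is_hom_ghom[OF W2(1) W(1) W2(2)]])
    ultimately have "rdim W \<le> rdim W2" using least[OF W2(1) _ block_fm[OF X(1)]] by blast
    moreover have "rdim W2 \<le> rdim W" by (rule inj_mat_le[OF k2c W2(3)])
    ultimately have "rdim W2 = rdim W" by simp
    then have "surj_mat k2" using inj_mat_square[of k2 "rdim W"] k2c W2(3) by simp
    then show ?thesis using W2(4) k2c by (auto simp: surj_mat_def)
  qed
  \<comment> \<open>Projectivity of \<open>P0\<close> lifts f0 to g along f. The endomorphism g k of
    W lies over V, so its image still covers V and is all of W by minimality. Thus g k is invertible
    and W is a retract of \<open>P0\<close>.\<close>
  obtain g where g: "ghom P0 W g" "f * g = f0"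
    using proj_lift[OF P0(1) W(1) f W(4) fs P0(2)] by blast
  define h where "h = g * k"
  have h: "ghom W W h" unfolding h_def by (rule ghom_comp[OF g(1) W(3)])
  let ?h = "mt (rdim W) (rdim W) h"
  have hh: "is_hom G W W ?h" by (rule ghom_is_hom[OF W(1) W(1) h])
  have fmh: "fm ?h = h" by (rule fm_mt[OF ghom_block[OF h]])
  have "f * h = f" unfolding h_def mult.assoc[symmetric] g(2) by (simp add: f_def)
  then have fh: "?f * ?h = ?f"
    by (intro fm_inj[OF mult_carrier_mat[OF mt_carrier mt_carrier] mt_carrier])
      (simp add: fm_times[OF mt_carrier mt_carrier] fmf fmh)
  have "(*\<^sub>v) ?f ` mat_range ?h = (*\<^sub>v) ?f ` carrier_vec (rdim W)"
    unfolding mat_range_carrier[OF mt_carrier] image_image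
    by (rule image_cong[OF refl]) (simp only: assoc_mult_mat_vec[OF mt_carrier mt_carrier, symmetric] fh)
  also have "\<dots> = carrier_vec (rdim V)"
    using surjf by (simp add: surj_mat_def mat_range_def mt_def)
  finally have "mat_range ?h = carrier_vec (rdim W)"
    by (intro minimal range_submodule[OF W(1) W(1) hh])
  then have "surj_mat ?h" by (simp add: surj_mat_def mt_def)
  then obtain X where X: "X \<in> carrier_mat (rdim W) (rdim W)" "?h * X = 1\<^sub>m (rdim W)"
    using surj_mat_right_inverse[OF mt_carrier] by blast
  have "X * ?h = 1\<^sub>m (rdim W)" by (rule mat_mult_left_right_inverse[OF mt_carrier X])
  then have "inj_mat ?h" by (rule inj_mat_left_inverse[OF mt_carrier X(1)])
  then obtain e where e: "ghom W W e" "e * h = idm (rdim W)"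
    using bij_hom_inverse[OF W(1) W(1) hh _ \<open>surj_mat ?h\<close>] fmh by auto
  have "stably_zero W W (e * g * k)"
    by (rule stably_zero_right[OF proj_stably_zero_from[OF P0(1) ghom_comp[OF e(1) g(1)]] W(3)])
  then have "proj W" using e(2) W(1) by (simp add: proj_def h_def mult.assoc)
  then have "projective_cover G V W ?f"
    unfolding projective_cover_def projective_iff_proj using hf surjf minimal by blast
  then show ?thesis by blast
qed

lemma ex_heller:
  fixes V :: "('a, 'k::field) rep"
  assumes V: "modl V"
  shows "\<exists>W. is_heller G V W"
proof -
  obtain P f where P: "projective_cover G V P f" using ex_projective_cover[OF V] by blast
  then have m: "modl P" and f: "is_hom G P V f"
    by (auto simp: projective_cover_def projective_def)
  obtain W k where "modl W" "is_hom G W P k" "inj_mat k" "mat_range k = mat_kernel f"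
    using sub_rep[OF m kernel_submodule[OF m V f]] by blast
  then show ?thesis unfolding is_heller_def using P by blast
qed

text \<open>A linear section s of f splits the sequence: 1 - s f takes values in the kernel of f,
  that is in the range of k, and factoring it through k yields the retraction t.\<close>

lemma is_heller_syzygy:
  fixes V :: "('a, 'k::field) rep"
  assumes V: "modl V" and W: "is_heller G V W"
  shows "syzygy V W"
proof -
  have mW: "modl W" using W unfolding is_heller_def by blast
  obtain P f k where h: "projective_cover G V P f" "is_hom G W P k" "inj_mat k" "mat_range k = mat_kernel f"
    using W by (auto simp: is_heller_def)
  have P: "proj P" "is_hom G P V f" "surj_mat f"
    using h(1) unfolding projective_cover_def projective_iff_proj by blast+
  have mP: "modl P" using P by (simp add: proj_def)
  have fc: "f \<in> carrier_mat (rdim V) (rdim P)" using P by (simp add: is_hom_def)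
  have kc: "k \<in> carrier_mat (rdim P) (rdim W)" using h by (simp add: is_hom_def)
  have gf: "ghom P V (fm f)" by (rule is_hom_ghom[OF mP V P(2)])
  have gk: "ghom W P (fm k)" by (rule is_hom_ghom[OF mW mP h(2)])
  obtain s where s: "block (rdim P) (rdim V) s" "fm f * s = idm (rdim V)"
    using surj_ghom_section[OF mP V P(2,3)] by blast
  have fk: "fm f * fm k = 0"
  proof -
    have "f * k = 0\<^sub>m (rdim V) (rdim W)"
    proof (rule mat_col_eqI)
      fix j assume "j < dim_col (0\<^sub>m (rdim V) (rdim W) :: 'k mat)"
      then have j: "j < rdim W" by simp
      have "col k j \<in> mat_range k"
        unfolding mat_range_carrier[OF kc] using mult_unit_vec_col[OF kc j] by (metis image_eqI unit_vec_carrier)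
      then have "f *\<^sub>v col k j = 0\<^sub>v (rdim V)" unfolding h(4) mat_kernel[OF fc] by blast
      then show "col (f * k) j = col (0\<^sub>m (rdim V) (rdim W)) j"
        using j col_mult2[OF fc kc j] by (auto intro!: eq_vecI)
    qed (use fc kc in auto)
    then have "fm (f * k) = 0" by (auto intro!: fmat_eqI simp: fm_def)
    then show ?thesis by (simp add: fm_times[OF fc kc])
  qed
  define c where "c = idm (rdim P) - s * fm f"
  have bc: "block (rdim P) (rdim P) c"
    unfolding c_def using s(1) block_fm[OF fc] by (blast intro: block_intros block_times block_idm)
  have fc0: "fm f * c = 0"
    unfolding c_def right_diff_distrib mult.assoc[symmetric] s(2) ghom_idm_left[OF gf] ghom_idm_right[OF gf] by simp
  obtain t where t: "block (rdim W) (rdim P) t" "fm k * t = c"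
  proof (rule fm_mat_factor[OF kc bc])
    fix j assume j: "j < rdim P"
    let ?c = "mt (rdim P) (rdim P) c"
    have "f * ?c = 0\<^sub>m (rdim V) (rdim P)"
      by (rule fm_inj[OF mult_carrier_mat[OF fc mt_carrier] zero_carrier_mat])
        (auto simp: fm_times[OF fc mt_carrier] fm_mt[OF bc] fc0 intro!: fmat_eqI, simp add: fm_def)
    then have "f *\<^sub>v col ?c j = 0\<^sub>v (rdim V)"
      using col_mult2[OF fc mt_carrier j, of c] j by simp
    then show "col ?c j \<in> mat_range k"
      unfolding h(4) mat_kernel[OF fc] by (auto intro: carrier_vecI simp: mt_def)
  qed blast
  have cs: "c * s = 0"
    unfolding c_def left_diff_distrib mult.assoc s(2) using s(1) by (simp add: idm_times times_idm)
  have inj: "x = y" if "fm k * x = fm k * y" "block (rdim W) n x" "block (rdim W) n y" for x y n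
  proof -
    have "k * mt (rdim W) n x = k * mt (rdim W) n y"
      by (rule fm_inj[OF mult_carrier_mat[OF kc mt_carrier] mult_carrier_mat[OF kc mt_carrier]])
        (simp add: fm_times[OF kc mt_carrier] fm_mt[OF that(2)] fm_mt[OF that(3)] that(1))
    then have "mt (rdim W) n x = mt (rdim W) n y" by (rule inj_mat_cancel[OF kc h(3) mt_carrier mt_carrier])
    then show ?thesis by (metis fm_mt that(2,3))
  qed
  have tk: "t * fm k = idm (rdim W)"
  proof (rule inj)
    have "fm k * (t * fm k) = c * fm k" by (simp add: mult.assoc[symmetric] t)
    also have "\<dots> = fm k" unfolding c_def left_diff_distrib mult.assoc fk ghom_idm_left[OF gk] by simp
    finally show "fm k * (t * fm k) = fm k * idm (rdim W)" by (simp add: ghom_idm_right[OF gk])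
    show "block (rdim W) (rdim W) (t * fm k)" by (rule block_times[OF t(1) ghom_block[OF gk]])
  qed simp
  have ts: "t * s = 0"
  proof (rule inj)
    show "fm k * (t * s) = fm k * 0" by (simp add: mult.assoc[symmetric] t cs)
    show "block (rdim W) (rdim V) (t * s)" by (rule block_times[OF t(1) s(1)])
  qed simp
  have "syzygy_by V W P (fm f) (fm k) s t"
    unfolding syzygy_by_def using V mW P(1) gf gk s t tk ts fk by (simp add: c_def)
  then show ?thesis unfolding syzygy_def by blast
qed

text \<open>Whatever module the choice in \<open>heller\<close> yields, it is a syzygy, and syzygies
  of stably isomorphic modules are stably isomorphic; nothing else about the choice enters
  later.\<close>

lemma heller_syzygy: "modl V \<Longrightarrow> syzygy V (heller G V)"
  unfolding heller_def using ex_heller is_heller_syzygy someI_ex by metis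

lemma modl_heller: "modl V \<Longrightarrow> modl (heller G V)"
  using heller_syzygy syzygy_modl by blast

lemma stab_iso_heller: "stab_iso V W \<Longrightarrow> stab_iso (heller G V) (heller G W)"
  using syzygy_stab_iso heller_syzygy stab_iso_modl by metis

lemma heller_power_Suc: "heller_power G (Suc n) V = heller G (heller_power G n V)"
  by (simp add: heller_power_def)

lemma heller_power_0 [simp]: "heller_power G 0 V = V"
  by (simp add: heller_power_def)

lemma modl_hp: "modl V \<Longrightarrow> modl (heller_power G n V)"
  by (induction n) (auto simp: heller_power_Suc modl_heller)

lemma stab_iso_hp: "stab_iso V W \<Longrightarrow> stab_iso (heller_power G n V) (heller_power G n W)"
  by (induction n) (auto simp: heller_power_Suc stab_iso_heller)

lemma stab_biprod_hp: "stab_biprod X A B \<Longrightarrow> stab_biprod (heller_power G n X) (heller_power G n A) (heller_power G n B)"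
  by (induction n) (auto simp: heller_power_Suc intro: syzygy_stab_biprod heller_syzygy dest: stab_biprod_modl)

lemma proj_hp: "proj V \<Longrightarrow> proj (heller_power G n V)"
  by (induction n) (auto simp: heller_power_Suc proj_def intro: syzygy_proj[unfolded proj_def, THEN conjunct2] syzygy_proj heller_syzygy modl_heller)

lemma heller_power_add: "heller_power G (m + n) V = heller_power G m (heller_power G n V)"
  by (simp add: heller_power_def funpow_add)

text \<open>Tensoring a syzygy sequence with W gives a syzygy sequence of the tensor product, which
  \<open>syzygy_stab_iso\<close> compares with the chosen one.\<close>

lemma hp_tensor_left:
  assumes "modl V" "modl W"
  shows "stab_iso (tensor (heller_power G n V) W) (heller_power G n (tensor V W))"
proof (induction n)
  case 0
  then show ?case using assms by (simp add: stab_iso_refl modl_tensor)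
next
  case (Suc n)
  let ?H = "heller_power G n V"
  have m: "modl ?H" "modl (tensor ?H W)" using assms modl_hp modl_tensor by blast+
  have "stab_iso (tensor (heller G ?H) W) (heller G (tensor ?H W))"
    by (rule syzygy_stab_iso[OF syzygy_tensor_left[OF heller_syzygy[OF m(1)] assms(2)] heller_syzygy[OF m(2)] stab_iso_refl[OF m(2)]])
  then show ?case unfolding heller_power_Suc using stab_iso_trans stab_iso_heller[OF Suc] by blast
qed

lemma hp_tensor_right:
  assumes "modl V" "modl W"
  shows "stab_iso (tensor W (heller_power G n V)) (heller_power G n (tensor W V))"
proof (induction n)
  case 0
  then show ?case using assms by (simp add: stab_iso_refl modl_tensor)
next
  case (Suc n)
  let ?H = "heller_power G n V"
  have m: "modl ?H" "modl (tensor W ?H)" using assms modl_hp modl_tensor by blast+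
  have "stab_iso (tensor W (heller G ?H)) (heller G (tensor W ?H))"
    by (rule syzygy_stab_iso[OF syzygy_tensor_right[OF heller_syzygy[OF m(1)] assms(2)] heller_syzygy[OF m(2)] stab_iso_refl[OF m(2)]])
  then show ?case unfolding heller_power_Suc using stab_iso_trans stab_iso_heller[OF Suc] by blast
qed

lemma modl_trivial: "modl trivial_module"
  by (auto simp: is_module_def trivial_module_def)

lemma modl_tensor_power: "modl V \<Longrightarrow> modl (tensor_power V n)"
  by (induction n) (auto simp: modl_trivial modl_tensor)

lemma stab_iso_tensor_power: "stab_iso V W \<Longrightarrow> stab_iso (tensor_power V n) (tensor_power W n)"
  by (induction n) (auto simp: stab_iso_refl modl_trivial stab_iso_tensor)

text \<open>Each further factor adds r to the shift: r is pulled out of the left factor, then the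
  accumulated shift out of the right one.\<close>

lemma tensor_power_hp:
  assumes V: "modl V"
  shows "stab_iso (tensor_power (heller_power G r V) n) (heller_power G (n * r) (tensor_power V n))"
proof (induction n)
  case 0
  then show ?case by (simp add: stab_iso_refl modl_trivial)
next
  case (Suc n)
  let ?H = "heller_power G r V" and ?T = "tensor_power V n"
  have m: "modl ?H" "modl ?T" "modl (heller_power G (n * r) ?T)"
    using V modl_hp modl_tensor_power by blast+
  have "stab_iso (tensor ?H (tensor_power ?H n)) (tensor ?H (heller_power G (n * r) ?T))"
    by (rule stab_iso_tensor_right[OF Suc m(1)])
  also have "stab_iso \<dots> (heller_power G r (tensor V (heller_power G (n * r) ?T)))"
    by (rule hp_tensor_left[OF V m(3)])
  also have "stab_iso \<dots> (heller_power G r (heller_power G (n * r) (tensor V ?T)))"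
    by (rule stab_iso_hp[OF hp_tensor_right[OF m(2) V]])
  finally show ?case by (simp add: heller_power_add)
qed

section \<open>Lists of summands up to stable isomorphism\<close>

lemma stab_iso_dsum: "list_all2 stab_iso Vs Ws \<Longrightarrow> stab_iso (dsum Vs) (dsum Ws)"
proof (induction rule: list_all2_induct)
  case Nil
  then show ?case by (simp add: stab_iso_refl modl_dsum_Nil)
next
  case (Cons V Vs W Ws)
  then show ?case by (meson stab_biprod_dsum stab_biprod_stab_isoI stab_iso_modl)
qed

lemma stab_biprod_dsum_append:
  assumes "\<And>V. V \<in> set As \<union> set Bs \<Longrightarrow> modl V"
  shows "stab_biprod (dsum (As @ Bs)) (dsum As) (dsum Bs)"
  using assms
proof (induction As)
  case Nil
  then show ?case
    using stab_biprod_commute[OF stab_iso_stab_biprod[OF stab_iso_refl[OF modl_dsum[of Bs]] proj_dsum_Nil]] by simp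
next
  case (Cons A As)
  have "stab_biprod (dsum (A # (As @ Bs))) A (dsum (As @ Bs))" "stab_biprod (dsum (A # As)) A (dsum As)"
    using Cons.prems by (auto intro!: stab_biprod_dsum modl_dsum)
  moreover have "stab_biprod (dsum (As @ Bs)) (dsum As) (dsum Bs)" using Cons by simp
  ultimately show ?case using stab_biprod_assoc by fastforce
qed

lemma stab_iso_dsum_mset:
  assumes "mset Vs = mset Ws" "\<And>V. V \<in> set Vs \<Longrightarrow> modl V"
  shows "stab_iso (dsum Vs) (dsum Ws)"
  using assms
proof (induction Vs arbitrary: Ws)
  case Nil
  then show ?case by (simp add: stab_iso_refl modl_dsum_Nil)
next
  case (Cons V Vs)
  have sW: "set Ws = insert V (set Vs)" using Cons.prems(1) by (metis list.simps(15) set_mset_mset)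
  obtain Xs Ys where Ws: "Ws = Xs @ V # Ys" using sW by (metis insertI1 split_list)
  have m: "modl U" if "U \<in> set Xs \<union> set (V # Ys)" for U using that Cons.prems(2) sW Ws by auto
  have "stab_iso (dsum Ws) (dsum ((V # Ys) @ Xs))"
    unfolding Ws
    by (rule stab_biprod_unique[OF stab_biprod_dsum_append[of Xs "V # Ys"] stab_biprod_commute[OF stab_biprod_dsum_append[of "V # Ys" Xs]]])
      (use m in auto)
  moreover have IH: "stab_iso (dsum Vs) (dsum (Ys @ Xs))"
    by (rule Cons.IH) (use Cons.prems Ws in \<open>auto simp: ac_simps\<close>)
  have "stab_iso (dsum (V # Vs)) (dsum (V # (Ys @ Xs)))"
    by (rule stab_biprod_stab_isoI[OF stab_biprod_dsum stab_biprod_dsum stab_iso_refl IH]) (use Cons.prems stab_iso_modl[OF IH] in auto)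
  ultimately show ?case using stab_iso_sym stab_iso_trans by fastforce
qed

end

context fin_group begin

lemma hp_dsum:
  assumes "\<And>V. V \<in> set Vs \<Longrightarrow> modl V"
  shows "stab_iso (heller_power G n (dsum Vs)) (dsum (map (heller_power G n) Vs))"
  using assms
proof (induction Vs)
  case Nil
  then show ?case by (simp add: stab_iso_proj proj_hp proj_dsum_Nil)
next
  case (Cons V Vs)
  have m: "modl V" "modl (dsum Vs)" "modl (dsum (map (heller_power G n) Vs))"
    using Cons.prems by (auto intro!: modl_dsum modl_hp)
  have IH: "stab_iso (heller_power G n (dsum Vs)) (dsum (map (heller_power G n) Vs))"
    using Cons by simp
  show ?case
    unfolding list.map
    by (rule stab_biprod_stab_isoI[OF stab_biprod_hp[OF stab_biprod_dsum[OF m(1,2)]] stab_biprod_dsum[OF modl_hp[OF m(1)] m(3)] stab_iso_refl[OF modl_hp[OF m(1)]] IH])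
qed

lemma tensor_dsum:
  assumes W: "modl W" and "\<And>V. V \<in> set Vs \<Longrightarrow> modl V"
  shows "stab_iso (tensor W (dsum Vs)) (dsum (map (tensor W) Vs))"
  using assms(2)
proof (induction Vs)
  case Nil
  then show ?case by (simp add: stab_iso_proj proj_tensor_right[OF W] proj_dsum_Nil)
next
  case (Cons V Vs)
  have m: "modl V" "modl (dsum Vs)" "modl (dsum (map (tensor W) Vs))"
    using Cons.prems by (auto intro!: modl_dsum modl_tensor[OF W])
  have IH: "stab_iso (tensor W (dsum Vs)) (dsum (map (tensor W) Vs))"
    using Cons by simp
  show ?case
    unfolding list.map
    by (rule stab_biprod_stab_isoI[OF stab_biprod_tensor_right[OF stab_biprod_dsum[OF m(1,2)] W] stab_biprod_dsum[OF modl_tensor[OF W m(1)] m(3)]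
          stab_iso_refl[OF modl_tensor[OF W m(1)]] IH])
qed

lemma dsum_concat:
  assumes "\<And>Vs V. Vs \<in> set Vss \<Longrightarrow> V \<in> set Vs \<Longrightarrow> modl V"
  shows "stab_iso (dsum (map dsum Vss)) (dsum (concat Vss))"
  using assms
proof (induction Vss)
  case Nil
  then show ?case by (simp add: stab_iso_refl modl_dsum_Nil)
next
  case (Cons Vs Vss)
  have m1: "modl (dsum Us)" if "Us \<in> set (Vs # Vss)" for Us
    using Cons.prems[OF that] by (rule modl_dsum)
  have m: "modl (dsum Vs)" "modl (dsum (map dsum Vss))"
    using m1 by (auto intro!: modl_dsum[of "map dsum Vss"])
  have IH: "stab_iso (dsum (map dsum Vss)) (dsum (concat Vss))"
    by (rule Cons.IH) (meson Cons.prems list.set_intros(2))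
  have "stab_biprod (dsum (Vs @ concat Vss)) (dsum Vs) (dsum (concat Vss))"
    using Cons.prems by (intro stab_biprod_dsum_append) auto
  from stab_biprod_stab_isoI[OF stab_biprod_dsum[OF m] this stab_iso_refl[OF m(1)] IH] show ?case by simp
qed

text \<open>The Schur complement of an invertible corner of an isomorphism is an isomorphism.\<close>

lemma stab_biprod_cancel_invertible:
  assumes 1: "stab_biprod_by B X Z i p j q" and 2: "stab_biprod_by B Y Z i' p' j' q'"
    and e: "ghom Z Z e" "e * (q' * j) = idm (rdim Z)" "(q' * j) * e = idm (rdim Z)"
  shows "stab_iso X Y"
proof -
  note h = 1[unfolded stab_biprod_by_def] 2[unfolded stab_biprod_by_def]
  have id: "i * idm (rdim X) = i" "idm (rdim B) * i = i" "p' * idm (rdim B) = p'" "idm (rdim B) * i' = i'"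
    "p * idm (rdim B) = p" "idm (rdim Z) * q = q" "j' * idm (rdim Z) = j'" "idm (rdim Z) * q' = q'"
    "q' * idm (rdim B) = q'" "idm (rdim B) * j = j" "j * idm (rdim Z) = j" "idm (rdim B) * j' = j'"
    "q * idm (rdim B) = q"
    using h by (blast intro: ghom_idm_left ghom_idm_right)+
  have e': "e * (q' * (j * x)) = idm (rdim Z) * x" "q' * (j * (e * x)) = idm (rdim Z) * x" for x
    using arg_cong[OF e(2), of "\<lambda>a. a * x"] arg_cong[OF e(3), of "\<lambda>a. a * x"] by (simp_all add: mult.assoc)
  \<comment> \<open>The identity of B is a 2 by 2 matrix between the two decompositions. \<phi> is
    the Schur complement of its corner q' j, and \<psi> is the entry of the inverse matrix from Y to
    X, which inverts that complement.\<close>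
  define \<phi> where "\<phi> = p' * i - p' * j * e * q' * i"
  define \<psi> where "\<psi> = p * i'"
  have h\<phi>: "ghom X Y \<phi>" and h\<psi>: "ghom Y X \<psi>"
    unfolding \<phi>_def \<psi>_def using h e(1) by (blast intro: ghom_comp ghom_diff)+
  have hz: "ghom Z Y (p' * j * e)" "ghom B Y (p' * j * e * q')" "ghom X Z (e * q' * i)"
    "ghom X B (j * e * q' * i)"
    using h e(1) by (blast intro: ghom_comp)+
  have n: "stably_zero Y Y (p' * (i * p + j * q - idm (rdim B)) * i')" "stably_zero Y Y (p' * i' - idm (rdim Y))"
    "stably_zero Y Y (p' * j * e * q' * (i * p + j * q - idm (rdim B)) * i')" "stably_zero Y Y (p' * j * e * (q' * i'))"
    "stably_zero X X (p * (i' * p' + j' * q' - idm (rdim B)) * i)" "stably_zero X X (p * i - idm (rdim X))"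
    "stably_zero X X (p * (i' * p' + j' * q' - idm (rdim B)) * (j * e * q' * i))" "stably_zero X X (p * j * (e * q' * i))"
    using h hz by (blast intro: stably_zero_left stably_zero_right)+
  have "stably_zero Y Y (p' * (i * p + j * q - idm (rdim B)) * i' + (p' * i' - idm (rdim Y))
     - p' * j * e * q' * (i * p + j * q - idm (rdim B)) * i' - p' * j * e * (q' * i'))"
    by (intro stably_zero_add stably_zero_diff n)
  also have "p' * (i * p + j * q - idm (rdim B)) * i' + (p' * i' - idm (rdim Y))
     - p' * j * e * q' * (i * p + j * q - idm (rdim B)) * i' - p' * j * e * (q' * i') = \<phi> * \<psi> - idm (rdim Y)"
    unfolding \<phi>_def \<psi>_def by (simp add: left_diff_distrib right_diff_distrib distrib_left distrib_right mult.assoc e' id)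
  finally have A: "stably_zero Y Y (\<phi> * \<psi> - idm (rdim Y))" .
  have "stably_zero X X (p * (i' * p' + j' * q' - idm (rdim B)) * i + (p * i - idm (rdim X))
     - p * (i' * p' + j' * q' - idm (rdim B)) * (j * e * q' * i) - p * j * (e * q' * i))"
    by (intro stably_zero_add stably_zero_diff n)
  also have "p * (i' * p' + j' * q' - idm (rdim B)) * i + (p * i - idm (rdim X))
     - p * (i' * p' + j' * q' - idm (rdim B)) * (j * e * q' * i) - p * j * (e * q' * i) = \<psi> * \<phi> - idm (rdim X)"
  proof -
    have "p * (j' * (q' * (j * (e * (q' * i))))) = p * (j' * (q' * i))" 
      by (simp add: e' id mult.assoc[symmetric, of "idm (rdim Z)"])
    then show ?thesis
      unfolding \<phi>_def \<psi>_def
      by (simp add: left_diff_distrib right_diff_distrib distrib_left distrib_right mult.assoc id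
          mult.assoc[symmetric, of "idm (rdim B)"])
  qed
  finally have B: "stably_zero X X (\<psi> * \<phi> - idm (rdim X))" .
  show ?thesis by (rule stab_isoI[OF _ _ h\<phi> h\<psi> B A]) (use h in blast)+
qed

text \<open>The component q' j from one copy of Z to the other decides. If it is nonzero, it is
  invertible and the Schur complement applies. Otherwise one copy is sheared so that a different
  component appears. If this one vanishes too, the identity of Z is stably zero, so Z is projective
  and both X and Y agree with B.\<close>

lemma stab_biprod_cancel:
  assumes 1: "stab_biprod A X Z" and 2: "stab_biprod B Y Z" and AB: "stab_iso A B"
    and div: "\<And>d. ghom Z Z d \<Longrightarrow> d \<noteq> 0 \<Longrightarrow> \<exists>e. ghom Z Z e \<and> e * d = idm (rdim Z) \<and> d * e = idm (rdim Z)"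
  shows "stab_iso X Y"
proof -
  obtain i p j q where s1: "stab_biprod_by B X Z i p j q" using stab_biprod_stab_iso[OF 1 AB] by (auto simp: stab_biprod_def)
  obtain i' p' j' q' where s2: "stab_biprod_by B Y Z i' p' j' q'" using 2 by (auto simp: stab_biprod_def)
  note h = s1[unfolded stab_biprod_by_def] s2[unfolded stab_biprod_by_def]
  have hd: "ghom Z Z (q' * j)" using h by (blast intro: ghom_comp)
  show ?thesis
  proof (cases "q' * j = 0")
    case False
    then show ?thesis using stab_biprod_cancel_invertible[OF s1 s2] div[OF hd] by blast
  next
    case True
    \<comment> \<open>Replacing j by j + i u and p by p - u q gives another biproduct, in which the
      component q' j becomes q' j + q' i p j'.\<close>
    define u where "u = p * j'"
    have hu: "ghom Z X u" unfolding u_def using h by (blast intro: ghom_comp)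
    have id: "u * idm (rdim Z) = u" "idm (rdim X) * u = u" "q' * idm (rdim B) = q'"
      using hu h by (blast intro: ghom_idm_left ghom_idm_right)+
    have "stably_zero X X ((p * i - idm (rdim X)) - u * (q * i))"
      by (rule stably_zero_diff; use h hu in \<open>blast intro: stably_zero_left stably_zero_right\<close>)
    then have n1: "stably_zero X X ((p - u * q) * i - idm (rdim X))"
      by (simp add: left_diff_distrib mult.assoc algebra_simps)
    have "stably_zero Z Z ((q * j - idm (rdim Z)) + (q * i) * u)"
      by (rule stably_zero_add; use h hu in \<open>blast intro: stably_zero_left stably_zero_right\<close>)
    then have n2: "stably_zero Z Z (q * (j + i * u) - idm (rdim Z))"
      by (simp add: distrib_left mult.assoc algebra_simps)
    have "stably_zero Z X (p * j + (p * i - idm (rdim X)) * u - u * (q * j - idm (rdim Z)) - u * (q * i) * u)"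
      by (rule stably_zero_diff[OF stably_zero_diff[OF stably_zero_add]]; use h hu in \<open>blast intro: stably_zero_left stably_zero_right\<close>)
    also have "p * j + (p * i - idm (rdim X)) * u - u * (q * j - idm (rdim Z)) - u * (q * i) * u
        = (p - u * q) * (j + i * u)"
      by (simp add: left_diff_distrib right_diff_distrib distrib_left distrib_right mult.assoc id)
    finally have n3: "stably_zero Z X ((p - u * q) * (j + i * u))" .
    have n4: "i * (p - u * q) + (j + i * u) * q = i * p + j * q"
      by (simp add: right_diff_distrib distrib_right mult.assoc)
    have g: "ghom B X (p - u * q)" "ghom Z B (j + i * u)"
      using h hu by (blast intro: ghom_comp ghom_add ghom_diff)+
    have "stab_biprod_by B X Z i (p - u * q) (j + i * u) q"
      unfolding stab_biprod_by_def n4 using h n1 n2 n3 g by blast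
    note s3 = this
    have hd': "ghom Z Z (q' * (j + i * u))"
      using h hu by (blast intro: ghom_comp ghom_add)
    show ?thesis
    proof (cases "q' * (j + i * u) = 0")
      case False
      then show ?thesis using stab_biprod_cancel_invertible[OF s3 s2] div[OF hd'] by blast
    next
      case 0: True
      \<comment> \<open>The identity of Z is stably q' j', and inserting i p + j q writes it through
        the two components that are zero here.\<close>
      have "stably_zero Z Z (q' * (i * p + j * q - idm (rdim B)) * j' + (q' * j' - idm (rdim Z)))"
        using h by (intro stably_zero_add; blast intro: stably_zero_left stably_zero_right)
      also have "q' * (i * p + j * q - idm (rdim B)) * j' + (q' * j' - idm (rdim Z))
          = q' * (j + i * u) - q' * j + (q' * j) * (q * j') - idm (rdim Z)"
        unfolding u_def by (simp add: left_diff_distrib right_diff_distrib distrib_left distrib_right mult.assoc id)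
      also have "\<dots> = - idm (rdim Z)" unfolding 0 True by simp
      finally have "proj Z" using stably_zero_uminus[of Z Z "- idm (rdim Z)"] h by (auto simp: proj_def)
      moreover have "stab_biprod B X Z" "stab_biprod B Y Z" using s1 s2 unfolding stab_biprod_def by blast+
      ultimately have "stab_iso B X" "stab_iso B Y" using stab_biprod_proj by blast+
      then show ?thesis by (rule stab_iso_trans[OF stab_iso_sym])
    qed
  qed
qed

lemma schur:
  assumes V: "simple_module G V" and W: "simple_module G W" and A: "is_hom G V W A"
    and nz: "A \<noteq> 0\<^sub>m (rdim W) (rdim V)"
  shows "inj_mat A" "surj_mat A"
proof -
  have m: "modl V" "modl W" using V W by (auto simp: simple_module_def)
  have c: "A \<in> carrier_mat (rdim W) (rdim V)" using A by (simp add: is_hom_def)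
  have z: "A = 0\<^sub>m (rdim W) (rdim V)" if "\<And>j. j < rdim V \<Longrightarrow> col A j = 0\<^sub>v (rdim W)"
    by (rule mat_col_eqI) (use that c in auto)
  have "mat_kernel A \<noteq> carrier_vec (rdim V)"
  proof
    assume *: "mat_kernel A = carrier_vec (rdim V)"
    have "col A j = 0\<^sub>v (rdim W)" if j: "j < rdim V" for j
    proof -
      have "unit_vec (rdim V) j \<in> mat_kernel A" unfolding * by (rule unit_vec_carrier)
      then show ?thesis unfolding mat_kernel[OF c] by (simp add: mult_unit_vec_col[OF c j])
    qed
    then show False using z nz by blast
  qed
  then have ker: "mat_kernel A = {0\<^sub>v (rdim V)}"
    using V kernel_submodule[OF m A] unfolding simple_module_def by blast
  show "inj_mat A"
  proof (rule inj_matI_kernel[OF c])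
    fix v assume "v \<in> carrier_vec (rdim V)" "A *\<^sub>v v = 0\<^sub>v (rdim W)"
    then have "v \<in> mat_kernel A" unfolding mat_kernel[OF c] by blast
    then show "v = 0\<^sub>v (rdim V)" using ker by blast
  qed
  have "mat_range A \<noteq> {0\<^sub>v (rdim W)}"
  proof
    assume *: "mat_range A = {0\<^sub>v (rdim W)}"
    have "col A j = 0\<^sub>v (rdim W)" if j: "j < rdim V" for j
    proof -
      have "col A j \<in> mat_range A"
        unfolding mat_range_carrier[OF c] using mult_unit_vec_col[OF c j] unit_vec_carrier by (metis image_eqI)
      then show ?thesis using * by blast
    qed
    then show False using z nz by blast
  qed
  then have "mat_range A = carrier_vec (rdim W)"
    using W range_submodule[OF m A] unfolding simple_module_def by blast
  then show "surj_mat A" using c by (auto simp: surj_mat_def)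
qed

text \<open>Supplies the division hypothesis of \<open>stab_biprod_cancel\<close> for a simple
  summand.\<close>

lemma simple_end_division:
  assumes Z: "simple_module G Z" and d: "ghom Z Z d" "d \<noteq> 0"
  shows "\<exists>e. ghom Z Z e \<and> e * d = idm (rdim Z) \<and> d * e = idm (rdim Z)"
proof -
  have m: "modl Z" using Z by (simp add: simple_module_def)
  let ?d = "mt (rdim Z) (rdim Z) d"
  have hd: "is_hom G Z Z ?d" by (rule ghom_is_hom[OF m m d(1)])
  have f: "fm ?d = d" by (rule fm_mt[OF ghom_block[OF d(1)]])
  have "fm (0\<^sub>m (rdim Z) (rdim Z)) = 0" by (auto intro!: fmat_eqI simp: fm_def)
  then have "?d \<noteq> 0\<^sub>m (rdim Z) (rdim Z)" using f d(2) by metis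
  then show ?thesis using bij_hom_inverse[OF m m hd schur[OF Z Z hd]] f by simp
qed

lemma simple_giso:
  assumes V: "simple_module G V" and W: "simple_module G W" and A: "ghom V W A" "A \<noteq> 0"
  shows "giso V W"
proof -
  have m: "modl V" "modl W" using V W by (auto simp: simple_module_def)
  let ?d = "mt (rdim W) (rdim V) A"
  have hd: "is_hom G V W ?d" by (rule ghom_is_hom[OF m A(1)])
  have f: "fm ?d = A" by (rule fm_mt[OF ghom_block[OF A(1)]])
  have "fm (0\<^sub>m (rdim W) (rdim V)) = 0" by (auto intro!: fmat_eqI simp: fm_def)
  then have "?d \<noteq> 0\<^sub>m (rdim W) (rdim V)" using f A(2) by metis
  then show ?thesis using bij_hom_giso[OF m hd schur[OF V W hd]] by simp
qed

end

section \<open>The heart of the permutation module\<close>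

locale char_sym =
  fixes p m :: nat and ty :: "'k::field itself"
  assumes prime: "prime p" and pm: "p = m + 2" and m0: "0 < m" and char: "CHAR('k) = p"
begin

abbreviation "G \<equiv> sym_group p"

lemma carrier_G: "carrier (sym_group p) = {g. g permutes {1..p}}"
  by (simp add: sym_group_def)

sublocale fin_group "sym_group p"
  by (intro fin_group.intro fin_group_axioms.intro sym_group_is_group)
    (simp add: carrier_G finite_permutations)

lemma p3: "3 \<le> p" using pm m0 by simp

lemma of_nat_p [simp]: "(of_nat p :: 'k) = 0"
  using of_nat_CHAR[where 'a = 'k] char by simp

lemma of_nat_nz: "0 < n \<Longrightarrow> n < p \<Longrightarrow> (of_nat n :: 'k) \<noteq> 0"
  unfolding of_nat_eq_0_iff_char_dvd char using nat_dvd_not_less by blast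

lemma two_nz [simp]: "(2 :: 'k) \<noteq> 0"
  using of_nat_nz[of 2] p3 by simp

lemma fact_nz: "n < p \<Longrightarrow> (of_nat (fact n) :: 'k) \<noteq> 0"
  unfolding of_nat_eq_0_iff_char_dvd char using prime_dvd_fact_iff[OF prime, of n] by simp

lemmas m = pm m0

text \<open>The source of the loop value -2: closing a strand labelled D gives the dimension m = p -
  2.\<close>

lemma of_nat_m: "(of_nat m :: 'k) = - 2"
proof -
  have "of_nat p = (of_nat m + 2 :: 'k)" by (subst m(1)) simp
  then show ?thesis by (simp add: eq_neg_iff_add_eq_0)
qed

definition points :: "nat set" where "points = {1..p}"

lemma points_iff: "a \<in> points \<longleftrightarrow> 1 \<le> a \<and> a \<le> p" by (auto simp: points_def)

lemma finite_points [simp]: "finite points" and card_points [simp]: "card points = p" by (simp_all add: points_def)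

lemma pf: "p \<noteq> Suc m" "Suc m \<noteq> p" "i < m \<Longrightarrow> Suc i \<noteq> p" "i < m \<Longrightarrow> p \<noteq> Suc i" "a \<le> m \<Longrightarrow> a \<noteq> p" "\<not> p \<le> m"
  using pm by auto

lemma points_cases: "a \<in> points \<Longrightarrow> (1 \<le> a \<and> a \<le> m \<and> a \<noteq> p \<and> a \<noteq> Suc m) \<or> a = Suc m \<or> a = p"
  unfolding points_iff using pm by linarith

lemma p_points [simp]: "p \<in> points" using p3 by (simp add: points_iff)

lemma sum_pick: "c \<in> points \<Longrightarrow> (\<Sum>a\<in>points. of_bool (a = c) * f a) = (f c :: 'b::comm_ring_1)"
proof -
  assume c: "c \<in> points"
  have "(\<Sum>a\<in>points. of_bool (a = c) * f a) = (\<Sum>a\<in>points. if a = c then f c else 0)"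
    by (rule sum.cong) auto
  then show ?thesis using c by simp
qed

lemma sum_pick1: "c \<in> points \<Longrightarrow> (\<Sum>a\<in>points. of_bool (a = c)) = (1 :: 'b::comm_ring_1)"
  using sum_pick[of c "\<lambda>_. 1"] by (simp del: sum_of_bool_eq)

lemma sum_pick_m: "(\<Sum>k<m. of_bool (a = Suc k) * f k) = (if 1 \<le> a \<and> a \<le> m then f (a - 1) else (0 :: 'b::comm_ring_1))"
proof -
  have "(\<Sum>k<m. of_bool (a = Suc k) * f k) = (\<Sum>k<m. if k = a - 1 then of_bool (1 \<le> a) * f (a - 1) else 0)"
    by (rule sum.cong) auto
  then show ?thesis by auto
qed

declare sum_of_bool_eq [simp del] sum_mult_of_bool_eq [simp del] sum_of_bool_mult_eq [simp del]

text \<open>The points of \<open>points\<close> give vectors \<open>pvec a\<close> of sum zero: the classes of \<open>x\<^sub>a - x\<^sub>p\<close> in the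
  quotient of the vectors of coordinate sum zero by the constants, in the basis
  \<open>x\<^sub>1 - x\<^sub>p, \<dots>, x\<^sub>p\<^sub>-\<^sub>2 - x\<^sub>p\<close>.  The row \<open>pform a\<close> is the standard symmetric form against \<open>pvec a\<close>.\<close>

definition pvec :: "nat \<Rightarrow> 'k fmat" where
  "pvec a = fmat_of m (Suc 0) (\<lambda>i _. of_bool (a = i + 1) - of_bool (a = Suc m))"

definition pform :: "nat \<Rightarrow> 'k fmat" where
  "pform a = fmat_of (Suc 0) m (\<lambda>_ j. of_bool (a = j + 1) - of_bool (a = p) + 1)"

text \<open>The Gram matrix of the vectors x_a - x_p under the standard form. All entries with a = p
  or b = p vanish.\<close>

definition sc :: "nat \<Rightarrow> nat \<Rightarrow> 'k" where
  "sc a b = of_bool (a = b) - of_bool (a = p) - of_bool (b = p) + 1"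

lemma sc_commute: "sc a b = sc b a" by (auto simp: sc_def)

lemma block_pvec [simp]: "block m (Suc 0) (pvec a)" and block_pform [simp]: "block (Suc 0) m (pform a)"
  by (simp_all add: pvec_def pform_def)

lemma pform_pvec: assumes "a \<in> points" "b \<in> points" shows "pform a * pvec b = sc a b \<cdot> idm (Suc 0)"
proof (rule fmat_eqI)
  fix i j
  show "entry (pform a * pvec b) i j = entry (sc a b \<cdot> idm (Suc 0)) i j"
  proof (cases "i = 0 \<and> j = 0")
    case True
    have "entry (pform a * pvec b) 0 0
      = (\<Sum>k<m. of_bool (b = Suc k) * (of_bool (a = Suc k) - of_bool (a = p) + 1))
        - of_bool (b = Suc m) * ((\<Sum>k<m. of_bool (a = Suc k) * 1) + of_nat m * (1 - of_bool (a = p)))"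
      unfolding entry_times_left[OF block_pform]
      by (simp add: pform_def pvec_def sum_distrib_left sum_subtractf[symmetric] sum.distrib[symmetric])
        (simp add: sum_subtractf sum.distrib algebra_simps sum_distrib_left sum_negf)
    also have "\<dots> = sc a b"
      unfolding sum_pick_m of_nat_m sc_def
      using points_cases[OF assms(1)] points_cases[OF assms(2)] by (auto simp: pf)
    finally show ?thesis using True by (simp add: entry_idm)
  next
    case False
    then show ?thesis
      using blockD[OF block_times[OF block_pform block_pvec], of i j a b] by (auto simp: entry_idm)
  qed
qed

lemma pvec_p [simp]: "pvec p = 0" and pform_p [simp]: "pform p = 0"
  by (auto intro!: fmat_eqI simp: pvec_def pform_def pf)

lemma pvec_point: "i < m \<Longrightarrow> Suc i \<in> points" "Suc m \<in> points"
  unfolding points_iff using pm by linarith+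

lemma sum_pvec: "(\<Sum>a\<in>points. pvec a) = 0"
proof (rule fmat_eqI)
  fix i j
  show "entry (\<Sum>a\<in>points. pvec a) i j = entry 0 i j"
    unfolding entry_sum using pvec_point(2) pvec_point(1)[of i]
    by (cases "i < m \<and> j = 0") (auto simp: pvec_def sum_subtractf sum_pick1)
qed

text \<open>The p vectors \<open>pvec a\<close> are linearly dependent but resolve the identity
  against their own forms, like a tight frame. This allows testing and expanding on all points at
  once instead of on a basis, which would break the symmetry.\<close>

lemma sum_pvec_pform: "(\<Sum>a\<in>points. pvec a * pform a) = idm m"
proof (rule fmat_eqI)
  fix i j
  have e: "entry (pvec a * pform a) i j = entry (pvec a) i 0 * entry (pform a) 0 j" for a
    unfolding entry_times_left[OF block_pvec] by simp
  show "entry (\<Sum>a\<in>points. pvec a * pform a) i j = entry (idm m) i j"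
  proof (cases "i < m \<and> j < m")
    case True
    then have "entry (\<Sum>a\<in>points. pvec a * pform a) i j
      = (\<Sum>a\<in>points. of_bool (a = Suc i) * entry (pform a) 0 j) - (\<Sum>a\<in>points. of_bool (a = Suc m) * entry (pform a) 0 j)"
      unfolding entry_sum e sum_subtractf[symmetric] by (intro sum.cong) (auto simp: pvec_def left_diff_distrib)
    also have "\<dots> = entry (pform (Suc i)) 0 j - entry (pform (Suc m)) 0 j"
      using pvec_point True by (simp only: sum_pick)
    finally show ?thesis using True by (auto simp: pform_def entry_idm pf)
  next
    case False
    have "block m m (\<Sum>a\<in>points. pvec a * pform a)" by (rule block_sum) (rule block_times[OF block_pvec block_pform])
    from blockD[OF this, of i j] show ?thesis using False
      by (auto simp: entry_idm not_less simp del: entry_sum)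
  qed
qed

lemma sum_points: "(\<Sum>a\<in>points. f a) = (\<Sum>j<m. f (Suc j)) + f (Suc m) + (f p :: 'b::comm_monoid_add)"
proof -
  have "points = {Suc 0..<Suc m} \<union> {Suc m, p}" unfolding points_def by (auto simp: pm)
  then have "(\<Sum>a\<in>points. f a) = (\<Sum>a\<in>{Suc 0..<Suc m}. f a) + (\<Sum>a\<in>{Suc m, p}. f a)"
    by (simp only:) (rule sum.union_disjoint, auto simp: pf pm)
  also have "(\<Sum>a\<in>{Suc 0..<Suc m}. f a) = (\<Sum>j<m. f (Suc j))"
    by (simp only: sum.atLeast_Suc_lessThan_Suc_shift comp_def atLeast0LessThan)
  finally show ?thesis by (simp add: add.assoc pf)
qed

lemma sum_sc_pvec: assumes "b \<in> points" shows "(\<Sum>a\<in>points. sc a b \<cdot> pvec a) = pvec b"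
proof -
  have "(\<Sum>a\<in>points. sc a b \<cdot> pvec a) = (\<Sum>a\<in>points. pvec a * pform a) * pvec b"
    unfolding sum_distrib_right by (rule sum.cong) (use assms in \<open>simp_all add: mult.assoc pform_pvec times_idm[OF block_pvec]\<close>)
  then show ?thesis by (simp add: sum_pvec_pform idm_times[OF block_pvec])
qed

lemma sum_sc: assumes "b \<in> points" shows "(\<Sum>a\<in>points. sc a b) = 0"
  using assms p_points by (simp add: sc_def sum_subtractf sum.distrib sum_pick1)

lemma sum_sc_sc: assumes "b \<in> points" "c \<in> points" shows "(\<Sum>a\<in>points. sc a b * sc a c) = sc b c"
proof -
  have "(\<Sum>a\<in>points. sc a b * sc a c) \<cdot> idm (Suc 0) = pform b * (\<Sum>a\<in>points. pvec a * pform a) * pvec c"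
    unfolding sum_distrib_left sum_distrib_right
  proof -
    have "pform b * (pvec a * pform a) * pvec c = (sc a b * sc a c) \<cdot> idm (Suc 0)" if "a \<in> points" for a
      using pform_pvec[OF assms(1) that] pform_pvec[OF that assms(2)]
      by (simp add: mult.assoc[symmetric] sc_commute) (simp add: mult.assoc)
    then show "(\<Sum>a\<in>points. sc a b * sc a c) \<cdot> idm (Suc 0) = (\<Sum>a\<in>points. pform b * (pvec a * pform a) * pvec c)"
      by (auto intro!: fmat_eqI simp: sum_distrib_right)
  qed
  also have "\<dots> = sc b c \<cdot> idm (Suc 0)"
    by (simp add: sum_pvec_pform times_idm[OF block_pform] pform_pvec assms)
  finally have "entry ((\<Sum>a\<in>points. sc a b * sc a c) \<cdot> idm (Suc 0)) 0 0 = entry (sc b c \<cdot> idm (Suc 0)) 0 0" by simp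
  then show ?thesis by (simp add: entry_idm)
qed

lemma pvec_test:
  assumes "block r m X" "block r m Y" "\<And>a. a \<in> points \<Longrightarrow> X * pvec a = Y * pvec a"
  shows "X = Y"
proof -
  have "X * (\<Sum>a\<in>points. pvec a * pform a) = Y * (\<Sum>a\<in>points. pvec a * pform a)"
    unfolding sum_distrib_left mult.assoc[symmetric] using assms(3) by simp
  then show ?thesis using assms by (simp add: sum_pvec_pform times_idm)
qed

text \<open>x_j - x_p goes to x_(g j) - x_(g p), the difference of two of the vectors
  \<open>pvec\<close>.\<close>

definition R :: "(nat \<Rightarrow> nat) \<Rightarrow> 'k fmat" where
  "R g = fmat_of m m (\<lambda>i j. entry (pvec (g (Suc j))) i 0 - entry (pvec (g p)) i 0)"

lemma block_R [simp]: "block m m (R g)" by (simp add: R_def)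

lemma perm_points: "g \<in> carrier G \<Longrightarrow> a \<in> points \<Longrightarrow> g a \<in> points"
  unfolding carrier_G points_def by (simp only: mem_Collect_eq permutes_in_image)

lemma perm_inj: "g \<in> carrier G \<Longrightarrow> g a = g b \<longleftrightarrow> a = b"
  unfolding carrier_G by (metis mem_Collect_eq permutes_inj injD)

lemma sum_perm: "g \<in> carrier G \<Longrightarrow> (\<Sum>a\<in>points. f (g a)) = (\<Sum>a\<in>points. f a)"
  unfolding carrier_G points_def using sum.permute[of g "{1..p}" f] by (simp add: comp_def)

text \<open>The vectors \<open>pvec a\<close> are not permuted: as x_p is subtracted in each of
  them, the correction \<open>pvec (g p)\<close> appears. Their differences are permuted.\<close>

lemma R_pvec:
  assumes g: "g \<in> carrier G" and a: "a \<in> points" shows "R g * pvec a = pvec (g a) - pvec (g p)"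
proof (rule fmat_eqI)
  fix i j
  show "entry (R g * pvec a) i j = entry (pvec (g a) - pvec (g p)) i j"
  proof (cases "i < m \<and> j = 0")
    case True
    have "entry (R g * pvec a) i j = (\<Sum>k<m. entry (R g) i k * entry (pvec a) k 0)"
      unfolding entry_times_left[OF block_R] using True by simp
    also have "\<dots> = (\<Sum>k<m. of_bool (a = Suc k) * (entry (pvec (g (Suc k))) i 0 - entry (pvec (g p)) i 0))
        - (\<Sum>k<m. of_bool (a = Suc m) * (entry (pvec (g (Suc k))) i 0 - entry (pvec (g p)) i 0))"
      unfolding sum_subtractf[symmetric]
      by (rule sum.cong) (use True in \<open>auto simp: R_def pvec_def[of a]\<close>)
    also have "\<dots> = (if 1 \<le> a \<and> a \<le> m then entry (pvec (g a)) i 0 - entry (pvec (g p)) i 0 else 0)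
        - of_bool (a = Suc m) * ((\<Sum>k<m. entry (pvec (g (Suc k))) i 0) + 2 * entry (pvec (g p)) i 0)"
      unfolding sum_pick_m sum_distrib_left[symmetric] sum_subtractf by (simp add: of_nat_m)
    \<comment> \<open>The point p - 1 has no basis vector of its own; its value comes from the
      vanishing of the sum over all points.\<close>
    also have "(\<Sum>k<m. entry (pvec (g (Suc k))) i 0) = - entry (pvec (g (Suc m))) i 0 - entry (pvec (g p)) i 0"
    proof -
      have "(\<Sum>a\<in>points. pvec (g a)) = 0" using sum_perm[OF g, of pvec] sum_pvec by simp
      then have "entry (\<Sum>a\<in>points. pvec (g a)) i 0 = 0" by simp
      then show ?thesis unfolding entry_sum sum_points by (simp add: algebra_simps eq_neg_iff_add_eq_0)
    qed
    finally show ?thesis using True points_cases[OF a] by (auto simp: pf)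
  next
    case False
    then show ?thesis
      using blockD[OF block_times[OF block_R block_pvec], of i j g a] blockD[OF block_pvec, of i j "g a"]
        blockD[OF block_pvec, of i j "g p"] by (auto simp: not_less)
  qed
qed

definition Dm :: "(nat \<Rightarrow> nat, 'k) rep" where "Dm = mkrep m R"

lemma rdim_Dm [simp]: "rdim Dm = m" by (simp add: Dm_def)

lemma act_Dm [simp]: "act Dm g = R g" by (simp add: Dm_def act_mkrep)

lemma sym_mult: "g \<otimes>\<^bsub>G\<^esub> h = g \<circ> h" and sym_one: "\<one>\<^bsub>G\<^esub> = id"
  by (simp_all add: sym_group_def)

lemma modl_Dm: "modl Dm"
  unfolding Dm_def
proof (rule modl_mkrep[OF block_R])
  show "R \<one>\<^bsub>G\<^esub> = idm m"
    by (rule pvec_test[of m]) (simp_all add: R_pvec idm_times[OF block_pvec], simp add: sym_one)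
  fix g h assume gh: "g \<in> carrier G" "h \<in> carrier G"
  show "R (g \<otimes>\<^bsub>G\<^esub> h) = R g * R h"
  proof (rule pvec_test[of m])
    fix a assume a: "a \<in> points"
    have "R g * R h * pvec a = R g * (pvec (h a) - pvec (h p))" by (simp add: mult.assoc R_pvec gh a)
    also have "\<dots> = pvec (g (h a)) - pvec (g (h p))"
      using gh a by (simp add: right_diff_distrib R_pvec perm_points)
    also have "\<dots> = R (g \<otimes>\<^bsub>G\<^esub> h) * pvec a"
      using R_pvec[OF m_closed[OF gh] a] by (simp add: sym_mult)
    finally show "R (g \<otimes>\<^bsub>G\<^esub> h) * pvec a = R g * R h * pvec a" by simp
  qed (auto intro: block_times[OF block_R block_R])
qed

lemma inv_perm: assumes "g \<in> carrier G" shows "g (inv' g a) = a" "inv' g (g a) = a"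
  using assms permutes_inverses[of g "{1..p}"] by (simp_all add: carrier_G)

lemma inv_carrier: "g \<in> carrier G \<Longrightarrow> inv' g \<in> carrier G" by (rule sym_group_inv_closed)

lemma inv_inv_perm: "g \<in> carrier G \<Longrightarrow> inv' (inv' g) = g"
  unfolding carrier_G using permutes_inv_inv by blast

text \<open>Invariance of the form, read on rows: inverse permutations from the right move the
  labels forward.\<close>

lemma pform_R:
  assumes g: "g \<in> carrier G" and a: "a \<in> points" shows "pform a * R (inv' g) = pform (g a) - pform (g p)"
proof (rule pvec_test[of "Suc 0"])
  fix b assume b: "b \<in> points"
  have i: "inv' g \<in> carrier G" using g by (rule inv_carrier)
  have eq: "a = (inv' g) c \<longleftrightarrow> g a = c" for a c using inv_perm[OF g] by metis
  have eq': "(inv' g) c = a \<longleftrightarrow> c = g a" for a c using inv_perm[OF g] by metis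
  have "pform a * R (inv' g) * pvec b = (sc a ((inv' g) b) - sc a ((inv' g) p)) \<cdot> idm (Suc 0)"
    using a b i by (simp add: mult.assoc R_pvec right_diff_distrib pform_pvec perm_points scale_distribs)
  also have "sc a ((inv' g) b) - sc a ((inv' g) p) = sc (g a) b - sc (g p) b"
    unfolding sc_def eq eq' by auto
  also have "\<dots> \<cdot> idm (Suc 0) = (pform (g a) - pform (g p)) * pvec b"
    using a b g by (simp add: left_diff_distrib pform_pvec perm_points scale_distribs)
  finally show "pform a * R (inv' g) * pvec b = (pform (g a) - pform (g p)) * pvec b" .
qed (auto intro: block_times[OF block_pform block_R])

section \<open>Swap, Casimir tensor and form on D \<otimes> D\<close>

definition swap :: "'k fmat" where
  "swap = fmat_of (m * m) (m * m) (\<lambda>i j. if i div m = j mod m \<and> i mod m = j div m then 1 else 0)"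

lemma block_swap [simp]: "block (m * m) (m * m) swap" by (simp add: swap_def)

lemma swap_times:
  assumes v: "block m (Suc 0) v" and w: "block m (Suc 0) w"
  shows "swap * tens m (Suc 0) v w = tens m (Suc 0) w v"
proof (rule fmat_eqI)
  fix i j
  have b: "block (m * m) (Suc 0) (tens m (Suc 0) v w)" if "block m (Suc 0) v" "block m (Suc 0) w" for v w :: "'k fmat"
    using block_tens[OF that] by simp
  show "entry (swap * tens m (Suc 0) v w) i j = entry (tens m (Suc 0) w v) i j"
  proof (cases "i < m * m \<and> j = 0")
    case True
    then have i: "i div m < m" "i mod m < m" using m0 by (auto simp: div_less_iff_less_mult)
    have "entry (swap * tens m (Suc 0) v w) i j
      = (\<Sum>k<m * m. (\<lambda>k1 k2. if i div m = k2 \<and> i mod m = k1 then entry v k1 0 * entry w k2 0 else 0) (k div m) (k mod m))"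
      unfolding entry_times_left[OF block_swap]
      by (rule sum.cong) (use True m0 in \<open>auto simp: swap_def entry_tens\<close>)
    also have "\<dots> = (\<Sum>k1<m. \<Sum>k2<m. if i div m = k2 \<and> i mod m = k1 then entry v k1 0 * entry w k2 0 else 0)"
      by (rule sum_div_mod) (rule m0)
    also have "\<dots> = (\<Sum>k1<m. if k1 = i mod m then entry v k1 0 * entry w (i div m) 0 else 0)"
    proof (rule sum.cong[OF refl])
      fix k1
      have "(\<Sum>k2<m. if i div m = k2 \<and> i mod m = k1 then entry v k1 0 * entry w k2 0 else 0)
        = (\<Sum>k2<m. if k2 = i div m then (if k1 = i mod m then entry v k1 0 * entry w (i div m) 0 else 0) else 0)"
        by (rule sum.cong) auto
      then show "(\<Sum>k2<m. if i div m = k2 \<and> i mod m = k1 then entry v k1 0 * entry w k2 0 else 0)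
        = (if k1 = i mod m then entry v k1 0 * entry w (i div m) 0 else 0)"
        using i by simp
    qed
    also have "\<dots> = entry (tens m (Suc 0) w v) i j"
      using i True m0 by (simp add: entry_tens mult.commute)
    finally show ?thesis .
  next
    case False
    then show ?thesis
      using blockD[OF block_times[OF block_swap b[OF v w]], of i j] blockD[OF b[OF w v], of i j]
      by (auto simp: not_less)
  qed
qed

text \<open>The Casimir tensor of the form. Dually, \<open>cap\<close> is the form itself as a map
  on D \<otimes> D, see \<open>cap_pvec2\<close>.\<close>

definition cup :: "'k fmat" where "cup = (\<Sum>a\<in>points. tens m (Suc 0) (pvec a) (pvec a))"

definition cap :: "'k fmat" where "cap = (\<Sum>a\<in>points. tens (Suc 0) m (pform a) (pform a))"

lemma block_pvec2: "block (m * m) (Suc 0) (tens m (Suc 0) (pvec a) (pvec b))"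
  using block_tens[OF block_pvec block_pvec] by simp

lemma block_pform2: "block (Suc 0) (m * m) (tens (Suc 0) m (pform a) (pform b))"
  using block_tens[OF block_pform block_pform] by simp

lemma block_cup [simp]: "block (m * m) (Suc 0) cup"
  unfolding cup_def by (rule block_sum) (rule block_pvec2)

lemma block_cap [simp]: "block (Suc 0) (m * m) cap"
  unfolding cap_def by (rule block_sum) (rule block_pform2)

lemma pform2_pvec2:
  assumes "a \<in> points" "b \<in> points" "c \<in> points" "e \<in> points"
  shows "tens (Suc 0) m (pform a) (pform b) * tens m (Suc 0) (pvec c) (pvec e) = (sc b e * sc a c) \<cdot> idm (Suc 0)"
  using tens_times[OF disjI1, OF block_pform, of "Suc 0" "pform a" b "Suc 0" "pvec c" "pvec e"] assms
  by (simp add: pform_pvec)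

lemma cap_pvec2:
  assumes "b \<in> points" "c \<in> points" shows "cap * tens m (Suc 0) (pvec b) (pvec c) = sc b c \<cdot> idm (Suc 0)"
proof -
  have "cap * tens m (Suc 0) (pvec b) (pvec c) = (\<Sum>a\<in>points. (sc a b * sc a c) \<cdot> idm (Suc 0))"
    unfolding cap_def sum_distrib_right by (rule sum.cong) (use assms in \<open>simp_all add: pform2_pvec2 mult.commute\<close>)
  also have "\<dots> = (\<Sum>a\<in>points. sc a b * sc a c) \<cdot> idm (Suc 0)"
    by (auto intro!: fmat_eqI simp: sum_distrib_right)
  finally show ?thesis using sum_sc_sc[OF assms] by simp
qed

lemma cap_cup: "cap * cup = (- 2) \<cdot> idm (Suc 0)"
proof -
  have "cap * cup = (\<Sum>a\<in>points. sc a a \<cdot> idm (Suc 0))"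
    unfolding cup_def sum_distrib_left by (rule sum.cong) (simp_all add: cap_pvec2)
  also have "\<dots> = (\<Sum>a\<in>points. sc a a) \<cdot> idm (Suc 0)"
    by (auto intro!: fmat_eqI simp: sum_distrib_right)
  \<comment> \<open>\<open>sc a a\<close> is 2 except at a = p, where it is 0; the sum 2 (m + 1)
    equals -2 as m = -2 in the field.\<close>
  also have "(\<Sum>a\<in>points. sc a a) = - 2"
  proof -
    have "(\<Sum>k<m. sc (Suc k) (Suc k)) = (\<Sum>k<m. 2)" by (rule sum.cong) (auto simp: sc_def pf)
    then have "(\<Sum>a\<in>points. sc a a) = of_nat m * 2 + 2" unfolding sum_points by (simp add: sc_def pf)
    then show ?thesis by (simp add: of_nat_m)
  qed
  finally show ?thesis .
qed

lemma swap_cup: "swap * cup = cup"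
  unfolding cup_def sum_distrib_left by (rule sum.cong) (simp_all add: swap_times)

lemma tens_R_pvec2:
  assumes "g \<in> carrier G" "b \<in> points" "c \<in> points"
  shows "tens m m (R g) (R g) * tens m (Suc 0) (pvec b) (pvec c) = tens m (Suc 0) (pvec (g b) - pvec (g p)) (pvec (g c) - pvec (g p))"
  using tens_times[OF disjI1, OF block_R, of m "R g" g "Suc 0" "pvec b" "pvec c"] assms by (simp add: R_pvec)

text \<open>Each factor moves to pvec (g a) - pvec (g p). The cross terms contain the sum of all
  \<open>pvec\<close>, and the last term consists of p equal tensors; both are zero.\<close>

lemma tens_R_cup: assumes "g \<in> carrier G" shows "tens m m (R g) (R g) * cup = cup"
proof -
  have s: "(\<Sum>a\<in>points. pvec (g a)) = 0" using sum_perm[OF assms, of pvec] sum_pvec by simp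
  have "tens m m (R g) (R g) * cup = (\<Sum>a\<in>points. tens m (Suc 0) (pvec (g a) - pvec (g p)) (pvec (g a) - pvec (g p)))"
    unfolding cup_def sum_distrib_left by (rule sum.cong) (use assms in \<open>simp_all add: tens_R_pvec2\<close>)
  also have "\<dots> = (\<Sum>a\<in>points. tens m (Suc 0) (pvec (g a)) (pvec (g a))) - tens m (Suc 0) (\<Sum>a\<in>points. pvec (g a)) (pvec (g p))
     - tens m (Suc 0) (pvec (g p)) (\<Sum>a\<in>points. pvec (g a)) + (\<Sum>a\<in>points. tens m (Suc 0) (pvec (g p)) (pvec (g p)))"
    unfolding tens_sum_left tens_sum_right sum_subtractf[symmetric] sum.distrib[symmetric]
    by (rule sum.cong) (simp_all add: tens_diff_left tens_diff_right)
  also have "(\<Sum>a\<in>points. tens m (Suc 0) (pvec (g p)) (pvec (g p))) = 0"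
    by (rule fmat_eqI) (simp add: sum_distrib_left[symmetric])
  also have "(\<Sum>a\<in>points. tens m (Suc 0) (pvec (g a)) (pvec (g a))) = cup"
    unfolding cup_def by (rule sum_perm[OF assms, of "\<lambda>a. tens m (Suc 0) (pvec a) (pvec a)"])
  finally show ?thesis by (simp add: s)
qed

end

lemma kronecker_carrier: "kronecker A B \<in> carrier_mat (dim_row A * dim_row B) (dim_col A * dim_col B)"
  by (simp add: kronecker_def)

lemma kronecker_assoc: "kronecker (kronecker A B) C = kronecker A (kronecker B C)"
proof (rule fm_inj)
  have d: "dim_row (kronecker X Y) = dim_row X * dim_row Y" "dim_col (kronecker X Y) = dim_col X * dim_col Y"
    for X Y :: "'a mat" by (simp_all add: kronecker_def)
  show "kronecker (kronecker A B) C \<in> carrier_mat (dim_row A * dim_row B * dim_row C) (dim_col A * dim_col B * dim_col C)"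
    using kronecker_carrier[of "kronecker A B" C] by (simp add: d)
  show "kronecker A (kronecker B C) \<in> carrier_mat (dim_row A * dim_row B * dim_row C) (dim_col A * dim_col B * dim_col C)"
    using kronecker_carrier[of A "kronecker B C"] by (simp add: d mult.assoc)
  show "fm (kronecker (kronecker A B) C) = fm (kronecker A (kronecker B C))"
    by (simp only: fm_kronecker d tens_assoc)
qed

lemma kronecker_one_right: "kronecker A (1\<^sub>m 1) = A"
  by (rule eq_matI) (auto simp: kronecker_def)

lemma kronecker_one_left: "kronecker (1\<^sub>m 1) A = A"
  by (rule eq_matI) (auto simp: kronecker_def)

text \<open>Mixed-radix indexing makes the tensor product strictly associative, and below strictly
  unital, so tensor powers are rebracketed by plain rewriting.\<close>

lemma tensor_assoc: "tensor (tensor U V) W = tensor U (tensor V W)"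
  by (simp add: tensor_def kronecker_assoc mult.assoc)

lemma tensor_trivial_right [simp]: "tensor V trivial_module = V"
  unfolding tensor_def trivial_module_def rep.simps kronecker_one_right by simp

lemma tensor_trivial_left [simp]: "tensor trivial_module V = V"
  unfolding tensor_def trivial_module_def rep.simps kronecker_one_left by simp

text \<open>Of the sixteen terms of the expansion, those with a factor alone in k or in l vanish
  because of the zero sums, and the two with all factors on one side because the cardinality is
  zero. The six balanced ones give every pairing twice.\<close>

lemma sum_four:
  fixes a b c e :: "'b \<Rightarrow> 'c::comm_ring_1"
  assumes z: "sum a S = 0" "sum b S = 0" "sum c S = 0" "sum e S = 0" and n: "(of_nat (card S) :: 'c) = 0"
  shows "(\<Sum>k\<in>S. \<Sum>l\<in>S. (a l - a k) * (b l - b k) * ((c l - c k) * (e l - e k)))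
    = 2 * ((\<Sum>l\<in>S. a l * b l) * (\<Sum>l\<in>S. c l * e l) + (\<Sum>l\<in>S. a l * c l) * (\<Sum>l\<in>S. b l * e l)
        + (\<Sum>l\<in>S. a l * e l) * (\<Sum>l\<in>S. b l * c l))"
proof -
  have P: "(\<Sum>k\<in>S. \<Sum>l\<in>S. f l * h k) = sum f S * sum h S" for f h :: "'b \<Rightarrow> 'c"
    by (subst sum.swap) (simp add: sum_product)
  have "(\<Sum>k\<in>S. \<Sum>l\<in>S. (a l - a k) * (b l - b k) * ((c l - c k) * (e l - e k)))
    = (\<Sum>k\<in>S. \<Sum>l\<in>S. (a l * b l * c l * e l) * 1 - (a l * b l * c l) * e k - (a l * b l * e l) * c k
      - (a l * c l * e l) * b k - (b l * c l * e l) * a k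
      + (a l * b l) * (c k * e k) + (a l * c l) * (b k * e k) + (a l * e l) * (b k * c k)
      + (b l * c l) * (a k * e k) + (b l * e l) * (a k * c k) + (c l * e l) * (a k * b k)
      - a l * (b k * c k * e k) - b l * (a k * c k * e k) - c l * (a k * b k * e k) - e l * (a k * b k * c k)
      + 1 * (a k * b k * c k * e k))"
    by (intro sum.cong refl) (simp add: algebra_simps)
  also have "\<dots> = 2 * ((\<Sum>l\<in>S. a l * b l) * (\<Sum>l\<in>S. c l * e l) + (\<Sum>l\<in>S. a l * c l) * (\<Sum>l\<in>S. b l * e l)
        + (\<Sum>l\<in>S. a l * e l) * (\<Sum>l\<in>S. b l * c l))"
    unfolding sum.distrib sum_subtractf P z sum_constant n by (simp add: algebra_simps)
  finally show ?thesis .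
qed

context char_sym begin

section \<open>Tensor powers of the spanning vectors, and the averaging argument\<close>

primrec tvec :: "nat list \<Rightarrow> 'k fmat" where
  "tvec [] = idm (Suc 0)"
| "tvec (a # as) = tens (m ^ length as) (Suc 0) (pvec a) (tvec as)"

primrec tform :: "nat list \<Rightarrow> 'k fmat" where
  "tform [] = idm (Suc 0)"
| "tform (a # as) = tens (Suc 0) (m ^ length as) (pform a) (tform as)"

lemma block_tvec: "block (m ^ length as) (Suc 0) (tvec as)"
proof (induction as)
  case (Cons a as)
  then show ?case using block_tens[OF block_pvec Cons, of a] by simp
qed simp

lemma block_tform: "block (Suc 0) (m ^ length as) (tform as)"
proof (induction as)
  case (Cons a as)
  then show ?case using block_tens[OF block_pform Cons, of a] by simp
qed simp

definition plist :: "nat \<Rightarrow> nat list set" where "plist n = {as. set as \<subseteq> points \<and> length as = n}"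

lemma finite_plist [simp]: "finite (plist n)"
  unfolding plist_def using finite_lists_length_eq[OF finite_points] by simp

lemma plist_0: "plist 0 = {[]}" by (auto simp: plist_def)

lemma sum_plist_Suc: "(\<Sum>as\<in>plist (Suc n). f as) = (\<Sum>a\<in>points. \<Sum>as\<in>plist n. f (a # as))"
proof -
  have "(\<Sum>as\<in>plist (Suc n). f as) = (\<Sum>(a, as)\<in>points \<times> plist n. f (a # as))"
    by (rule sum.reindex_bij_witness[of _ "\<lambda>(a, as). a # as" "\<lambda>as. (hd as, tl as)"])
      (auto simp: plist_def length_Suc_conv)
  then show ?thesis by (simp add: sum.cartesian_product)
qed

lemma sum_tvec_tform: "(\<Sum>as\<in>plist n. tvec as * tform as) = idm (m ^ n)"
proof (induction n)
  case 0
  then show ?case by (simp add: plist_0)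
next
  case (Suc n)
  have "(\<Sum>as\<in>plist (Suc n). tvec as * tform as)
      = (\<Sum>a\<in>points. \<Sum>as\<in>plist n. tens (m ^ n) (m ^ n) (pvec a * pform a) (tvec as * tform as))"
    unfolding sum_plist_Suc
  proof (intro sum.cong refl)
    fix a as assume "as \<in> plist n"
    then have l: "length as = n" by (simp add: plist_def)
    show "tvec (a # as) * tform (a # as) = tens (m ^ n) (m ^ n) (pvec a * pform a) (tvec as * tform as)"
      using tens_times[OF disjI1, OF block_tvec[of as]] by (simp add: l)
  qed
  also have "\<dots> = tens (m ^ n) (m ^ n) (\<Sum>a\<in>points. pvec a * pform a) (\<Sum>as\<in>plist n. tvec as * tform as)"
    by (subst sum.swap) (simp add: tens_sum_left tens_sum_right)
  finally show ?case by (simp add: Suc sum_pvec_pform)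
qed

lemma tvec_test:
  assumes "block r (m ^ n) X" "block r (m ^ n) Y" "\<And>as. as \<in> plist n \<Longrightarrow> X * tvec as = Y * tvec as"
  shows "X = Y"
proof -
  have "X * (\<Sum>as\<in>plist n. tvec as * tform as) = Y * (\<Sum>as\<in>plist n. tvec as * tform as)"
    unfolding sum_distrib_left mult.assoc[symmetric] using assms(3) by simp
  then show ?thesis using assms by (simp add: sum_tvec_tform times_idm)
qed

lemma plist2: "as \<in> plist 2 \<Longrightarrow> \<exists>a b. as = [a, b] \<and> a \<in> points \<and> b \<in> points"
  by (auto simp: plist_def length_Suc_conv numeral_2_eq_2)

lemma plist3: "as \<in> plist 3 \<Longrightarrow> \<exists>a b c. as = [a, b, c] \<and> a \<in> points \<and> b \<in> points \<and> c \<in> points"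
  by (auto simp: plist_def length_Suc_conv numeral_3_eq_3)

lemma pvec2_test:
  assumes "block r (m * m) X" "block r (m * m) Y"
    and "\<And>a b. a \<in> points \<Longrightarrow> b \<in> points \<Longrightarrow> X * tens m (Suc 0) (pvec a) (pvec b) = Y * tens m (Suc 0) (pvec a) (pvec b)"
  shows "X = Y"
proof (rule tvec_test[of r 2])
  fix as assume "as \<in> plist 2"
  then obtain a b where "as = [a, b]" "a \<in> points" "b \<in> points" using plist2 by blast
  then show "X * tvec as = Y * tvec as" using assms(3)[of a b] by simp
qed (use assms in \<open>simp_all add: power2_eq_square\<close>)

lemma swap_swap: "swap * swap = idm (m * m)"
  by (rule pvec2_test[of "m * m"]) (auto simp: mult.assoc swap_times idm_times[OF block_pvec2] intro: block_times[OF block_swap block_swap])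

lemma cap_swap: "cap * swap = cap"
  by (rule pvec2_test[of "Suc 0"]) (auto simp: mult.assoc swap_times cap_pvec2 sc_commute intro: block_times[OF block_cap block_swap])

lemma cap_R: assumes g: "g \<in> carrier G" shows "cap * tens m m (R g) (R g) = cap"
proof (rule pvec2_test[of "Suc 0"])
  fix b c assume bc: "b \<in> points" "c \<in> points"
  have "cap * tens m m (R g) (R g) * tens m (Suc 0) (pvec b) (pvec c)
      = (sc (g b) (g c) - sc (g b) (g p) - sc (g p) (g c) + sc (g p) (g p)) \<cdot> idm (Suc 0)"
    using g bc by (simp add: mult.assoc tens_R_pvec2 tens_diff_left tens_diff_right right_diff_distrib cap_pvec2 perm_points scale_distribs algebra_simps)
  also have "sc (g b) (g c) - sc (g b) (g p) - sc (g p) (g c) + sc (g p) (g p) = sc b c"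
    by (auto simp: sc_def perm_inj[OF g])
  finally show "cap * tens m m (R g) (R g) * tens m (Suc 0) (pvec b) (pvec c) = cap * tens m (Suc 0) (pvec b) (pvec c)"
    using bc by (simp add: cap_pvec2)
qed (use block_times[OF block_cap block_tens[OF block_R block_R]] in auto)

lemma swap_R: assumes g: "g \<in> carrier G" shows "swap * tens m m (R g) (R g) = tens m m (R g) (R g) * swap"
proof (rule pvec2_test[of "m * m"])
  fix b c assume bc: "b \<in> points" "c \<in> points"
  then show "swap * tens m m (R g) (R g) * tens m (Suc 0) (pvec b) (pvec c) = tens m m (R g) (R g) * swap * tens m (Suc 0) (pvec b) (pvec c)"
    using g by (simp add: mult.assoc tens_R_pvec2 swap_times)
qed (use block_times[OF block_swap block_tens[OF block_R block_R]] block_times[OF block_tens[OF block_R block_R] block_swap] in auto)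

lemma act_Dm2: "g \<in> carrier G \<Longrightarrow> act (tensor Dm Dm) g = tens m m (R g) (R g)"
  using act_tensor[OF modl_Dm modl_Dm] by simp

lemma ghom_swap: "ghom (tensor Dm Dm) (tensor Dm Dm) swap"
  unfolding ghom_def by (auto simp: act_Dm2 swap_R)

lemma rdim_trivial [simp]: "rdim trivial_module = Suc 0"
  by (simp add: trivial_module_def)

lemma act_trivial [simp]: "act trivial_module g = idm (Suc 0)"
  by (simp add: trivial_module_def act_def)

lemma ghom_cup: "ghom trivial_module (tensor Dm Dm) cup"
  unfolding ghom_def by (auto simp: act_Dm2 tens_R_cup times_idm[OF block_cup])

lemma ghom_cap: "ghom (tensor Dm Dm) trivial_module cap"
  unfolding ghom_def by (auto simp: act_Dm2 cap_R idm_times[OF block_cap])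

lemma sum_const_scale: "(\<Sum>x\<in>S. c) = of_nat (card S) \<cdot> (c :: 'k fmat)"
  by (rule fmat_eqI) simp

text \<open>Composition with the transposition of k and p matches the fibre over k with the one over
  p, so the p fibres share the p! permutations equally.\<close>

lemma card_fiber: assumes "k \<in> points" shows "card {g \<in> carrier G. g p = k} = fact (p - 1)"
proof -
  have eq: "card {g \<in> carrier G. g p = k} = card {g \<in> carrier G. g p = p}" if k: "k \<in> points" for k
  proof (rule bij_betw_same_card[of "\<lambda>g. Transposition.transpose k p \<circ> g"])
    have t: "Transposition.transpose k p permutes {1..p}"
      using k p_points by (intro permutes_swap_id) (auto simp: points_def)
    show "bij_betw (\<lambda>g. Transposition.transpose k p \<circ> g) {g \<in> carrier G. g p = k} {g \<in> carrier G. g p = p}"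
    proof (rule bij_betw_byWitness[of _ "\<lambda>g. Transposition.transpose k p \<circ> g"])
      have c: "Transposition.transpose k p \<circ> g \<in> carrier G" if "g \<in> carrier G" for g
        using permutes_compose[OF _ t, of g] that by (simp add: carrier_G)
      show "(\<lambda>g. Transposition.transpose k p \<circ> g) ` {g \<in> carrier G. g p = k} \<subseteq> {g \<in> carrier G. g p = p}"
      proof (rule image_subsetI)
        fix g assume g: "g \<in> {g \<in> carrier G. g p = k}"
        then have "(Transposition.transpose k p \<circ> g) p = p" by (simp only: comp_apply mem_Collect_eq transpose_apply_first)
        then show "Transposition.transpose k p \<circ> g \<in> {g \<in> carrier G. g p = p}" using c g by blast
      qed
      show "(\<lambda>g. Transposition.transpose k p \<circ> g) ` {g \<in> carrier G. g p = p} \<subseteq> {g \<in> carrier G. g p = k}"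
      proof (rule image_subsetI)
        fix g assume g: "g \<in> {g \<in> carrier G. g p = p}"
        then have "(Transposition.transpose k p \<circ> g) p = k" by (simp only: comp_apply mem_Collect_eq transpose_apply_second)
        then show "Transposition.transpose k p \<circ> g \<in> {g \<in> carrier G. g p = k}" using c g by blast
      qed
      have "Transposition.transpose k p \<circ> (Transposition.transpose k p \<circ> g) = g" for g :: "nat \<Rightarrow> nat"
        by (rule ext) simp
      then show "\<forall>g\<in>{g \<in> carrier G. g p = k}. Transposition.transpose k p \<circ> (Transposition.transpose k p \<circ> g) = g"
        "\<forall>g\<in>{g \<in> carrier G. g p = p}. Transposition.transpose k p \<circ> (Transposition.transpose k p \<circ> g) = g"
        by blast+
    qed
  qed
  have "fact p = card (carrier G)" by (rule sym_group_card_carrier[symmetric])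
  also have "\<dots> = (\<Sum>k\<in>points. card {g \<in> carrier G. g p = k})"
  proof -
    have "(\<Sum>k\<in>points. \<Sum>g\<in>{g \<in> carrier G. g p = k}. 1::nat) = (\<Sum>g\<in>carrier G. 1)"
      by (rule sum.group) (use fin perm_points in auto)
    then show ?thesis by simp
  qed
  also have "\<dots> = (\<Sum>k\<in>points. card {g \<in> carrier G. g p = p})"
    by (rule sum.cong[OF refl]) (rule eq)
  also have "\<dots> = p * card {g \<in> carrier G. g p = p}" by simp
  finally have "p * card {g \<in> carrier G. g p = p} = fact p" by (rule sym)
  also have "\<dots> = p * fact (p - 1)"
    using p3 by (subst fact_reduce) (auto simp only: of_nat_id)
  finally have "p * card {g \<in> carrier G. g p = p} = p * fact (p - 1)" .
  then have "card {g \<in> carrier G. g p = p} = fact (p - 1)" using p3 by (simp only: mult_left_cancel)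
  then show ?thesis by (simp only: eq[OF assms])
qed

lemma sum_orbit: "(\<Sum>g\<in>carrier G. F (g p)) = of_nat (fact (p - 1)) \<cdot> (\<Sum>k\<in>points. F k :: 'k fmat)"
proof -
  have "(\<Sum>g\<in>carrier G. F (g p)) = (\<Sum>k\<in>points. \<Sum>g\<in>{g \<in> carrier G. g p = k}. F (g p))"
    by (rule sum.group[symmetric]) (use fin perm_points in auto)
  also have "\<dots> = (\<Sum>k\<in>points. of_nat (fact (p - 1)) \<cdot> F k)"
  proof (rule sum.cong[OF refl])
    fix k assume k: "k \<in> points"
    have "(\<Sum>g\<in>{g \<in> carrier G. g p = k}. F (g p)) = (\<Sum>g\<in>{g \<in> carrier G. g p = k}. F k)"
      by (rule sum.cong) auto
    then show "(\<Sum>g\<in>{g \<in> carrier G. g p = k}. F (g p)) = of_nat (fact (p - 1)) \<cdot> F k"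
      by (simp only: sum_const_scale card_fiber[OF k])
  qed
  finally show ?thesis by (simp add: scale_sum)
qed

text \<open>The fourth tensor powers of the differences pvec l - pvec k, summed over l, with two of
  the four slots turned into linear forms. Conjugation by g takes \<open>Ek k\<close> to
  \<open>Ek (g k)\<close>.\<close>

definition Ek :: "nat \<Rightarrow> 'k fmat" where
  "Ek k = (\<Sum>l\<in>points. tens m (Suc 0) (pvec l - pvec k) (pvec l - pvec k) * tens (Suc 0) m (pform l - pform k) (pform l - pform k))"

lemma block_Ek: "block (m * m) (m * m) (Ek k)"
proof -
  have "block (m * m) (Suc 0) (tens m (Suc 0) (pvec l - pvec k) (pvec l - pvec k))"
    "block (Suc 0) (m * m) (tens (Suc 0) m (pform l - pform k) (pform l - pform k))" for l
    using block_tens[of m "Suc 0" "pvec l - pvec k" m "Suc 0" "pvec l - pvec k"]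
      block_tens[of "Suc 0" m "pform l - pform k" "Suc 0" m "pform l - pform k"] by auto
  then show ?thesis unfolding Ek_def by (blast intro: block_sum block_times)
qed

text \<open>The differences of the vectors \<open>pvec a\<close> form a spherical 4-design: the sum of their fourth
  tensor powers is a multiple of the symmetrised square of the Casimir tensor.\<close>

lemma sum_Ek: "(\<Sum>k\<in>points. Ek k) = 2 \<cdot> (idm (m * m) + swap + cup * cap)"
proof (rule pvec2_test[of "m * m"])
  show "block (m * m) (m * m) (\<Sum>k\<in>points. Ek k)" by (rule block_sum) (rule block_Ek)
  show "block (m * m) (m * m) (2 \<cdot> (idm (m * m) + swap + cup * cap))"
    by (intro block_intros block_idm block_swap block_times[OF block_cup block_cap])
  fix b c assume bc: "b \<in> points" "c \<in> points"
  let ?v = "tens m (Suc 0) (pvec b) (pvec c)"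
  have r: "tens (Suc 0) m (pform l - pform k) (pform l - pform k) * ?v = ((sc l b - sc k b) * (sc l c - sc k c)) \<cdot> idm (Suc 0)"
    if "l \<in> points" "k \<in> points" for l k
  proof -
    have "block (Suc 0) m (pform l - pform k)" by auto
    from tens_times[OF disjI1, OF this, of "Suc 0" "pform l - pform k" "Suc 0" "pvec b" "pvec c"]
    show ?thesis using that bc by (simp add: left_diff_distrib pform_pvec scale_distribs[symmetric] mult.commute)
  qed
  have L: "(\<Sum>k\<in>points. Ek k) * ?v = (\<Sum>k\<in>points. \<Sum>l\<in>points. ((sc l b - sc k b) * (sc l c - sc k c)) \<cdot> tens m (Suc 0) (pvec l - pvec k) (pvec l - pvec k))"
    unfolding Ek_def sum_distrib_right
  proof (intro sum.cong refl)
    fix k l assume kl: "k \<in> points" "l \<in> points"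
    have bb: "block (m * m) (Suc 0) (tens m (Suc 0) (pvec l - pvec k) (pvec l - pvec k))"
      using block_tens[of m "Suc 0" "pvec l - pvec k" m "Suc 0" "pvec l - pvec k"] by auto
    show "tens m (Suc 0) (pvec l - pvec k) (pvec l - pvec k) * tens (Suc 0) m (pform l - pform k) (pform l - pform k) * ?v
      = ((sc l b - sc k b) * (sc l c - sc k c)) \<cdot> tens m (Suc 0) (pvec l - pvec k) (pvec l - pvec k)"
      unfolding mult.assoc r[OF kl(2,1)] by (simp add: times_idm[OF bb])
  qed
  have R: "2 \<cdot> (idm (m * m) + swap + cup * cap) * ?v = 2 \<cdot> (?v + tens m (Suc 0) (pvec c) (pvec b) + sc b c \<cdot> cup)"
    using bc by (simp add: distrib_right swap_times idm_times[OF block_pvec2] mult.assoc cap_pvec2 times_idm[OF block_cup])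
  show "(\<Sum>k\<in>points. Ek k) * ?v = 2 \<cdot> (idm (m * m) + swap + cup * cap) * ?v"
    unfolding L R
  proof (rule fmat_eqI)
    fix i j
    let ?c = "\<lambda>l. entry (pvec l) (i div m) j" and ?e = "\<lambda>l. entry (pvec l) (i mod m) 0"
    have pick: "(\<Sum>l\<in>points. sc l b * entry (pvec l) x y) = entry (pvec b) x y" if "b \<in> points" for b x y
      using arg_cong[OF sum_sc_pvec[OF that], of "\<lambda>X. entry X x y"] by simp
    have z: "(\<Sum>l\<in>points. entry (pvec l) x y) = 0" for x y
      using arg_cong[OF sum_pvec, of "\<lambda>X. entry X x y"] by simp
    have "(\<Sum>k\<in>points. \<Sum>l\<in>points. (sc l b - sc k b) * (sc l c - sc k c) * ((?c l - ?c k) * (?e l - ?e k)))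
      = 2 * ((\<Sum>l\<in>points. sc l b * sc l c) * (\<Sum>l\<in>points. ?c l * ?e l) + (\<Sum>l\<in>points. sc l b * ?c l) * (\<Sum>l\<in>points. sc l c * ?e l)
        + (\<Sum>l\<in>points. sc l b * ?e l) * (\<Sum>l\<in>points. sc l c * ?c l))"
      by (rule sum_four) (simp_all add: sum_sc bc z)
    also have "\<dots> = 2 * (sc b c * (\<Sum>l\<in>points. ?c l * ?e l) + entry (pvec b) (i div m) j * entry (pvec c) (i mod m) 0
        + entry (pvec b) (i mod m) 0 * entry (pvec c) (i div m) j)"
      using bc by (simp add: sum_sc_sc pick)
    finally show "entry (\<Sum>k\<in>points. \<Sum>l\<in>points. ((sc l b - sc k b) * (sc l c - sc k c)) \<cdot> tens m (Suc 0) (pvec l - pvec k) (pvec l - pvec k)) i j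
      = entry (2 \<cdot> (?v + tens m (Suc 0) (pvec c) (pvec b) + sc b c \<cdot> cup)) i j"
      using m0 by (simp add: cup_def entry_tens algebra_simps sum_distrib_left)
  qed
qed

text \<open>The transfer of \<open>Ek p\<close> is the sum of all \<open>Ek (g p)\<close>. Each k is
  the value g p for (p - 1)! permutations, so by \<open>sum_Ek\<close> the transfer is 2 (p - 1)!
  times the operator, and this scalar is invertible modulo p.\<close>

lemma stably_zero_T: "stably_zero (tensor Dm Dm) (tensor Dm Dm) (idm (m * m) + swap + cup * cap)"
  unfolding stably_zero_def
proof (intro exI conjI)
  let ?c = "1 / (2 * of_nat (fact (p - 1))) :: 'k"
  let ?V = "tensor Dm Dm"
  show "block (rdim ?V) (rdim ?V) (?c \<cdot> Ek p)" using block_Ek by simp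
  have "transfer ?V ?V (Ek p) = (\<Sum>g\<in>carrier G. Ek (g p))"
    unfolding transfer_def
  proof (rule sum.cong[OF refl])
    fix g assume g: "g \<in> carrier G"
    let ?R = "tens m m (R g) (R g)" and ?R' = "tens m m (R (inv' g)) (R (inv' g))"
    have l: "?R * tens m (Suc 0) (pvec l - pvec p) (pvec l - pvec p) = tens m (Suc 0) (pvec (g l) - pvec (g p)) (pvec (g l) - pvec (g p))"
      if "l \<in> points" for l
      using tens_times[OF disjI1, OF block_R, of m "R g" g "Suc 0" "pvec l - pvec p" "pvec l - pvec p"] g that
      by (simp add: right_diff_distrib R_pvec)
    have r: "tens (Suc 0) m (pform l - pform p) (pform l - pform p) * ?R' = tens (Suc 0) m (pform (g l) - pform (g p)) (pform (g l) - pform (g p))"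
      if "l \<in> points" for l
      using tens_times[OF disjI2, OF block_R, of "Suc 0" "pform l - pform p" "pform l - pform p" m "R (inv' g)" "inv' g"] g that
        pform_R[OF g that] pform_R[OF g p_points]
      by (simp add: left_diff_distrib)
    have "?R * Ek p * ?R' = (\<Sum>l\<in>points. (?R * tens m (Suc 0) (pvec l - pvec p) (pvec l - pvec p)) * (tens (Suc 0) m (pform l - pform p) (pform l - pform p) * ?R'))"
      unfolding Ek_def sum_distrib_left sum_distrib_right by (simp only: mult.assoc)
    also have "\<dots> = (\<Sum>l\<in>points. (\<lambda>x. tens m (Suc 0) (pvec x - pvec (g p)) (pvec x - pvec (g p)) * tens (Suc 0) m (pform x - pform (g p)) (pform x - pform (g p))) (g l))"
      by (rule sum.cong[OF refl]) (simp only: l r)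
    also have "\<dots> = Ek (g p)" unfolding Ek_def by (rule sum_perm[OF g])
    finally show "act ?V g * Ek p * act ?V (inv\<^bsub>G\<^esub> g) = Ek (g p)"
      using g inv_carrier[OF g] by (simp add: act_Dm2)
  qed
  also have "\<dots> = of_nat (fact (p - 1)) \<cdot> (2 \<cdot> (idm (m * m) + swap + cup * cap))"
    unfolding sum_orbit sum_Ek ..
  finally have "transfer ?V ?V (?c \<cdot> Ek p) = (?c * (of_nat (fact (p - 1)) * 2)) \<cdot> (idm (m * m) + swap + cup * cap)"
    unfolding transfer_scale by simp
  also have "?c * (of_nat (fact (p - 1)) * 2) = 1"
    using fact_nz[of "p - 1"] p3 by simp
  finally show "idm (m * m) + swap + cup * cap = transfer ?V ?V (?c \<cdot> Ek p)" by simp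
qed

end

section \<open>Antisymmetrisers and exterior powers\<close>

text \<open>The inductive step of Wenzl's recursion for the antisymmetrisers: \<open>e\<close>, \<open>f\<close> are the
  antisymmetrisers on the last \<open>N\<close>, \<open>N - 1\<close> of \<open>N + 1\<close> strands, \<open>s\<close>, \<open>t\<close> the first two
  transpositions.\<close>

lemma wenzl_step:
  fixes e f s t I :: "'k::field fmat"
  assumes fe: "f * e = e" "e * f = e" and te: "t * e = - e" "e * t = - e" and sf: "s * f = f * s"
    and ss: "s * s = I" and I: "f * I = f" "e * I = e"
    and braid: "s * t * s = t * s * t"
    and e: "N \<cdot> e = f - (N - 1) \<cdot> (f * t * f)"
  shows "N \<cdot> (s * e * s * e) + N \<cdot> (e * s * e) = e + s * e"
    and "N \<cdot> (e * s * e * s) + N \<cdot> (e * s * e) = e + e * s"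
proof -
  have A: "N \<cdot> (s * e * s * e) = e + (N - 1) \<cdot> (f * t * s * e)"
  proof -
    have "N \<cdot> (s * e * s * e) = s * (N \<cdot> e) * s * e" by simp
    also have "\<dots> = s * f * s * e - (N - 1) \<cdot> (s * f * t * f * s * e)"
      unfolding e by (simp add: left_diff_distrib right_diff_distrib mult.assoc)
    also have "s * f * s * e = f * (s * s) * e" by (simp only: sf mult.assoc)
    also have "f * (s * s) * e = e" by (simp only: ss I fe)
    \<comment> \<open>Moving s past f exposes s t s. The braid relation turns it into t s t, whose
      last factor is absorbed by e with a sign.\<close>
    also have "s * f * t * f * s * e = - (f * t * s * e)"
    proof -
      have "s * f * t * f * s * e = (s * f) * t * (f * s) * e" by (simp only: mult.assoc)
      also have "\<dots> = (f * s) * t * (s * f) * e" by (simp only: sf)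
      also have "\<dots> = f * (s * t * s) * (f * e)" by (simp only: mult.assoc)
      also have "\<dots> = f * t * s * (t * e)" by (subst braid) (simp only: fe mult.assoc)
      finally show ?thesis by (simp add: te)
    qed
    finally show ?thesis by simp
  qed
  have B: "N \<cdot> (e * s * e) = s * e - (N - 1) \<cdot> (f * t * s * e)"
  proof -
    have "N \<cdot> (e * s * e) = (N \<cdot> e) * s * e" by simp
    also have "\<dots> = f * s * e - (N - 1) \<cdot> (f * t * (f * s) * e)"
      unfolding e by (simp add: left_diff_distrib mult.assoc)
    also have "\<dots> = s * (f * e) - (N - 1) \<cdot> (f * t * s * (f * e))"
      unfolding sf[symmetric] by (simp only: mult.assoc)
    finally show ?thesis unfolding fe .
  qed
  show "N \<cdot> (s * e * s * e) + N \<cdot> (e * s * e) = e + s * e" unfolding A B by simp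
  have A': "N \<cdot> (e * s * e * s) = e + (N - 1) \<cdot> (e * s * t * f)"
  proof -
    have "N \<cdot> (e * s * e * s) = e * s * (N \<cdot> e) * s" by simp
    also have "\<dots> = e * (s * f) * s - (N - 1) \<cdot> (e * (s * f) * t * (f * s))"
      unfolding e by (simp add: left_diff_distrib right_diff_distrib mult.assoc)
    also have "e * (s * f) * s = e * f * (s * s)" by (simp only: sf mult.assoc)
    also have "e * f * (s * s) = e" by (simp only: fe ss I)
    also have "e * (s * f) * t * (f * s) = - (e * s * t * f)"
    proof -
      have "e * (s * f) * t * (f * s) = e * (f * s) * t * (s * f)" by (simp only: sf)
      also have "\<dots> = e * f * (s * t * s) * f" by (simp only: mult.assoc)
      also have "\<dots> = e * t * s * t * f" by (subst braid) (simp only: fe mult.assoc)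
      finally show ?thesis by (simp add: te)
    qed
    finally show ?thesis by simp
  qed
  have B': "N \<cdot> (e * s * e) = e * s - (N - 1) \<cdot> (e * s * t * f)"
  proof -
    have "N \<cdot> (e * s * e) = e * s * (N \<cdot> e)" by simp
    also have "\<dots> = e * (s * f) - (N - 1) \<cdot> (e * (s * f) * t * f)"
      unfolding e by (simp add: right_diff_distrib mult.assoc)
    also have "\<dots> = e * f * s - (N - 1) \<cdot> (e * f * s * t * f)"
      unfolding sf by (simp only: mult.assoc)
    finally show ?thesis unfolding fe .
  qed
  show "N \<cdot> (e * s * e * s) + N \<cdot> (e * s * e) = e + e * s" unfolding A' B' by simp
qed

context char_sym begin

abbreviation Tn :: "nat \<Rightarrow> (nat \<Rightarrow> nat, 'k) rep" where "Tn n \<equiv> tensor_power Dm n"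

lemma rdim_Tn [simp]: "rdim (Tn n) = m ^ n" by (induction n) simp_all

lemma modl_Tn: "modl (Tn n)" by (rule modl_tensor_power[OF modl_Dm])

text \<open>\<open>L n X\<close> is \<open>X\<close> with an identity strand added on the left; \<open>S n\<close> swaps the first two of
  \<open>n + 2\<close> strands.\<close>

definition L :: "nat \<Rightarrow> 'k fmat \<Rightarrow> 'k fmat" where "L n X = tens (m ^ n) (m ^ n) (idm m) X"

definition S :: "nat \<Rightarrow> 'k fmat" where "S n = tens (m ^ n) (m ^ n) swap (idm (m ^ n))"

lemma block_L [simp]: "block (m ^ n) (m ^ n) X \<Longrightarrow> block (m ^ Suc n) (m ^ Suc n) (L n X)"
  unfolding L_def using block_tens[OF block_idm[of m], of "m ^ n" "m ^ n" X] by simp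

lemma block_S [simp]: "block (m ^ Suc (Suc n)) (m ^ Suc (Suc n)) (S n)"
  unfolding S_def using block_tens[OF block_swap block_idm[of "m ^ n"]] by (simp add: mult.assoc)

lemma L_times: "block r (m ^ n) X \<Longrightarrow> L n X * L n Y = L n (X * Y)"
  unfolding L_def by (subst tens_times[OF disjI1]) auto

lemma L_simps: "L n (X - Y) = L n X - L n Y" "L n (a \<cdot> X) = a \<cdot> L n X" "L n (- X) = - L n X" "L n (idm (m ^ n)) = idm (m ^ Suc n)"
  by (simp_all add: L_def tens_diff_right)

lemma S_S: "S n * S n = idm (m ^ Suc (Suc n))"
  unfolding S_def by (subst tens_times[OF disjI1, OF block_idm]) (simp add: swap_swap mult.assoc)

lemma LL: "L (Suc n) (L n X) = tens (m ^ n) (m ^ n) (idm (m * m)) X"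
  unfolding L_def using tens_assoc[of "m ^ n" "m ^ n" m m "idm m" "idm m" X] by simp

lemma S_LL: "block (m ^ n) (m ^ n) X \<Longrightarrow> S n * L (Suc n) (L n X) = L (Suc n) (L n X) * S n"
  unfolding S_def LL using tens_times[OF disjI1, OF block_idm[of "m ^ n"], of "m ^ n" swap "m ^ n" "idm (m * m)" X]
    tens_times[OF disjI1, of "m ^ n" "m ^ n" X "m ^ n" "idm (m * m)" "m ^ n" swap "idm (m ^ n)"]
  by (simp add: idm_times times_idm[OF block_swap] idm_times[OF block_swap] times_idm)

definition sw1 :: "'k fmat" where "sw1 = tens m m swap (idm m)"
definition sw2 :: "'k fmat" where "sw2 = tens (m * m) (m * m) (idm m) swap"

lemma block_sw1: "block (m ^ 3) (m ^ 3) sw1" and block_sw2: "block (m ^ 3) (m ^ 3) sw2"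
  unfolding sw1_def sw2_def using block_tens[OF block_swap block_idm[of m]] block_tens[OF block_idm[of m] block_swap]
  by (simp_all add: power3_eq_cube mult.assoc)

definition tri :: "'k fmat \<Rightarrow> 'k fmat \<Rightarrow> 'k fmat \<Rightarrow> 'k fmat" where
  "tri x y z = tens (m * m) (Suc 0) x (tens m (Suc 0) y z)"

lemma tri_alt: "tri x y z = tens m (Suc 0) (tens m (Suc 0) x y) z"
  unfolding tri_def using tens_assoc[of m "Suc 0" m "Suc 0" x y z] by simp

lemma sw1_tri:
  assumes "block m (Suc 0) x" "block m (Suc 0) y" "block m (Suc 0) z"
  shows "sw1 * tri x y z = tri y x z"
  unfolding sw1_def tri_alt
  by (subst tens_times[OF disjI1, OF block_idm]) (simp add: swap_times assms idm_times[OF assms(3)])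

lemma sw2_tri:
  assumes "block m (Suc 0) x" "block m (Suc 0) y" "block m (Suc 0) z"
  shows "sw2 * tri x y z = tri x z y"
  unfolding sw2_def tri_def
  by (subst tens_times[OF disjI1, OF block_swap]) (simp add: swap_times assms idm_times[OF assms(1)])

lemma dcol3: "tvec [a, b, c] = tri (pvec a) (pvec b) (pvec c)"
  by (simp add: tri_def)

text \<open>Both sides reverse the three factors of a spanning tensor.\<close>

lemma swap_braid: "sw1 * sw2 * sw1 = sw2 * sw1 * sw2"
proof (rule tvec_test[of "m ^ 3" 3])
  fix as assume "as \<in> plist 3"
  then obtain a b c where "as = [a, b, c]" using plist3 by blast
  then show "sw1 * sw2 * sw1 * tvec as = sw2 * sw1 * sw2 * tvec as"
    by (simp only: dcol3 mult.assoc sw1_tri sw2_tri block_pvec)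
qed (blast intro: block_times block_sw1 block_sw2)+

lemma S_Suc: "S (Suc n) = tens (m ^ n) (m ^ n) sw1 (idm (m ^ n))"
  unfolding S_def sw1_def using tens_assoc[of "m ^ n" "m ^ n" m m swap "idm m" "idm (m ^ n)"] by simp

lemma L_S: "L (Suc (Suc n)) (S n) = tens (m ^ n) (m ^ n) sw2 (idm (m ^ n))"
  unfolding S_def sw2_def L_def using tens_assoc[of "m ^ n" "m ^ n" "m * m" "m * m" "idm m" swap "idm (m ^ n)"]
  by (simp add: mult.assoc)

lemma tens_idm_times: "tens n n X (idm n) * tens n n Y (idm n) = tens n n (X * Y) (idm n)"
  by (subst tens_times[OF disjI1, OF block_idm]) simp

lemma S_braid: "S (Suc n) * L (Suc (Suc n)) (S n) * S (Suc n) = L (Suc (Suc n)) (S n) * S (Suc n) * L (Suc (Suc n)) (S n)"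
  unfolding S_Suc L_S tens_idm_times swap_braid ..

text \<open>Wenzl's recursion: A_(n+1) = (e - n e s e) / (n + 1), where e is A_n on the last n
  strands and s the first transposition. The divisions are legitimate only below n = p.\<close>

fun antisymm :: "nat \<Rightarrow> 'k fmat" where
  "antisymm 0 = idm (Suc 0)"
| "antisymm (Suc 0) = idm m"
| "antisymm (Suc (Suc n)) = (1 / of_nat (Suc (Suc n))) \<cdot>
    (L (Suc n) (antisymm (Suc n)) - of_nat (Suc n) \<cdot> (L (Suc n) (antisymm (Suc n)) * S n * L (Suc n) (antisymm (Suc n))))"

lemma block_antisymm [simp]: "block (m ^ n) (m ^ n) (antisymm n)"
proof (induction n rule: antisymm.induct)
  case (3 n)
  have b: "block (m ^ Suc (Suc n)) (m ^ Suc (Suc n)) (L (Suc n) (antisymm (Suc n)))" by (rule block_L[OF 3(1)])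
  show ?case unfolding antisymm.simps by (intro block_intros(5) block_intros(3) block_times[OF block_times[OF b block_S] b] b)
qed simp_all

lemma antisymm_eq:
  assumes "Suc (Suc n) < p"
  shows "of_nat (Suc (Suc n)) \<cdot> antisymm (Suc (Suc n))
    = L (Suc n) (antisymm (Suc n)) - of_nat (Suc n) \<cdot> (L (Suc n) (antisymm (Suc n)) * S n * L (Suc n) (antisymm (Suc n)))"
  using of_nat_nz[OF _ assms] by (simp only: antisymm.simps scale_simps(4)) (simp del: of_nat_Suc)

declare antisymm.simps(3) [simp del]

text \<open>Idempotence, the sign under the first transposition and the absorption of the smaller
  antisymmetriser are proved together, since \<open>wenzl_step\<close> and its consequences need all
  of them one strand lower.\<close>

lemma antisymm_props:
  assumes "Suc n < p"
  shows "antisymm (Suc n) * antisymm (Suc n) = antisymm (Suc n) \<and>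
    (\<forall>k. n = Suc k \<longrightarrow> S k * antisymm (Suc n) = - antisymm (Suc n) \<and> antisymm (Suc n) * S k = - antisymm (Suc n) \<and>
       L n (antisymm n) * antisymm (Suc n) = antisymm (Suc n) \<and> antisymm (Suc n) * L n (antisymm n) = antisymm (Suc n))"
  using assms
proof (induction n)
  case 0
  show ?case by simp
next
  case (Suc n)
  define e where "e = L (Suc n) (antisymm (Suc n))"
  define N :: 'k where "N = of_nat (Suc n)"
  let ?I = "idm (m ^ Suc (Suc n)) :: 'k fmat"
  have N: "N + 1 \<noteq> 0" unfolding N_def using of_nat_nz[OF _ Suc.prems] by (simp add: add.commute)
  have IH: "antisymm (Suc n) * antisymm (Suc n) = antisymm (Suc n)" using Suc by simp
  have be: "block (m ^ Suc (Suc n)) (m ^ Suc (Suc n)) e" unfolding e_def by (rule block_L[OF block_antisymm])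
  have ee: "e * e = e" unfolding e_def by (simp only: L_times[OF block_antisymm] IH)
  have star: "N \<cdot> (S n * e * S n * e) + N \<cdot> (e * S n * e) = e + S n * e \<and>
     N \<cdot> (e * S n * e * S n) + N \<cdot> (e * S n * e) = e + e * S n"
  proof (cases n)
    \<comment> \<open>On two strands e is the identity and N = 1, so both equations reduce to s s =
      1.\<close>
    case 0
    have "e = ?I" unfolding e_def 0 using L_simps(4)[of 1] by simp
    then show ?thesis using S_S[of n] idm_times[OF block_S[of n]] times_idm[OF block_S[of n]]
      by (simp add: N_def 0 mult.assoc)
  next
    case (Suc k)
    define f where "f = L (Suc n) (L n (antisymm n))"
    define t where "t = L (Suc n) (S k)"
    have bf0: "block (m ^ Suc n) (m ^ Suc n) (L n (antisymm n))" by (rule block_L[OF block_antisymm])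
    have bf: "block (m ^ Suc (Suc n)) (m ^ Suc (Suc n)) f" unfolding f_def by (rule block_L[OF bf0])
    have IH': "S k * antisymm (Suc n) = - antisymm (Suc n)" "antisymm (Suc n) * S k = - antisymm (Suc n)"
      "L n (antisymm n) * antisymm (Suc n) = antisymm (Suc n)" "antisymm (Suc n) * L n (antisymm n) = antisymm (Suc n)"
      using Suc.IH Suc.prems Suc by auto
    have bS: "block (m ^ Suc n) (m ^ Suc n) (S k)" unfolding Suc by (rule block_S)
    have eN: "N \<cdot> e = f - (N - 1) \<cdot> (f * t * f)"
    proof -
      have lt: "Suc (Suc k) < p" using Suc.prems Suc by simp
      have "N \<cdot> e = L (Suc n) (N \<cdot> antisymm (Suc n))" by (simp add: e_def L_simps)
      also have "N \<cdot> antisymm (Suc n) = L n (antisymm n) - (N - 1) \<cdot> (L n (antisymm n) * S k * L n (antisymm n))"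
        using antisymm_eq[OF lt] unfolding N_def Suc by simp
      finally show ?thesis
        unfolding f_def t_def by (simp only: L_simps L_times[OF bf0] L_times[OF block_times[OF bf0 bS]])
    qed
    have a: "f * e = e" "e * f = e" "t * e = - e" "e * t = - e"
      unfolding f_def e_def t_def
      by (simp_all only: L_times[OF bf0] L_times[OF block_antisymm] L_times[OF bS] IH' L_simps)
    have sf: "S n * f = f * S n" unfolding f_def by (rule S_LL[OF block_antisymm])
    have br: "S n * t * S n = t * S n * t" unfolding t_def Suc by (rule S_braid)
    show ?thesis
      using wenzl_step[OF a sf S_S times_idm[OF bf] times_idm[OF be] br eN] by blast
  qed
  define d where "d = antisymm (Suc (Suc n))"
  have d: "d = (1 / (N + 1)) \<cdot> (e - N \<cdot> (e * S n * e))"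
    unfolding d_def N_def e_def antisymm.simps by (simp add: add.commute)
  \<comment> \<open>In this form the equations say that the transposition acts by -1 on e - N e s e,
    from the left and from the right.\<close>
  have s1: "N \<cdot> (S n * e * S n * e) = e + S n * e - N \<cdot> (e * S n * e)"
    and s2: "N \<cdot> (e * S n * e * S n) = e + e * S n - N \<cdot> (e * S n * e)"
    using star by (simp_all add: eq_diff_eq)
  have "S n * (e - N \<cdot> (e * S n * e)) = - (e - N \<cdot> (e * S n * e))"
    using s1 by (simp add: right_diff_distrib mult.assoc)
  then have Sd: "S n * d = - d" unfolding d by (metis scale_simps(6) scale_times(2))
  have "(e - N \<cdot> (e * S n * e)) * S n = - (e - N \<cdot> (e * S n * e))"
    using s2 by (simp add: left_diff_distrib mult.assoc)
  then have dS: "d * S n = - d" unfolding d by (metis scale_simps(6) scale_times(1))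
  have eee: "e * (e * x) = e * x" for x by (simp add: mult.assoc[symmetric] ee)
  have ed: "e * d = d" unfolding d by (simp add: right_diff_distrib eee mult.assoc ee)
  have de: "d * e = d" unfolding d by (simp add: left_diff_distrib mult.assoc ee)
  \<comment> \<open>Only the second factor is expanded: the first one absorbs e and turns s into -1,
    which gives (1 + N) d / (N + 1).\<close>
  have "d * d = (1 / (N + 1)) \<cdot> (d * e - N \<cdot> (d * e * S n * e))"
    by (subst (2) d) (simp add: right_diff_distrib mult.assoc)
  also have "\<dots> = (1 / (N + 1)) \<cdot> (d + N \<cdot> d)" unfolding de dS by (simp add: de)
  also have "d + N \<cdot> d = (N + 1) \<cdot> d" by (simp add: scale_distribs)
  also have "(1 / (N + 1)) \<cdot> (N + 1) \<cdot> d = d" using N by simp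
  finally have dd: "d * d = d" .
  show ?case using dd Sd dS ed de unfolding d_def e_def by simp
qed

lemma antisymm_idem: "n < p \<Longrightarrow> antisymm n * antisymm n = antisymm n"
  using antisymm_props[of "n - 1"] by (cases n) auto

lemma S_antisymm: "Suc (Suc k) < p \<Longrightarrow> S k * antisymm (Suc (Suc k)) = - antisymm (Suc (Suc k))"
  and antisymm_S: "Suc (Suc k) < p \<Longrightarrow> antisymm (Suc (Suc k)) * S k = - antisymm (Suc (Suc k))"
  using antisymm_props[of "Suc k"] by auto

lemma L_antisymm: "Suc n < p \<Longrightarrow> L n (antisymm n) * antisymm (Suc n) = antisymm (Suc n)"
  and antisymm_L: "Suc n < p \<Longrightarrow> antisymm (Suc n) * L n (antisymm n) = antisymm (Suc n)"
  using antisymm_props[of n] L_simps(4)[of 0] by (cases n; simp)+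

lemma ghom_L: "ghom (Tn n) (Tn n) X \<Longrightarrow> ghom (Tn (Suc n)) (Tn (Suc n)) (L n X)"
  unfolding L_def using ghom_tensor[OF modl_Dm modl_Dm modl_Tn modl_Tn ghom_id[OF modl_Dm], of n n X] by simp

lemma Tn_Suc2: "Tn (Suc (Suc n)) = tensor (tensor Dm Dm) (Tn n)"
  by (simp add: tensor_assoc)

lemma ghom_S: "ghom (Tn (Suc (Suc n))) (Tn (Suc (Suc n))) (S n)"
  unfolding S_def Tn_Suc2
  using ghom_tensor[OF modl_tensor[OF modl_Dm modl_Dm] modl_tensor[OF modl_Dm modl_Dm] modl_Tn modl_Tn ghom_swap ghom_id[OF modl_Tn], of n]
  by simp

lemma ghom_antisymm: "ghom (Tn n) (Tn n) (antisymm n)"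
proof (induction n rule: antisymm.induct)
  case 1
  show ?case using ghom_id[OF modl_Tn[of 0]] by simp
next
  case 2
  show ?case using ghom_id[OF modl_Tn[of 1]] by simp
next
  case (3 n)
  have h: "ghom (Tn (Suc (Suc n))) (Tn (Suc (Suc n))) (L (Suc n) (antisymm (Suc n)))" by (rule ghom_L[OF 3(1)])
  show ?case unfolding antisymm.simps by (intro ghom_scale ghom_diff h ghom_comp[OF ghom_comp[OF h ghom_S] h])
qed

text \<open>A chosen image of the antisymmetriser: the exterior power together with its inclusion
  into the tensor power and the projection back.\<close>

definition Edata :: "nat \<Rightarrow> (nat \<Rightarrow> nat, 'k) rep \<times> 'k fmat \<times> 'k fmat" where
  "Edata n = (SOME (W, i, q). modl W \<and> ghom W (Tn n) i \<and> ghom (Tn n) W q \<and> i * q = antisymm n \<and> q * i = idm (rdim W))"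

definition E :: "nat \<Rightarrow> (nat \<Rightarrow> nat, 'k) rep" where "E n = fst (Edata n)"
definition inc :: "nat \<Rightarrow> 'k fmat" where "inc n = fst (snd (Edata n))"
definition prj :: "nat \<Rightarrow> 'k fmat" where "prj n = snd (snd (Edata n))"

lemma E_props:
  assumes "n < p"
  shows "modl (E n)" "ghom (E n) (Tn n) (inc n)" "ghom (Tn n) (E n) (prj n)" "inc n * prj n = antisymm n"
    "prj n * inc n = idm (rdim (E n))"
proof -
  obtain W i q where "modl W \<and> ghom W (Tn n) i \<and> ghom (Tn n) W q \<and> i * q = antisymm n \<and> q * i = idm (rdim W)"
    using split_idempotent[OF modl_Tn ghom_antisymm antisymm_idem[OF assms]] by blast
  then have "case (W, i, q) of (W, i, q) \<Rightarrow> modl W \<and> ghom W (Tn n) i \<and> ghom (Tn n) W q \<and> i * q = antisymm n \<and> q * i = idm (rdim W)"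
    by simp
  then have "case Edata n of (W, i, q) \<Rightarrow> modl W \<and> ghom W (Tn n) i \<and> ghom (Tn n) W q \<and> i * q = antisymm n \<and> q * i = idm (rdim W)"
    unfolding Edata_def by (rule someI)
  then show "modl (E n)" "ghom (E n) (Tn n) (inc n)" "ghom (Tn n) (E n) (prj n)" "inc n * prj n = antisymm n"
    "prj n * inc n = idm (rdim (E n))"
    by (auto simp: E_def inc_def prj_def split: prod.splits)
qed

lemma antisymm_inc: "n < p \<Longrightarrow> antisymm n * inc n = inc n"
  using E_props[of n] ghom_idm_right[OF E_props(2)] by (metis mult.assoc)

lemma prj_antisymm: "n < p \<Longrightarrow> prj n * antisymm n = prj n"
  using E_props[of n] ghom_idm_left[OF E_props(3)] by (metis mult.assoc)

section \<open>Cups and caps against antisymmetrisers\<close>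

definition Uc :: "nat \<Rightarrow> 'k fmat" where "Uc k = tens (m ^ k) (m ^ k) cup (idm (m ^ k))"
definition Cc :: "nat \<Rightarrow> 'k fmat" where "Cc k = tens (m ^ k) (m ^ k) cap (idm (m ^ k))"

lemma ghom_Uc: "ghom (Tn k) (Tn (Suc (Suc k))) (Uc k)"
  unfolding Uc_def Tn_Suc2
  using ghom_tensor[OF modl_trivial modl_tensor[OF modl_Dm modl_Dm] modl_Tn modl_Tn ghom_cup ghom_id[OF modl_Tn], of k]
  by simp

lemma ghom_Cc: "ghom (Tn (Suc (Suc k))) (Tn k) (Cc k)"
  unfolding Cc_def Tn_Suc2
  using ghom_tensor[OF modl_tensor[OF modl_Dm modl_Dm] modl_trivial modl_Tn modl_Tn ghom_cap ghom_id[OF modl_Tn], of k]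
  by simp

lemma S_Uc: "S k * Uc k = Uc k" and Cc_S: "Cc k * S k = Cc k"
  unfolding S_def Uc_def Cc_def tens_idm_times swap_cup cap_swap by (rule refl)+

lemma Cc_Uc: "Cc k * Uc k = (- 2) \<cdot> idm (m ^ k)"
  unfolding Uc_def Cc_def tens_idm_times cap_cup tens_scale_left tens_idm by simp

lemma tens_one_antisymm: "block (m ^ k) (m ^ k) X \<Longrightarrow> tens (m ^ k) (m ^ k) (idm (Suc 0)) X = X"
  using m0 by (intro tens_one_left) auto

lemma LL_Uc: assumes "block (m ^ k) (m ^ k) X" shows "L (Suc k) (L k X) * Uc k = Uc k * X"
proof -
  have "L (Suc k) (L k X) * Uc k = tens (m ^ k) (m ^ k) cup X"
    unfolding LL Uc_def by (subst tens_times[OF disjI1, OF assms]) (simp add: idm_times[OF block_cup] times_idm[OF assms])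
  also have "\<dots> = tens (m ^ k) (m ^ k) cup (idm (m ^ k)) * tens (m ^ k) (m ^ k) (idm (Suc 0)) X"
    by (subst tens_times[OF disjI1, OF block_idm]) (simp add: times_idm[OF block_cup] idm_times[OF assms])
  finally show ?thesis by (simp add: tens_one_antisymm[OF assms] Uc_def)
qed

lemma Cc_LL: assumes "block (m ^ k) (m ^ k) X" shows "Cc k * L (Suc k) (L k X) = X * Cc k"
proof -
  have "Cc k * L (Suc k) (L k X) = tens (m ^ k) (m ^ k) cap X"
    unfolding LL Cc_def by (subst tens_times[OF disjI1, OF block_idm]) (simp add: times_idm[OF block_cap] idm_times[OF assms])
  also have "\<dots> = tens (m ^ k) (m ^ k) (idm (Suc 0)) X * tens (m ^ k) (m ^ k) cap (idm (m ^ k))"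
    by (subst tens_times[OF disjI1, OF assms]) (simp add: idm_times[OF block_cap] times_idm[OF assms])
  finally show ?thesis by (simp add: tens_one_antisymm[OF assms] Cc_def)
qed

text \<open>With pvec c on the last strand the cup inserts a sum over a of the labels a, a, c.
  Swapping the last two strands gives a, c, a, and the cap leaves the sum of sc a c times pvec a,
  which is pvec c.\<close>

lemma zigzag: "tens m m cap (idm m) * sw2 * tens m m cup (idm m) = idm m"
proof (rule pvec_test[of m])
  have b: "block m (m ^ 3) (tens m m cap (idm m))" "block (m ^ 3) m (tens m m cup (idm m))"
    using block_tens[OF block_cap block_idm[of m]] block_tens[OF block_cup block_idm[of m]]
    by (simp_all add: power3_eq_cube mult.assoc)
  show "block m m (tens m m cap (idm m) * sw2 * tens m m cup (idm m))"
    by (rule block_times[OF block_times[OF b(1) block_sw2] b(2)])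
  fix c assume c: "c \<in> points"
  have "tens m m cup (idm m) * pvec c = tens m m cup (idm m) * tens m (Suc 0) (idm (Suc 0)) (pvec c)"
    using m0 by (simp add: tens_one_left[OF block_pvec])
  also have "\<dots> = tens m (Suc 0) cup (pvec c)"
    by (subst tens_times[OF disjI1, OF block_idm]) (simp add: times_idm[OF block_cup] idm_times[OF block_pvec])
  also have "\<dots> = (\<Sum>a\<in>points. tri (pvec a) (pvec a) (pvec c))" by (simp add: cup_def tens_sum_left tri_alt)
  finally have 1: "tens m m cup (idm m) * pvec c = (\<Sum>a\<in>points. tri (pvec a) (pvec a) (pvec c))" .
  have "tens m m cap (idm m) * sw2 * tens m m cup (idm m) * pvec c
      = tens m m cap (idm m) * (sw2 * (tens m m cup (idm m) * pvec c))" by (simp add: mult.assoc)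
  also have "\<dots> = (\<Sum>a\<in>points. tens m m cap (idm m) * tri (pvec a) (pvec c) (pvec a))"
    unfolding 1 sum_distrib_left by (simp only: sw2_tri block_pvec)
  also have "\<dots> = (\<Sum>a\<in>points. sc a c \<cdot> pvec a)"
  proof (rule sum.cong[OF refl])
    fix a assume a: "a \<in> points"
    have "tens m m cap (idm m) * tri (pvec a) (pvec c) (pvec a) = tens m (Suc 0) (cap * tens m (Suc 0) (pvec a) (pvec c)) (idm m * pvec a)"
      unfolding tri_alt by (subst tens_times[OF disjI1, OF block_idm]) simp
    then show "tens m m cap (idm m) * tri (pvec a) (pvec c) (pvec a) = sc a c \<cdot> pvec a"
      using a c m0 by (simp add: cap_pvec2 idm_times[OF block_pvec] tens_one_left[OF block_pvec])
  qed
  finally show "tens m m cap (idm m) * sw2 * tens m m cup (idm m) * pvec c = idm m * pvec c"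
    using sum_sc_pvec[OF c] by (simp add: idm_times[OF block_pvec])
qed simp

lemma Cc_S_Uc: "Cc (Suc j) * L (Suc (Suc j)) (S j) * Uc (Suc j) = idm (m ^ Suc j)"
proof -
  have "Cc (Suc j) = tens (m ^ j) (m ^ j) (tens m m cap (idm m)) (idm (m ^ j))"
    unfolding Cc_def using tens_assoc[of "m ^ j" "m ^ j" m m cap "idm m" "idm (m ^ j)"] by simp
  moreover have "Uc (Suc j) = tens (m ^ j) (m ^ j) (tens m m cup (idm m)) (idm (m ^ j))"
    unfolding Uc_def using tens_assoc[of "m ^ j" "m ^ j" m m cup "idm m" "idm (m ^ j)"] by simp
  ultimately show ?thesis unfolding L_S by (simp only: tens_idm_times zigzag) simp
qed

text \<open>The factors come from the dimension \<open>m\<close> of \<open>Dm\<close>, which is \<open>- 2\<close> in the field.\<close>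

lemma Cc_antisymm_Uc:
  assumes "Suc (Suc k) < p"
  shows "of_nat (Suc k) \<cdot> (Cc k * L (Suc k) (antisymm (Suc k)) * Uc k) = - (of_nat (Suc (Suc k)) \<cdot> antisymm k)"
proof (cases k)
  case 0
  have "L (Suc 0) (antisymm (Suc 0)) = idm (m ^ Suc (Suc 0))" using L_simps(4)[of 1] by simp
  then show ?thesis
    unfolding 0 using Cc_Uc[of 0] times_idm[OF ghom_block[OF ghom_Cc[of 0]]] by simp
next
  case (Suc j)
  have bf0: "block (m ^ Suc k) (m ^ Suc k) (L k (antisymm k))" by (rule block_L[OF block_antisymm])
  have bS: "block (m ^ Suc k) (m ^ Suc k) (S j)" unfolding Suc by (rule block_S)
  define f where "f = L (Suc k) (L k (antisymm k))"
  define t where "t = L (Suc k) (S j)"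
  have k: "Suc (Suc j) < p" "k < p" using assms Suc by auto
  have e: "of_nat (Suc k) \<cdot> L (Suc k) (antisymm (Suc k)) = f - of_nat k \<cdot> (f * t * f)"
  proof -
    have "of_nat (Suc k) \<cdot> L (Suc k) (antisymm (Suc k)) = L (Suc k) (of_nat (Suc k) \<cdot> antisymm (Suc k))" by (simp add: L_simps)
    also have "of_nat (Suc k) \<cdot> antisymm (Suc k) = L k (antisymm k) - of_nat k \<cdot> (L k (antisymm k) * S j * L k (antisymm k))"
      unfolding Suc by (rule antisymm_eq[OF k(1)])
    finally show ?thesis
      unfolding f_def t_def by (simp only: L_simps L_times[OF bf0] L_times[OF block_times[OF bf0 bS]])
  qed
  have Cf: "Cc k * f = antisymm k * Cc k" unfolding f_def by (rule Cc_LL[OF block_antisymm])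
  have fU: "f * Uc k = Uc k * antisymm k" unfolding f_def by (rule LL_Uc[OF block_antisymm])
  have CtU: "Cc k * t * Uc k = idm (m ^ k)" unfolding t_def Suc by (rule Cc_S_Uc)
  \<comment> \<open>In the recursion for the middle antisymmetriser f slides outwards past cup and
    cap. The first term then contains a loop, worth -2, and the second a zigzag, worth 1 with weight
    -k: in total -(k + 2).\<close>
  have "of_nat (Suc k) \<cdot> (Cc k * L (Suc k) (antisymm (Suc k)) * Uc k) = Cc k * (of_nat (Suc k) \<cdot> L (Suc k) (antisymm (Suc k))) * Uc k"
    by simp
  also have "\<dots> = Cc k * f * Uc k - of_nat k \<cdot> (Cc k * f * t * f * Uc k)"
    unfolding e by (simp add: left_diff_distrib right_diff_distrib mult.assoc)
  also have "Cc k * f * Uc k = (- 2) \<cdot> antisymm k"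
    unfolding Cf mult.assoc Cc_Uc by (simp add: times_idm[OF block_antisymm])
  also have "Cc k * f * t * f * Uc k = antisymm k * (Cc k * t * Uc k) * antisymm k"
    unfolding Cf mult.assoc fU ..
  also have "\<dots> = antisymm k" unfolding CtU times_idm[OF block_antisymm] by (rule antisymm_idem[OF k(2)])
  finally show ?thesis by (simp add: scale_distribs)
qed

text \<open>Here a = k + 1. After compression to D \<otimes> E_a the two idempotents are c U C and
  (1 + c) + c s for c = -a / (a + 1); their sum is the identity plus c (1 + s + U C), and the last
  term is stably zero.\<close>

lemma stab_biprod_E:
  assumes "Suc (Suc k) < p"
  shows "stab_biprod (tensor Dm (E (Suc k))) (E k) (E (Suc (Suc k)))"
proof -
  let ?n = "Suc k" and ?n' = "Suc (Suc k)"
  have lt: "k < p" "?n < p" using assms by auto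
  note K = E_props[OF lt(1)] and N = E_props[OF lt(2)] and N' = E_props[OF assms]
  define X where "X = tensor Dm (E ?n)"
  have mX: "modl X" unfolding X_def by (rule modl_tensor[OF modl_Dm N(1)])
  define e where "e = L ?n (antisymm ?n)"
  define I where "I = tens (m ^ ?n) (rdim (E ?n)) (idm m) (inc ?n)"
  define P where "P = tens (rdim (E ?n)) (m ^ ?n) (idm m) (prj ?n)"
  have hI: "ghom X (Tn ?n') I"
    unfolding X_def I_def using ghom_tensor[OF modl_Dm modl_Dm N(1) modl_Tn ghom_id[OF modl_Dm] N(2)] by simp
  have hP: "ghom (Tn ?n') X P"
    unfolding X_def P_def using ghom_tensor[OF modl_Dm modl_Dm modl_Tn N(1) ghom_id[OF modl_Dm] N(3)] by simp
  have IP: "I * P = e"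
    unfolding I_def P_def e_def L_def using tens_comp[OF N(3) N(2), of "idm m" "idm m"] by (simp add: N(4))
  have PI: "P * I = idm (rdim X)"
    unfolding I_def P_def X_def using tens_comp[OF N(2) N(3), of "idm m" "idm m"] by (simp add: N(5))
  define a :: 'k where "a = of_nat ?n"
  have a: "a + 1 \<noteq> 0" "a \<noteq> 0"
    using of_nat_nz[OF _ assms] of_nat_nz[OF _ lt(2)] by (simp_all add: a_def add.commute)
  define U where "U = Uc k"
  define C where "C = Cc k"
  define s where "s = S k"
  define f where "f = L ?n (L k (antisymm k))"
  have ee: "e * e = e" unfolding e_def by (simp only: L_times[OF block_antisymm] antisymm_idem[OF lt(2)])
  have fe: "f * e = e" "e * f = e"
    unfolding f_def e_def by (simp_all only: L_times[OF block_antisymm] L_times[OF block_L[OF block_antisymm]] L_antisymm[OF lt(2)] antisymm_L[OF lt(2)])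
  have CeU: "C * e * U = (- ((a + 1) / a)) \<cdot> antisymm k"
  proof -
    have "a \<cdot> (C * e * U) = - ((a + 1) \<cdot> antisymm k)"
      using Cc_antisymm_Uc[OF assms] unfolding C_def e_def U_def a_def by (simp add: add.commute)
    then have "(1 / a) \<cdot> a \<cdot> (C * e * U) = (1 / a) \<cdot> (- ((a + 1) \<cdot> antisymm k))" by simp
    then show ?thesis using a by (simp add: divide_inverse mult.commute)
  qed
  have Cf: "C * f = antisymm k * C" unfolding C_def f_def by (rule Cc_LL[OF block_antisymm])
  have fU: "f * U = U * antisymm k" unfolding U_def f_def by (rule LL_Uc[OF block_antisymm])
  have two0: "x = 0" if "x = - x" for x :: "'k fmat"
  proof (rule fmat_eqI)
    fix i j
    have "entry x i j = - entry x i j" using that by (metis entry_uminus)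
    then have "2 * entry x i j = 0" by (simp add: eq_neg_iff_add_eq_0)
    then show "entry x i j = entry 0 i j" by simp
  qed
  \<comment> \<open>The first transposition acts by -1 on the antisymmetriser and trivially on the
    cup, and 2 is invertible.\<close>
  have dU: "antisymm ?n' * U = 0"
  proof (rule two0)
    have "antisymm ?n' * U = antisymm ?n' * (s * U)" unfolding s_def U_def by (simp add: S_Uc)
    then show "antisymm ?n' * U = - (antisymm ?n' * U)" unfolding s_def by (simp add: mult.assoc[symmetric] antisymm_S[OF assms])
  qed
  have Cd: "C * antisymm ?n' = 0"
  proof (rule two0)
    have "C * antisymm ?n' = (C * s) * antisymm ?n'" unfolding s_def C_def by (simp add: Cc_S)
    then show "C * antisymm ?n' = - (C * antisymm ?n')" unfolding s_def by (simp add: mult.assoc S_antisymm[OF assms])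
  qed
  have ed: "e * antisymm ?n' = antisymm ?n'" and de: "antisymm ?n' * e = antisymm ?n'"
    unfolding e_def by (rule L_antisymm[OF assms], rule antisymm_L[OF assms])
  have eI: "e * I = I" unfolding IP[symmetric] mult.assoc PI by (rule ghom_idm_right[OF hI])
  have Pe: "P * e = P" unfolding IP[symmetric] mult.assoc[symmetric] PI by (rule ghom_idm_left[OF hP])
  have fI: "f * I = I" using fe eI by (metis mult.assoc)
  have Pf: "P * f = P" using fe Pe by (metis mult.assoc)
  have d: "antisymm ?n' = (1 / (a + 1)) \<cdot> (e - a \<cdot> (e * s * e))"
    unfolding a_def e_def s_def antisymm.simps by (simp add: add.commute)
  \<comment> \<open>Normalises the contraction: by \<open>CeU\<close> the unscaled composite on E_k
    is -(a + 1) / a.\<close>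
  define c :: 'k where "c = - (a / (a + 1))"
  define i1 where "i1 = c \<cdot> (P * U * inc k)"
  define p1 where "p1 = prj k * C * I"
  define i2 where "i2 = P * inc ?n'"
  define p2 where "p2 = prj ?n' * I"
  have hU: "ghom (Tn k) (Tn ?n') U" and hC: "ghom (Tn ?n') (Tn k) C"
    unfolding U_def C_def by (rule ghom_Uc ghom_Cc)+
  have h: "ghom (E k) X i1" "ghom X (E k) p1" "ghom (E ?n') X i2" "ghom X (E ?n') p2"
    unfolding i1_def p1_def i2_def p2_def using hI hP hU hC K N'
    by (blast intro: ghom_comp ghom_scale)+
  have 11: "p1 * i1 = idm (rdim (E k))"
  proof -
    have "p1 * i1 = c \<cdot> (prj k * (C * (I * P) * U) * inc k)"
      unfolding p1_def i1_def by (simp add: mult.assoc)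
    also have "\<dots> = (c * (- ((a + 1) / a))) \<cdot> (prj k * antisymm k * inc k)" unfolding IP CeU by simp
    also have "c * (- ((a + 1) / a)) = 1" using a by (simp add: c_def)
    finally show ?thesis by (simp add: prj_antisymm[OF lt(1)] K(5))
  qed
  have 22: "p2 * i2 = idm (rdim (E ?n'))"
  proof -
    have "p2 * i2 = prj ?n' * (I * P) * inc ?n'" unfolding p2_def i2_def by (simp add: mult.assoc)
    also have "\<dots> = prj ?n' * (antisymm ?n' * e) * inc ?n'"
      unfolding IP using prj_antisymm[OF assms] by (simp add: mult.assoc[symmetric])
    finally show ?thesis unfolding de by (simp add: prj_antisymm[OF assms] N'(5))
  qed
  have 21: "p2 * i1 = 0"
  proof -
    have "p2 * i1 = c \<cdot> (prj ?n' * (I * P) * U * inc k)" unfolding p2_def i1_def by (simp add: mult.assoc)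
    also have "prj ?n' * (I * P) * U * inc k = prj ?n' * (antisymm ?n' * e) * U * inc k"
      unfolding IP using prj_antisymm[OF assms] by (simp add: mult.assoc[symmetric])
    also have "\<dots> = prj ?n' * (antisymm ?n' * U) * inc k" unfolding de by (simp add: mult.assoc)
    finally show ?thesis by (simp add: dU)
  qed
  have 12: "p1 * i2 = 0"
  proof -
    have "p1 * i2 = prj k * C * (I * P) * inc ?n'" unfolding p1_def i2_def by (simp add: mult.assoc)
    also have "\<dots> = prj k * C * (e * antisymm ?n') * inc ?n'"
      unfolding IP using antisymm_inc[OF assms] by (simp add: mult.assoc)
    also have "\<dots> = prj k * (C * antisymm ?n') * inc ?n'" unfolding ed by (simp add: mult.assoc)
    finally show ?thesis by (simp add: Cd)
  qed
  have i1p1: "i1 * p1 = c \<cdot> (P * (U * C) * I)"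
  proof -
    have "i1 * p1 = c \<cdot> (P * (U * (inc k * prj k)) * C * I)" unfolding p1_def i1_def by (simp add: mult.assoc)
    also have "P * (U * (inc k * prj k)) * C * I = P * f * U * C * I" unfolding K(4) fU[symmetric] by (simp add: mult.assoc)
    finally show ?thesis unfolding Pf by (simp add: mult.assoc)
  qed
  have i2p2: "i2 * p2 = (1 / (a + 1)) \<cdot> (idm (rdim X) - a \<cdot> (P * s * I))"
  proof -
    have "i2 * p2 = P * antisymm ?n' * I" unfolding p2_def i2_def N'(4)[symmetric] by (simp add: mult.assoc)
    also have "\<dots> = (1 / (a + 1)) \<cdot> (P * e * I - a \<cdot> (P * e * s * (e * I)))"
      unfolding d by (simp add: left_diff_distrib right_diff_distrib mult.assoc)
    finally show ?thesis unfolding Pe eI PI .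
  qed
  have "stably_zero (Tn ?n') (Tn ?n') (tens (m ^ k) (m ^ k) (idm (m * m) + swap + cup * cap) (idm (m ^ k)))"
    unfolding Tn_Suc2
    using stably_zero_tensor_left[OF modl_tensor[OF modl_Dm modl_Dm] modl_tensor[OF modl_Dm modl_Dm] modl_Tn modl_Tn stably_zero_T ghom_id[OF modl_Tn], of k]
    by simp
  also have "tens (m ^ k) (m ^ k) (idm (m * m) + swap + cup * cap) (idm (m ^ k)) = idm (m ^ ?n') + s + U * C"
    unfolding s_def U_def C_def S_def Uc_def Cc_def tens_idm_times by (simp add: tens_add_left mult.assoc)
  finally have "stably_zero X X (P * (idm (m ^ ?n') + s + U * C) * I)"
    using stably_zero_left[OF hP] stably_zero_right[OF _ hI] by blast
  then have stably_zero: "stably_zero X X (c \<cdot> (P * (idm (m ^ ?n') + s + U * C) * I))" by (rule stably_zero_scale)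
  have Pid: "P * idm (m ^ ?n') = P" using ghom_idm_right[OF hP] by simp
  have "P * (idm (m ^ ?n') + s + U * C) * I = idm (rdim X) + P * s * I + P * (U * C) * I"
    by (simp only: distrib_left distrib_right Pid PI)
  then have "c \<cdot> (P * (idm (m ^ ?n') + s + U * C) * I) = i1 * p1 + i2 * p2 - idm (rdim X)"
  proof -
    have c1: "1 / (a + 1) = 1 + c" and c2: "1 / (a + 1) * a = - c" using a by (simp_all add: c_def field_simps)
    have "i2 * p2 = (1 + c) \<cdot> idm (rdim X) + c \<cdot> (P * s * I)"
      unfolding i2p2 scale_distribs(2) scale_simps(4) c2 unfolding c1 by simp
    then show ?thesis
      unfolding i1p1 \<open>P * (idm (m ^ ?n') + s + U * C) * I = _\<close> by (simp add: scale_distribs)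
  qed
  then have "stably_zero X X (i1 * p1 + i2 * p2 - idm (rdim X))" using stably_zero by simp
  then have "stab_biprod_by X (E k) (E ?n') i1 p1 i2 p2"
    unfolding stab_biprod_by_def 11 22 12 21 using mX K(1) N'(1) h by simp
  then show ?thesis unfolding X_def stab_biprod_def by blast
qed

end

section \<open>Alternating functions on tuples of points\<close>

text \<open>Only adjacent exchanges are mentioned, because these are what the transpositions
  \<open>S n\<close> and induction along the strands produce.\<close>

definition alternating :: "nat \<Rightarrow> (nat list \<Rightarrow> 'b::ab_group_add) \<Rightarrow> bool" where
  "alternating n q \<longleftrightarrow> (\<forall>xs a b ys. length xs + length ys + 2 = n \<longrightarrow> q (xs @ b # a # ys) = - q (xs @ a # b # ys))"

lemma alternatingD: "alternating n q \<Longrightarrow> length xs + length ys + 2 = n \<Longrightarrow> q (xs @ b # a # ys) = - q (xs @ a # b # ys)"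
  unfolding alternating_def by blast

lemma alternating_Cons: assumes "alternating (Suc n) q" shows "alternating n (\<lambda>as. q (z # as))"
  unfolding alternating_def
proof (intro allI impI)
  fix xs a b ys assume "length (xs :: nat list) + length (ys :: nat list) + 2 = n"
  then have "length (z # xs) + length ys + 2 = Suc n" by simp
  from alternatingD[OF assms this] show "q (z # xs @ b # a # ys) = - q (z # xs @ a # b # ys)" unfolding append_Cons .
qed

text \<open>Exchange y with its neighbour b, then y with x across the shorter gap, then b with x:
  three changes of sign.\<close>

lemma alternating_swap:
  assumes "alternating n q"
  shows "length xs + length bs + length ys + 2 = n \<Longrightarrow> q (xs @ y # bs @ x # ys) = - q (xs @ x # bs @ y # ys)"
proof (induction bs arbitrary: xs)
  case Nil
  then have "length xs + length ys + 2 = n" by simp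
  from alternatingD[OF assms this] show ?case unfolding append_Nil .
next
  case (Cons b bs)
  have l: "length xs + length (bs @ z # ys) + 2 = n" for z using Cons.prems by simp
  have "q (xs @ y # b # bs @ x # ys) = - q (xs @ b # y # bs @ x # ys)"
    by (rule alternatingD[OF assms l])
  also have "\<dots> = q (xs @ b # x # bs @ y # ys)"
  proof -
    have "length (xs @ [b]) + length bs + length ys + 2 = n" using Cons.prems by simp
    from Cons.IH[OF this] have "q (xs @ b # y # bs @ x # ys) = - q (xs @ b # x # bs @ y # ys)"
      unfolding append_Cons append_Nil append_assoc .
    then show ?thesis by (simp only: minus_minus)
  qed
  also have "\<dots> = - q (xs @ x # b # bs @ y # ys)" by (rule alternatingD[OF assms l])
  finally show ?case unfolding append_Cons .
qed

text \<open>In a general abelian group only this equation follows; vanishing is concluded where 2 is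
  invertible.\<close>

lemma alternating_not_distinct:
  assumes "alternating n q" "length c = n" "\<not> distinct c" shows "q c = - q c"
proof -
  obtain xs bs ys x where c: "c = xs @ [x] @ bs @ [x] @ ys" using not_distinct_decomp[OF assms(3)] by blast
  then have "length xs + length bs + length ys + 2 = n" using assms(2) by simp
  from alternating_swap[OF assms(1) this] show ?thesis unfolding c append_Cons append_Nil .
qed

lemma split_two:
  assumes "x \<in> set c" "y \<in> set c" "x \<noteq> y"
  shows "\<exists>xs bs ys. c = xs @ x # bs @ y # ys \<or> c = xs @ y # bs @ x # ys"
proof -
  obtain us vs where c: "c = us @ x # vs" using split_list[OF assms(1)] by blast
  then have "y \<in> set us \<or> y \<in> set vs" using assms by auto
  then show ?thesis
  proof
    assume "y \<in> set us"
    then obtain us1 us2 where "us = us1 @ y # us2" using split_list by metis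
    then show ?thesis using c by auto
  next
    assume "y \<in> set vs"
    then obtain vs1 vs2 where "vs = vs1 @ y # vs2" using split_list by metis
    then show ?thesis using c by auto
  qed
qed

lemma map_transpose_id: "x \<notin> set c \<Longrightarrow> y \<notin> set c \<Longrightarrow> map (Transposition.transpose x y) c = c"
  by (rule map_idI) (auto simp: transpose_def)

lemma alternating_transpose:
  assumes "alternating n q" "length c = n" "distinct c" "x \<in> set c" "y \<in> set c" "x \<noteq> y"
  shows "q (map (Transposition.transpose x y) c) = - q c"
proof -
  obtain xs bs ys u v where c: "c = xs @ u # bs @ v # ys" and uv: "{u, v} = {x, y}"
    using split_two[OF assms(4-6)] by blast
  have t: "Transposition.transpose x y = Transposition.transpose u v"
    using uv by (auto simp: doubleton_eq_iff transpose_commute)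
  have "length xs + length bs + length ys + 2 = n" using assms(2) c by simp
  from alternating_swap[OF assms(1) this, of v u]
  have *: "q (xs @ v # bs @ u # ys) = - q c" unfolding c .
  have "map (Transposition.transpose u v) c = xs @ v # bs @ u # ys"
    using assms(3) unfolding c by (simp add: map_transpose_id)
  then show ?thesis unfolding t * [symmetric] by (rule arg_cong)
qed

lemma permutes_set_map:
  assumes "s permutes set c" "distinct c" shows "set (map s c) = set c" "distinct (map s c)"
  using permutes_image[OF assms(1)] permutes_inj_on[OF assms(1), of "set c"] assms(2) by (simp_all add: distinct_map)

lemma alternating_permute:
  fixes q :: "nat list \<Rightarrow> 'k::field fmat"
  assumes q: "alternating n q" and c: "length c = n" "distinct c" and s: "s permutes set c"
  shows "q (map s c) = of_int (sign s) \<cdot> q c"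
proof -
  have "s permutes set c \<and> q (map s c) = of_int (sign s) \<cdot> q c" using s
  proof (rule permutes_induct[where P = "\<lambda>s. s permutes set c \<and> q (map s c) = of_int (sign s) \<cdot> q c"])
    show "id permutes set c \<and> q (map id c) = of_int (sign id) \<cdot> q c" by (simp add: permutes_id)
    fix x y s
    assume xy: "x \<in> set c" "y \<in> set c" and IH: "s permutes set c \<and> q (map s c) = of_int (sign s) \<cdot> q c"
    have s: "s permutes set c" using IH ..
    have t: "Transposition.transpose x y permutes set c" using xy by (rule permutes_swap_id)
    have ps: "permutation s" "permutation (Transposition.transpose x y)"
      using s t by (blast intro: permutes_imp_permutation finite_set)+
    show "Transposition.transpose x y \<circ> s permutes set c \<and>
      q (map (Transposition.transpose x y \<circ> s) c) = of_int (sign (Transposition.transpose x y \<circ> s)) \<cdot> q c"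
    proof (intro conjI)
      show "Transposition.transpose x y \<circ> s permutes set c" by (rule permutes_compose[OF s t])
      show "q (map (Transposition.transpose x y \<circ> s) c) = of_int (sign (Transposition.transpose x y \<circ> s)) \<cdot> q c"
      proof (cases "x = y")
        case True
        then show ?thesis using IH by simp
      next
        case False
        have "q (map (Transposition.transpose x y) (map s c)) = - q (map s c)"
          using alternating_transpose[OF q, of "map s c" x y] permutes_set_map[OF s c(2)] xy False c by simp
        then show ?thesis using IH False by (simp add: sign_compose[OF ps(2,1)] sign_swap_id)
      qed
    qed
  qed simp
  then show ?thesis ..
qed

context char_sym begin

lemma neg_eq_zero: assumes "x = - x" shows "x = (0 :: 'k fmat)"
proof (rule fmat_eqI)
  fix i j
  have "entry x i j = - entry x i j" by (subst assms) simp
  then have "2 * entry x i j = 0" by (simp add: eq_neg_iff_add_eq_0)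
  then show "entry x i j = entry 0 i j" by simp
qed

lemma swap_pform2: "a \<in> points \<Longrightarrow> b \<in> points \<Longrightarrow> tens (Suc 0) m (pform a) (pform b) * swap = tens (Suc 0) m (pform b) (pform a)"
  by (rule pvec2_test[of "Suc 0"])
    (auto simp: mult.assoc swap_times pform2_pvec2 mult.commute intro: block_times[OF block_pform2 block_swap] block_pform2)

lemma L_tvec: "length as = n \<Longrightarrow> L n X * tvec (a # as) = tens (m ^ n) (Suc 0) (pvec a) (X * tvec as)"
  unfolding L_def tvec.simps using tens_times[OF disjI2, OF block_tvec[of as]]
  by (simp add: idm_times[OF block_pvec])

lemma tform_L: "length as = n \<Longrightarrow> tform (a # as) * L n X = tens (Suc 0) (m ^ n) (pform a) (tform as * X)"
  unfolding L_def tform.simps using tens_times[OF disjI1, OF block_tform[of as]]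
  by (simp add: times_idm[OF block_pform])

lemma tvec_two: "length as = n \<Longrightarrow> tvec (a # b # as) = tens (m ^ n) (Suc 0) (tens m (Suc 0) (pvec a) (pvec b)) (tvec as)"
  using tens_assoc[of "m ^ n" "Suc 0" m "Suc 0" "pvec a" "pvec b" "tvec as"] by simp

lemma tform_two: "length as = n \<Longrightarrow> tform (a # b # as) = tens (Suc 0) (m ^ n) (tens (Suc 0) m (pform a) (pform b)) (tform as)"
  using tens_assoc[of "Suc 0" "m ^ n" "Suc 0" m "pform a" "pform b" "tform as"] by simp

lemma S_tvec: assumes "length as = n" shows "S n * tvec (a # b # as) = tvec (b # a # as)"
  unfolding tvec_two[OF assms] S_def using tens_times[OF disjI2, OF block_tvec[of as]] assms
  by (simp add: idm_times[OF block_tvec[of as, unfolded assms]] swap_times)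

lemma tform_S: assumes "length as = n" "a \<in> points" "b \<in> points" shows "tform (a # b # as) * S n = tform (b # a # as)"
  unfolding tform_two[OF assms(1)] S_def using tens_times[OF disjI1, OF block_tform[of as]] assms
  by (simp add: times_idm[OF block_tform[of as, unfolded assms(1)]] swap_pform2)

text \<open>An exchange of the first two entries is absorbed by the antisymmetriser as a
  transposition with a sign. Further to the right, a smaller antisymmetriser is split off on the
  remaining strands and the induction applies to it.\<close>

lemma alternating_tvec: "n < p \<Longrightarrow> alternating n (\<lambda>c. antisymm n * tvec c)"
proof (induction n)
  case (Suc n)
  show ?case unfolding alternating_def
  proof (intro allI impI)
    fix xs a b ys assume l: "length (xs :: nat list) + length (ys :: nat list) + 2 = Suc n"
    show "antisymm (Suc n) * tvec (xs @ b # a # ys) = - (antisymm (Suc n) * tvec (xs @ a # b # ys))"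
    proof (cases xs)
      case Nil
      then obtain k where k: "n = Suc k" "length ys = k" using l by auto
      have "antisymm (Suc n) * tvec (b # a # ys) = antisymm (Suc n) * S k * tvec (a # b # ys)"
        using k by (simp only: mult.assoc S_tvec)
      also have "\<dots> = - (antisymm (Suc n) * tvec (a # b # ys))"
        using Suc.prems unfolding k by (simp only: antisymm_S) simp
      finally show ?thesis using Nil by simp
    next
      case (Cons z us)
      then have l': "length us + length ys + 2 = n" using l by simp
      have e: "antisymm (Suc n) * tvec (z # us @ v # w # ys)
          = antisymm (Suc n) * tens (m ^ n) (Suc 0) (pvec z) (antisymm n * tvec (us @ v # w # ys))" for v w
      proof -
        have "antisymm (Suc n) * tvec (z # us @ v # w # ys) = antisymm (Suc n) * (L n (antisymm n) * tvec (z # us @ v # w # ys))"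
          unfolding mult.assoc[symmetric] using antisymm_L[OF Suc.prems] by simp
        moreover have "length (us @ v # w # ys) = n" using l' by simp
        ultimately show ?thesis by (simp only: L_tvec)
      qed
      have "antisymm n * tvec (us @ b # a # ys) = - (antisymm n * tvec (us @ a # b # ys))"
        by (rule alternatingD[OF Suc.IH l']) (use Suc.prems in simp)
      then show ?thesis unfolding Cons append_Cons e by (simp only: tens_uminus_right mult_minus_right)
    qed
  qed
qed (simp add: alternating_def)

text \<open>The guard is needed to match domains: \<open>alternating\<close> speaks of all lists of
  numbers, \<open>tform_S\<close> of points.\<close>

lemma alternating_tform: "n < p \<Longrightarrow> alternating n (\<lambda>c. if set c \<subseteq> points then tform c * antisymm n else 0)"
proof (induction n)
  case (Suc n)
  show ?case unfolding alternating_def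
  proof (intro allI impI)
    fix xs a b ys assume l: "length (xs :: nat list) + length (ys :: nat list) + 2 = Suc n"
    have "tform (xs @ b # a # ys) * antisymm (Suc n) = - (tform (xs @ a # b # ys) * antisymm (Suc n))"
      if s: "set (xs @ b # a # ys) \<subseteq> points"
    proof (cases xs)
      case Nil
      then obtain k where k: "n = Suc k" "length ys = k" using l by auto
      have "tform (b # a # ys) * antisymm (Suc n) = tform (a # b # ys) * (S k * antisymm (Suc n))"
        using k s by (simp add: mult.assoc[symmetric] tform_S del: tform.simps)
      also have "\<dots> = - (tform (a # b # ys) * antisymm (Suc n))"
        using Suc.prems unfolding k by (simp only: S_antisymm) simp
      finally show ?thesis using Nil by simp
    next
      case (Cons z us)
      then have l': "length us + length ys + 2 = n" using l by simp
      have e: "tform (z # us @ v # w # ys) * antisymm (Suc n)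
          = tens (Suc 0) (m ^ n) (pform z) (tform (us @ v # w # ys) * antisymm n) * antisymm (Suc n)" for v w
      proof -
        have "tform (z # us @ v # w # ys) * antisymm (Suc n) = tform (z # us @ v # w # ys) * L n (antisymm n) * antisymm (Suc n)"
          unfolding mult.assoc using L_antisymm[OF Suc.prems] by simp
        moreover have "length (us @ v # w # ys) = n" using l' by simp
        ultimately show ?thesis by (simp only: tform_L)
      qed
      have "tform (us @ b # a # ys) * antisymm n = - (tform (us @ a # b # ys) * antisymm n)"
      proof -
        have lt: "n < p" using Suc.prems by simp
        have "set (us @ b # a # ys) \<subseteq> points" "set (us @ a # b # ys) \<subseteq> points" using s Cons by auto
        then show ?thesis using alternatingD[OF Suc.IH[OF lt] l', of b a] by (simp only: if_True simp_thms)
      qed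
      then show ?thesis unfolding Cons append_Cons e by (simp only: tens_uminus_right mult_minus_left)
    qed
    then show "(if set (xs @ b # a # ys) \<subseteq> points then tform (xs @ b # a # ys) * antisymm (Suc n) else 0)
      = - (if set (xs @ a # b # ys) \<subseteq> points then tform (xs @ a # b # ys) * antisymm (Suc n) else 0)"
    proof (cases "set (xs @ b # a # ys) \<subseteq> points")
      case True
      moreover from True have "set (xs @ a # b # ys) \<subseteq> points" by auto
      ultimately show ?thesis
        using \<open>set (xs @ b # a # ys) \<subseteq> points \<Longrightarrow> _\<close> by (simp only: if_True simp_thms)
    next
      case False
      moreover from False have "\<not> set (xs @ a # b # ys) \<subseteq> points" by auto
      ultimately show ?thesis by (simp only: if_False minus_zero simp_thms)
    qed
  qed
qed (simp add: alternating_def)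

abbreviation sg :: "(nat \<Rightarrow> nat) \<Rightarrow> 'k" where "sg s \<equiv> of_int (sign s)"

lemma sg_square: "sg s * sg s = 1" by (simp add: sign_def)

lemma sum_sign_neg:
  fixes F :: "(nat \<Rightarrow> nat) \<Rightarrow> 'k"
  assumes A: "finite A" "x \<in> A" "y \<in> A" "x \<noteq> y"
    and F: "\<And>s. s permutes A \<Longrightarrow> F (s \<circ> Transposition.transpose x y) = F' s"
  shows "(\<Sum>s | s permutes A. sg s * F s) = - (\<Sum>s | s permutes A. sg s * F' s)"
proof -
  let ?t = "Transposition.transpose x y"
  have t: "?t permutes A" using A by (intro permutes_swap_id)
  have "(\<Sum>s | s permutes A. sg s * F s) = (\<Sum>s | s permutes A. sg (s \<circ> ?t) * F (s \<circ> ?t))"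
    by (rule sum_permutations_compose_right[OF t])
  also have "\<dots> = (\<Sum>s | s permutes A. - (sg s * F' s))"
  proof (rule sum.cong[OF refl])
    fix s assume "s \<in> {s. s permutes A}"
    then have s: "s permutes A" by simp
    have "sign (s \<circ> ?t) = - sign s"
      using sign_compose[of s ?t] permutes_imp_permutation[OF A(1)] s t A(4) by (simp add: sign_swap_id)
    then show "sg (s \<circ> ?t) * F (s \<circ> ?t) = - (sg s * F' s)" using F[OF s] by simp
  qed
  finally show ?thesis by (simp add: sum_negf)
qed

text \<open>Pairing s with its composite with the transposition shows that the sum is its own
  negative.\<close>

lemma sum_sign_zero:
  fixes F :: "(nat \<Rightarrow> nat) \<Rightarrow> 'k"
  assumes "finite A" "x \<in> A" "y \<in> A" "x \<noteq> y"
    and "\<And>s. s permutes A \<Longrightarrow> F (s \<circ> Transposition.transpose x y) = F s"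
  shows "(\<Sum>s | s permutes A. sg s * F s) = 0"
proof -
  have "2 * (\<Sum>s | s permutes A. sg s * F s) = 0"
    unfolding mult_2 by (subst (2) sum_sign_neg[where F = F and F' = F, OF assms]) simp_all
  then show ?thesis by simp
qed

abbreviation fc :: "nat \<Rightarrow> 'k" where "fc n \<equiv> of_nat (fact n)"

text \<open>A list of length \<open>n\<close> stands for the tabloid whose rows below the first are its entries, a list
  \<open>a\<close> of length \<open>n + 1\<close> for the first column of a tableau, and \<open>polytab a\<close> for its polytabloid.\<close>

definition polytab :: "nat list \<Rightarrow> nat list \<Rightarrow> 'k" where
  "polytab a c = (\<Sum>s | s permutes set a. sg s * of_bool (map s (tl a) = c))"

definition columns :: "nat \<Rightarrow> nat list set" where
  "columns n = {a. distinct a \<and> set a \<subseteq> points \<and> length a = Suc n}"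

lemma columnsD: assumes "a \<in> columns n" shows "distinct a" "set a \<subseteq> points" "length a = Suc n" "length (tl a) = n"
  using assms by (auto simp: columns_def)

lemma columns_perm: "a \<in> columns n \<Longrightarrow> s permutes set a \<Longrightarrow> map s (tl a) \<in> plist n"
proof -
  assume a: "a \<in> columns n" and s: "s permutes set a"
  have "set (tl a) \<subseteq> set a" by (cases a) auto
  then have "s ` set (tl a) \<subseteq> set a" using permutes_image[OF s] by blast
  then show ?thesis using columnsD[OF a] by (simp add: plist_def)
qed

text \<open>Exchanging two adjacent entries of c amounts to composing the column permutation with
  the transposition of the entries y and z of the column at these two places.\<close>

lemma alternating_polytab: assumes a: "a \<in> columns n" shows "alternating n (polytab a)"
  unfolding alternating_def
proof (intro allI impI)
  fix xs u v ys assume l: "length (xs :: nat list) + length (ys :: nat list) + 2 = n"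
  define i where "i = length xs"
  have i: "Suc i < length (tl a)" using l columnsD(4)[OF a] by (simp add: i_def)
  define as1 as2 y z where "as1 = take i (tl a)" "as2 = drop (Suc (Suc i)) (tl a)" "y = tl a ! i" "z = tl a ! Suc i"
  have t: "tl a = as1 @ y # z # as2" unfolding as1_as2_y_z_def using i
    by (metis Cons_nth_drop_Suc Suc_lessD append_take_drop_id)
  have l1: "length as1 = length xs" unfolding as1_as2_y_z_def using i by (simp add: i_def)
  have d: "distinct (as1 @ y # z # as2)" using columnsD(1)[OF a] unfolding t[symmetric] by (rule distinct_tl)
  have s: "set (tl a) \<subseteq> set a" by (cases a) auto
  show "polytab a (xs @ v # u # ys) = - polytab a (xs @ u # v # ys)"
    unfolding polytab_def
  proof (rule sum_sign_neg)
    show "y \<in> set a" "z \<in> set a" using s unfolding t by auto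
    show "y \<noteq> z" using d by auto
    fix s :: "nat \<Rightarrow> nat"
    have "map (s \<circ> Transposition.transpose y z) (tl a) = map s (map (Transposition.transpose y z) (tl a))" by simp
    also have "map (Transposition.transpose y z) (tl a) = as1 @ z # y # as2"
      unfolding t using d by (simp add: map_transpose_id)
    finally have "map (s \<circ> Transposition.transpose y z) (tl a) = map s as1 @ s z # s y # map s as2"
      by (simp only: map_append list.map)
    then show "of_bool (map (s \<circ> Transposition.transpose y z) (tl a) = xs @ v # u # ys)
        = (of_bool (map s (tl a) = xs @ u # v # ys) :: 'k)"
      unfolding t using l1 by auto
  qed simp
qed

text \<open>The condition that makes the base point immaterial: \<open>pvec a\<close> stands for x_a
  - x_p, and the contributions of x_p to a slot cancel. It makes \<open>to_tensor\<close>
  equivariant and compatible with the forms.\<close>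

definition slot_sum_zero :: "nat \<Rightarrow> (nat list \<Rightarrow> 'k) \<Rightarrow> bool" where
  "slot_sum_zero n x \<longleftrightarrow> (\<forall>xs ys. length xs + length ys + 1 = n \<longrightarrow> (\<Sum>z\<in>points. x (xs @ z # ys)) = 0)"

lemma slot_sum_zero_Cons: assumes "slot_sum_zero (Suc n) x" shows "slot_sum_zero n (\<lambda>c. x (z # c))"
  unfolding slot_sum_zero_def
proof (intro allI impI)
  fix xs ys assume "length (xs :: nat list) + length (ys :: nat list) + 1 = n"
  then have "length (z # xs) + length ys + 1 = Suc n" by simp
  with assms have "(\<Sum>w\<in>points. x ((z # xs) @ w # ys)) = 0" unfolding slot_sum_zero_def by blast
  then show "(\<Sum>w\<in>points. x (z # xs @ w # ys)) = 0" by simp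
qed

lemma slot_sum_zero_head: assumes "slot_sum_zero (Suc n) x" "c \<in> plist n" shows "(\<Sum>z\<in>points. x (z # c)) = 0"
proof -
  have "length [] + length c + 1 = Suc n" using assms(2) by (simp add: plist_def)
  with assms(1) have "(\<Sum>w\<in>points. x ([] @ w # c)) = 0" unfolding slot_sum_zero_def by blast
  then show ?thesis by simp
qed

text \<open>Once the slot of the column entry y is summed out, y and the head h of the column are
  both unconstrained, and exchanging them cancels the terms in pairs.\<close>

lemma slot_sum_zero_polytab: assumes a: "a \<in> columns n" shows "slot_sum_zero n (polytab a)"
  unfolding slot_sum_zero_def
proof (intro allI impI)
  fix xs ys assume l: "length (xs :: nat list) + length (ys :: nat list) + 1 = n"
  define i where "i = length xs"
  have i: "i < length (tl a)" using l columnsD(4)[OF a] by (simp add: i_def)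
  define as1 as2 y where "as1 = take i (tl a)" "as2 = drop (Suc i) (tl a)" "y = tl a ! i"
  have t: "tl a = as1 @ y # as2" unfolding as1_as2_y_def using i by (metis id_take_nth_drop)
  have l1: "length as1 = length xs" unfolding as1_as2_y_def using i by (simp add: i_def)
  obtain h where h: "a = h # tl a" using columnsD(3)[OF a] by (cases a) auto
  have d: "distinct (h # as1 @ y # as2)" using columnsD(1)[OF a] h t by metis
  have sa: "set a = set (h # as1 @ y # as2)" using h t by metis
  define F :: "(nat \<Rightarrow> nat) \<Rightarrow> 'k" where "F s = of_bool (map s as1 = xs \<and> map s as2 = ys)" for s
  have "(\<Sum>z\<in>points. polytab a (xs @ z # ys)) = (\<Sum>s | s permutes set a. sg s * F s)"
  proof -
    have "(\<Sum>z\<in>points. polytab a (xs @ z # ys)) = (\<Sum>s | s permutes set a. sg s * (\<Sum>z\<in>points. of_bool (map s (tl a) = xs @ z # ys)))"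
      unfolding polytab_def by (subst sum.swap) (simp add: sum_distrib_left)
    also have "\<dots> = (\<Sum>s | s permutes set a. sg s * F s)"
    proof (rule sum.cong[OF refl])
      fix s assume "s \<in> {s. s permutes set a}"
      then have "s y \<in> set a" unfolding sa using permutes_in_image by fastforce
      then have sy: "s y \<in> points" using columnsD(2)[OF a] by blast
      have "(\<Sum>z\<in>points. of_bool (map s (tl a) = xs @ z # ys)) = (\<Sum>z\<in>points. of_bool (z = s y) * F s)"
        unfolding t F_def using l1 by (intro sum.cong) auto
      also have "\<dots> = F s" by (rule sum_pick[OF sy])
      finally show "sg s * (\<Sum>z\<in>points. of_bool (map s (tl a) = xs @ z # ys)) = sg s * F s" by simp
    qed
    finally show ?thesis .
  qed
  also have "\<dots> = 0"
  proof (rule sum_sign_zero)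
    show "h \<in> set a" "y \<in> set a" "h \<noteq> y" using d by (auto simp: sa)
    fix s :: "nat \<Rightarrow> nat"
    have e: "map (s \<circ> Transposition.transpose h y) as' = map s as'" if "h \<notin> set as'" "y \<notin> set as'" for as'
      using map_transpose_id[OF that] by (metis map_map)
    have "map (s \<circ> Transposition.transpose h y) as1 = map s as1" "map (s \<circ> Transposition.transpose h y) as2 = map s as2"
      using d by (intro e; auto)+
    then show "F (s \<circ> Transposition.transpose h y) = F s" unfolding F_def by (simp only:)
  qed simp
  finally show "(\<Sum>z\<in>points. polytab a (xs @ z # ys)) = 0" .
qed

lemma sum_polytab:
  assumes a: "a \<in> columns n"
  shows "(\<Sum>c\<in>plist n. polytab a c * x c) = (\<Sum>s | s permutes set a. sg s * x (map s (tl a)))"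
proof -
  have "(\<Sum>c\<in>plist n. polytab a c * x c) = (\<Sum>s | s permutes set a. \<Sum>c\<in>plist n. sg s * of_bool (map s (tl a) = c) * x c)"
    unfolding polytab_def sum_distrib_right by (rule sum.swap)
  also have "\<dots> = (\<Sum>s | s permutes set a. sg s * x (map s (tl a)))"
  proof (rule sum.cong[OF refl])
    fix s assume "s \<in> {s. s permutes set a}"
    then have m: "map s (tl a) \<in> plist n" using columns_perm[OF a] by simp
    have "(\<Sum>c\<in>plist n. sg s * of_bool (map s (tl a) = c) * x c)
        = (\<Sum>c\<in>plist n. if c = map s (tl a) then sg s * x (map s (tl a)) else 0)"
      by (rule sum.cong) auto
    then show "(\<Sum>c\<in>plist n. sg s * of_bool (map s (tl a) = c) * x c) = sg s * x (map s (tl a))"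
      using m by simp
  qed
  finally show ?thesis .
qed

lemma sum_polytab_fmat:
  assumes a: "a \<in> columns n"
  shows "(\<Sum>c\<in>plist n. polytab a c \<cdot> q c) = (\<Sum>s | s permutes set a. sg s \<cdot> (q (map s (tl a)) :: 'k fmat))"
  by (rule fmat_eqI) (simp add: sum_polytab[OF a])

text \<open>A column permutation is determined by its values off the head, so a polytabloid contains
  no tabloid twice and its coefficients are signs.\<close>

lemma permutes_tl_eq:
  assumes d: "distinct a" and s: "s permutes set a" "s' permutes set a" and eq: "map s (tl a) = map s' (tl a)"
  shows "s = s'"
proof (cases a)
  case Nil
  then show ?thesis using s by (simp add: permutes_empty)
next
  case (Cons h as)
  have e: "s y = s' y" if "y \<noteq> h" for y
  proof (cases "y \<in> set as")
    case True
    then show ?thesis using eq Cons by auto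
  next
    case False
    then show ?thesis using permutes_not_in[OF s(1)] permutes_not_in[OF s(2)] that Cons by auto
  qed
  obtain y where y: "s' y = s h" using permutes_surj[OF s(2)] by (metis surjD)
  have "y = h"
  proof (rule ccontr)
    assume "y \<noteq> h"
    then have "s y = s h" using e y by simp
    then show False using permutes_inj[OF s(1)] \<open>y \<noteq> h\<close> by (auto dest: injD)
  qed
  then show ?thesis using e y by (intro ext) metis
qed

lemma polytab_permute:
  assumes a: "a \<in> columns n" and s: "s permutes set a"
  shows "polytab a (map s (tl a)) = sg s"
proof -
  have "polytab a (map s (tl a)) = (\<Sum>s' | s' permutes set a. if s' = s then sg s else 0)"
    unfolding polytab_def using permutes_tl_eq[OF columnsD(1)[OF a]] s by (intro sum.cong) (auto simp: of_bool_def)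
  then show ?thesis using s finite_permutations[of "set a"] by simp
qed

lemma sum_polytab_polytab: assumes a: "a \<in> columns n" shows "(\<Sum>c\<in>plist n. polytab a c * polytab a c) = fc (Suc n)"
proof -
  have "(\<Sum>c\<in>plist n. polytab a c * polytab a c) = (\<Sum>s | s permutes set a. sg s * sg s)"
    unfolding sum_polytab[OF a] by (rule sum.cong) (simp_all add: polytab_permute[OF a])
  also have "\<dots> = of_nat (card {s. s permutes set a})" by (simp add: sg_square)
  also have "card {s. s permutes set a} = fact (Suc n)"
    using card_permutations[of "set a" "Suc n"] distinct_card[OF columnsD(1)[OF a]] columnsD(3)[OF a] by simp
  finally show ?thesis .
qed

text \<open>As q kills every list containing p, only column permutations fixing p contribute. There
  are n! of them, and each gives q b because the two signs cancel.\<close>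

lemma sum_polytab_alternating:
  assumes b: "p # b \<in> columns n" and q: "alternating n q" "\<And>c. p \<in> set c \<Longrightarrow> q c = 0"
  shows "(\<Sum>c\<in>plist n. polytab (p # b) c \<cdot> q c) = fc n \<cdot> (q b :: 'k fmat)"
proof -
  have d: "distinct b" "p \<notin> set b" "length b = n" using columnsD[OF b] by auto
  have "(\<Sum>c\<in>plist n. polytab (p # b) c \<cdot> q c) = (\<Sum>s | s permutes set (p # b). sg s \<cdot> q (map s b))"
    using sum_polytab_fmat[OF b] by simp
  also have "\<dots> = (\<Sum>s | s permutes set b. sg s \<cdot> q (map s b))"
  proof (rule sum.mono_neutral_right)
    show "finite {s. s permutes set (p # b)}" by (rule finite_permutations) simp
    show "{s. s permutes set b} \<subseteq> {s. s permutes set (p # b)}"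
    proof (rule subsetI)
      fix s assume "s \<in> {s. s permutes set b}"
      then have "s permutes set b" by (rule CollectD)
      then have "s permutes set (p # b)" by (rule permutes_subset[OF _ set_subset_Cons])
      then show "s \<in> {s. s permutes set (p # b)}" unfolding mem_Collect_eq .
    qed
    show "\<forall>s\<in>{s. s permutes set (p # b)} - {s. s permutes set b}. sg s \<cdot> q (map s b) = 0"
    proof
      fix s assume "s \<in> {s. s permutes set (p # b)} - {s. s permutes set b}"
      then have s: "s permutes insert p (set b)" "\<not> s permutes set b" by auto
      have "p \<in> s ` insert p (set b)" unfolding permutes_image[OF s(1)] by (rule insertI1)
      moreover have "s p \<noteq> p"
      proof
        assume "s p = p"
        then have "s permutes set b" by (intro permutes_superset[OF s(1)]) auto
        with s(2) show False ..
      qed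
      ultimately have "p \<in> set (map s b)" by fastforce
      then show "sg s \<cdot> q (map s b) = 0" using q(2) by simp
    qed
  qed
  also have "\<dots> = (\<Sum>s | s permutes set b. q b)"
  proof (rule sum.cong[OF refl])
    fix s assume "s \<in> {s. s permutes set b}"
    then have "q (map s b) = sg s \<cdot> q b" using alternating_permute[OF q(1) d(3,1)] by blast
    then show "sg s \<cdot> q (map s b) = q b" by (simp only: scale_simps sg_square)
  qed
  also have "\<dots> = of_nat (card {s. s permutes set b}) \<cdot> q b" by (rule sum_const_scale)
  also have "card {s. s permutes set b} = fact n"
    using card_permutations[of "set b" n] distinct_card[OF d(1)] d(3) by simp
  finally show ?thesis .
qed

section \<open>From alternating functions to exterior powers\<close>

definition to_tensor :: "nat \<Rightarrow> (nat list \<Rightarrow> 'k) \<Rightarrow> 'k fmat" where "to_tensor n x = (\<Sum>c\<in>plist n. x c \<cdot> tvec c)"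
definition to_cotensor :: "nat \<Rightarrow> (nat list \<Rightarrow> 'k) \<Rightarrow> 'k fmat" where "to_cotensor n x = (\<Sum>c\<in>plist n. x c \<cdot> tform c)"

lemma plist_length: "c \<in> plist n \<Longrightarrow> length c = n" by (simp add: plist_def)

lemma block_to_tensor [simp]: "block (m ^ n) (Suc 0) (to_tensor n x)" and block_to_cotensor [simp]: "block (Suc 0) (m ^ n) (to_cotensor n x)"
proof -
  have "block (m ^ n) (Suc 0) (tvec c)" "block (Suc 0) (m ^ n) (tform c)" if "c \<in> plist n" for c
    using block_tvec[of c] block_tform[of c] plist_length[OF that] by simp_all
  then show "block (m ^ n) (Suc 0) (to_tensor n x)" "block (Suc 0) (m ^ n) (to_cotensor n x)"
    unfolding to_tensor_def to_cotensor_def by (blast intro: block_sum block_intros(5))+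
qed

lemma to_tensor_Suc: "to_tensor (Suc n) x = (\<Sum>z\<in>points. tens (m ^ n) (Suc 0) (pvec z) (to_tensor n (\<lambda>c. x (z # c))))"
  unfolding to_tensor_def sum_plist_Suc tens_sum_right by (intro sum.cong refl) (simp add: plist_length)

lemma to_cotensor_Suc: "to_cotensor (Suc n) x = (\<Sum>z\<in>points. tens (Suc 0) (m ^ n) (pform z) (to_cotensor n (\<lambda>c. x (z # c))))"
  unfolding to_cotensor_def sum_plist_Suc tens_sum_right by (intro sum.cong refl) (simp add: plist_length)

lemma S_to_tensor: assumes "alternating (Suc (Suc n)) x" shows "S n * to_tensor (Suc (Suc n)) x = - to_tensor (Suc (Suc n)) x"
proof -
  have "S n * to_tensor (Suc (Suc n)) x = (\<Sum>z\<in>points. \<Sum>w\<in>points. \<Sum>c\<in>plist n. x (z # w # c) \<cdot> tvec (w # z # c))"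
    unfolding to_tensor_def sum_plist_Suc sum_distrib_left scale_times
    by (intro sum.cong refl) (simp only: S_tvec plist_length)
  also have "\<dots> = (\<Sum>w\<in>points. \<Sum>z\<in>points. \<Sum>c\<in>plist n. x (z # w # c) \<cdot> tvec (w # z # c))"
    by (rule sum.swap)
  also have "\<dots> = (\<Sum>w\<in>points. \<Sum>z\<in>points. \<Sum>c\<in>plist n. - (x (w # z # c) \<cdot> tvec (w # z # c)))"
  proof (intro sum.cong refl)
    fix w z c assume "c \<in> plist n"
    then have "length [] + length c + 2 = Suc (Suc n)" by (simp add: plist_def)
    from alternatingD[OF assms this, of z w] have "x (z # w # c) = - x (w # z # c)" by simp
    then show "x (z # w # c) \<cdot> tvec (w # z # c) = - (x (w # z # c) \<cdot> tvec (w # z # c))"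
      by (simp only: scale_simps)
  qed
  finally show ?thesis unfolding to_tensor_def sum_plist_Suc by (simp only: sum_negf)
qed

text \<open>On such tensors the smaller antisymmetriser is the identity by induction and the first
  transposition is -1, so the recursion gives (1 + N) / (N + 1).\<close>

lemma antisymm_to_tensor: "n < p \<Longrightarrow> alternating n x \<Longrightarrow> antisymm n * to_tensor n x = to_tensor n x"
proof (induction n arbitrary: x rule: antisymm.induct)
  case 1
  then show ?case using idm_times[OF block_to_tensor[of 0 x]] by simp
next
  case 2
  then show ?case using idm_times[OF block_to_tensor[of "Suc 0" x]] by simp
next
  case (3 n)
  let ?e = "L (Suc n) (antisymm (Suc n))"
  define N :: 'k where "N = of_nat (Suc n)"
  have N: "N + 1 \<noteq> 0" unfolding N_def using of_nat_nz[OF _ "3.prems"(1)] by (simp add: add.commute)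
  have e: "?e * to_tensor (Suc (Suc n)) x = to_tensor (Suc (Suc n)) x"
    unfolding to_tensor_Suc[of "Suc n"] sum_distrib_left
  proof (rule sum.cong[OF refl])
    fix z
    have "antisymm (Suc n) * to_tensor (Suc n) (\<lambda>c. x (z # c)) = to_tensor (Suc n) (\<lambda>c. x (z # c))"
      using "3.prems"(1) by (intro "3.IH"(1) alternating_Cons[OF "3.prems"(2)]) simp
    then show "?e * tens (m ^ Suc n) (Suc 0) (pvec z) (to_tensor (Suc n) (\<lambda>c. x (z # c)))
      = tens (m ^ Suc n) (Suc 0) (pvec z) (to_tensor (Suc n) (\<lambda>c. x (z # c)))"
      unfolding L_def by (subst tens_times[OF disjI2, OF block_to_tensor]) (simp only: idm_times[OF block_pvec])
  qed
  have "antisymm (Suc (Suc n)) * to_tensor (Suc (Suc n)) x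
    = (1 / (N + 1)) \<cdot> (?e * to_tensor (Suc (Suc n)) x - N \<cdot> (?e * (S n * (?e * to_tensor (Suc (Suc n)) x))))"
    unfolding antisymm.simps N_def by (simp add: left_diff_distrib mult.assoc add.commute)
  also have "\<dots> = (1 / (N + 1)) \<cdot> (N + 1) \<cdot> to_tensor (Suc (Suc n)) x"
    unfolding e S_to_tensor[OF "3.prems"(2)] by (simp add: e scale_distribs add.commute)
  finally show ?case using N by simp
qed

lemma to_tensor_sum_head: assumes "slot_sum_zero (Suc n) x" shows "(\<Sum>z\<in>points. to_tensor n (\<lambda>c. x (z # c))) = 0"
  and "(\<Sum>z\<in>points. to_cotensor n (\<lambda>c. x (z # c))) = 0"
proof -
  have "(\<Sum>z\<in>points. to_tensor n (\<lambda>c. x (z # c))) = (\<Sum>c\<in>plist n. \<Sum>z\<in>points. x (z # c) \<cdot> tvec c)"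
    unfolding to_tensor_def by (rule sum.swap)
  also have "\<dots> = (\<Sum>c\<in>plist n. (\<Sum>z\<in>points. x (z # c)) \<cdot> tvec c)"
    by (intro sum.cong refl fmat_eqI) (simp add: sum_distrib_right)
  finally show "(\<Sum>z\<in>points. to_tensor n (\<lambda>c. x (z # c))) = 0" by (simp add: slot_sum_zero_head[OF assms])
  have "(\<Sum>z\<in>points. to_cotensor n (\<lambda>c. x (z # c))) = (\<Sum>c\<in>plist n. \<Sum>z\<in>points. x (z # c) \<cdot> tform c)"
    unfolding to_cotensor_def by (rule sum.swap)
  also have "\<dots> = (\<Sum>c\<in>plist n. (\<Sum>z\<in>points. x (z # c)) \<cdot> tform c)"
    by (intro sum.cong refl fmat_eqI) (simp add: sum_distrib_right)
  finally show "(\<Sum>z\<in>points. to_cotensor n (\<lambda>c. x (z # c))) = 0" by (simp add: slot_sum_zero_head[OF assms])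
qed

text \<open>The correction \<open>pvec (g p)\<close> from \<open>R_pvec\<close> is paired with a
  full sum over one slot and therefore disappears.\<close>

lemma act_to_tensor:
  assumes g: "g \<in> carrier G"
  shows "slot_sum_zero n x \<Longrightarrow> act (Tn n) g * to_tensor n x = to_tensor n (\<lambda>c. x (map (inv' g) c))"
proof (induction n arbitrary: x)
  case 0
  then show ?case by (simp add: to_tensor_def plist_0)
next
  case (Suc n)
  let ?A = "act (Tn n) g" and ?x = "\<lambda>z. to_tensor n (\<lambda>c. x (z # c))" and ?y = "\<lambda>z. to_tensor n (\<lambda>c. x (z # map (inv' g) c))"
  have "act (Tn (Suc n)) g * to_tensor (Suc n) x = (\<Sum>z\<in>points. tens (m ^ n) (m ^ n) (R g) ?A * tens (m ^ n) (Suc 0) (pvec z) (?x z))"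
    unfolding to_tensor_Suc sum_distrib_left using act_tensor[OF modl_Dm modl_Tn g, of n] by simp
  also have "\<dots> = (\<Sum>z\<in>points. tens (m ^ n) (Suc 0) (pvec (g z) - pvec (g p)) (?A * ?x z))"
    by (intro sum.cong refl) (subst tens_times[OF disjI2, OF block_to_tensor], simp add: R_pvec g)
  also have "\<dots> = (\<Sum>z\<in>points. tens (m ^ n) (Suc 0) (pvec (g z)) (?y z)) - tens (m ^ n) (Suc 0) (pvec (g p)) (?A * (\<Sum>z\<in>points. ?x z))"
    unfolding tens_diff_left sum_subtractf sum_distrib_left tens_sum_right
    by (simp only: Suc.IH[OF slot_sum_zero_Cons[OF Suc.prems]])
  also have "\<dots> = (\<Sum>z\<in>points. tens (m ^ n) (Suc 0) (pvec (g z)) (?y z))"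
    by (simp only: to_tensor_sum_head[OF Suc.prems] mult_zero_right tens_zero_right diff_zero)
  also have "\<dots> = (\<Sum>z\<in>points. tens (m ^ n) (Suc 0) (pvec (g z)) (?y (inv' g (g z))))"
    by (simp only: inv_perm[OF g])
  also have "\<dots> = (\<Sum>z\<in>points. tens (m ^ n) (Suc 0) (pvec z) (?y (inv' g z)))"
    by (rule sum_perm[OF g])
  finally show ?case unfolding to_tensor_Suc by (simp only: list.map)
qed

text \<open>Of the four terms of \<open>sc a b\<close> only the one with a = b survives the slot
  sums and \<open>pform p = 0\<close>-type cancellations at the base point, so the form on tensors
  becomes the standard form on coefficient functions.\<close>

lemma to_cotensor_to_tensor: "slot_sum_zero n w \<Longrightarrow> slot_sum_zero n x \<Longrightarrow> to_cotensor n w * to_tensor n x = (\<Sum>c\<in>plist n. w c * x c) \<cdot> idm (Suc 0)"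
proof (induction n arbitrary: w x)
  case 0
  then show ?case by (simp add: to_tensor_def to_cotensor_def plist_0 idm_times mult.commute)
next
  case (Suc n)
  let ?x = "\<lambda>z. to_tensor n (\<lambda>c. x (z # c))" and ?w = "\<lambda>z. to_cotensor n (\<lambda>c. w (z # c))"
  have x0: "(\<Sum>z\<in>points. ?x z) = 0" and w0: "(\<Sum>z\<in>points. ?w z) = 0"
    by (rule to_tensor_sum_head[OF Suc.prems(2)], rule to_tensor_sum_head[OF Suc.prems(1)])
  have "to_cotensor (Suc n) w * to_tensor (Suc n) x = (\<Sum>a\<in>points. \<Sum>b\<in>points. tens (Suc 0) (m ^ n) (pform a) (?w a) * tens (m ^ n) (Suc 0) (pvec b) (?x b))"
    unfolding to_tensor_Suc to_cotensor_Suc sum_product ..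
  also have "\<dots> = (\<Sum>a\<in>points. \<Sum>b\<in>points. sc a b \<cdot> (?w a * ?x b))"
    by (intro sum.cong refl, subst tens_times[OF disjI2, OF block_to_tensor])
      (simp add: pform_pvec tens_one_left[OF block_times[OF block_to_cotensor block_to_tensor]])
  also have "\<dots> = (\<Sum>a\<in>points. ?w a * (?x a - ?x p))"
  proof (rule sum.cong[OF refl])
    fix a assume a: "a \<in> points"
    have pick: "(\<Sum>b\<in>points. of_bool (b = c) \<cdot> ?x b) = ?x c" if "c \<in> points" for c
      by (rule fmat_eqI) (simp add: sum_pick[OF that])
    have "(\<Sum>b\<in>points. sc a b \<cdot> (?w a * ?x b)) = ?w a * (\<Sum>b\<in>points. sc a b \<cdot> ?x b)"
      by (simp add: sum_distrib_left)
    also have "(\<Sum>b\<in>points. sc a b \<cdot> ?x b)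
      = (\<Sum>b\<in>points. of_bool (b = a) \<cdot> ?x b) - (\<Sum>b\<in>points. of_bool (b = p) \<cdot> ?x b) + (1 - of_bool (a = p)) \<cdot> (\<Sum>b\<in>points. ?x b)"
      unfolding scale_sum sum_subtractf[symmetric] sum.distrib[symmetric]
      by (intro sum.cong refl) (auto simp: sc_def scale_distribs)
    finally show "(\<Sum>b\<in>points. sc a b \<cdot> (?w a * ?x b)) = ?w a * (?x a - ?x p)"
      unfolding x0 pick[OF a] pick[OF p_points] by simp
  qed
  also have "\<dots> = (\<Sum>a\<in>points. ?w a * ?x a) - (\<Sum>a\<in>points. ?w a) * ?x p"
    by (simp add: right_diff_distrib sum_subtractf sum_distrib_right)
  also have "\<dots> = (\<Sum>a\<in>points. (\<Sum>c\<in>plist n. w (a # c) * x (a # c)) \<cdot> idm (Suc 0))"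
    unfolding w0 using Suc.IH[OF slot_sum_zero_Cons[OF Suc.prems(1)] slot_sum_zero_Cons[OF Suc.prems(2)]] by simp
  also have "\<dots> = (\<Sum>c\<in>plist (Suc n). w c * x c) \<cdot> idm (Suc 0)"
    unfolding sum_plist_Suc by (rule fmat_eqI) (simp add: sum_distrib_right)
  finally show ?case .
qed

lemma tvec_p: "p \<in> set c \<Longrightarrow> tvec c = 0" and tform_p: "p \<in> set c \<Longrightarrow> tform c = 0"
  by (induction c) auto

lemma p_columns: "c \<in> plist n \<Longrightarrow> distinct c \<Longrightarrow> p \<notin> set c \<Longrightarrow> p # c \<in> columns n"
  by (simp add: plist_def columns_def)

lemma antisymm_tvec_zero: assumes "n < p" "length c = n" "\<not> distinct c" shows "antisymm n * tvec c = 0"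
  by (rule neg_eq_zero[OF alternating_not_distinct[OF alternating_tvec[OF assms(1)] assms(2,3)]])

text \<open>The tensor of \<open>polytab (p # c)\<close> is fixed by the antisymmetriser. Applying
  this to its expansion gives n! times the left-hand side, since tensors containing
  \<open>pvec p = 0\<close> drop out.\<close>

lemma antisymm_tvec:
  assumes n: "n < p" and c: "c \<in> plist n" "distinct c" "p \<notin> set c"
  shows "antisymm n * tvec c = (1 / fc n) \<cdot> to_tensor n (polytab (p # c))"
proof -
  have "to_tensor n (polytab (p # c)) = antisymm n * to_tensor n (polytab (p # c))"
    by (rule antisymm_to_tensor[OF n alternating_polytab[OF p_columns[OF c]], symmetric])
  also have "\<dots> = (\<Sum>b\<in>plist n. polytab (p # c) b \<cdot> (antisymm n * tvec b))" by (simp add: to_tensor_def sum_distrib_left)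
  also have "\<dots> = fc n \<cdot> (antisymm n * tvec c)"
    by (rule sum_polytab_alternating[OF p_columns[OF c] alternating_tvec[OF n]]) (simp add: tvec_p)
  finally show ?thesis using fact_nz[OF n] by simp
qed

text \<open>A tensor is recovered from its values under the rows \<open>tform c\<close>. As a
  function of c these values alternate and vanish on lists containing p, so n! times each is the
  pairing of x with \<open>polytab (p # c)\<close>. Hence the radical of the form lies in the
  kernel.\<close>

lemma to_tensor_zero:
  assumes n: "n < p" and x: "alternating n x" "slot_sum_zero n x" and ort: "\<And>a. a \<in> columns n \<Longrightarrow> (\<Sum>c\<in>plist n. polytab a c * x c) = 0"
  shows "to_tensor n x = 0"
proof -
  define q where "q c = (if set c \<subseteq> points then tform c * to_tensor n x else 0)" for c
  have "alternating n (\<lambda>c. (if set c \<subseteq> points then tform c * antisymm n else 0) * to_tensor n x)"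
    unfolding alternating_def
  proof (intro allI impI)
    fix xs a b ys assume l: "length (xs :: nat list) + length (ys :: nat list) + 2 = n"
    show "(if set (xs @ b # a # ys) \<subseteq> points then tform (xs @ b # a # ys) * antisymm n else 0) * to_tensor n x
      = - ((if set (xs @ a # b # ys) \<subseteq> points then tform (xs @ a # b # ys) * antisymm n else 0) * to_tensor n x)"
      unfolding alternatingD[OF alternating_tform[OF n] l, of b a] by simp
  qed
  also have "(\<lambda>c. (if set c \<subseteq> points then tform c * antisymm n else 0) * to_tensor n x) = q"
    unfolding q_def by (rule ext) (simp add: mult.assoc antisymm_to_tensor[OF n x(1)])
  finally have alternating: "alternating n q" .
  have "q c = 0" if c: "c \<in> plist n" for c
  proof -
    have s: "set c \<subseteq> points" "length c = n" using c by (simp_all add: plist_def)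
    consider "p \<in> set c" | "\<not> distinct c" | "distinct c" "p \<notin> set c" by blast
    then show ?thesis
    proof cases
      case 1
      then show ?thesis by (simp add: q_def tform_p)
    next
      case 2
      then show ?thesis using alternating_not_distinct[OF alternating s(2)] neg_eq_zero by blast
    next
      case 3
      have "fc n \<cdot> q c = (\<Sum>b\<in>plist n. polytab (p # c) b \<cdot> q b)"
        by (rule sum_polytab_alternating[OF p_columns[OF c 3] alternating, symmetric]) (simp add: q_def tform_p)
      also have "\<dots> = to_cotensor n (polytab (p # c)) * to_tensor n x"
        unfolding to_cotensor_def sum_distrib_right by (rule sum.cong) (auto simp: q_def plist_def)
      also have "\<dots> = 0"
        by (simp add: to_cotensor_to_tensor[OF slot_sum_zero_polytab[OF p_columns[OF c 3]] x(2)] ort[OF p_columns[OF c 3]])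
      finally have "(1 / fc n) \<cdot> fc n \<cdot> q c = (1 / fc n) \<cdot> 0" by simp
      then show ?thesis using fact_nz[OF n] by simp
    qed
  qed
  then have "(\<Sum>c\<in>plist n. tvec c * q c) = 0" by simp
  moreover have "(\<Sum>c\<in>plist n. tvec c * q c) = (\<Sum>c\<in>plist n. tvec c * tform c) * to_tensor n x"
    unfolding sum_distrib_right by (rule sum.cong) (auto simp: q_def plist_def mult.assoc)
  ultimately show ?thesis using idm_times[OF block_to_tensor[of n x]] by (simp add: sum_tvec_tform)
qed

text \<open>The pairing of a polytabloid with itself is (n + 1)!, which is nonzero in the field as n
  + 1 < p.\<close>

lemma to_tensor_polytab_nonzero: assumes "Suc n < p" "a \<in> columns n" shows "to_tensor n (polytab a) \<noteq> 0"
proof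
  assume 0: "to_tensor n (polytab a) = 0"
  have "fc (Suc n) \<cdot> idm (Suc 0) = to_cotensor n (polytab a) * to_tensor n (polytab a)"
    using to_cotensor_to_tensor[OF slot_sum_zero_polytab[OF assms(2)] slot_sum_zero_polytab[OF assms(2)]] sum_polytab_polytab[OF assms(2)] by simp
  then have "entry (fc (Suc n) \<cdot> idm (Suc 0) :: 'k fmat) 0 0 = 0" using 0 by simp
  then show False using fact_nz[OF assms(1)] by (simp add: entry_idm del: fact_Suc)
qed

text \<open>A list of p - 1 distinct points without p contains all the other points. If its first
  entry is summed over all points, every change produces a repetition or the point p, so the
  original term equals the whole sum, which is zero.\<close>

lemma antisymm_top: assumes "Suc n = p" shows "antisymm n = 0"
proof (rule tvec_test[of "m ^ n" n])
  have n: "n < p" using assms by simp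
  fix c assume c: "c \<in> plist n"
  then have s: "set c \<subseteq> points" "length c = n" by (simp_all add: plist_def)
  have "antisymm n * tvec c = 0"
  proof (cases "distinct c \<and> p \<notin> set c")
    case False
    then show ?thesis using antisymm_tvec_zero[OF n s(2)] tvec_p by auto
  next
    case True
    have sc: "set c = points - {p}"
    proof (rule card_subset_eq)
      show "set c \<subseteq> points - {p}" using s True by auto
      show "card (set c) = card (points - {p})" using distinct_card[of c] True s assms by simp
    qed simp
    obtain y ys where y: "c = y # ys" using s p3 assms by (cases c) auto
    have "antisymm n * (\<Sum>z\<in>points. tvec (z # ys)) = 0"
      using s sum_pvec unfolding y tvec.simps by (simp add: tens_sum_left[symmetric])
    also have "antisymm n * (\<Sum>z\<in>points. tvec (z # ys)) = (\<Sum>z\<in>points. if z = y then antisymm n * tvec c else 0)"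
      unfolding sum_distrib_left
    proof (rule sum.cong[OF refl])
      fix z assume z: "z \<in> points"
      show "antisymm n * tvec (z # ys) = (if z = y then antisymm n * tvec c else 0)"
      proof (cases "z = y \<or> z = p")
        case True
        then show ?thesis using y \<open>distinct c \<and> p \<notin> set c\<close> by (auto simp: tvec_p simp del: tvec.simps)
      next
        case False
        then have "z \<in> set ys" using z sc y by auto
        then show ?thesis using antisymm_tvec_zero[OF n, of "z # ys"] s y False by auto
      qed
    qed
    also have "\<dots> = antisymm n * tvec c" using s y by simp
    finally show ?thesis .
  qed
  then show "antisymm n * tvec c = 0 * tvec c" by simp
qed simp_all

lemma proj_E_top: assumes "Suc n = p" shows "proj (E n)"
proof -
  have n: "n < p" using assms by simp
  have "idm (rdim (E n)) = (prj n * inc n) * (prj n * inc n)" unfolding E_props(5)[OF n] by (simp only: idm_idm)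
  also have "\<dots> = prj n * (inc n * prj n) * inc n" by (simp only: mult.assoc)
  also have "\<dots> = 0" unfolding E_props(4)[OF n] antisymm_top[OF assms] by simp
  finally show ?thesis using E_props(1)[OF n] stably_zero_zero[of "E n" "E n"] by (simp add: proj_def)
qed

end

section \<open>Specht modules of hooks\<close>

definition fspan :: "'i set \<Rightarrow> ('i \<Rightarrow> 'b \<Rightarrow> 'k::field) \<Rightarrow> ('b \<Rightarrow> 'k) set" where
  "fspan I f = {v. \<exists>c. v = (\<lambda>T. \<Sum>t\<in>I. c t * f t T)}"

lemma fspan_add: assumes "u \<in> fspan I f" "v \<in> fspan I f" shows "(\<lambda>T. u T + v T) \<in> fspan I f"
proof -
  obtain c d where "u = (\<lambda>T. \<Sum>t\<in>I. c t * f t T)" "v = (\<lambda>T. \<Sum>t\<in>I. d t * f t T)"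
    using assms unfolding fspan_def by blast
  then have "(\<lambda>T. u T + v T) = (\<lambda>T. \<Sum>t\<in>I. (c t + d t) * f t T)" by (simp add: distrib_right sum.distrib)
  then show ?thesis unfolding fspan_def by (intro CollectI exI)
qed

lemma fspan_scale: assumes "u \<in> fspan I f" shows "(\<lambda>T. k * u T) \<in> fspan I f"
proof -
  obtain c where "u = (\<lambda>T. \<Sum>t\<in>I. c t * f t T)" using assms unfolding fspan_def by blast
  then have "(\<lambda>T. k * u T) = (\<lambda>T. \<Sum>t\<in>I. (k * c t) * f t T)" by (simp add: sum_distrib_left mult.assoc)
  then show ?thesis unfolding fspan_def by (intro CollectI exI)
qed

lemma fspan_zero: "(\<lambda>T. 0) \<in> fspan I f"
  unfolding fspan_def by (intro CollectI exI[of _ "\<lambda>_. 0"]) simp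

lemma fspan_base: assumes "finite I" "t \<in> I" shows "f t \<in> fspan I f"
proof -
  have "f t T = (\<Sum>s\<in>I. (if s = t then 1 else 0) * f s T)" for T
  proof -
    have "(\<Sum>s\<in>I. (if s = t then 1 else 0) * f s T) = (\<Sum>s\<in>I. if s = t then f t T else 0)" by (rule sum.cong) auto
    then show ?thesis using assms by simp
  qed
  then have "f t = (\<lambda>T. \<Sum>s\<in>I. (if s = t then 1 else 0) * f s T)" by (rule ext)
  then show ?thesis unfolding fspan_def by (intro CollectI exI)
qed

text \<open>Through \<open>fspan_least\<close> a linear property of Specht modules has to be checked
  on polytabloids only.\<close>

definition lin_closed :: "('b \<Rightarrow> 'k::field) set \<Rightarrow> bool" where
  "lin_closed L \<longleftrightarrow> (\<lambda>T. 0) \<in> L \<and> (\<forall>u\<in>L. \<forall>v\<in>L. (\<lambda>T. u T + v T) \<in> L) \<and> (\<forall>k. \<forall>u\<in>L. (\<lambda>T. k * u T) \<in> L)"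

lemma lin_closedD:
  assumes "lin_closed L"
  shows "(\<lambda>T. 0) \<in> L" "u \<in> L \<Longrightarrow> v \<in> L \<Longrightarrow> (\<lambda>T. u T + v T) \<in> L" "u \<in> L \<Longrightarrow> (\<lambda>T. k * u T) \<in> L"
  using assms unfolding lin_closed_def by blast+

lemma fspan_closed: "lin_closed (fspan I f)"
  unfolding lin_closed_def using fspan_zero fspan_add fspan_scale by blast

lemma lin_closed_sum:
  assumes L: "lin_closed L" and f: "\<And>i. i \<in> I \<Longrightarrow> f i \<in> L"
  shows "(\<lambda>T. \<Sum>i\<in>I. k i * f i T) \<in> L"
  using f
proof (induction I rule: infinite_finite_induct)
  case (insert i I)
  have "(\<lambda>T. k i * f i T + (\<Sum>i\<in>I. k i * f i T)) \<in> L"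
    by (rule lin_closedD(2)[OF L lin_closedD(3)[OF L]]) (use insert in blast)+
  then show ?case using insert.hyps by simp
qed (simp_all add: lin_closedD(1)[OF L])

lemma fspan_least: assumes "lin_closed L" "\<And>t. t \<in> I \<Longrightarrow> f t \<in> L" shows "fspan I f \<subseteq> L"
proof
  fix v assume "v \<in> fspan I f"
  then obtain c where v: "v = (\<lambda>T. \<Sum>t\<in>I. c t * f t T)" unfolding fspan_def by blast
  show "v \<in> L" unfolding v by (rule lin_closed_sum[OF assms])
qed

lemma list_permutation:
  assumes a: "distinct a" "distinct a'" "length a = length a'" "set a = set a'"
  shows "\<exists>s. s permutes set a \<and> map s a = a'"
proof -
  define s where "s y = (case map_of (zip a a') y of Some z \<Rightarrow> z | None \<Rightarrow> y)" for y
  have m: "map s a = a'"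
    by (rule nth_equalityI) (simp_all add: s_def map_of_zip_nth[OF a(3,1)] a(3))
  have "s ` set a = set a" using m a(4) by (metis list.set_map)
  then have "bij_betw s (set a) (set a)"
    by (simp add: bij_betw_def eq_card_imp_inj_on)
  moreover have "s x = x" if "x \<notin> set a" for x
  proof -
    have "map_of (zip a a') x = None" using that a(3) by (simp add: map_of_zip_is_None)
    then show ?thesis by (simp add: s_def)
  qed
  ultimately have "s permutes set a" by (rule bij_imp_permutes)
  then show ?thesis using m by blast
qed

text \<open>Yields the transitivity of the symmetric group on columns; listing the complements
  matches the remaining points.\<close>

lemma list_permutation_extend:
  assumes S: "finite S" and a: "distinct a" "distinct a'" "length a = length a'" "set a \<subseteq> S" "set a' \<subseteq> S"
  shows "\<exists>s. s permutes S \<and> map s a = a'"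
proof -
  obtain e where e: "set e = S - set a" "distinct e" using finite_distinct_list[of "S - set a"] S by blast
  obtain e' where e': "set e' = S - set a'" "distinct e'" using finite_distinct_list[of "S - set a'"] S by blast
  have le: "length e = length e'"
    using distinct_card[OF e(2)] distinct_card[OF e'(2)] distinct_card[OF a(1)] distinct_card[OF a(2)] a(3-5) S e(1) e'(1)
    by (simp add: card_Diff_subset)
  have "\<exists>s. s permutes set (a @ e) \<and> map s (a @ e) = a' @ e'"
    using a e e' le by (intro list_permutation) auto
  moreover have "set (a @ e) = S" using e a by auto
  ultimately show ?thesis using a(3) by auto
qed

context char_sym begin

section \<open>The Specht module on lists, and James's submodule theorem\<close>

lemma finite_columns: "finite (columns n)"
  by (rule finite_subset[OF _ finite_plist[of "Suc n"]]) (auto simp: columns_def plist_def)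

definition specht_lists :: "nat \<Rightarrow> (nat list \<Rightarrow> 'k) set" where "specht_lists n = fspan (columns n) polytab"

lemma polytab_specht_lists: "a \<in> columns n \<Longrightarrow> polytab a \<in> specht_lists n"
  unfolding specht_lists_def by (rule fspan_base[OF finite_columns])

lemma closed_alternating: "lin_closed {x :: nat list \<Rightarrow> 'k. alternating n x}"
proof -
  have "alternating n (\<lambda>T. u T + v T)" if "alternating n u" "alternating n v" for u v :: "nat list \<Rightarrow> 'k"
    unfolding alternating_def
  proof (intro allI impI)
    fix xs a b ys assume l: "length (xs :: nat list) + length (ys :: nat list) + 2 = n"
    show "u (xs @ b # a # ys) + v (xs @ b # a # ys) = - (u (xs @ a # b # ys) + v (xs @ a # b # ys))"
      unfolding alternatingD[OF that(1) l, of b a] alternatingD[OF that(2) l, of b a] by simp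
  qed
  moreover have "alternating n (\<lambda>T. k * u T)" if "alternating n u" for u :: "nat list \<Rightarrow> 'k" and k
    unfolding alternating_def
  proof (intro allI impI)
    fix xs a b ys assume l: "length (xs :: nat list) + length (ys :: nat list) + 2 = n"
    show "k * u (xs @ b # a # ys) = - (k * u (xs @ a # b # ys))"
      unfolding alternatingD[OF that l, of b a] by simp
  qed
  moreover have "alternating n (\<lambda>T. 0 :: 'k)" by (simp add: alternating_def)
  ultimately show ?thesis unfolding lin_closed_def mem_Collect_eq by blast
qed

lemma closed_slot_sum_zero: "lin_closed {x. slot_sum_zero n x}"
  unfolding lin_closed_def mem_Collect_eq slot_sum_zero_def by (simp add: sum.distrib sum_distrib_left[symmetric])

lemma specht_lists_alternating: "x \<in> specht_lists n \<Longrightarrow> alternating n x" and specht_lists_slot_sum_zero: "x \<in> specht_lists n \<Longrightarrow> slot_sum_zero n x"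
  using fspan_least[OF closed_alternating, of "columns n" polytab n] fspan_least[OF closed_slot_sum_zero, of "columns n" polytab n] alternating_polytab slot_sum_zero_polytab
  unfolding specht_lists_def by blast+

lemma polytab_plist: assumes a: "a \<in> columns n" and c: "c \<notin> plist n" shows "polytab a c = 0"
proof -
  have "map s (tl a) \<noteq> c" if "s permutes set a" for s using columns_perm[OF a that] c by blast
  then show ?thesis unfolding polytab_def by (intro sum.neutral) auto
qed

lemma specht_lists_plist: "x \<in> specht_lists n \<Longrightarrow> c \<notin> plist n \<Longrightarrow> x c = 0"
proof -
  assume x: "x \<in> specht_lists n" and c: "c \<notin> plist n"
  have "lin_closed {x :: nat list \<Rightarrow> 'k. x c = 0}" unfolding lin_closed_def by simp
  from fspan_least[OF this, of "columns n" polytab] show "x c = 0" using polytab_plist[OF _ c] x unfolding specht_lists_def by blast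
qed

lemma map_plist: assumes s: "s \<in> carrier G" shows "map s c \<in> plist n \<longleftrightarrow> c \<in> plist n"
proof -
  have "s y \<in> points \<longleftrightarrow> y \<in> points" for y
    using permutes_in_image[of s "{1..p}" y] s unfolding carrier_G points_def by simp
  then show ?thesis unfolding plist_def by auto
qed

lemma map_columns: assumes s: "s \<in> carrier G" and a: "a \<in> columns n" shows "map s a \<in> columns n"
proof -
  have "inj_on s (set a)" using perm_inj[OF s] by (simp add: inj_on_def)
  then show ?thesis using a perm_points[OF s] unfolding columns_def by (auto simp: distinct_map)
qed

lemma permutes_carrier: "a \<in> columns n \<Longrightarrow> s permutes set a \<Longrightarrow> s \<in> carrier G"
  unfolding carrier_G columns_def points_def by (auto intro: permutes_subset)

lemma conj_permutes:
  assumes s: "s \<in> carrier G" and w: "w permutes A"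
  shows "s \<circ> w \<circ> inv' s permutes s ` A"
proof (rule bij_imp_permutes)
  have "bij_betw w A A" by (rule permutes_imp_bij[OF w])
  moreover have i: "bij_betw s A (s ` A)" by (rule inj_on_imp_bij_betw) (simp add: inj_on_def perm_inj[OF s])
  moreover have "bij_betw (inv' s) (s ` A) A"
    by (rule bij_betw_byWitness[of _ s]) (auto simp: inv_perm[OF s])
  ultimately show "bij_betw (s \<circ> w \<circ> inv' s) (s ` A) (s ` A)" by (metis bij_betw_trans)
  fix x assume "x \<notin> s ` A"
  then have "inv' s x \<notin> A" using inv_perm(1)[OF s] by (metis image_eqI)
  then show "(s \<circ> w \<circ> inv' s) x = x" using permutes_not_in[OF w] inv_perm[OF s] by simp
qed

text \<open>The column permutation w is replaced by its conjugate under s, which has the same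
  sign.\<close>

lemma polytab_map:
  assumes a: "a \<in> columns n" and s: "s \<in> carrier G"
  shows "polytab a (map (inv' s) c) = polytab (map s a) c"
  unfolding polytab_def
proof (rule sum.reindex_bij_witness[of _ "\<lambda>u. inv' s \<circ> u \<circ> s" "\<lambda>w. s \<circ> w \<circ> inv' s"])
  have tl: "tl (map s a) = map s (tl a)" by (rule map_tl[symmetric])
  have canc: "map s d = c \<longleftrightarrow> d = map (inv' s) c" for d
    using inv_perm[OF s] by (auto simp: comp_def)
  fix w assume "w \<in> {w. w permutes set a}"
  then have w: "w permutes set a" by simp
  show "s \<circ> w \<circ> inv' s \<in> {w. w permutes set (map s a)}" using conj_permutes[OF s w] by simp
  show "inv' s \<circ> (s \<circ> w \<circ> inv' s) \<circ> s = w" by (rule ext) (simp add: inv_perm[OF s])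
  have ps: "permutation s" "permutation w"
    using s w unfolding carrier_G by (auto intro: permutes_imp_permutation)
  then have "sign (s \<circ> w \<circ> inv' s) = sign s * sign w * sign s"
    by (simp add: sign_compose permutation_compose permutation_inverse sign_inverse)
  then have "sign (s \<circ> w \<circ> inv' s) = sign w" by (simp add: sign_def)
  moreover have "map (s \<circ> w \<circ> inv' s) (tl (map s a)) = map s (map w (tl a))"
    unfolding tl by (simp add: inv_perm[OF s] comp_def)
  ultimately show "sg (s \<circ> w \<circ> inv' s) * of_bool (map (s \<circ> w \<circ> inv' s) (tl (map s a)) = c)
      = sg w * of_bool (map w (tl a) = map (inv' s) c)"
    by (simp only: canc)
next
  fix u assume "u \<in> {w. w permutes set (map s a)}"
  then have u: "u permutes s ` set a" by simp
  have i: "inv' s ` s ` set a = set a" by (simp add: image_image inv_perm[OF s])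
  show "inv' s \<circ> u \<circ> s \<in> {w. w permutes set a}"
    using conj_permutes[OF inv_carrier[OF s] u] unfolding inv_inv_perm[OF s] i by simp
  show "s \<circ> (inv' s \<circ> u \<circ> s) \<circ> inv' s = u" by (rule ext) (simp add: inv_perm[OF s])
qed

lemma specht_lists_map: assumes s: "s \<in> carrier G" and x: "x \<in> specht_lists n" shows "(\<lambda>c. x (map (inv' s) c)) \<in> specht_lists n"
proof -
  have "lin_closed {x :: nat list \<Rightarrow> 'k. (\<lambda>c. x (map (inv' s) c)) \<in> specht_lists n}"
    using fspan_closed[of "columns n" polytab] unfolding lin_closed_def specht_lists_def by simp
  moreover have "polytab a \<in> {x. (\<lambda>c. x (map (inv' s) c)) \<in> specht_lists n}" if a: "a \<in> columns n" for a
    using polytab_specht_lists[OF map_columns[OF s a]] polytab_map[OF a s] by simp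
  ultimately show ?thesis using fspan_least[of _ "columns n" polytab] x unfolding specht_lists_def by blast
qed

lemma scalar_neg: "(y :: 'k) = - y \<Longrightarrow> y = 0"
  by (simp add: eq_neg_iff_add_eq_0 mult_2[symmetric])

lemma alternating_zero: "alternating n x \<Longrightarrow> length c = n \<Longrightarrow> \<not> distinct c \<Longrightarrow> x c = (0 :: 'k)"
  by (rule scalar_neg[OF alternating_not_distinct])

text \<open>The signed column sum of a tableau maps every vector to a multiple of its polytabloid; for
  hook shapes this holds because two points outside \<open>c\<close> may be swapped.\<close>

lemma column_sum:
  assumes a: "a \<in> columns n" and x: "x \<in> specht_lists n"
  shows "(\<Sum>s | s permutes set a. sg s * x (map s c)) = (\<Sum>d\<in>plist n. polytab a d * x d) * polytab a c"
proof -
  have da: "distinct a" "length a = Suc n" "length (tl a) = n" using columnsD[OF a] by auto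
  have sp: "map s c \<in> plist n \<longleftrightarrow> c \<in> plist n" if "s permutes set a" for s
    by (rule map_plist[OF permutes_carrier[OF a that]])
  consider "c \<notin> plist n" | "c \<in> plist n" "\<not> distinct c" | "c \<in> plist n" "distinct c" "set c \<subseteq> set a"
    | "c \<in> plist n" "distinct c" "\<not> set c \<subseteq> set a" by blast
  then show ?thesis
  proof cases
    case 1
    then have "x (map s c) = 0" if "s permutes set a" for s
      using specht_lists_plist[OF x, of "map s c"] sp[OF that] by blast
    then show ?thesis using polytab_plist[OF a 1] by simp
  next
    case 2
    have "x (map s c) = 0" for s
      using alternating_zero[OF specht_lists_alternating[OF x], of "map s c"] 2 by (auto simp: plist_def distinct_map)
    moreover have "polytab a c = 0" using alternating_zero[OF alternating_polytab[OF a], of c] 2 by (auto simp: plist_def)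
    ultimately show ?thesis by simp
  next
    case 3
    have lc: "length c = n" "card (set c) = n" using 3 distinct_card by (auto simp: plist_def)
    have "card (set a - set c) = 1"
      using 3 lc distinct_card[OF da(1)] da(2) by (simp add: card_Diff_subset)
    then obtain h where h: "set a - set c = {h}" by (auto simp: card_1_singleton_iff)
    obtain k as where ak: "a = k # as" using da(2) by (cases a) auto
    \<comment> \<open>c omits a single column entry h, so it is the tail of a rearrangement of the
      column. Substituting this rearrangement reduces to c = tl a and costs its sign, which is the
      coefficient of c in the polytabloid.\<close>
    have "\<exists>s. s permutes set a \<and> map s a = h # c"
    proof (rule list_permutation)
      have "h \<notin> set c" and eq: "set a = insert h (set c)" using h 3 by blast+
      then show "distinct (h # c)" using 3 by simp
      show "set a = set (h # c)" unfolding eq by simp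
    qed (simp_all add: da lc)
    then obtain s0 where s0: "s0 permutes set a" "map s0 a = h # c" by (elim exE conjE)
    have c: "c = map s0 (tl a)" using s0(2) unfolding ak by (simp only: list.map list.inject list.sel)
    define F :: "(nat \<Rightarrow> nat) \<Rightarrow> 'k" where "F s = sg s0 * (sg s * x (map s (tl a)))" for s
    have "(\<Sum>s | s permutes set a. sg s * x (map s c)) = (\<Sum>s | s permutes set a. F (s \<circ> s0))"
    proof (rule sum.cong[OF refl])
      fix s assume "s \<in> {s. s permutes set a}"
      then have "s permutes set a" by simp
      then have "sign (s \<circ> s0) = sign s * sign s0"
        using s0(1) by (intro sign_compose permutes_imp_permutation[OF finite_set])
      then have "F (s \<circ> s0) = (sg s0 * sg s0) * (sg s * x (map s (map s0 (tl a))))"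
        unfolding F_def map_map by (simp only: of_int_mult ac_simps)
      then show "sg s * x (map s c) = F (s \<circ> s0)" unfolding c by (simp only: sg_square mult_1)
    qed
    also have "\<dots> = (\<Sum>s | s permutes set a. F s)" by (rule sum_permutations_compose_right[OF s0(1), symmetric])
    also have "\<dots> = sg s0 * (\<Sum>d\<in>plist n. polytab a d * x d)"
      unfolding F_def sum_polytab[OF a] by (simp add: sum_distrib_left)
    also have "sg s0 = polytab a c" unfolding c by (rule polytab_permute[OF a s0(1), symmetric])
    finally show ?thesis by (simp add: mult.commute)
  next
    case 4
    have lc: "length c = n" "card (set c) = n" using 4 distinct_card by (auto simp: plist_def)
    \<comment> \<open>An entry of c lies outside the column, so at least two column entries are
      missing from c; exchanging them fixes c and changes the sign.\<close>
    have "card (set a \<inter> set c) < n"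
    proof -
      have "set a \<inter> set c \<subset> set c" using 4 by blast
      from psubset_card_mono[OF _ this] show ?thesis using lc by simp
    qed
    moreover have "card (set a - set c) = Suc n - card (set a \<inter> set c)"
      using distinct_card[OF da(1)] da(2) by (simp add: card_Diff_subset_Int)
    ultimately have "\<not> card (set a - set c) \<le> Suc 0" by simp
    then obtain u v where uv: "u \<in> set a" "v \<in> set a" "u \<noteq> v" "u \<notin> set c" "v \<notin> set c"
      unfolding card_le_Suc0_iff_eq[OF finite_Diff[OF finite_set]] by blast
    have "(\<Sum>s | s permutes set a. sg s * x (map s c)) = 0"
    proof (rule sum_sign_zero[OF _ uv(1-3)])
      fix s :: "nat \<Rightarrow> nat"
      have "map (s \<circ> Transposition.transpose u v) c = map s c"
        using map_transpose_id[OF uv(4,5)] by (metis map_map)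
      then show "x (map (s \<circ> Transposition.transpose u v) c) = x (map s c)" by (simp only:)
    qed simp
    moreover have "polytab a c = 0"
    proof -
      have "map s (tl a) \<noteq> c" if s: "s permutes set a" for s
      proof
        assume "map s (tl a) = c"
        then have "set c = s ` set (tl a)" by auto
        also have "\<dots> \<subseteq> s ` set a" by (cases a) auto
        finally show False using permutes_image[OF s] 4 by simp
      qed
      then show ?thesis unfolding polytab_def by (intro sum.neutral) auto
    qed
    ultimately show ?thesis by simp
  qed
qed

text \<open>If some x in K pairs nontrivially with a polytabloid, the signed column sum puts that
  polytabloid into K, and transitivity brings in all others. Otherwise K lies in the radical of the
  form, which \<open>to_tensor\<close> kills.\<close>

lemma james_submodule:
  assumes n: "n < p" and K: "K \<subseteq> specht_lists n" "lin_closed K"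
    and perm: "\<And>s x. s \<in> carrier G \<Longrightarrow> x \<in> K \<Longrightarrow> (\<lambda>c. x (map (inv' s) c)) \<in> K"
  shows "specht_lists n \<subseteq> K \<or> (\<forall>x\<in>K. to_tensor n x = 0)"
proof (cases "\<exists>x\<in>K. \<exists>a\<in>columns n. (\<Sum>d\<in>plist n. polytab a d * x d) \<noteq> 0")
  case True
  then obtain x a where x: "x \<in> K" and a: "a \<in> columns n" and nz: "(\<Sum>d\<in>plist n. polytab a d * x d) \<noteq> 0" by blast
  have "(\<lambda>c. x (map s c)) \<in> K" if "s permutes set a" for s
    using perm[OF inv_carrier x, of s] permutes_carrier[OF a that] inv_inv_perm[of s] by simp
  then have "(\<lambda>c. \<Sum>s | s permutes set a. sg s * x (map s c)) \<in> K"
    by (intro lin_closed_sum[OF K(2)]) simp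
  then have "(\<lambda>c. (\<Sum>d\<in>plist n. polytab a d * x d) * polytab a c) \<in> K"
    using column_sum[OF a] x K(1) by auto
  from lin_closedD(3)[OF K(2) this, of "inverse (\<Sum>d\<in>plist n. polytab a d * x d)"] have polytab: "polytab a \<in> K"
    using nz by (simp add: mult.assoc[symmetric])
  have "polytab a' \<in> K" if a': "a' \<in> columns n" for a'
  proof -
    obtain s where s: "s permutes points" "map s a = a'"
      using list_permutation_extend[OF finite_points, of a a'] columnsD[OF a] columnsD[OF a'] by auto
    then have "s \<in> carrier G" by (simp add: carrier_G points_def)
    from perm[OF this polytab] show ?thesis using polytab_map[OF a \<open>s \<in> carrier G\<close>] s(2) by simp
  qed
  then show ?thesis using fspan_least[OF K(2), of "columns n" polytab] unfolding specht_lists_def by blast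
next
  case False
  have "to_tensor n x = 0" if "x \<in> K" for x
    using to_tensor_zero[OF n specht_lists_alternating specht_lists_slot_sum_zero] that K(1) False by blast
  then show ?thesis by blast
qed

definition quot_map :: "nat \<Rightarrow> (nat list \<Rightarrow> 'k) \<Rightarrow> 'k fmat" where "quot_map n x = prj n * to_tensor n x"

definition quot_vec :: "nat \<Rightarrow> (nat list \<Rightarrow> 'k) \<Rightarrow> 'k vec" where
  "quot_vec n x = vec (rdim (E n)) (\<lambda>i. entry (quot_map n x) i 0)"

lemma block_quot_map: "n < p \<Longrightarrow> block (rdim (E n)) (Suc 0) (quot_map n x)"
  unfolding quot_map_def using block_times[OF ghom_block[OF E_props(3)] block_to_tensor] by simp

lemma quot_map_add: "quot_map n (\<lambda>c. x c + y c) = quot_map n x + quot_map n y"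
  unfolding quot_map_def to_tensor_def by (simp add: scale_distribs sum.distrib distrib_left)

lemma quot_map_scale: "quot_map n (\<lambda>c. k * x c) = k \<cdot> quot_map n x"
  unfolding quot_map_def to_tensor_def by (simp add: sum_distrib_left scale_sum)

lemma quot_map_sum: "quot_map n (\<lambda>c. \<Sum>j\<in>J. k j * x j c) = (\<Sum>j\<in>J. k j \<cdot> quot_map n (x j))"
proof (induction J rule: infinite_finite_induct)
  case (insert j J)
  then show ?case by (simp add: quot_map_add quot_map_scale)
qed (use quot_map_scale[of n 0] in simp_all)

lemma act_quot_map:
  assumes n: "n < p" and s: "s \<in> carrier G" and x: "x \<in> specht_lists n"
  shows "act (E n) s * quot_map n x = quot_map n (\<lambda>c. x (map (inv' s) c))"
proof -
  have "act (E n) s * prj n = prj n * act (Tn n) s"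
    using E_props(3)[OF n] s unfolding ghom_def by auto
  then show ?thesis unfolding quot_map_def act_to_tensor[OF s specht_lists_slot_sum_zero[OF x], symmetric] by (simp only: mult.assoc[symmetric])
qed

lemma ract_vec:
  assumes V: "modl V" and s: "s \<in> carrier G" and u: "block (rdim V) (Suc 0) u"
  shows "ract V s *\<^sub>v vec (rdim V) (\<lambda>i. entry u i 0) = vec (rdim V) (\<lambda>i. entry (act V s * u) i 0)"
proof -
  have c: "ract V s \<in> carrier_mat (rdim V) (rdim V)" using V s unfolding is_module_def by blast
  show ?thesis
  proof (rule eq_vecI)
    fix i assume "i < dim_vec (vec (rdim V) (\<lambda>i. entry (act V s * u) i 0))"
    then have i: "i < rdim V" by simp
    have "(ract V s *\<^sub>v vec (rdim V) (\<lambda>i. entry u i 0)) $ i = (\<Sum>k<rdim V. ract V s $$ (i, k) * entry u k 0)"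
      using c i by (simp add: scalar_prod_def atLeast0LessThan)
    also have "\<dots> = entry (act V s * u) i 0"
      unfolding entry_times_right[OF u] using c i by (simp add: act_def fm_def)
    finally show "(ract V s *\<^sub>v vec (rdim V) (\<lambda>i. entry u i 0)) $ i = vec (rdim V) (\<lambda>i. entry (act V s * u) i 0) $ i"
      using i by simp
  qed (use c in simp)
qed

text \<open>The conditions of \<open>specht_quotient\<close>, carried over from functions on
  tabloids to functions on lists.\<close>

definition specht_onto :: "nat \<Rightarrow> (nat \<Rightarrow> nat, 'k) rep \<Rightarrow> ((nat list \<Rightarrow> 'k) \<Rightarrow> 'k vec) \<Rightarrow> bool" where
  "specht_onto n V f \<longleftrightarrow> (\<forall>u\<in>specht_lists n. \<forall>v\<in>specht_lists n. f (\<lambda>T. u T + v T) = f u + f v) \<and>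
     (\<forall>c. \<forall>v\<in>specht_lists n. f (\<lambda>T. c * v T) = c \<cdot>\<^sub>v f v) \<and>
     (\<forall>s\<in>carrier G. \<forall>v\<in>specht_lists n. f (\<lambda>T. v (map (inv' s) T)) = ract V s *\<^sub>v f v) \<and>
     f ` specht_lists n = carrier_vec (rdim V)"

lemma specht_ontoD:
  assumes "specht_onto n V f"
  shows "u \<in> specht_lists n \<Longrightarrow> v \<in> specht_lists n \<Longrightarrow> f (\<lambda>T. u T + v T) = f u + f v"
    and "v \<in> specht_lists n \<Longrightarrow> f (\<lambda>T. c * v T) = c \<cdot>\<^sub>v f v"
    and "s \<in> carrier G \<Longrightarrow> v \<in> specht_lists n \<Longrightarrow> f (\<lambda>T. v (map (inv' s) T)) = ract V s *\<^sub>v f v"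
    and "f ` specht_lists n = carrier_vec (rdim V)"
  using assms unfolding specht_onto_def by blast+

lemma specht_lists_closed: "lin_closed (specht_lists n)" unfolding specht_lists_def by (rule fspan_closed)

lemma specht_onto_E: assumes n: "n < p" shows "specht_onto n (E n) (quot_vec n)"
  unfolding specht_onto_def
proof (intro conjI ballI allI)
  fix u v :: "nat list \<Rightarrow> 'k" and c :: 'k
  show "quot_vec n (\<lambda>T. u T + v T) = quot_vec n u + quot_vec n v" unfolding quot_vec_def quot_map_add by (rule eq_vecI) simp_all
  show "quot_vec n (\<lambda>T. c * v T) = c \<cdot>\<^sub>v quot_vec n v" unfolding quot_vec_def quot_map_scale by (rule eq_vecI) simp_all
next
  fix s v assume "s \<in> carrier G" "v \<in> specht_lists n"
  then show "quot_vec n (\<lambda>T. v (map (inv' s) T)) = ract (E n) s *\<^sub>v quot_vec n v"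
    unfolding quot_vec_def by (simp add: ract_vec[OF E_props(1)[OF n] _ block_quot_map[OF n]] act_quot_map[OF n])
next
  show "quot_vec n ` specht_lists n = carrier_vec (rdim (E n))"
  proof
    show "quot_vec n ` specht_lists n \<subseteq> carrier_vec (rdim (E n))" by (auto simp: quot_vec_def)
    show "carrier_vec (rdim (E n)) \<subseteq> quot_vec n ` specht_lists n"
    proof
      fix w :: "'k vec" assume w: "w \<in> carrier_vec (rdim (E n))"
      define u where "u = fmat_of (rdim (E n)) (Suc 0) (\<lambda>i _. w $ i)"
      have bu: "block (rdim (E n)) (Suc 0) u" by (simp add: u_def)
      define J where "J = {c \<in> plist n. distinct c \<and> p \<notin> set c}"
      define k where "k c = entry (tform c * inc n * u) 0 0 * (1 / fc n)" for c
      \<comment> \<open>Expanding u over the tensors of points leaves multiples of antisymmetrised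
        \<open>tvec c\<close>; these vanish or come from polytabloids by
        \<open>antisymm_tvec\<close>, which gives a preimage.\<close>
      have "u = prj n * (antisymm n * (\<Sum>c\<in>plist n. tvec c * tform c) * inc n * u)"
      proof -
        have "u = prj n * inc n * u" unfolding E_props(5)[OF n] by (rule idm_times[OF bu, symmetric])
        also have "\<dots> = prj n * (antisymm n * inc n) * u" unfolding antisymm_inc[OF n] ..
        also have "antisymm n = antisymm n * (\<Sum>c\<in>plist n. tvec c * tform c)"
          unfolding sum_tvec_tform by (rule times_idm[OF block_antisymm, symmetric])
        finally show ?thesis by (simp only: mult.assoc)
      qed
      also have "\<dots> = prj n * (\<Sum>c\<in>plist n. antisymm n * tvec c * (tform c * inc n * u))"
        by (simp add: sum_distrib_left sum_distrib_right mult.assoc)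
      also have "(\<Sum>c\<in>plist n. antisymm n * tvec c * (tform c * inc n * u)) = (\<Sum>c\<in>J. antisymm n * tvec c * (tform c * inc n * u))"
      proof (rule sum.mono_neutral_right)
        show "\<forall>c\<in>plist n - J. antisymm n * tvec c * (tform c * inc n * u) = 0"
        proof
          fix c assume "c \<in> plist n - J"
          then have "antisymm n * tvec c = 0" using antisymm_tvec_zero[OF n] tvec_p by (auto simp: J_def plist_def)
          then show "antisymm n * tvec c * (tform c * inc n * u) = 0" by simp
        qed
      qed (auto simp: J_def)
      also have "\<dots> = (\<Sum>c\<in>J. k c \<cdot> to_tensor n (polytab (p # c)))"
      proof (rule sum.cong[OF refl])
        fix c assume c: "c \<in> J"
        have b1: "block (Suc 0) (Suc 0) (tform c * inc n * u)"
        proof -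
          have "block (Suc 0) (m ^ n) (tform c)" using block_tform[of c] c by (simp add: J_def plist_def)
          from block_times[OF block_times[OF this] bu] show ?thesis using ghom_block[OF E_props(2)[OF n]] by simp
        qed
        have sc: "X = entry X 0 0 \<cdot> idm (Suc 0)" if "block (Suc 0) (Suc 0) X" for X :: "'k fmat"
        proof (rule fmat_eqI)
          fix i j show "entry X i j = entry (entry X 0 0 \<cdot> idm (Suc 0)) i j"
            using blockD[OF that, of i j] by (cases "i = 0"; cases "j = 0") (auto simp: entry_idm)
        qed
        have "antisymm n * tvec c = (1 / fc n) \<cdot> to_tensor n (polytab (p # c))"
          using c by (intro antisymm_tvec[OF n]) (auto simp: J_def)
        moreover have "(1 / fc n) \<cdot> to_tensor n (polytab (p # c)) * (tform c * inc n * u) = k c \<cdot> (to_tensor n (polytab (p # c)) * idm (Suc 0))"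
          by (subst sc[OF b1]) (simp add: k_def)
        ultimately show "antisymm n * tvec c * (tform c * inc n * u) = k c \<cdot> to_tensor n (polytab (p # c))"
          by (simp only: times_idm[OF block_to_tensor])
      qed
      also have "prj n * \<dots> = quot_map n (\<lambda>d. \<Sum>c\<in>J. k c * polytab (p # c) d)"
        unfolding quot_map_sum by (simp add: quot_map_def sum_distrib_left)
      finally have u: "u = quot_map n (\<lambda>d. \<Sum>c\<in>J. k c * polytab (p # c) d)" .
      have "(\<lambda>d. \<Sum>c\<in>J. k c * polytab (p # c) d) \<in> specht_lists n"
        by (rule lin_closed_sum[OF specht_lists_closed polytab_specht_lists[OF p_columns]]) (auto simp: J_def)
      moreover have "w = quot_vec n (\<lambda>d. \<Sum>c\<in>J. k c * polytab (p # c) d)"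
        unfolding quot_vec_def u[symmetric] using w by (intro eq_vecI) (auto simp: u_def)
      ultimately show "w \<in> quot_vec n ` specht_lists n" by (simp only: image_eqI)
    qed
  qed
qed

lemma columns_nonempty: assumes "Suc n < p" shows "\<exists>a. a \<in> columns n"
  using assms by (intro exI[of _ "[1..<Suc (Suc n)]"]) (auto simp: columns_def points_iff)

lemma quot_map_polytab_nonzero: assumes n: "Suc n < p" and a: "a \<in> columns n" shows "quot_map n (polytab a) \<noteq> 0"
proof
  have n': "n < p" using n by simp
  assume "quot_map n (polytab a) = 0"
  then have "inc n * prj n * to_tensor n (polytab a) = 0" unfolding quot_map_def by (simp add: mult.assoc)
  then have "to_tensor n (polytab a) = 0" unfolding E_props(4)[OF n'] antisymm_to_tensor[OF n' alternating_polytab[OF a]] .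
  then show False using to_tensor_polytab_nonzero[OF n a] by simp
qed

lemma specht_onto_carrier: "specht_onto n V f \<Longrightarrow> x \<in> specht_lists n \<Longrightarrow> f x \<in> carrier_vec (rdim V)"
  using specht_ontoD(4) by blast

lemma specht_onto_zero: assumes "specht_onto n V f" shows "f (\<lambda>T. 0) = 0\<^sub>v (rdim V)"
proof -
  have z: "(\<lambda>T. 0) \<in> specht_lists n" by (rule lin_closedD(1)[OF specht_lists_closed])
  have "f (\<lambda>T. 0) = 0 \<cdot>\<^sub>v f (\<lambda>T. 0)" using specht_ontoD(2)[OF assms z, of 0] by simp
  also have "\<dots> = 0\<^sub>v (rdim V)" using specht_onto_carrier[OF assms z] by (intro eq_vecI) auto
  finally show ?thesis .
qed

text \<open>The preimage of a submodule in the Specht module is invariant, so by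
  \<open>james_submodule\<close> it is everything or is killed by the map onto
  \<open>E n\<close>.\<close>

lemma simple_E: assumes n: "Suc n < p" shows "simple_module G (E n)"
  unfolding simple_module_def
proof (intro conjI allI impI)
  have n': "n < p" using n by simp
  note sq = specht_onto_E[OF n']
  show "modl (E n)" by (rule E_props(1)[OF n'])
  obtain a where a: "a \<in> columns n" using columns_nonempty[OF n] by blast
  show "rdim (E n) \<noteq> 0"
  proof
    assume "rdim (E n) = 0"
    then have "quot_map n (polytab a) = 0" using blockD[OF block_quot_map[OF n', of "polytab a"]] by (intro fmat_eqI) simp
    then show False using quot_map_polytab_nonzero[OF n a] by simp
  qed
  fix U assume "is_submodule G (E n) U"
  then have U: "U \<subseteq> carrier_vec (rdim (E n))" "0\<^sub>v (rdim (E n)) \<in> U" "\<And>u v. u \<in> U \<Longrightarrow> v \<in> U \<Longrightarrow> u + v \<in> U"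
    "\<And>c u. u \<in> U \<Longrightarrow> c \<cdot>\<^sub>v u \<in> U" "\<And>g u. g \<in> carrier G \<Longrightarrow> u \<in> U \<Longrightarrow> ract (E n) g *\<^sub>v u \<in> U"
    unfolding is_submodule_def by blast+
  define K where "K = {x \<in> specht_lists n. quot_vec n x \<in> U}"
  have K: "K \<subseteq> specht_lists n" "lin_closed K"
    unfolding K_def lin_closed_def
    using U(2-4) specht_onto_zero[OF sq] specht_ontoD(1,2)[OF sq] lin_closedD[OF specht_lists_closed] by (auto simp del: fun_upd_apply)
  have perm: "(\<lambda>c. x (map (inv' s) c)) \<in> K" if "s \<in> carrier G" "x \<in> K" for s x
    using that specht_lists_map specht_ontoD(3)[OF sq] U(5) unfolding K_def by simp
  have "specht_lists n \<subseteq> K \<or> (\<forall>x\<in>K. to_tensor n x = 0)" by (rule james_submodule[OF n' K]) (rule perm)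
  then show "U = {0\<^sub>v (rdim (E n))} \<or> U = carrier_vec (rdim (E n))"
  proof (elim disjE)
    assume "specht_lists n \<subseteq> K"
    then have "quot_vec n ` specht_lists n \<subseteq> U" unfolding K_def by blast
    then show ?thesis using specht_ontoD(4)[OF sq] U(1) by blast
  next
    assume z: "\<forall>x\<in>K. to_tensor n x = 0"
    have "u = 0\<^sub>v (rdim (E n))" if u: "u \<in> U" for u
    proof -
      obtain x where x: "x \<in> specht_lists n" "u = quot_vec n x" using specht_ontoD(4)[OF sq] U(1) u by blast
      then have "to_tensor n x = 0" using z u unfolding K_def by blast
      then show ?thesis unfolding x(2) quot_vec_def quot_map_def by (intro eq_vecI) simp_all
    qed
    then show ?thesis using U(2) by blast
  qed
qed

lemma specht_onto_sum:
  fixes f :: "(nat list \<Rightarrow> 'k) \<Rightarrow> 'k vec" and N :: nat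
  assumes sq: "specht_onto n V f" and w: "\<And>j. j < N \<Longrightarrow> w j \<in> specht_lists n" and i: "i < rdim V"
  shows "f (\<lambda>T. \<Sum>j<N. k j * w j T) $ i = (\<Sum>j<N. k j * f (w j) $ i)"
  using w
proof (induction N)
  case 0
  then show ?case using specht_onto_zero[OF sq] i by simp
next
  case (Suc N)
  have s: "(\<lambda>T. \<Sum>j<N. k j * w j T) \<in> specht_lists n"
    by (rule lin_closed_sum[OF specht_lists_closed]) (use Suc.prems in auto)
  have w: "w N \<in> specht_lists n" "(\<lambda>T. k N * w N T) \<in> specht_lists n"
    using Suc.prems[of N] lin_closedD(3)[OF specht_lists_closed] by blast+
  have "f (\<lambda>T. (\<Sum>j<N. k j * w j T) + k N * w N T) = f (\<lambda>T. \<Sum>j<N. k j * w j T) + k N \<cdot>\<^sub>v f (w N)"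
    unfolding specht_ontoD(1)[OF sq s w(2)] specht_ontoD(2)[OF sq w(1)] ..
  then show ?case using specht_onto_carrier[OF sq s] specht_onto_carrier[OF sq w(1)] i Suc.IH Suc.prems by simp
qed

text \<open>The kernel of f is not everything, so \<open>james_submodule\<close> places it in the
  kernel of \<open>to_tensor\<close>. Thus \<open>quot_map\<close> factors through f, and the
  induced nonzero map between simple modules is an isomorphism.\<close>

lemma specht_onto_giso:
  assumes n: "Suc n < p" and V: "simple_module G V" and sq: "specht_onto n V f"
  shows "giso V (E n)"
proof -
  have n': "n < p" using n by simp
  have mV: "modl V" and nV: "rdim V \<noteq> 0" using V unfolding simple_module_def by blast+
  have "\<exists>x. x \<in> specht_lists n \<and> f x = unit_vec (rdim V) j" for j
    using specht_ontoD(4)[OF sq] unit_vec_carrier[of "rdim V" j] by (metis imageE)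
  then obtain w where w: "\<And>j. w j \<in> specht_lists n" "\<And>j. f (w j) = unit_vec (rdim V) j" by metis
  define K where "K = {x \<in> specht_lists n. f x = 0\<^sub>v (rdim V)}"
  have K: "K \<subseteq> specht_lists n" "lin_closed K"
    unfolding K_def lin_closed_def
    using specht_onto_zero[OF sq] specht_ontoD(1,2)[OF sq] lin_closedD[OF specht_lists_closed] by auto
  have perm: "(\<lambda>c. x (map (inv' s) c)) \<in> K" if s: "s \<in> carrier G" and x: "x \<in> K" for s x
  proof -
    have "ract V s *\<^sub>v 0\<^sub>v (rdim V) = 0\<^sub>v (rdim V)"
      using mV s unfolding is_module_def by (intro eq_vecI) auto
    then show ?thesis using x s specht_lists_map specht_ontoD(3)[OF sq] unfolding K_def by simp
  qed
  have james: "specht_lists n \<subseteq> K \<or> (\<forall>x\<in>K. to_tensor n x = 0)" by (rule james_submodule[OF n' K]) (rule perm)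
  have "w 0 \<notin> K"
  proof
    assume "w 0 \<in> K"
    then have "unit_vec (rdim V) 0 $ 0 = (0\<^sub>v (rdim V) $ 0 :: 'k)" unfolding K_def by (simp add: w)
    then show False using nV by simp
  qed
  then have z: "\<And>x. x \<in> K \<Longrightarrow> to_tensor n x = 0" using james w(1) by blast
  define B where "B = fmat_of (rdim (E n)) (rdim V) (\<lambda>i j. entry (quot_map n (w j)) i 0)"
  have bB: "block (rdim (E n)) (rdim V) B" by (simp add: B_def)
  \<comment> \<open>x and the combination of the preimages w j with the coordinates of f x have the
    same image under f, so their difference lies in K and \<open>quot_map\<close> does not see
    it.\<close>
  have key: "entry (quot_map n x) i 0 = (\<Sum>j<rdim V. f x $ j * entry (quot_map n (w j)) i 0)" if x: "x \<in> specht_lists n" for x i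
  proof -
    let ?y = "\<lambda>T. \<Sum>j<rdim V. (f x $ j) * w j T"
    let ?d = "\<lambda>T. x T + (- 1) * ?y T"
    have y: "?y \<in> specht_lists n" by (rule lin_closed_sum[OF specht_lists_closed w(1)])
    have y': "(\<lambda>T. (- 1) * ?y T) \<in> specht_lists n" by (rule lin_closedD(3)[OF specht_lists_closed y])
    have d: "?d \<in> specht_lists n" by (rule lin_closedD(2)[OF specht_lists_closed x y'])
    have fy: "f ?y = f x"
    proof (rule eq_vecI)
      show "dim_vec (f ?y) = dim_vec (f x)" using specht_onto_carrier[OF sq y] specht_onto_carrier[OF sq x] by simp
      fix i assume "i < dim_vec (f x)"
      then have i: "i < rdim V" using specht_onto_carrier[OF sq x] by simp
      have "f ?y $ i = (\<Sum>j<rdim V. f x $ j * f (w j) $ i)" by (rule specht_onto_sum[OF sq w(1) i])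
      also have "\<dots> = (\<Sum>j<rdim V. if j = i then f x $ i else 0)" using i by (intro sum.cong) (auto simp: w)
      finally show "f ?y $ i = f x $ i" using i by simp
    qed
    have "f ?d = f x + (- 1) \<cdot>\<^sub>v f ?y" unfolding specht_ontoD(1)[OF sq x y'] specht_ontoD(2)[OF sq y] ..
    also have "\<dots> = 0\<^sub>v (rdim V)" unfolding fy using specht_onto_carrier[OF sq x] by (intro eq_vecI) auto
    finally have "?d \<in> K" using d unfolding K_def by blast
    then have "quot_map n ?d = 0" using z unfolding quot_map_def by simp
    then have "quot_map n x = quot_map n ?y" unfolding quot_map_add quot_map_scale by simp
    then show ?thesis unfolding quot_map_sum by simp
  qed
  have BQ: "entry (quot_map n x) i 0 = (\<Sum>j<rdim V. entry B i j * f x $ j)" if x: "x \<in> specht_lists n" and i: "i < rdim (E n)" for x i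
    unfolding key[OF x] B_def using i by (intro sum.cong) (auto simp: mult.commute)
  have "ghom V (E n) B"
    unfolding ghom_def
  proof (intro conjI ballI)
    fix s assume s: "s \<in> carrier G"
    have cV: "ract V s \<in> carrier_mat (rdim V) (rdim V)" using mV s unfolding is_module_def by blast
    have bE: "block (rdim (E n)) (rdim (E n)) (act (E n) s)" by (rule act_block[OF E_props(1)[OF n'] s])
    have b1: "block (rdim (E n)) (rdim V) (B * act V s)" by (rule block_times[OF bB act_block[OF mV s]])
    have b2: "block (rdim (E n)) (rdim V) (act (E n) s * B)" by (rule block_times[OF bE bB])
    show "B * act V s = act (E n) s * B"
    proof (rule fmat_eqI)
      fix i j
      show "entry (B * act V s) i j = entry (act (E n) s * B) i j"
      proof (cases "i < rdim (E n) \<and> j < rdim V")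
        case False
        then show ?thesis using blockD[OF b1, of i j] blockD[OF b2, of i j] by (auto simp: not_less)
      next
        case True
        have "f (\<lambda>T. w j (map (inv' s) T)) = ract V s *\<^sub>v unit_vec (rdim V) j"
          unfolding specht_ontoD(3)[OF sq s w(1)] w(2) ..
        also have "\<dots> = col (ract V s) j" using mult_unit_vec_col[OF cV] True by blast
        finally have fc: "f (\<lambda>T. w j (map (inv' s) T)) $ k = ract V s $$ (k, j)" if "k < rdim V" for k
          using that True cV by simp
        have "entry (B * act V s) i j = (\<Sum>k<rdim V. entry B i k * f (\<lambda>T. w j (map (inv' s) T)) $ k)"
          unfolding entry_times_left[OF bB] using cV True by (intro sum.cong) (auto simp: fc act_def fm_def)
        also have "\<dots> = entry (quot_map n (\<lambda>T. w j (map (inv' s) T))) i 0"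
          by (rule BQ[symmetric]) (use specht_lists_map[OF s w(1)] True in auto)
        also have "\<dots> = entry (act (E n) s * quot_map n (w j)) i 0" unfolding act_quot_map[OF n' s w(1)] ..
        also have "\<dots> = entry (act (E n) s * B) i j"
          unfolding entry_times_left[OF bE] using True by (intro sum.cong) (auto simp: B_def)
        finally show ?thesis .
      qed
    qed
  qed (use bB in auto)
  moreover have "B \<noteq> 0"
  proof
    assume B0: "B = 0"
    obtain a where a: "a \<in> columns n" using columns_nonempty[OF n] by blast
    have "quot_map n (polytab a) = 0"
    proof (rule fmat_eqI)
      fix i j
      show "entry (quot_map n (polytab a)) i j = entry 0 i j"
        using BQ[OF polytab_specht_lists[OF a], of i] blockD[OF block_quot_map[OF n', of "polytab a"], of i j] B0
        by (cases "i < rdim (E n) \<and> j = 0") auto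
    qed
    then show False using quot_map_polytab_nonzero[OF n a] by simp
  qed
  ultimately show ?thesis by (rule simple_giso[OF V simple_E[OF n]])
qed

end

context char_sym begin

section \<open>Translation of hook tableaux and tabloids into lists\<close>

definition hook :: "nat \<Rightarrow> nat list" where "hook n = (p - n) # replicate n (Suc 0)"

lemma length_hook [simp]: "length (hook n) = Suc n" by (simp add: hook_def)

lemma hook_nth: "hook n ! 0 = p - n" "0 < i \<Longrightarrow> i \<le> n \<Longrightarrow> hook n ! i = Suc 0"
  by (auto simp: hook_def nth_Cons')

lemma young_iff: "(i, j) \<in> young (hook n) \<longleftrightarrow> (i = 0 \<and> j < p - n) \<or> (0 < i \<and> i \<le> n \<and> j = 0)"
  unfolding young_def by (cases "i = 0") (auto simp: hook_nth)

lemma young_hook: "young (hook n) = {0} \<times> {..<p - n} \<union> (\<lambda>i. (i, 0)) ` {Suc 0..<Suc n}"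
proof (rule Set.set_eqI)
  fix x :: "nat \<times> nat"
  obtain i j where x: "x = (i, j)" by (cases x)
  show "x \<in> young (hook n) \<longleftrightarrow> x \<in> {0} \<times> {..<p - n} \<union> (\<lambda>i. (i, 0)) ` {Suc 0..<Suc n}"
    unfolding x young_iff by auto
qed

lemma sum_hook: "n < p \<Longrightarrow> sum_list (hook n) = p"
  by (simp add: hook_def sum_list_replicate)

definition first_column :: "nat \<Rightarrow> (nat \<times> nat \<Rightarrow> nat) \<Rightarrow> nat list" where
  "first_column n t = map (\<lambda>i. t (i, 0)) [0..<Suc n]"

lemma tl_first_column: "tl (first_column n t) = map (\<lambda>i. t (i, 0)) [Suc 0..<Suc n]"
  unfolding first_column_def by (subst upt_conv_Cons) simp_all

lemma set_first_column: "set (first_column n t) = (\<lambda>i. t (i, 0)) ` {0..<Suc n}" by (simp only: first_column_def set_map set_upt)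

lemma first_column_comp: "first_column n (s \<circ> t) = map s (first_column n t)" by (simp add: first_column_def)

definition list_tabloid :: "nat list \<Rightarrow> nat set list" where "list_tabloid c = (points - set c) # map (\<lambda>x. {x}) c"

lemma list_tabloid_inj: "list_tabloid c = list_tabloid d \<longleftrightarrow> c = d"
  unfolding list_tabloid_def by (auto dest: map_injective[rotated] simp: inj_def)

lemma inj_list_tabloid: "inj list_tabloid" by (rule injI) (simp only: list_tabloid_inj)

text \<open>Lists of sets not of the form \<open>list_tabloid c\<close> get the value 0, so this
  embeds functions on lists linearly into functions on tabloids.\<close>

definition on_tabloids :: "(nat list \<Rightarrow> 'k) \<Rightarrow> nat set list \<Rightarrow> 'k" where
  "on_tabloids x T = (if T \<in> range list_tabloid then x (the_inv list_tabloid T) else 0)"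

lemma on_tabloids_list_tabloid [simp]: "on_tabloids x (list_tabloid c) = x c" by (simp add: on_tabloids_def the_inv_f_f[OF inj_list_tabloid])

lemma on_tabloids_out: "T \<notin> range list_tabloid \<Longrightarrow> on_tabloids x T = 0" by (simp add: on_tabloids_def)

lemma on_tabloids_eqI: assumes "\<And>c. v (list_tabloid c) = x c" "\<And>T. T \<notin> range list_tabloid \<Longrightarrow> v T = 0" shows "v = on_tabloids x"
proof
  fix T
  show "v T = on_tabloids x T"
  proof (cases "T \<in> range list_tabloid")
    case True
    then obtain c where "T = list_tabloid c" by blast
    then show ?thesis using assms(1) by simp
  next
    case False
    then show ?thesis using assms(2) on_tabloids_out by simp
  qed
qed

lemma image_list_tabloid: assumes s: "s \<in> carrier G" shows "map ((`) s) (list_tabloid c) = list_tabloid (map s c)"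
proof -
  have i: "inj s" using perm_inj[OF s] by (simp add: inj_def)
  have "s ` points = points" using s permutes_image[of s "{1..p}"] unfolding carrier_G points_def by simp
  then have "s ` (points - set c) = points - s ` set c" by (simp add: image_set_diff[OF i])
  then show ?thesis by (simp add: list_tabloid_def)
qed

lemma perm_act_on_tabloids: assumes s: "s \<in> carrier G" shows "perm_act s (on_tabloids x) = on_tabloids (\<lambda>c. x (map (inv' s) c))"
proof (rule on_tabloids_eqI)
  fix c
  show "perm_act s (on_tabloids x) (list_tabloid c) = x (map (inv' s) c)"
    unfolding perm_act_def image_list_tabloid[OF inv_carrier[OF s]] by simp
next
  fix T assume T: "T \<notin> range list_tabloid"
  have "map ((`) (inv' s)) T \<notin> range list_tabloid"
  proof
    assume "map ((`) (inv' s)) T \<in> range list_tabloid"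
    then obtain d where d: "map ((`) (inv' s)) T = list_tabloid d" by blast
    have "T = map ((`) s) (map ((`) (inv' s)) T)" by (simp add: comp_def image_image inv_perm[OF s])
    also have "\<dots> = list_tabloid (map s d)" unfolding d by (rule image_list_tabloid[OF s])
    finally show False using T by blast
  qed
  then show "perm_act s (on_tabloids x) T = 0" unfolding perm_act_def by (rule on_tabloids_out)
qed

context
  fixes n :: nat and t :: "nat \<times> nat \<Rightarrow> nat"
  assumes n: "n < p" and t: "bij_betw t (young (hook n)) points"
begin

lemma t_inj: "x \<in> young (hook n) \<Longrightarrow> y \<in> young (hook n) \<Longrightarrow> t x = t y \<longleftrightarrow> x = y"
  using bij_betw_imp_inj_on[OF t] by (auto dest: inj_onD)

lemma t_image: "t ` young (hook n) = points" by (rule bij_betw_imp_surj_on[OF t])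

lemma column_cell: "i \<le> n \<Longrightarrow> (i, 0) \<in> young (hook n)" using n by (auto simp: young_iff)

lemma first_column_columns: "first_column n t \<in> columns n"
proof -
  have "inj_on (\<lambda>i. t (i, 0)) (set [0..<Suc n])"
    by (rule inj_onI) (auto simp: t_inj column_cell less_Suc_eq_le)
  then have "distinct (first_column n t)" unfolding first_column_def distinct_map by simp
  moreover have "set (first_column n t) \<subseteq> points" unfolding set_first_column t_image[symmetric] using column_cell by auto
  ultimately show ?thesis by (simp add: columns_def first_column_def)
qed

lemma tabloid_list_tabloid: "tabloid (hook n) t = list_tabloid (tl (first_column n t))"
proof -
  have "t ` ({0} \<times> {..<hook n ! 0}) = t ` (young (hook n) - (\<lambda>i. (i, 0)) ` {Suc 0..<Suc n})"
    unfolding hook_nth young_hook by (rule arg_cong[of _ _ "(`) t"]) auto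
  also have "\<dots> = t ` young (hook n) - t ` (\<lambda>i. (i, 0)) ` {Suc 0..<Suc n}"
    by (rule inj_on_image_set_diff[OF bij_betw_imp_inj_on[OF t]]) (auto simp: young_hook)
  also have "\<dots> = points - set (tl (first_column n t))" unfolding t_image tl_first_column by (simp add: image_image del: upt_Suc)
  finally have 0: "t ` ({0} \<times> {..<hook n ! 0}) = points - set (tl (first_column n t))" .
  have "map (\<lambda>i. t ` ({i} \<times> {..<hook n ! i})) [Suc 0..<Suc n] = map (\<lambda>x. {x}) (tl (first_column n t))"
    unfolding tl_first_column map_map
  proof (rule map_cong[OF refl])
    fix i assume "i \<in> set [Suc 0..<Suc n]"
    then have "hook n ! i = Suc 0" by (intro hook_nth) auto
    then show "t ` ({i} \<times> {..<hook n ! i}) = ((\<lambda>x. {x}) \<circ> (\<lambda>i. t (i, 0))) i" by (simp add: lessThan_Suc)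
  qed
  moreover have "[0..<Suc n] = 0 # [Suc 0..<Suc n]" by (rule upt_conv_Cons) simp
  ultimately show ?thesis unfolding tabloid_def length_hook list_tabloid_def using 0 by (simp del: upt_Suc)
qed

text \<open>Every column other than the first is a single cell, whose entry has to be fixed.\<close>

lemma column_stabilizer_hook: "column_stabilizer (hook n) t = {s. s permutes set (first_column n t)}"
proof (intro Set.set_eqI iffI)
  fix s assume "s \<in> column_stabilizer (hook n) t"
  then have s: "s permutes points" and c: "\<And>i j. (i, j) \<in> young (hook n) \<Longrightarrow> \<exists>i'. (i', j) \<in> young (hook n) \<and> s (t (i, j)) = t (i', j)"
    unfolding column_stabilizer_def sum_hook[OF n] points_def by blast+
  have "s permutes set (first_column n t)"
  proof (rule permutes_superset[OF s])
    fix y assume y: "y \<in> points - set (first_column n t)"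
    then obtain i j where ij: "(i, j) \<in> young (hook n)" "y = t (i, j)" unfolding t_image[symmetric] by auto
    have "j \<noteq> 0"
    proof
      assume "j = 0"
      then have "i \<in> {0..<Suc n}" "y = t (i, 0)" using ij by (auto simp: young_iff)
      then show False using y unfolding set_first_column by blast
    qed
    then have i: "i' = 0" if "(i', j) \<in> young (hook n)" for i' using that by (simp add: young_iff)
    obtain i' where i': "(i', j) \<in> young (hook n)" "s (t (i, j)) = t (i', j)" using c[OF ij(1)] by blast
    show "s y = y" using i'(2) unfolding ij(2) i[OF ij(1)] i[OF i'(1)] .
  qed
  then show "s \<in> {s. s permutes set (first_column n t)}" by simp
next
  fix s assume "s \<in> {s. s permutes set (first_column n t)}"
  then have s: "s permutes set (first_column n t)" by simp
  have "set (first_column n t) \<subseteq> points" using first_column_columns columnsD(2) by blast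
  then have sp: "s permutes {1..sum_list (hook n)}" unfolding sum_hook[OF n] points_def[symmetric] by (rule permutes_subset[OF s])
  have "\<exists>i'. (i', j) \<in> young (hook n) \<and> s (t (i, j)) = t (i', j)" if ij: "(i, j) \<in> young (hook n)" for i j
  proof (cases "j = 0")
    case True
    then have "i \<in> {0..<Suc n}" using ij by (auto simp: young_iff)
    then have "t (i, 0) \<in> set (first_column n t)" unfolding set_first_column by blast
    then have "s (t (i, 0)) \<in> set (first_column n t)" using permutes_in_image[OF s] by simp
    then obtain i' where "i' \<in> {0..<Suc n}" "s (t (i, 0)) = t (i', 0)" unfolding set_first_column by blast
    then show ?thesis using True column_cell[of i'] by auto
  next
    case False
    have "t (i, j) \<notin> set (first_column n t)"
    proof
      assume "t (i, j) \<in> set (first_column n t)"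
      then obtain i' where "i' \<in> {0..<Suc n}" "t (i, j) = t (i', 0)" unfolding set_first_column by blast
      then show False using t_inj[OF ij column_cell[of i']] False by simp
    qed
    then show ?thesis using permutes_not_in[OF s] ij by auto
  qed
  then show "s \<in> column_stabilizer (hook n) t" unfolding column_stabilizer_def using sp by blast
qed

end

lemma polytabloid_on_tabloids:
  assumes n: "n < p" and t: "bij_betw t (young (hook n)) points"
  shows "polytabloid (hook n) t = on_tabloids (polytab (first_column n t))"
proof -
  have tb: "tabloid (hook n) (s \<circ> t) = list_tabloid (map s (tl (first_column n t)))" if s: "s permutes set (first_column n t)" for s
  proof -
    have "s permutes points" using permutes_subset[OF s] columnsD(2)[OF first_column_columns[OF n t]] by blast
    then have "bij_betw (s \<circ> t) (young (hook n)) points" by (rule bij_betw_trans[OF t permutes_imp_bij])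
    from tabloid_list_tabloid[OF n this] show ?thesis by (simp only: first_column_comp map_tl)
  qed
  have e: "polytabloid (hook n) t T
      = (\<Sum>s | s permutes set (first_column n t). sg s * (if list_tabloid (map s (tl (first_column n t))) = T then 1 else 0))" for T
    unfolding polytabloid_def column_stabilizer_hook[OF n t] by (rule sum.cong) (simp_all add: tb)
  show ?thesis
  proof (rule on_tabloids_eqI)
    fix c
    show "polytabloid (hook n) t (list_tabloid c) = polytab (first_column n t) c"
      unfolding e polytab_def list_tabloid_inj by (simp add: of_bool_def)
  next
    fix T assume "T \<notin> range list_tabloid"
    then have "list_tabloid c \<noteq> T" for c by blast
    then show "polytabloid (hook n) t T = (0 :: 'k)" unfolding e by simp
  qed
qed

lemma tableaux_bij: "n < p \<Longrightarrow> t \<in> tableaux (hook n) \<Longrightarrow> bij_betw t (young (hook n)) points"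
  unfolding tableaux_def points_def by (simp add: sum_hook)

lemma finite_tableaux: assumes n: "n < p" shows "finite (tableaux (hook n))"
proof (rule finite_subset)
  show "tableaux (hook n) \<subseteq> (\<Pi>\<^sub>E x\<in>young (hook n). points)"
    using tableaux_bij[OF n] bij_betwE unfolding tableaux_def PiE_def Pi_def by fast
  show "finite (\<Pi>\<^sub>E x\<in>young (hook n). points)" by (rule finite_PiE) (simp_all add: young_hook)
qed

lemma tableau_exists: assumes n: "n < p" and a: "a \<in> columns n" shows "\<exists>t\<in>tableaux (hook n). first_column n t = a"
proof -
  obtain e where e: "set e = points - set a" "distinct e" using finite_distinct_list[of "points - set a"] by auto
  define l where "l = a @ e"
  have l: "distinct l" "set l = points" unfolding l_def using columnsD[OF a] e by auto
  then have len: "length l = p" using distinct_card[of l] by simp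
  \<comment> \<open>Numbers the cells down the first column as 0, ..., n and then along the rest of
    the first row, so that the enumeration l puts a into the first column.\<close>
  define h where "h x = (if snd x = 0 then fst x else n + snd x)" for x :: "nat \<times> nat"
  have "bij_betw h (young (hook n)) {..<length l}"
    by (rule bij_betw_byWitness[of _ "\<lambda>k. if k \<le> n then (k, 0) else (0, k - n)"])
      (use n in \<open>auto simp: young_iff h_def len\<close>)
  moreover have "bij_betw ((!) l) {..<length l} points" by (rule bij_betw_nth) (simp_all add: l)
  ultimately have b: "bij_betw ((!) l \<circ> h) (young (hook n)) points" by (rule bij_betw_trans)
  define t where "t = restrict ((!) l \<circ> h) (young (hook n))"
  have "bij_betw t (young (hook n)) points" using b unfolding t_def by (simp add: bij_betw_def inj_on_def cong: image_cong)
  then have "t \<in> tableaux (hook n)" unfolding tableaux_def t_def points_def sum_hook[OF n] by simp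
  moreover have "first_column n t = a"
  proof (rule nth_equalityI)
    show "length (first_column n t) = length a" by (simp add: first_column_def columnsD(3)[OF a])
    fix i assume "i < length (first_column n t)"
    then have i: "i < Suc n" by (simp add: first_column_def)
    then have "(i, 0) \<in> young (hook n)" using n by (auto simp: young_iff)
    then show "first_column n t ! i = a ! i"
      using i columnsD(3)[OF a] unfolding first_column_def t_def h_def l_def by (simp add: nth_append del: upt_Suc)
  qed
  ultimately show ?thesis by blast
qed

lemma on_tabloids_sum: "on_tabloids (\<lambda>c. \<Sum>i\<in>I. k i * x i c) = (\<lambda>T. \<Sum>i\<in>I. k i * on_tabloids (x i) T)"
  by (rule on_tabloids_eqI[symmetric]) (simp_all add: on_tabloids_out)

lemma on_tabloids_add: "on_tabloids (\<lambda>c. u c + v c) = (\<lambda>T. on_tabloids u T + on_tabloids v T)" and on_tabloids_scale: "on_tabloids (\<lambda>c. k * v c) = (\<lambda>T. k * on_tabloids v T)"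
  by (rule on_tabloids_eqI[symmetric]; simp add: on_tabloids_out)+

lemma specht_hook: assumes n: "n < p" shows "specht (hook n) = on_tabloids ` specht_lists n"
proof
  have sp: "specht (hook n) = fspan (tableaux (hook n)) (polytabloid (hook n) :: _ \<Rightarrow> _ \<Rightarrow> 'k)" unfolding specht_def fspan_def ..
  note poly = polytabloid_on_tabloids[OF n tableaux_bij[OF n]]
  show "specht (hook n) \<subseteq> on_tabloids ` specht_lists n"
  proof
    fix v :: "nat set list \<Rightarrow> 'k" assume "v \<in> specht (hook n)"
    then obtain c where v: "v = (\<lambda>T. \<Sum>t\<in>tableaux (hook n). c t * polytabloid (hook n) t T)" unfolding specht_def by blast
    have "v = on_tabloids (\<lambda>d. \<Sum>t\<in>tableaux (hook n). c t * polytab (first_column n t) d)"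
      unfolding v on_tabloids_sum by (intro ext sum.cong refl) (simp add: poly)
    moreover have "(\<lambda>d. \<Sum>t\<in>tableaux (hook n). c t * polytab (first_column n t) d) \<in> specht_lists n"
      by (rule lin_closed_sum[OF specht_lists_closed polytab_specht_lists[OF first_column_columns[OF n tableaux_bij[OF n]]]])
    ultimately show "v \<in> on_tabloids ` specht_lists n" by blast
  qed
  show "on_tabloids ` specht_lists n \<subseteq> specht (hook n)"
  proof (rule image_subsetI)
    fix x assume "x \<in> specht_lists n"
    then obtain c where x: "x = (\<lambda>d. \<Sum>a\<in>columns n. c a * polytab a d)" unfolding specht_lists_def fspan_def by blast
    have "on_tabloids (polytab a) \<in> specht (hook n)" if a: "a \<in> columns n" for a
    proof -
      obtain t where t: "t \<in> tableaux (hook n)" "first_column n t = a" using tableau_exists[OF n a] by blast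
      have "on_tabloids (polytab a) = polytabloid (hook n) t" unfolding poly[OF t(1)] t(2) ..
      then show ?thesis using fspan_base[OF finite_tableaux[OF n] t(1), of "polytabloid (hook n)"] unfolding sp by (simp only:)
    qed
    then show "on_tabloids x \<in> specht (hook n)" unfolding x on_tabloids_sum sp by (intro lin_closed_sum[OF fspan_closed]) simp
  qed
qed

lemma specht_onto_specht_quotient:
  assumes n: "n < p" and V: "modl V" and sq: "specht_onto n V f"
  shows "specht_quotient (hook n) V"
  unfolding specht_quotient_def sum_hook[OF n] specht_hook[OF n]
proof (intro conjI exI[of _ "\<lambda>v. f (\<lambda>c. v (list_tabloid c))"])
  show "modl V" by (rule V)
  show "\<forall>u\<in>on_tabloids ` specht_lists n. \<forall>v\<in>on_tabloids ` specht_lists n. f (\<lambda>c. u (list_tabloid c) + v (list_tabloid c)) = f (\<lambda>c. u (list_tabloid c)) + f (\<lambda>c. v (list_tabloid c))"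
    using specht_ontoD(1)[OF sq] by simp
  show "\<forall>k. \<forall>v\<in>on_tabloids ` specht_lists n. f (\<lambda>c. k * v (list_tabloid c)) = k \<cdot>\<^sub>v f (\<lambda>c. v (list_tabloid c))"
    using specht_ontoD(2)[OF sq] by simp
  show "\<forall>s\<in>carrier G. \<forall>v\<in>on_tabloids ` specht_lists n. f (\<lambda>c. perm_act s v (list_tabloid c)) = ract V s *\<^sub>v f (\<lambda>c. v (list_tabloid c))"
    using specht_ontoD(3)[OF sq] by (simp add: perm_act_on_tabloids)
  show "(\<lambda>v. f (\<lambda>c. v (list_tabloid c))) ` on_tabloids ` specht_lists n = carrier_vec (rdim V)"
    using specht_ontoD(4)[OF sq] by (simp add: image_image)
qed

lemma specht_quotient_specht_onto:
  assumes n: "n < p" and "specht_quotient (hook n) V"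
  shows "\<exists>f. specht_onto n V f"
proof -
  have "\<exists>f. (\<forall>u\<in>on_tabloids ` specht_lists n. \<forall>v\<in>on_tabloids ` specht_lists n. f (\<lambda>T. u T + v T) = f u + f v) \<and>
      (\<forall>c. \<forall>v\<in>on_tabloids ` specht_lists n. f (\<lambda>T. c * v T) = c \<cdot>\<^sub>v f v) \<and>
      (\<forall>s\<in>carrier G. \<forall>v\<in>on_tabloids ` specht_lists n. f (perm_act s v) = ract V s *\<^sub>v f v) \<and>
      f ` on_tabloids ` specht_lists n = carrier_vec (rdim V)"
    using assms(2) unfolding specht_quotient_def sum_hook[OF n] specht_hook[OF n] by (rule conjunct2)
  then obtain f where f: "\<forall>u\<in>on_tabloids ` specht_lists n. \<forall>v\<in>on_tabloids ` specht_lists n. f (\<lambda>T. u T + v T) = f u + f v"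
    "\<forall>c. \<forall>v\<in>on_tabloids ` specht_lists n. f (\<lambda>T. c * v T) = c \<cdot>\<^sub>v f v"
    "\<forall>s\<in>carrier G. \<forall>v\<in>on_tabloids ` specht_lists n. f (perm_act s v) = ract V s *\<^sub>v f v"
    "f ` on_tabloids ` specht_lists n = carrier_vec (rdim V)"
    by (elim exE conjE)
  have "specht_onto n V (\<lambda>x. f (on_tabloids x))"
    unfolding specht_onto_def on_tabloids_add on_tabloids_scale perm_act_on_tabloids[symmetric]
    using f by (simp add: image_image perm_act_on_tabloids[symmetric])
  then show ?thesis by (rule exI[of _ "\<lambda>x. f (on_tabloids x)"])
qed

text \<open>\<open>hook_simple\<close> is an arbitrary simple quotient of the Specht module.
  \<open>E n\<close> shows that one exists, and \<open>specht_onto_giso\<close> that every choice is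
  isomorphic to it.\<close>

lemma hook_giso: assumes n: "Suc n < p" shows "giso (hook_simple p n) (E n)"
proof -
  have n': "n < p" using n by simp
  have h: "hook_simple p n = (SOME V :: (nat \<Rightarrow> nat, 'k) rep. simple_module G V \<and> specht_quotient (hook n) V)"
    unfolding hook_simple_def james_simple_def One_nat_def hook_def[symmetric] sum_hook[OF n'] ..
  have "simple_module G (E n) \<and> specht_quotient (hook n) (E n)"
    using simple_E[OF n] specht_onto_specht_quotient[OF n' E_props(1)[OF n'] specht_onto_E[OF n']] ..
  then have V: "simple_module G (hook_simple p n :: (nat \<Rightarrow> nat, 'k) rep) \<and> specht_quotient (hook n) (hook_simple p n :: (nat \<Rightarrow> nat, 'k) rep)"
    unfolding h by (rule someI)
  then obtain f where "specht_onto n (hook_simple p n) f" using specht_quotient_specht_onto[OF n'] by blast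
  then show ?thesis using specht_onto_giso[OF n] V by blast
qed

end

section \<open>Fusion rules and waves\<close>

text \<open>The stroke of a wave with \<open>h\<close> levels is interleaved to the sequence of the coefficients of
  \<open>D\<^sub>0, D\<^sub>2, D\<^sub>4, \<dots>\<close>; then the even and the odd rule become the same.\<close>

definition wave_step :: "nat \<Rightarrow> (nat \<Rightarrow> nat) \<Rightarrow> nat \<Rightarrow> nat" where
  "wave_step h c j = (if h \<le> j then 0 else if j = 0 then c 1 else if Suc j = h then c (j - 1) + c j
     else c (j - 1) + c j + c (Suc j))"

text \<open>The seed is the trivial module D_0, the zeroth tensor power; it precedes the first
  stroke by two steps.\<close>

primrec wave :: "nat \<Rightarrow> nat \<Rightarrow> nat \<Rightarrow> nat" where
  "wave h 0 = (\<lambda>j. of_bool (j = 0))"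
| "wave h (Suc k) = wave_step h (wave h k)"

text \<open>The multiplicities in E_2 \<otimes> E_2: one each for E_0, E_2 and E_4, the last missing
  when h = 2. Interleaved, this is the first stroke of W_h, so stroke k belongs to k + 2 tensor
  factors.\<close>

lemma wave_step_wave_step:
  assumes "2 \<le> h" shows "wave_step h (wave_step h (\<lambda>j. of_bool (j = 0))) j = of_bool (j < h \<and> j < 3)"
proof -
  consider "j = 0" | "j = Suc 0" | "j = Suc (Suc 0)" | "3 \<le> j" by linarith
  then show ?thesis using assms by cases (auto simp: wave_step_def)
qed

lemma wave_even:
  assumes l: "0 < l" and xy: "even_stroke l k = (x, y)" and i: "1 \<le> i" "i \<le> l"
  shows "wave (2 * l) (k + 2) (2 * i - 2) = x i \<and> wave (2 * l) (k + 2) (2 * i - 1) = y i"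
  using xy i
proof (induction k arbitrary: x y i)
  case 0
  then show ?case using l by (auto simp: even_stroke_def wave_step_wave_step)
next
  case (Suc k)
  obtain u v where uv: "even_stroke l k = (u, v)" by (cases "even_stroke l k")
  define c where "c = wave (2 * l) (k + 2)"
  have IH: "c (2 * j - 2) = u j" "c (2 * j - 1) = v j" if "1 \<le> j" "j \<le> l" for j
    using Suc.IH[OF uv that] by (simp_all add: c_def)
  have s: "wave (2 * l) (Suc k + 2) = wave_step (2 * l) c" by (simp add: c_def)
  have "(x, y) = even_step l (u, v)" using Suc.prems(1) uv by (simp add: even_stroke_def)
  then have x: "x i = (if i = 1 then v 1 else v (i - 1) + u i + v i)"
    and y: "y i = (if i = l then u l + v l else u i + v i + u (i + 1))" by auto
  obtain k' where i: "i = Suc k'" using Suc.prems by (cases i) auto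
  have c: "c (2 * k') = u (Suc k')" "c (Suc (2 * k')) = v (Suc k')" "k' < l"
    using IH[of "Suc k'"] Suc.prems i by auto
  have x1: "wave_step (2 * l) c (2 * k') = x i"
  proof (cases k')
    case 0
    then show ?thesis using c x i by (simp add: wave_step_def)
  next
    case (Suc q)
    then have "c (Suc (2 * q)) = v (Suc q)" using IH(2)[of "Suc q"] c(3) by simp
    then show ?thesis using c x i Suc by (simp add: wave_step_def)
  qed
  have y1: "wave_step (2 * l) c (Suc (2 * k')) = y i"
  proof (cases "i = l")
    case True
    then show ?thesis using c y i by (auto simp: wave_step_def)
  next
    case False
    then have "c (Suc (Suc (2 * k'))) = u (Suc (Suc k'))" using IH(1)[of "Suc (Suc k')"] c(3) i by simp
    then show ?thesis using c y i False by (auto simp: wave_step_def)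
  qed
  show ?case unfolding s using x1 y1 i by simp
qed

text \<open>z stands between y_1 and x_2 and moves all later pairs one place further; this is why
  the indices 1 and 2 have rules of their own.\<close>

lemma wave_odd:
  assumes l: "0 < l" and xy: "odd_stroke l k = (x, z, y)"
  shows "wave (2 * l + 1) (k + 2) 0 = x 1 \<and> wave (2 * l + 1) (k + 2) 1 = y 1 \<and> wave (2 * l + 1) (k + 2) 2 = z \<and>
    (\<forall>i. 2 \<le> i \<longrightarrow> i \<le> l \<longrightarrow> wave (2 * l + 1) (k + 2) (2 * i - 1) = x i \<and> wave (2 * l + 1) (k + 2) (2 * i) = y i)"
  using xy
proof (induction k arbitrary: x y z)
  case 0
  then show ?case using l by (auto simp: odd_stroke_def wave_step_wave_step)
next
  case (Suc k)
  obtain u w v where uv: "odd_stroke l k = (u, w, v)" by (cases "odd_stroke l k") auto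
  define c where "c = wave (2 * l + 1) (k + 2)"
  have c: "c 0 = u 1" "c (Suc 0) = v 1" "c 2 = w"
    and IH: "\<And>i. 2 \<le> i \<Longrightarrow> i \<le> l \<Longrightarrow> c (2 * i - 1) = u i" "\<And>i. 2 \<le> i \<Longrightarrow> i \<le> l \<Longrightarrow> c (2 * i) = v i"
    using Suc.IH[OF uv] by (simp_all add: c_def)
  have s: "wave (2 * l + 1) (Suc k + 2) = wave_step (2 * l + 1) c" by (simp add: c_def)
  have "(x, z, y) = odd_step l (u, w, v)" using Suc.prems uv by (simp add: odd_stroke_def)
  then have x: "\<And>i. x i = (if i = 1 then v 1 else if i = 2 then w + u 2 + v 2 else v (i - 1) + u i + v i)"
    and z: "z = v 1 + w + (if l = 1 then 0 else u 2)"
    and y: "\<And>i. y i = (if i = 1 then u 1 + v 1 + w else if i = l then u l + v l else u i + v i + u (i + 1))" by auto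
  have 1: "wave_step (2 * l + 1) c 0 = x 1" "wave_step (2 * l + 1) c 1 = y 1"
    using l c unfolding x y by (auto simp: wave_step_def numeral_2_eq_2)
  have 2: "wave_step (2 * l + 1) c 2 = z"
  proof (cases "l = 1")
    case False
    then have "c (Suc 2) = u 2" using IH(1)[of 2] l by (simp add: numeral_3_eq_3 numeral_2_eq_2)
    then show ?thesis using False l c unfolding z by (simp add: wave_step_def)
  qed (use c in \<open>simp add: z wave_step_def\<close>)
  have "wave_step (2 * l + 1) c (2 * i - 1) = x i \<and> wave_step (2 * l + 1) c (2 * i) = y i" if i: "2 \<le> i" "i \<le> l" for i
  proof -
    obtain q where q: "i = Suc (Suc q)" using i(1) by (metis add_2_eq_Suc le_Suc_ex)
    define a where "a = 2 * i - 2"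
    have a: "2 * i - 1 = Suc a" "2 * i = Suc (Suc a)" "0 < a" "Suc (Suc a) < 2 * l + 1"
      using i by (auto simp: a_def)
    have ca: "c (Suc a) = u i" "c (Suc (Suc a)) = v i" using IH[OF i] unfolding a by simp_all
    have ca0: "c a = (if i = 2 then w else v (i - 1))"
    proof (cases "i = 2")
      case False
      then have "c (2 * (i - 1)) = v (i - 1)" using i by (intro IH(2)) auto
      then show ?thesis using False by (simp add: a_def diff_mult_distrib2)
    qed (use c in \<open>simp add: a_def\<close>)
    have "wave_step (2 * l + 1) c (Suc a) = x i"
      using a ca ca0 i unfolding x by (auto simp: wave_step_def)
    moreover have "wave_step (2 * l + 1) c (Suc (Suc a)) = y i"
    proof (cases "i = l")
      case True
      then have "2 * l + 1 = Suc (Suc (Suc a))" using a by simp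
      then have "wave_step (2 * l + 1) c (Suc (Suc a)) = c (Suc a) + c (Suc (Suc a))" by (simp only: wave_step_def) simp
      then show ?thesis using True i ca unfolding y by simp
    next
      case False
      then have "c (2 * (i + 1) - 1) = u (i + 1)" using i by (intro IH(1)) auto
      then have "c (Suc (Suc (Suc a))) = u (i + 1)" using a by simp
      moreover have "Suc (Suc (Suc a)) \<noteq> 2 * l + 1" "\<not> 2 * l + 1 \<le> Suc (Suc a)" using a False by auto
      ultimately show ?thesis using False i ca unfolding y by (simp add: wave_step_def)
    qed
    ultimately show ?thesis unfolding a by simp
  qed
  then show ?case unfolding s using 1 2 by simp
qed

text \<open>The summands of E_2 \<otimes> E_(2j), listed by half their degree. At j = 0 there is
  only E_2, and for p = 2h + 1 the summand E_(2h) = E_(p-1) is lost at the top.\<close>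

definition neighbours :: "nat \<Rightarrow> nat \<Rightarrow> nat list" where
  "neighbours h j = (if j = 0 then [1] else if Suc j = h then [j - 1, j] else [j - 1, j, Suc j])"

lemma wave_step_add: "wave_step h (\<lambda>k. c k + d k) j = wave_step h c j + wave_step h d j"
  by (simp add: wave_step_def)

text \<open>The neighbour relation is symmetric, so replacing indices by their neighbours changes
  multiplicities exactly as \<open>wave_step\<close> sums them.\<close>

lemma count_neighbours:
  assumes "2 \<le> h" "i < h" shows "count (mset (neighbours h i)) j = wave_step h (\<lambda>k. of_bool (k = i)) j"
proof -
  consider "i = 0" | q where "i = Suc q" "Suc i = h" | q where "i = Suc q" "Suc i < h"
    using assms(2) by (cases i) (auto simp: less_Suc_eq intro: Suc_lessI)
  then show ?thesis
  proof cases
    case 1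
    then show ?thesis using assms by (cases j) (auto simp: neighbours_def wave_step_def)
  next
    case 2
    then show ?thesis by (cases j) (auto simp: neighbours_def wave_step_def)
  next
    case 3
    then show ?thesis by (cases j) (auto simp: neighbours_def wave_step_def)
  qed
qed

lemma count_concat_neighbours:
  assumes h: "2 \<le> h"
  shows "set js \<subseteq> {..<h} \<Longrightarrow> count (mset (concat (map (neighbours h) js))) = wave_step h (count (mset js))"
proof (induction js)
  case Nil
  show ?case by (rule ext) (simp add: wave_step_def)
next
  case (Cons i js)
  have i: "i < h" "set js \<subseteq> {..<h}" using Cons.prems by auto
  show ?case
  proof
    fix j
    have "count (mset (concat (map (neighbours h) (i # js)))) j = wave_step h (\<lambda>k. of_bool (k = i)) j + wave_step h (count (mset js)) j"
      using Cons.IH[OF i(2)] count_neighbours[OF h i(1)] by simp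
    also have "\<dots> = wave_step h (\<lambda>k. of_bool (k = i) + count (mset js) k) j" by (rule wave_step_add[symmetric])
    also have "(\<lambda>k. of_bool (k = i) + count (mset js) k) = count (mset (i # js))" by (rule ext) simp
    finally show "count (mset (concat (map (neighbours h) (i # js)))) j = wave_step h (count (mset (i # js))) j" .
  qed
qed

primrec fusion_indices :: "nat \<Rightarrow> nat \<Rightarrow> nat list" where
  "fusion_indices h 0 = [0]"
| "fusion_indices h (Suc k) = concat (map (neighbours h) (fusion_indices h k))"

lemma set_fusion_indices: "2 \<le> h \<Longrightarrow> set (fusion_indices h k) \<subseteq> {..<h}"
proof (induction k)
  case (Suc k)
  have "set (neighbours h j) \<subseteq> {..<h}" if "j < h" for j using that Suc.prems by (auto simp: neighbours_def)
  then show ?case using Suc by auto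
qed simp

lemma count_fusion_indices: assumes "2 \<le> h" shows "count (mset (fusion_indices h k)) = wave h k"
proof (induction k)
  case 0
  show ?case by (rule ext) simp
next
  case (Suc k)
  then show ?case using count_concat_neighbours[OF assms set_fusion_indices[OF assms, of k]] by simp
qed

lemma count_concat_replicate:
  "count (mset (concat (map (\<lambda>j. replicate (c j) j) [0..<h]))) j = (if j < h then c j else 0)"
  by (induction h) (auto simp: less_Suc_eq)

lemma mset_fusion_indices:
  assumes "2 \<le> h" shows "mset (fusion_indices h k) = mset (concat (map (\<lambda>j. replicate (wave h k j) j) [0..<h]))"
proof (rule multiset_eqI)
  fix j
  have "wave h k j = 0" if "\<not> j < h"
  proof -
    have "j \<notin> set (fusion_indices h k)" using that set_fusion_indices[OF assms, of k] by auto
    then have "count (mset (fusion_indices h k)) j = 0" by (simp add: count_eq_zero_iff)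
    then show ?thesis by (simp only: count_fusion_indices[OF assms])
  qed
  then show "count (mset (fusion_indices h k)) j = count (mset (concat (map (\<lambda>j. replicate (wave h k j) j) [0..<h]))) j"
    unfolding count_concat_replicate count_fusion_indices[OF assms] by simp
qed

context fin_group begin

lemma stab_iso_dsum_single: "modl V \<Longrightarrow> stab_iso (dsum [V]) V"
  by (rule stab_biprod_proj[OF stab_biprod_dsum proj_dsum_Nil]) (simp_all add: modl_dsum_Nil)

lemma stab_biprod_append_dsum:
  assumes X: "stab_biprod X A B" "stab_iso A (dsum Vs)" "stab_iso B (dsum Ws)" and m: "\<And>V. V \<in> set Vs \<union> set Ws \<Longrightarrow> modl V"
  shows "stab_iso X (dsum (Vs @ Ws))"
  by (rule stab_biprod_unique[OF stab_biprod_cong[OF X] stab_biprod_dsum_append[OF m]])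

lemma stab_biprod_two: assumes "stab_biprod X A B" shows "stab_iso X (dsum [A, B])"
proof -
  note m = stab_biprod_modl[OF assms]
  have "stab_iso X (dsum ([A] @ [B]))"
    using m by (intro stab_biprod_append_dsum[OF assms] stab_iso_sym[OF stab_iso_dsum_single]) auto
  then show ?thesis by simp
qed

end

context char_sym begin

lemma stab_iso_E_Tn: assumes n: "n < p" and e: "antisymm n = idm (m ^ n)" shows "stab_iso (E n) (Tn n)"
  by (rule stab_isoI[OF E_props(1)[OF n] modl_Tn E_props(2,3)[OF n]])
    (simp_all add: E_props(4,5)[OF n] e)

lemma stab_iso_E_0: "stab_iso (E 0) trivial_module" and stab_iso_E_1: "stab_iso (E 1) Dm"
  using stab_iso_E_Tn[of 0] stab_iso_E_Tn[of 1] p3 by simp_all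

text \<open>With n = i + 2, the module D \<otimes> D \<otimes> E_n is decomposed twice: as E_n plus
  E_2 \<otimes> E_n, and as D \<otimes> E_(n-1) plus D \<otimes> E_(n+1). The second way gives
  E_(n-2), E_n twice and E_(n+2), and one simple E_n is cancelled.\<close>

lemma fusion_E:
  assumes i: "Suc (Suc i) + 2 < p"
  shows "stab_iso (tensor (E 2) (E (Suc (Suc i)))) (dsum [E i, E (Suc (Suc i)), E (Suc (Suc i) + 2)])"
proof -
  let ?i = "Suc (Suc i)"
  have me: "modl (E n)" if "n < p" for n by (rule E_props(1)[OF that])
  have mi: "modl (E i)" "modl (E (Suc i))" "modl (E ?i)" "modl (E (Suc ?i))" "modl (E (Suc (Suc ?i)))" "modl (E 2)"
    using i p3 by (auto intro!: me)
  have "stab_biprod (tensor Dm (E (Suc 0))) (E 0) (E (Suc (Suc 0)))" by (rule stab_biprod_E) (use p3 in simp)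
  then have "stab_biprod (tensor Dm Dm) trivial_module (E 2)"
    using stab_biprod_cong[OF stab_biprod_stab_iso[OF _ stab_iso_tensor_right[OF stab_iso_E_1 modl_Dm]] stab_iso_E_0 stab_iso_refl[OF mi(6)]]
    by (simp add: numeral_2_eq_2)
  from stab_biprod_tensor_left[OF this mi(3)]
  have 1: "stab_biprod (tensor Dm (tensor Dm (E ?i))) (E ?i) (tensor (E 2) (E ?i))"
    by (simp only: tensor_assoc tensor_trivial_left)
  have "stab_biprod (tensor Dm (E ?i)) (E (Suc i)) (E (Suc ?i))" by (rule stab_biprod_E) (use i in simp)
  from stab_biprod_tensor_right[OF this modl_Dm]
  have 2: "stab_biprod (tensor Dm (tensor Dm (E ?i))) (tensor Dm (E (Suc i))) (tensor Dm (E (Suc ?i)))" .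
  have a: "stab_iso (tensor Dm (E (Suc i))) (dsum [E i, E ?i])" by (rule stab_biprod_two[OF stab_biprod_E]) (use i in simp)
  have b: "stab_iso (tensor Dm (E (Suc ?i))) (dsum [E ?i, E (Suc (Suc ?i))])" by (rule stab_biprod_two[OF stab_biprod_E]) (use i in simp)
  have "stab_iso (tensor Dm (tensor Dm (E ?i))) (dsum ([E i, E ?i] @ [E ?i, E (Suc (Suc ?i))]))"
    by (rule stab_biprod_append_dsum[OF 2 a b]) (use mi in auto)
  also have "stab_iso (dsum ([E i, E ?i] @ [E ?i, E (Suc (Suc ?i))])) (dsum [E ?i, E i, E ?i, E (Suc (Suc ?i))])"
    by (rule stab_iso_dsum_mset) (use mi in auto)
  finally have 3: "stab_iso (tensor Dm (tensor Dm (E ?i))) (dsum [E ?i, E i, E ?i, E (Suc (Suc ?i))])" .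
  have 4: "stab_biprod (dsum [E ?i, E i, E ?i, E (Suc (Suc ?i))]) (E ?i) (dsum [E i, E ?i, E (Suc (Suc ?i))])"
    by (rule stab_biprod_dsum[OF mi(3) modl_dsum]) (use mi in auto)
  have s: "simple_module G (E ?i)" by (rule simple_E) (use i in simp)
  have "stab_iso (tensor (E 2) (E ?i)) (dsum [E i, E ?i, E (Suc (Suc ?i))])"
    by (rule stab_biprod_cancel[OF stab_biprod_commute[OF 1] stab_biprod_commute[OF 4] 3 simple_end_division[OF s]])
  then show ?thesis by simp
qed

lemma stab_iso_drop_proj: assumes "proj P" "\<And>V. V \<in> set Vs \<Longrightarrow> modl V" shows "stab_iso (dsum (Vs @ [P])) (dsum Vs)"
proof -
  have P: "modl P" using assms(1) by (simp add: proj_def)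
  have "stab_biprod (dsum (Vs @ [P])) (dsum Vs) (dsum [P])" by (rule stab_biprod_dsum_append) (use assms(2) P in auto)
  moreover have "proj (dsum [P])"
    using stab_biprod_projs[OF stab_biprod_dsum[OF P modl_dsum_Nil] assms(1) proj_dsum_Nil] .
  ultimately show ?thesis by (rule stab_biprod_proj)
qed

context
  fixes h :: nat
  assumes h: "p = 2 * h + 1" "2 \<le> h"
begin

lemma modl_E2: "j \<le> h \<Longrightarrow> modl (E (2 * j))" by (rule E_props(1)) (use h in simp)

lemma set_neighbours: "j < h \<Longrightarrow> set (neighbours h j) \<subseteq> {..<h}" using h(2) by (auto simp: neighbours_def)

lemma fusion_neighbours:
  assumes j: "j < h"
  shows "stab_iso (tensor (E 2) (E (2 * j))) (dsum (map (\<lambda>j. E (2 * j)) (neighbours h j)))"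
proof (cases j)
  case 0
  have m: "modl (E 2)" using modl_E2[of 1] h by simp
  have "stab_iso (tensor (E 2) (E 0)) (E 2)" using stab_iso_tensor_right[OF stab_iso_E_0 m] by simp
  also have "stab_iso (E 2) (dsum [E 2])" by (rule stab_iso_sym[OF stab_iso_dsum_single[OF m]])
  finally show ?thesis by (simp add: 0 neighbours_def)
next
  case (Suc q)
  have f: "stab_iso (tensor (E 2) (E (2 * j))) (dsum [E (2 * q), E (2 * j), E (2 * Suc j)])"
    using fusion_E[of "2 * q"] j h(1) Suc by simp
  show ?thesis
  proof (cases "Suc j = h")
    case False
    then show ?thesis using f Suc by (simp add: neighbours_def)
  next
    case True
    \<comment> \<open>Here 2 (j + 1) = p - 1, where the exterior power is zero and in particular
      projective.\<close>
    have "proj (E (2 * Suc j))" by (rule proj_E_top) (use True h in simp)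
    then have "stab_iso (dsum ([E (2 * q), E (2 * j)] @ [E (2 * Suc j)])) (dsum [E (2 * q), E (2 * j)])"
      by (rule stab_iso_drop_proj) (use modl_E2[of q] modl_E2[of j] j Suc in auto)
    with f have "stab_iso (tensor (E 2) (E (2 * j))) (dsum [E (2 * q), E (2 * j)])"
      using stab_iso_trans by (simp only: append_Cons append_Nil)
    then show ?thesis using True Suc by (simp add: neighbours_def)
  qed
qed

lemma tensor_power_E: "stab_iso (tensor_power (E 2) k) (dsum (map (\<lambda>j. E (2 * j)) (fusion_indices h k)))"
proof (induction k)
  case 0
  have "modl (E 0)" using modl_E2[of 0] by simp
  then show ?case using stab_iso_sym[OF stab_iso_trans[OF stab_iso_dsum_single stab_iso_E_0]] by simp
next
  case (Suc k)
  let ?F = "\<lambda>j. E (2 * j)"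
  have fs: "j < h" if "j \<in> set (fusion_indices h k)" for j using set_fusion_indices[OF h(2), of k] that by auto
  have m2: "modl (E 2)" using modl_E2[of 1] h by simp
  have mF: "modl V" if "V \<in> set (map ?F (fusion_indices h k))" for V using that fs modl_E2 by fastforce
  have "stab_iso (tensor_power (E 2) (Suc k)) (tensor (E 2) (dsum (map ?F (fusion_indices h k))))"
    using stab_iso_tensor_right[OF Suc m2] by simp
  also have "stab_iso \<dots> (dsum (map (tensor (E 2)) (map ?F (fusion_indices h k))))" by (rule tensor_dsum[OF m2 mF])
  also have "stab_iso \<dots> (dsum (map dsum (map (\<lambda>j. map ?F (neighbours h j)) (fusion_indices h k))))"
    by (rule stab_iso_dsum) (simp add: list_all2_map1 list_all2_map2 list_all2_same fusion_neighbours fs)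
  also have "stab_iso \<dots> (dsum (concat (map (\<lambda>j. map ?F (neighbours h j)) (fusion_indices h k))))"
  proof (rule dsum_concat)
    fix Vs V assume "Vs \<in> set (map (\<lambda>j. map ?F (neighbours h j)) (fusion_indices h k))" "V \<in> set Vs"
    then obtain j i where "j \<in> set (fusion_indices h k)" "i \<in> set (neighbours h j)" "V = ?F i" by auto
    then show "modl V" using set_neighbours[of j] fs[of j] modl_E2[of i] by auto
  qed
  also have "concat (map (\<lambda>j. map ?F (neighbours h j)) (fusion_indices h k)) = map ?F (fusion_indices h (Suc k))"
    by (simp add: map_concat comp_def)
  finally show ?case .
qed

text \<open>The computation takes place in the exterior powers: \<open>hook_giso\<close> passes from
  D_2 to E_2 at the start and from E_(2j) back to D_(2j) at the end, while the shifts of the k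
  factors add up to k r.\<close>

lemma tensor_power_omega_hook:
  fixes r k :: nat
  defines "W \<equiv> \<lambda>j. heller_power G (k * r) (hook_simple p (2 * j)) :: (nat \<Rightarrow> nat, 'k) rep"
  shows "stab_iso (tensor_power (heller_power G r (hook_simple p 2)) k) (dsum (map (\<lambda>j. copies (wave h k j) (W j)) [0..<h]))"
proof -
  let ?F = "\<lambda>j. E (2 * j)" and ?c = "wave h k"
  have D: "stab_iso (hook_simple p (2 * j)) (?F j)" if "j < h" for j
    by (rule giso_stab_iso[OF hook_giso]) (use that h in simp)
  have D2: "stab_iso (hook_simple p 2) (E 2)" using D[of 1] h by simp
  have fs: "j < h" if "j \<in> set (fusion_indices h k)" for j using set_fusion_indices[OF h(2), of k] that by auto
  have mW: "modl (W j)" if "j < h" for j unfolding W_def by (rule modl_hp[OF stab_iso_modl(1)[OF D[OF that]]])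
  let ?ys = "concat (map (\<lambda>j. replicate (?c j) j) [0..<h])"
  let ?H = "hook_simple p 2 :: (nat \<Rightarrow> nat, 'k) rep"
  have "stab_iso (tensor_power (heller_power G r ?H) k) (heller_power G (k * r) (tensor_power ?H k))"
    by (rule tensor_power_hp[OF stab_iso_modl(1)[OF D2]])
  also have "stab_iso \<dots> (heller_power G (k * r) (tensor_power (E 2) k))" by (rule stab_iso_hp[OF stab_iso_tensor_power[OF D2]])
  also have "stab_iso \<dots> (heller_power G (k * r) (dsum (map ?F (fusion_indices h k))))" by (rule stab_iso_hp[OF tensor_power_E])
  also have "stab_iso \<dots> (dsum (map (heller_power G (k * r)) (map ?F (fusion_indices h k))))"
    by (rule hp_dsum) (use fs modl_E2 in fastforce)
  also have "stab_iso \<dots> (dsum (map W (fusion_indices h k)))"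
    by (rule stab_iso_dsum) (auto simp: list_all2_map1 list_all2_map2 list_all2_same W_def intro!: stab_iso_sym[OF stab_iso_hp[OF D]] fs)
  also have "stab_iso \<dots> (dsum (map W ?ys))"
    by (rule stab_iso_dsum_mset) (use fs mW in \<open>auto simp: mset_fusion_indices[OF h(2), of k]\<close>)
  also have "map W ?ys = concat (map (\<lambda>j. replicate (?c j) (W j)) [0..<h])"
    by (simp add: map_concat comp_def)
  also have "stab_iso (dsum (concat (map (\<lambda>j. replicate (?c j) (W j)) [0..<h]))) (dsum (map dsum (map (\<lambda>j. replicate (?c j) (W j)) [0..<h])))"
    by (rule stab_iso_sym[OF dsum_concat]) (use mW in auto)
  also have "map dsum (map (\<lambda>j. replicate (?c j) (W j)) [0..<h]) = map (\<lambda>j. copies (?c j) (W j)) [0..<h]"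
    by (simp add: copies_def)
  finally show ?thesis .
qed

end

end

lemma even_list:
  assumes "\<And>i. 1 \<le> i \<Longrightarrow> i \<le> l \<Longrightarrow> c (2 * i - 2) = x i \<and> c (2 * i - 1) = (y i :: nat)"
  shows "map (\<lambda>j. f (c j) j) [0..<2 * l] = concat (map (\<lambda>i. [f (x i) (2 * i - 2), f (y i) (2 * i - 1)]) [1..<l + 1])"
  using assms
proof (induction l)
  case (Suc l)
  have "c (2 * l) = x (Suc l)" "c (Suc (2 * l)) = y (Suc l)" using Suc.prems[of "Suc l"] by simp_all
  then show ?case using Suc by simp
qed simp

lemma odd_list:
  assumes l: "1 \<le> l" and c: "c 0 = x 1" "c 1 = y 1" "c 2 = (z :: nat)"
    and i: "\<And>i. 2 \<le> i \<Longrightarrow> i \<le> l \<Longrightarrow> c (2 * i - 1) = x i \<and> c (2 * i) = y i"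
  shows "map (\<lambda>j. f (c j) j) [0..<2 * l + 1] = [f (x 1) 0, f (y 1) 1, f z 2] @
    concat (map (\<lambda>i. [f (x i) (2 * i - 1), f (y i) (2 * i)]) [2..<l + 1])"
  using l i
proof (induction l rule: dec_induct)
  case base
  have "[0..<2 * 1 + 1] = [0, 1, 2 :: nat]" by (simp add: upt_rec)
  then show ?case using c by simp
next
  case (step l)
  have "c (Suc (2 * l)) = x (Suc l)" "c (Suc (Suc (2 * l))) = y (Suc l)"
    using step.prems[of "Suc l"] step.hyps by simp_all
  moreover have "[0..<2 * Suc l + 1] = [0..<2 * l + 1] @ [Suc (2 * l), Suc (Suc (2 * l))]" by simp
  moreover have "[2..<Suc l + 1] = [2..<l + 1] @ [Suc l]" using step.hyps by simp
  ultimately show ?case using step by simp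
qed

theorem theorem5p8:
  fixes p b r h :: nat
    and D :: "nat \<Rightarrow> (nat \<Rightarrow> nat, 'a::alg_closed_field) rep"
    and \<Omega> :: "nat \<Rightarrow> (nat \<Rightarrow> nat, 'a) rep \<Rightarrow> (nat \<Rightarrow> nat, 'a) rep"
  assumes "prime p" and "p \<ge> 5" and "CHAR('a) = p"
    and "b \<ge> 1" and "r \<in> {0..2 * p - 3}" and "h = (p - 1) div 2"
    and "D = hook_simple p" and "\<Omega> = heller_power (sym_group p)"
  shows "(\<forall>l x y. h = 2 * l \<and> (x, y) = even_wave_descent l b \<longrightarrow>
           stably_equiv (sym_group p) (tensor_power (\<Omega> r (D 2)) (2 * b))
             (dsum (concat (map (\<lambda>i. [copies (x i) (\<Omega> (2 * b * r) (D (4 * i - 4))),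
                                      copies (y i) (\<Omega> (2 * b * r) (D (4 * i - 2)))])
                                [1..<l + 1])))) \<and>
         (\<forall>l x z y. h = 2 * l + 1 \<and> (x, z, y) = odd_wave_descent l b \<longrightarrow>
           stably_equiv (sym_group p) (tensor_power (\<Omega> r (D 2)) (2 * b))
             (dsum ([copies (x 1) (\<Omega> (2 * b * r) (D 0)),
                     copies (y 1) (\<Omega> (2 * b * r) (D 2)),
                     copies z (\<Omega> (2 * b * r) (D 4))] @
                    concat (map (\<lambda>i. [copies (x i) (\<Omega> (2 * b * r) (D (4 * i - 2))),
                                      copies (y i) (\<Omega> (2 * b * r) (D (4 * i)))])
                                [2..<l + 1]))))"
proof -
  interpret char_sym p "p - 2" "TYPE('a)"
    by unfold_locales (use assms(1-3) in auto)
  have "odd p" using prime_odd_nat[OF assms(1)] assms(2) by simp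
  then have h: "p = 2 * h + 1" "2 \<le> h" using assms(2,6) by (auto elim!: oddE)
  \<comment> \<open>The descent of the b-th period is stroke number 2 (b - 1); two more steps from
    the trivial module make 2 b, the number of tensor factors.\<close>
  define k where "k = 2 * (b - 1)"
  have k: "2 * b = k + 2" using assms(4) by (simp add: k_def)
  define f where "f a j = copies a (\<Omega> (2 * b * r) (D (2 * j)))" for a j
  have main: "stably_equiv (sym_group p) (tensor_power (\<Omega> r (D 2)) (2 * b)) (dsum (map (\<lambda>j. f (wave h (k + 2) j) j) [0..<h]))"
    using stab_iso_stably_equiv[OF tensor_power_omega_hook[OF h, of r "2 * b"]]
    unfolding f_def assms(7,8) k[symmetric] .
  \<comment> \<open>Converts the position j of a coefficient, which belongs to D_(2j), into the
    labels of the statement.\<close>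
  have e: "2 * (2 * i - 2) = 4 * i - 4" "2 * (2 * i - 1) = 4 * i - 2" "2 * (2 * i) = 4 * i" for i :: nat by auto
  show ?thesis
  proof (intro conjI allI impI)
    fix l x y assume "h = 2 * l \<and> (x, y) = even_wave_descent l b"
    then have l: "h = 2 * l" "0 < l" and xy: "even_stroke l k = (x, y)"
      using h(2) by (auto simp: even_wave_descent_def k_def)
    have "map (\<lambda>j. f (wave h (k + 2) j) j) [0..<h]
      = concat (map (\<lambda>i. [f (x i) (2 * i - 2), f (y i) (2 * i - 1)]) [1..<l + 1])"
      unfolding l(1) by (rule even_list) (rule wave_even[OF l(2) xy])
    then show "stably_equiv (sym_group p) (tensor_power (\<Omega> r (D 2)) (2 * b))
             (dsum (concat (map (\<lambda>i. [copies (x i) (\<Omega> (2 * b * r) (D (4 * i - 4))),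
                                      copies (y i) (\<Omega> (2 * b * r) (D (4 * i - 2)))])
                                [1..<l + 1])))"
      using main unfolding f_def e by (simp only:)
  next
    fix l x z y assume "h = 2 * l + 1 \<and> (x, z, y) = odd_wave_descent l b"
    then have l: "h = 2 * l + 1" "0 < l" and xy: "odd_stroke l k = (x, z, y)"
      using h(2) by (auto simp: odd_wave_descent_def k_def)
    have "map (\<lambda>j. f (wave h (k + 2) j) j) [0..<h] = [f (x 1) 0, f (y 1) 1, f z 2] @
        concat (map (\<lambda>i. [f (x i) (2 * i - 1), f (y i) (2 * i)]) [2..<l + 1])"
      unfolding l(1) by (rule odd_list) (use l(2) wave_odd[OF l(2) xy] in auto)
    moreover have "2 * 0 = (0 :: nat)" "2 * 1 = (2 :: nat)" "2 * 2 = (4 :: nat)" by simp_all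
    ultimately show "stably_equiv (sym_group p) (tensor_power (\<Omega> r (D 2)) (2 * b))
             (dsum ([copies (x 1) (\<Omega> (2 * b * r) (D 0)),
                     copies (y 1) (\<Omega> (2 * b * r) (D 2)),
                     copies z (\<Omega> (2 * b * r) (D 4))] @
                    concat (map (\<lambda>i. [copies (x i) (\<Omega> (2 * b * r) (D (4 * i - 2))),
                                      copies (y i) (\<Omega> (2 * b * r) (D (4 * i)))])
                                [2..<l + 1])))"
      using main unfolding f_def e by (simp only:)
  qed
qed

end
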